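(* Assume the Generalized Riemann Hypothesis for Dirichlet $L$-functions. Let $\epsilon>0$ be fixed and let $\eta>0$ be arbitrarily small but fixed. Then for all sufficiently large $N$ and all $h$ with $\log^{14}N\ll h\ll N^{\frac17-\epsilon}$, writing $h=N^{\alpha}$, there exist integers $n_1,n_2\in[N+1,2N]$ such that $$\psi(n_1+h)-\psi(n_1)-h>\left(\frac{\sqrt{1-5\alpha}}{2}-\eta\right)(h\log N)^{\frac12}$$ and $$\psi(n_2+h)-\psi(n_2)-h<-\left(\frac{\sqrt{1-5\alpha}}{2}-\eta\right)(h\log N)^{\frac12}.$$
   Context: $\psi(x)=\sum_{n\le x}\Lambda(n)$, where $\Lambda$ is the von Mangoldt function. $N$ denotes a natural number; "sufficiently large" may depend on $\eta$, $\epsilon$ and the implied constants in the conditions on $h$. *)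

theory Defs
  imports "HOL-Complex_Analysis.Complex_Analysis" "HOL-Number_Theory.Prime_Powers"
begin

definition dirichlet_character :: "nat \<Rightarrow> (nat \<Rightarrow> complex) \<Rightarrow> bool" where
  "dirichlet_character q chi \<longleftrightarrow> q > 0 \<and>
     (\<forall>m n. chi (m * n) = chi m * chi n) \<and>
     (\<forall>n. chi (n + q) = chi n) \<and>
     (\<forall>n. chi n = 0 \<longleftrightarrow> \<not> coprime n q)"

text \<open>
  A nicely meromorphic function is analytic away from its poles and takes the value 0 at them.
  Hence the meromorphic continuation of the Dirichlet series is unique as a total function
  (see below), and only at the pole at 1 of a principal character's L-function is the value a
  convention.
\<close>
definition is_dirichlet_L :: "(nat \<Rightarrow> complex) \<Rightarrow> (complex \<Rightarrow> complex) \<Rightarrow> bool" where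
  "is_dirichlet_L chi L \<longleftrightarrow> L nicely_meromorphic_on UNIV \<and>
     (\<forall>s. Re s > 1 \<longrightarrow> (\<lambda>n. chi (Suc n) / of_nat (Suc n) powr s) sums L s)"

lemma is_dirichlet_L_unique:
  assumes "is_dirichlet_L chi f" and "is_dirichlet_L chi g"
  shows "f = g"
proof -
  have f: "f nicely_meromorphic_on UNIV" and g: "g nicely_meromorphic_on UNIV"
    using assms by (auto simp: is_dirichlet_L_def)
  have eq: "f s = g s" if "Re s > 1" for s
    using assms that by (auto simp: is_dirichlet_L_def intro: sums_unique2)
  let ?D = "\<lambda>z. f z - g z"
  have "?D meromorphic_on UNIV"
    using f g by (auto simp: nicely_meromorphic_on_def intro!: meromorphic_intros)
  then have "(\<forall>\<^sub>\<approx>z\<in>UNIV. ?D z = 0) \<or> (\<forall>\<^sub>\<approx>z\<in>UNIV. ?D z \<noteq> 0)"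
    by (rule meromorphic_imp_constant_or_avoid) auto
  moreover have "\<not> (\<forall>\<^sub>\<approx>z\<in>UNIV. ?D z \<noteq> 0)"
  proof
    assume "\<forall>\<^sub>\<approx>z\<in>UNIV. ?D z \<noteq> 0"
    then have "\<forall>\<^sub>F z in at 2. ?D z \<noteq> 0"
      by (rule eventually_cosparse_imp_eventually_at) auto
    moreover have "\<forall>\<^sub>F z in at (2 :: complex). z \<in> {z. Re z > 1}"
      by (rule eventually_at_in_open') (auto simp: open_halfspace_Re_gt)
    ultimately have "\<forall>\<^sub>F z in at (2 :: complex). False"
      by eventually_elim (auto simp: eq)
    then show False by simp
  qed
  ultimately have ev: "\<forall>\<^sub>F w in at z. f w = g w" for z
    by (auto simp: eventually_cosparse_open_eq)
  show ?thesis
  proof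
    fix z
    have pole: "is_pole f z \<longleftrightarrow> is_pole g z"
      by (intro is_pole_cong ev refl)
    show "f z = g z"
    proof (cases "is_pole f z")
      case True
      then show ?thesis
        using is_pole_zero_at_nicely_mero[OF f] is_pole_zero_at_nicely_mero[OF g] pole by simp
    next
      case False
      then have "f \<midarrow>z\<rightarrow> f z" and "g \<midarrow>z\<rightarrow> g z"
        using f g pole by (auto simp: nicely_meromorphic_on_def)
      moreover from \<open>f \<midarrow>z\<rightarrow> f z\<close> have "g \<midarrow>z\<rightarrow> f z"
        using tendsto_cong[OF ev] by blast
      ultimately show ?thesis
        by (blast intro: LIM_unique)
    qed
  qed
qed

definition dirichlet_L :: "(nat \<Rightarrow> complex) \<Rightarrow> complex \<Rightarrow> complex" where
  "dirichlet_L chi = (THE L. is_dirichlet_L chi L)"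

text \<open>
  Imprimitive characters are included; the extra zeros of their L-functions lie on the line
  \<open>Re s = 0\<close>, outside the open critical strip.
\<close>
definition GRH :: bool where
  "GRH \<longleftrightarrow> (\<forall>q chi s. dirichlet_character q chi \<and> 0 < Re s \<and> Re s < 1 \<and> dirichlet_L chi s = 0
     \<longrightarrow> Re s = 1 / 2)"

definition chebyshev_psi :: "real \<Rightarrow> real" where
  "chebyshev_psi x = (\<Sum>n | 0 < n \<and> real n \<le> x. mangoldt n)"

end

theory Submission
  imports Defs "HOL-Number_Theory.Number_Theory" "HOL-Computational_Algebra.Squarefree" "HOL-Real_Asymp.Real_Asymp"
begin

text \<open>
  Under GRH, Perron's formula shows that the sums of \<open>\<Lambda>(m) \<chi>(m)\<close> over \<open>m \<sim> N\<close>, smoothed by a hat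
  function, have their expected value up to \<open>N^(3/2 + \<delta>)\<close>. Summed over all characters of a squarefree modulus,
  this gives the correlation of \<open>\<Lambda>(n + j)\<close> with any periodic weight of moderate period.

  The weight is a resonator. Let \<open>P\<close> be the trigonometric polynomial with frequencies \<open>a/r\<close>, where \<open>r\<close> is
  squarefree, \<open>y < r \<le> x\<close>, \<open>gcd(a, r) = 1\<close> and \<open>\<bar>a\<bar> \<le> \<eta> r\<close>, whose coefficients are those of
  \<open>\<Lambda>(n + 1) + \<dots> + \<Lambda>(n + H)\<close> in its formal Ramanujan expansion. With \<open>V\<close> the mean square of \<open>P\<close> and \<open>C = \<plusminus>\<surd>V\<close>,
  the mean of \<open>\<psi>(n + h) - \<psi>(n) - h\<close> against \<open>\<bar>C + P(n)\<bar>\<^sup>2\<close>, a weight of mean \<open>C\<^sup>2 + V\<close>, is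
  \<open>2CV/(C\<^sup>2 + V) = C\<close> plus the contribution of pairs of distinct frequencies, so
  \<open>\<psi>(n + h) - \<psi>(n) - h\<close> comes close to both \<open>\<surd>V\<close> and \<open>-\<surd>V\<close>. Taking \<open>y\<close> close to \<open>h\<close> and \<open>x\<close> close
  to \<open>(N/h)^(1/4)\<close>, the largest length for which the errors of the characters are negligible, gives
  \<open>V \<sim> h log(x/y) \<sim> (1 - 5\<alpha>)/4 h log N\<close>. The off-diagonal pairs are few because \<open>\<eta>\<close> is
  only slightly larger than \<open>1/h\<close>; they are negligible as soon as \<open>h\<close> exceeds a power of \<open>log N\<close>.
\<close>

section \<open>Perron's formula for Riesz means\<close>

text \<open>The value \<open>2CV/(C\<^sup>2 + V)\<close> is extremal in C exactly at
  \<open>C = \<plusminus>\<surd>V\<close>, which forces that choice. The length x is dictated by the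
  errors: each pair of denominators and each of the h shifts costs about N^(3/2) times a mean-square
  bound of size nearly h, against a main term of size N^2 V^(3/2), so x^4 must stay below N/h. Then
  x exceeds h by a power of N while \<alpha> < 1/5. The width \<eta> = K/h is squeezed from two
  sides. The exponential sum over the h shifts has square mass of order 1/\<eta> outside the window;
  after the logarithms lost to (r/\<phi>(r))^2 and to the sum over r this is negligible only if K
  exceeds log N. The off-diagonal pairs contribute about h K^2 times powers of log N and must stay
  below h^(3/2); this is why h has to exceed a power of log N. Squarefree denominators lose nothing,
  since the Ramanujan coefficients \<mu>(r)/\<phi>(r) vanish at all others. They also keep every
  modulus squarefree, so the characters needed come from primitive roots modulo primes and
  products.\<close>

lemma contour_integral_rectpath_eq:
  assumes "continuous_on (path_image (rectpath (Complex a b) (Complex c d))) f"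
  shows "contour_integral (rectpath (Complex a b) (Complex c d)) f =
    contour_integral (linepath (Complex a b) (Complex c b)) f
    + contour_integral (linepath (Complex c b) (Complex c d)) f
    + contour_integral (linepath (Complex c d) (Complex a d)) f
    + contour_integral (linepath (Complex a d) (Complex a b)) f"
proof -
  have *: "f contour_integrable_on linepath (Complex a b) (Complex c b)"
     "f contour_integrable_on linepath (Complex c b) (Complex c d)"
     "f contour_integrable_on linepath (Complex c d) (Complex a d)"
     "f contour_integrable_on linepath (Complex a d) (Complex a b)"
    by (rule contour_integrable_continuous_linepath, rule continuous_on_subset[OF assms],
        force simp: rectpath_def Let_def path_image_join)+
  show ?thesis
    using * by (simp add: rectpath_def Let_def contour_integral_join contour_integrable_joinI valid_path_join add.assoc)
qed

lemma cmod_ge_abs_Im: "\<bar>Im z\<bar> \<le> cmod z" and cmod_ge_abs_Re: "\<bar>Re z\<bar> \<le> cmod z"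
  by (simp_all add: abs_Im_le_cmod abs_Re_le_cmod)

text \<open>\<open>1 / (s * (s + 1))\<close> is the Mellin transform of
  \<open>max 0 (1 - u)\<close>. Its quadratic decay makes the vertical integrals absolutely
  convergent, so truncation at height T costs only a factor 1/T and disappears in the limit.\<close>

definition perron_kernel :: "real \<Rightarrow> complex \<Rightarrow> complex" where
  "perron_kernel x s = of_real x powr s / (s * (s + 1))"

lemma norm_perron_kernel:
  "x > 0 \<Longrightarrow> norm (perron_kernel x s) = x powr Re s / (norm s * norm (s + 1))"
  by (simp add: perron_kernel_def norm_divide norm_mult norm_powr_real_powr)

lemma perron_kernel_holomorphic:
  "x > 0 \<Longrightarrow> 0 \<notin> S \<Longrightarrow> -1 \<notin> S \<Longrightarrow> perron_kernel x holomorphic_on S"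
  unfolding perron_kernel_def by (intro holomorphic_intros) (auto simp: add_eq_0_iff2)

lemma closed_segment_same_Im_iff:
  "z \<in> closed_segment (Complex a t) (Complex b t) \<longleftrightarrow> Im z = t \<and> Re z \<in> closed_segment a b"
  using closed_segment_same_Im[of "Complex a t" "Complex b t"] by auto
lemma closed_segment_same_Re_iff:
  "z \<in> closed_segment (Complex t a) (Complex t b) \<longleftrightarrow> Re z = t \<and> Im z \<in> closed_segment a b"
  using closed_segment_same_Re[of "Complex t a" "Complex t b"] by auto

lemma perron_kernel_bound:
  assumes "x > 0" "T > 0" "x powr Re s \<le> X" "norm s \<ge> T" "norm (s + 1) \<ge> U" "U > 0"
  shows "norm (perron_kernel x s) \<le> X / (T * U)"
proof -
  have "0 \<le> X" using assms(3) by (meson order_trans powr_ge_zero)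
  have "T * U \<le> norm s * norm (s + 1)" using assms by (intro mult_mono) auto
  then show ?thesis unfolding norm_perron_kernel[OF assms(1)]
    using assms \<open>0 \<le> X\<close> by (intro frac_le) auto
qed

lemma perron_kernel_integral_horizontal:
  assumes "x > 0" "T > 0" "\<And>u. u \<in> closed_segment a b \<Longrightarrow> x powr u \<le> X" "\<bar>t\<bar> = T"
  shows "norm (contour_integral (linepath (Complex a t) (Complex b t)) (perron_kernel x)) \<le> X / T\<^sup>2 * \<bar>b - a\<bar>"
proof -
  have X: "0 \<le> X" using assms(3)[of a] by (simp) (meson order_trans powr_ge_zero)
  have "perron_kernel x contour_integrable_on linepath (Complex a t) (Complex b t)"
    using assms by (intro contour_integrable_continuous_linepath holomorphic_on_imp_continuous_on perron_kernel_holomorphic)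
      (auto simp: closed_segment_same_Im_iff)
  then have "norm (contour_integral (linepath (Complex a t) (Complex b t)) (perron_kernel x)) \<le> X / T\<^sup>2 * norm (Complex b t - Complex a t)"
  proof (rule contour_integral_bound_linepath)
    fix z assume z: "z \<in> closed_segment (Complex a t) (Complex b t)"
    then have "Im z = t" "Re z \<in> closed_segment a b" by (auto simp: closed_segment_same_Im_iff)
    then show "norm (perron_kernel x z) \<le> X / T\<^sup>2"
      unfolding power2_eq_square
      using assms cmod_ge_abs_Im[of z] cmod_ge_abs_Im[of "z+1"] by (intro perron_kernel_bound) auto
  qed (use X in auto)
  also have "norm (Complex b t - Complex a t) = \<bar>b - a\<bar>" by (simp add: cmod_def)
  finally show ?thesis .
qed

lemma perron_kernel_integral_vertical:
  assumes "x > 0" "T > 0" "\<bar>a\<bar> \<ge> U" "\<bar>a + 1\<bar> \<ge> W" "U > 0" "W > 0"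
  shows "norm (contour_integral (linepath (Complex a t) (Complex a u)) (perron_kernel x)) \<le> x powr a / (U * W) * \<bar>u - t\<bar>"
proof -
  have "perron_kernel x contour_integrable_on linepath (Complex a t) (Complex a u)"
    using assms by (intro contour_integrable_continuous_linepath holomorphic_on_imp_continuous_on perron_kernel_holomorphic)
      (auto simp: closed_segment_same_Re_iff)
  then have "norm (contour_integral (linepath (Complex a t) (Complex a u)) (perron_kernel x)) \<le> x powr a / (U * W) * norm (Complex a u - Complex a t)"
  proof (rule contour_integral_bound_linepath)
    fix z assume z: "z \<in> closed_segment (Complex a t) (Complex a u)"
    then have "Re z = a" by (auto simp: closed_segment_same_Re_iff)
    then show "norm (perron_kernel x z) \<le> x powr a / (U * W)"
      using assms cmod_ge_abs_Re[of z] cmod_ge_abs_Re[of "z+1"] by (intro perron_kernel_bound) auto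
  qed (use assms in auto)
  also have "norm (Complex a u - Complex a t) = \<bar>u - t\<bar>" by (simp add: cmod_def)
  finally show ?thesis .
qed

text \<open>For \<open>x \<le> 1\<close> the function \<open>x powr Re s\<close> only decreases to
  the right, where the kernel has no pole, so the line is closed by a rectangle on that side. Its
  width is taken to be T so that all three remaining sides are of order
  \<open>x powr c / T\<close>.\<close>

lemma perron_kernel_right:
  assumes x: "0 < x" "x \<le> 1" and c: "0 < c" and T: "T \<ge> 2"
  shows "norm (contour_integral (linepath (Complex c (-T)) (Complex c T)) (perron_kernel x)) \<le> 8 * x powr c / T"
proof -
  let ?I = "\<lambda>a b. contour_integral (linepath a b) (perron_kernel x)"
  let ?S = "{s. Re s > 0}"
  have hol: "perron_kernel x holomorphic_on ?S" using x by (intro perron_kernel_holomorphic) auto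
  have sub: "path_image (rectpath (Complex c (-T)) (Complex (c+T) T)) \<subseteq> ?S"
    by (rule order_trans[OF path_image_rectpath_subset_cbox]) (use assms in \<open>auto simp: in_cbox_complex_iff\<close>)
  have "(perron_kernel x has_contour_integral 0) (rectpath (Complex c (-T)) (Complex (c+T) T))"
    by (rule Cauchy_theorem_convex_simple[OF hol _ _ sub]) (auto simp: convex_halfspace_Re_gt)
  then have "contour_integral (rectpath (Complex c (-T)) (Complex (c+T) T)) (perron_kernel x) = 0"
    by (rule contour_integral_unique)
  moreover have "contour_integral (rectpath (Complex c (-T)) (Complex (c+T) T)) (perron_kernel x) =
    ?I (Complex c (-T)) (Complex (c+T) (-T)) + ?I (Complex (c+T) (-T)) (Complex (c+T) T)
    + ?I (Complex (c+T) T) (Complex c T) + ?I (Complex c T) (Complex c (-T))"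
    by (rule contour_integral_rectpath_eq[OF holomorphic_on_imp_continuous_on[OF holomorphic_on_subset[OF hol sub]]])
  moreover have "?I (Complex c T) (Complex c (-T)) = - ?I (Complex c (-T)) (Complex c T)"
    using contour_integral_reversepath[OF valid_path_linepath, of "Complex c (-T)" "Complex c T" "perron_kernel x"]
    by (simp add: reversepath_linepath)
  ultimately have eq: "?I (Complex c (-T)) (Complex c T) = ?I (Complex c (-T)) (Complex (c+T) (-T)) + ?I (Complex (c+T) (-T)) (Complex (c+T) T)
    + ?I (Complex (c+T) T) (Complex c T)" by (simp add: algebra_simps eq_neg_iff_add_eq_0)
  have pw: "x powr u \<le> x powr c" if "u \<ge> c" for u using x that by (intro powr_mono') auto
  have 1: "norm (?I (Complex c (-T)) (Complex (c+T) (-T))) \<le> x powr c / T\<^sup>2 * \<bar>c + T - c\<bar>"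
    using assms by (intro perron_kernel_integral_horizontal) (auto simp: closed_segment_eq_real_ivl split: if_splits intro!: pw)
  have 2: "norm (?I (Complex (c+T) T) (Complex c T)) \<le> x powr c / T\<^sup>2 * \<bar>c - (c + T)\<bar>"
    using assms by (intro perron_kernel_integral_horizontal) (auto simp: closed_segment_eq_real_ivl split: if_splits intro!: pw)
  have "norm (?I (Complex (c+T) (-T)) (Complex (c+T) T)) \<le> x powr (c+T) / (T * T) * \<bar>T - (-T)\<bar>"
    using assms by (intro perron_kernel_integral_vertical) auto
  also have "\<dots> \<le> x powr c / (T * T) * \<bar>T - (-T)\<bar>"
    using assms by (intro mult_right_mono divide_right_mono pw) auto
  finally have 3: "norm (?I (Complex (c+T) (-T)) (Complex (c+T) T)) \<le> x powr c / (T * T) * \<bar>T - (-T)\<bar>" .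
  have "norm (?I (Complex c (-T)) (Complex c T)) \<le> x powr c / T\<^sup>2 * T + x powr c / (T * T) * (2 * T) + x powr c / T\<^sup>2 * T"
    unfolding eq using 1 2 3 T by (intro norm_triangle_le add_mono) auto
  also have "\<dots> = 4 * x powr c / T" using T by (simp add: field_simps power2_eq_square)
  also have "\<dots> \<le> 8 * x powr c / T" using T by (intro divide_right_mono) auto
  finally show ?thesis .
qed

lemma residue_perron_kernel_0:
  assumes "x > 0" shows "residue (perron_kernel x) 0 = 1"
proof -
  have "residue (\<lambda>s. (of_real x powr s / (s + 1)) / (s - 0)) 0 = of_real x powr 0 / (0 + 1)"
    using assms by (intro residue_simple[of "ball 0 1"] holomorphic_intros)
      (auto simp: add_eq_0_iff2 dist_norm)
  moreover have "perron_kernel x = (\<lambda>s. (of_real x powr s / (s + 1)) / (s - 0))"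
    by (auto simp: perron_kernel_def fun_eq_iff)
  ultimately show ?thesis using assms by simp
qed

lemma residue_perron_kernel_m1:
  assumes "x > 0" shows "residue (perron_kernel x) (-1) = - 1 / of_real x"
proof -
  have "residue (\<lambda>s. (of_real x powr s / s) / (s - (-1))) (-1) = of_real x powr (-1) / (-1)"
    using assms by (intro residue_simple[of "ball (-1) 1"] holomorphic_intros)
      (auto simp: add_eq_0_iff dist_norm)
  moreover have "perron_kernel x = (\<lambda>s. (of_real x powr s / s) / (s - (-1)))"
    by (auto simp: perron_kernel_def fun_eq_iff)
  ultimately show ?thesis using assms by (simp add: powr_minus_divide)
qed

text \<open>For \<open>x \<ge> 1\<close> the rectangle is closed on the left instead and encloses
  both poles; the residues 1 at 0 and \<open>- 1 / x\<close> at -1 add up to the Riesz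
  weight.\<close>

lemma perron_kernel_left:
  assumes x: "1 \<le> x" and c: "0 < c" "c \<le> 2" and T: "T \<ge> 2"
  shows "norm (contour_integral (linepath (Complex c (-T)) (Complex c T)) (perron_kernel x) - 2 * pi * \<i> * of_real (1 - 1 / x)) \<le> 8 * x powr c / T"
proof -
  let ?I = "\<lambda>a b. contour_integral (linepath a b) (perron_kernel x)"
  let ?R = "rectpath (Complex (-T) (-T)) (Complex c T)"
  have hol: "perron_kernel x holomorphic_on UNIV - {0, -1}" using x by (intro perron_kernel_holomorphic) auto
  have sub: "path_image ?R \<subseteq> UNIV - {0, -1}"
    using path_image_rectpath_cbox_minus_box[of "Complex (-T) (-T)" "Complex c T"] assms
    by (auto simp: in_cbox_complex_iff in_box_complex_iff)
  have "contour_integral ?R (perron_kernel x) = complex_of_real (2 * pi) * \<i> *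
       (\<Sum>p\<in>{0,-1}. winding_number ?R p * residue (perron_kernel x) p)"
    by (rule Residue_theorem[OF _ _ _ hol]) (use sub in auto)
  also have "\<dots> = 2 * pi * \<i> * (1 - 1 / of_real x)"
    using x c T by (simp add: winding_number_rectpath in_box_complex_iff residue_perron_kernel_0 residue_perron_kernel_m1)
  finally have "contour_integral ?R (perron_kernel x) = 2 * pi * \<i> * (1 - 1 / of_real x)" .
  moreover have "contour_integral ?R (perron_kernel x) =
    ?I (Complex (-T) (-T)) (Complex c (-T)) + ?I (Complex c (-T)) (Complex c T)
    + ?I (Complex c T) (Complex (-T) T) + ?I (Complex (-T) T) (Complex (-T) (-T))"
    by (rule contour_integral_rectpath_eq[OF holomorphic_on_imp_continuous_on[OF holomorphic_on_subset[OF hol sub]]])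
  ultimately have eq: "?I (Complex c (-T)) (Complex c T) - 2 * pi * \<i> * of_real (1 - 1 / x) =
     - (?I (Complex (-T) (-T)) (Complex c (-T)) + ?I (Complex (-T) T) (Complex (-T) (-T)) + ?I (Complex c T) (Complex (-T) T))"
    by (simp add: algebra_simps eq_neg_iff_add_eq_0)
  have pw: "x powr u \<le> x powr c" if "u \<le> c" for u using x that by (intro powr_mono) auto
  have 1: "norm (?I (Complex (-T) (-T)) (Complex c (-T))) \<le> x powr c / T\<^sup>2 * \<bar>c - (- T)\<bar>"
    using assms by (intro perron_kernel_integral_horizontal) (auto simp: closed_segment_eq_real_ivl split: if_splits intro!: pw)
  have 2: "norm (?I (Complex c T) (Complex (-T) T)) \<le> x powr c / T\<^sup>2 * \<bar>-T - c\<bar>"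
    using assms by (intro perron_kernel_integral_horizontal) (auto simp: closed_segment_eq_real_ivl split: if_splits intro!: pw)
  have "norm (?I (Complex (-T) T) (Complex (-T) (-T))) \<le> x powr (-T) / (T * (T - 1)) * \<bar>-T - T\<bar>"
    using assms by (intro perron_kernel_integral_vertical) auto
  also have "\<dots> \<le> x powr c / (T * (T - 1)) * \<bar>-T - T\<bar>"
    using assms by (intro mult_right_mono divide_right_mono pw) auto
  finally have 3: "norm (?I (Complex (-T) T) (Complex (-T) (-T))) \<le> x powr c / (T * (T - 1)) * \<bar>-T - T\<bar>" .
  have "norm (?I (Complex c (-T)) (Complex c T) - 2 * pi * \<i> * of_real (1 - 1 / x)) \<le> x powr c / T\<^sup>2 * (c + T) + x powr c / (T * (T - 1)) * (2 * T) + x powr c / T\<^sup>2 * (c + T)"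
    unfolding eq norm_minus_cancel using 1 2 3 T c by (intro norm_triangle_le add_mono) (auto simp: add.commute)
  also have "\<dots> \<le> x powr c / T\<^sup>2 * (2 * T) + x powr c / (T * (T / 2)) * (2 * T) + x powr c / T\<^sup>2 * (2 * T)"
    using T c by (intro add_mono mult_mono divide_left_mono) (auto simp: )
  also have "\<dots> = 8 * x powr c / T" using T by (simp add: field_simps power2_eq_square)
  finally show ?thesis .
qed

lemma perron_kernel_integral:
  assumes "x > 0" and "0 < c" "c \<le> 2" and "T \<ge> 2"
  shows "norm (contour_integral (linepath (Complex c (-T)) (Complex c T)) (perron_kernel x) - 2 * pi * \<i> * of_real (max 0 (1 - 1 / x))) \<le> 8 * x powr c / T"
proof (cases "x \<ge> 1")
  case True
  then have "max 0 (1 - 1 / x) = 1 - 1 / x" by (simp add: max_def field_simps)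
  then show ?thesis using perron_kernel_left[OF True assms(2-4)] by simp
next
  case False
  then have "max 0 (1 - 1 / x) = 0" using assms by (simp add: max_def field_simps)
  then show ?thesis using perron_kernel_right[of x c T] False assms by simp
qed

text \<open>Borel--Caratheodory, applied to a logarithm of \<open>f\<close>.\<close>
lemma holomorphic_log_deriv_bound:
  assumes hol: "f holomorphic_on ball c R" and nz: "\<And>z. z \<in> ball c R \<Longrightarrow> f z \<noteq> 0"
    and bd: "\<And>z. z \<in> ball c R \<Longrightarrow> norm (f z) < B * norm (f c)"
    and r: "0 < r" "r < R" and z: "z \<in> cball c r"
  shows "norm (deriv f z / f z) \<le> 8 * ln B * R / (R - r)\<^sup>2"
proof -
  have R: "R > 0" using r by simp
  have c: "c \<in> ball c R" using R by simp
  define f1 where "f1 w = f w / f c" for w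
  have f1: "f1 holomorphic_on ball c R" unfolding f1_def using nz[OF c] by (intro holomorphic_intros hol)
  have f1nz: "\<And>z. z \<in> ball c R \<Longrightarrow> f1 z \<noteq> 0" using nz c by (auto simp: f1_def)
  obtain g0 where g0: "g0 holomorphic_on ball c R" "\<And>z. z \<in> ball c R \<Longrightarrow> f1 z = exp (g0 z)"
    using contractible_imp_holomorphic_log[OF f1 convex_imp_contractible[OF convex_ball] f1nz] by blast
  define g where "g w = g0 w - g0 c" for w
  have e0: "exp (g0 c) = 1" using g0(2)[OF c] nz[OF c] by (simp add: f1_def)
  have g: "g holomorphic_on ball c R" "\<And>z. z \<in> ball c R \<Longrightarrow> f1 z = exp (g z)" "g c = 0"
    using g0 e0 unfolding g_def by (auto simp: exp_diff intro!: holomorphic_intros)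
  have B1: "B > 1" using bd[OF c] nz[OF c] by simp
  define M where "M = ln B"
  have M: "M > 0" using B1 by (simp add: M_def)
  have Re: "Re (g w) < M" if "w \<in> ball c R" for w
  proof -
    have "exp (Re (g w)) = norm (f1 w)" using g(2)[OF that] by simp
    also have "\<dots> < B" using bd[OF that] nz[OF c] by (simp add: f1_def norm_divide field_simps)
    finally show ?thesis using B1 unfolding M_def by (metis exp_less_cancel_iff exp_ln less_trans zero_less_one)
  qed
  have nz2: "2 * M - g w \<noteq> 0" if "w \<in> ball c R" for w
  proof
    assume "2 * M - g w = 0" then have "Re (g w) = 2 * M" by (auto simp: complex_eq_iff)
    then show False using Re[OF that] M by simp
  qed
  \<comment> \<open>The map \<open>w / (2 * M - w)\<close> sends the half-plane
    \<open>Re w < M\<close> into the unit disc and fixes 0, so that the Schwarz lemma turns the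
    one-sided bound on \<open>Re g\<close> into a bound on \<open>norm g\<close>.\<close>
  define h where "h u = g (c + of_real R * u) / (2 * M - g (c + of_real R * u))" for u
  have inb: "c + of_real R * u \<in> ball c R" if "u \<in> ball 0 1" for u
    using that R by (simp add: dist_norm norm_mult)
  have h_hol: "h holomorphic_on ball 0 1"
    unfolding h_def
    by (intro holomorphic_intros holomorphic_on_compose_gen[OF _ g(1), unfolded o_def]) (use inb nz2 in auto)
  have h1: "norm (h u) < 1" if "norm u < 1" for u
  proof -
    define w where "w = g (c + of_real R * u)"
    have inb: "c + of_real R * u \<in> ball c R" using inb that by simp
    have "Re w < M" using Re[OF inb] by (simp add: w_def)
    then have "(norm w)^2 < (norm (2 * M - w))^2"
      using M by (simp only: cmod_power2) (simp add: power2_eq_square algebra_simps)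
    then have "norm w < norm (2 * M - w)" by (rule power_less_imp_less_base) simp
    then show ?thesis unfolding h_def w_def[symmetric] norm_divide using nz2[OF inb] by (simp add: w_def)
  qed
  have gb: "norm (g w) \<le> 2 * M * norm (w - c) / (R - norm (w - c))" if w: "w \<in> ball c R" for w
  proof -
    define u where "u = (w - c) / of_real R"
    have wu: "w = c + of_real R * u" using R by (simp add: u_def)
    have nu: "norm u < 1" using w R by (simp add: u_def norm_divide dist_norm norm_minus_commute)
    have hu: "norm (h u) \<le> norm u"
      by (rule Schwarz_Lemma(1)[OF h_hol _ h1 nu]) (auto simp: h_def g(3))
    have "h u * (2 * M - g w) = g w" using nz2[OF w] by (simp add: h_def wu)
    then have "norm (g w) = norm (h u) * norm (2 * M - g w)" by (metis norm_mult)
    also have "\<dots> \<le> norm u * (2 * M + norm (g w))"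
      using hu M norm_triangle_ineq4[of "2 * of_real M" "g w"] by (intro mult_mono) (auto simp: norm_mult)
    finally have "norm (g w) * (1 - norm u) \<le> 2 * M * norm u" by (simp add: algebra_simps)
    then have "norm (g w) \<le> 2 * M * norm u / (1 - norm u)" using nu by (simp add: field_simps)
    also have "\<dots> = 2 * M * norm (w - c) / (R - norm (w - c))"
      using R nu unfolding u_def by (simp add: norm_divide field_simps)
    finally show ?thesis .
  qed
  \<comment> \<open>Half of the distance from \<open>cball c r\<close> to the outer circle: Cauchy's
    inequality on circles of this radius pays one factor \<open>1 / \<rho>\<close>, and the bound
    for g on them pays another.\<close>
  define \<rho> where "\<rho> = (R - r) / 2"
  have \<rho>: "\<rho> > 0" using r by (simp add: \<rho>_def)
  have sub: "cball z \<rho> \<subseteq> ball c R"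
  proof
    fix w assume "w \<in> cball z \<rho>"
    then have "dist c w \<le> r + \<rho>" using z dist_triangle[of c w z] by auto
    also have "\<dots> < R" using r by (simp add: \<rho>_def field_simps)
    finally show "w \<in> ball c R" by simp
  qed
  have zin: "z \<in> ball c R" using sub \<rho> centre_in_cball[of z \<rho>] by (auto simp del: mem_ball mem_cball)
  have "norm ((deriv ^^ 1) g z) \<le> fact 1 * (2 * M * R / \<rho>) / \<rho> ^ 1"
  proof (rule Cauchy_inequality)
    show "g holomorphic_on ball z \<rho>" using g(1) sub ball_subset_cball by (meson holomorphic_on_subset order_trans)
    show "continuous_on (cball z \<rho>) g" using g(1) sub holomorphic_on_imp_continuous_on holomorphic_on_subset by blast
    fix w assume w: "norm (z - w) = \<rho>"
    then have wb: "w \<in> ball c R" using sub by (auto simp: dist_norm)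
    have "norm (w - c) \<le> norm (w - z) + norm (z - c)" using norm_triangle_ineq[of "w - z" "z - c"] by simp
    also have "\<dots> \<le> \<rho> + r" using z w by (simp add: dist_norm norm_minus_commute)
    finally have le: "norm (w - c) \<le> R - \<rho>" by (simp add: \<rho>_def field_simps)
    have "norm (g w) \<le> 2 * M * norm (w - c) / (R - norm (w - c))" by (rule gb[OF wb])
    also have "\<dots> \<le> 2 * M * R / \<rho>" using le \<rho> M R by (intro frac_le mult_left_mono) auto
    finally show "norm (g w) \<le> 2 * M * R / \<rho>" .
  qed (use \<rho> in auto)
  also have "\<dots> = 8 * M * R / (R - r)\<^sup>2" unfolding \<rho>_def by (simp add: power2_eq_square field_simps)
  finally have dg: "norm (deriv g z) \<le> 8 * M * R / (R - r)\<^sup>2" by simp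
  have "deriv f z / f z = deriv g z"
  proof -
    have dgz: "(g has_field_derivative deriv g z) (at z)" using g(1) zin by (simp add: holomorphic_derivI)
    have "((\<lambda>w. f c * exp (g w)) has_field_derivative f c * (exp (g z) * deriv g z)) (at z)"
      by (auto intro!: derivative_eq_intros dgz)
    then have "(f has_field_derivative f c * (exp (g z) * deriv g z)) (at z)"
    proof (rule has_field_derivative_transform_within_open[OF _ open_ball zin])
      show "f c * exp (g w) = f w" if "w \<in> ball c R" for w
        using g(2)[OF that] nz[OF c] by (simp add: f1_def field_simps)
    qed
    moreover have "f z = f c * exp (g z)" using g(2)[OF zin] nz[OF c] by (simp add: f1_def field_simps)
    ultimately show ?thesis using nz[OF zin] by (simp add: DERIV_imp_deriv mult.assoc[symmetric])
  qed
  then show ?thesis using dg by (simp add: M_def)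
qed

lemma perron_kernel_le:
  assumes "x > 0" "1/2 \<le> Re s"
  shows "norm (perron_kernel x s) \<le> 2 * x powr Re s / (1 + (Im s)\<^sup>2)"
proof -
  have "(1 + (Im s)\<^sup>2) / 2 \<le> norm s * norm (s + 1)"
  proof (rule power2_le_imp_le)
    have a: "1/4 \<le> (Re s)\<^sup>2" "1 \<le> (Re s + 1)\<^sup>2"
      using power_mono[OF assms(2), of 2] power_mono[of 1 "Re s + 1" 2] assms(2) by (simp_all add: power_divide)
    have "((1 + (Im s)\<^sup>2) / 2)\<^sup>2 = ((1 + (Im s)\<^sup>2) / 4) * (1 + (Im s)\<^sup>2)" unfolding power2_eq_square[of "(_ + _)/2"] by simp
    also have "\<dots> \<le> ((Re s)\<^sup>2 + (Im s)\<^sup>2) * ((Re s + 1)\<^sup>2 + (Im s)\<^sup>2)"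
    proof (rule mult_mono)
      show "(1 + (Im s)\<^sup>2) / 4 \<le> (Re s)\<^sup>2 + (Im s)\<^sup>2" using a zero_le_power2[of "Im s"] by argo
      show "1 + (Im s)\<^sup>2 \<le> (Re s + 1)\<^sup>2 + (Im s)\<^sup>2" using a by linarith
    qed auto
    also have "\<dots> = (norm s * norm (s + 1))\<^sup>2" unfolding power_mult_distrib cmod_power2 by simp
    finally show "((1 + (Im s)\<^sup>2) / 2)\<^sup>2 \<le> (norm s * norm (s + 1))\<^sup>2" .
  qed auto
  then have "x powr Re s / (norm s * norm (s + 1)) \<le> x powr Re s / ((1 + (Im s)\<^sup>2) / 2)"
  proof (intro divide_left_mono mult_pos_pos)
    have "s \<noteq> 0" "s + 1 \<noteq> 0" using assms(2) by (auto simp: complex_eq_iff)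
    then show "0 < norm s" "0 < norm (s + 1)" by simp_all
    show "0 < (1 + (Im s)\<^sup>2) / 2" using zero_le_power2[of "Im s"] by argo
  qed auto
  also have "\<dots> = 2 * x powr Re s / (1 + (Im s)\<^sup>2)" by simp
  finally show ?thesis unfolding norm_perron_kernel[OF assms(1)] .
qed

lemma integral_sqrt_growth_le:
  fixes T :: real assumes "T > 0"
  shows "((\<lambda>t. 2 * (1 + \<bar>t\<bar>) powr (-3/2)) has_integral (8 - 8 * (1 + T) powr (-1/2))) {-T..T}"
proof -
  have p: "((\<lambda>t. 2 * (1 + \<bar>t\<bar>) powr (-3/2)) has_integral ((-4) * (1 + T) powr (-1/2) - (-4) * (1 + 0) powr (-1/2))) {0..T}"
  proof (rule has_integral_eq)
    show "((\<lambda>t. 2 * (1 + t) powr (-3/2)) has_integral ((-4) * (1 + T) powr (-1/2) - (-4) * (1 + 0) powr (-1/2))) {0..T}"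
    proof (rule fundamental_theorem_of_calculus)
      fix t assume "t \<in> {0..T}"
      then have "((\<lambda>t. (1 + t) powr (-1/2)) has_real_derivative (-1/2) * (1 + t) powr (-1/2 - of_nat 1) * 1) (at t)"
        by (intro DERIV_fun_powr) (auto intro!: derivative_eq_intros)
      from DERIV_cmult[OF this, of "-4"] show "((\<lambda>t. (-4) * (1 + t) powr (-1/2)) has_vector_derivative 2 * (1 + t) powr (-3/2)) (at t within {0..T})"
        by (simp add: has_real_derivative_iff_has_vector_derivative[symmetric] has_field_derivative_at_within)
    qed (use assms in auto)
  qed auto
  have n: "((\<lambda>t. 2 * (1 + \<bar>t\<bar>) powr (-3/2)) has_integral (4 * (1 - 0) powr (-1/2) - 4 * (1 - (-T)) powr (-1/2))) {-T..0}"
  proof (rule has_integral_eq)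
    show "((\<lambda>t. 2 * (1 - t) powr (-3/2)) has_integral (4 * (1 - 0) powr (-1/2) - 4 * (1 - (-T)) powr (-1/2))) {-T..0}"
    proof (rule fundamental_theorem_of_calculus)
      fix t assume "t \<in> {-T..0}"
      then have "((\<lambda>t. (1 - t) powr (-1/2)) has_real_derivative (-1/2) * (1 - t) powr (-1/2 - of_nat 1) * (-1)) (at t)"
        by (intro DERIV_fun_powr) (auto intro!: derivative_eq_intros)
      from DERIV_cmult[OF this, of "4"] show "((\<lambda>t. 4 * (1 - t) powr (-1/2)) has_vector_derivative 2 * (1 - t) powr (-3/2)) (at t within {-T..0})"
        by (simp add: has_real_derivative_iff_has_vector_derivative[symmetric] has_field_derivative_at_within)
    qed (use assms in auto)
  qed auto
  show ?thesis using has_integral_combine[OF _ _ n p] assms by (simp add: algebra_simps)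
qed

lemma sqrt_growth_le: "(1 + \<bar>t\<bar>) powr (1/2) / (1 + t\<^sup>2) \<le> 2 * (1 + \<bar>t\<bar>) powr (-3/2)" for t :: real
proof -
  have "(1 + \<bar>t\<bar>)\<^sup>2 \<le> 2 * (1 + t\<^sup>2)"
    using zero_le_power2[of "1 - \<bar>t\<bar>"] unfolding power2_sum power2_diff power2_abs by simp
  then have "(1 + \<bar>t\<bar>) powr (1/2) / (1 + t\<^sup>2) \<le> (1 + \<bar>t\<bar>) powr (1/2) / ((1 + \<bar>t\<bar>)\<^sup>2 / 2)"
  proof (intro divide_left_mono mult_pos_pos)
    show "0 < 1 + t\<^sup>2" using zero_le_power2[of t] by linarith
    show "0 < (1 + \<bar>t\<bar>)\<^sup>2 / 2" using zero_less_power[of "1 + \<bar>t\<bar>" 2] by simp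
  qed (auto simp: field_simps)
  also have "(1 + \<bar>t\<bar>)\<^sup>2 = (1 + \<bar>t\<bar>) powr 2" by simp
  also have "(1 + \<bar>t\<bar>) powr (1/2) / ((1 + \<bar>t\<bar>) powr 2 / 2) = 2 * ((1 + \<bar>t\<bar>) powr (1/2) / (1 + \<bar>t\<bar>) powr 2)" by simp
  also have "(1 + \<bar>t\<bar>) powr (1/2) / (1 + \<bar>t\<bar>) powr 2 = (1 + \<bar>t\<bar>) powr (1/2 - 2)" by (rule powr_diff[symmetric])
  finally show ?thesis by simp
qed

text \<open>A growth of order 1/2 in the imaginary part leaves
  \<open>(1 + \<bar>t\<bar>) powr (-3/2)\<close> after division by the quadratic decay of the
  kernel. This is integrable over the whole line, so the bound is uniform in T; a logarithmic growth
  of the function fits with room to spare.\<close>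

lemma perron_vertical_bound:
  assumes y: "y > 0" and c: "1/2 \<le> c" and T: "T > 0" and M: "M \<ge> 0"
    and cont: "continuous_on (closed_segment (Complex c (-T)) (Complex c T)) f"
    and f: "\<And>t. norm (f (Complex c t)) \<le> M * (1 + \<bar>t\<bar>) powr (1/2)"
  shows "norm (contour_integral (linepath (Complex c (-T)) (Complex c T)) (\<lambda>s. f s * perron_kernel y s)) \<le> 16 * M * y powr c"
proof -
  let ?g = "\<lambda>s. f s * perron_kernel y s"
  have cg: "continuous_on (closed_segment (Complex c (-T)) (Complex c T)) ?g"
    using y c by (intro continuous_intros cont holomorphic_on_imp_continuous_on perron_kernel_holomorphic)
     (auto simp: closed_segment_same_Re_iff)
  have eq: "contour_integral (linepath (Complex c (-T)) (Complex c T)) ?g = \<i> * integral {-T..T} (\<lambda>t. ?g (Complex c t))"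
    using T by (intro contour_integral_linepath_same_Re) auto
  have "continuous_on {-T..T} (\<lambda>t. ?g (Complex c t))"
    by (rule continuous_on_compose2[OF cg]) (use T in \<open>auto simp: closed_segment_same_Re_iff closed_segment_eq_real_ivl intro!: continuous_on_Complex continuous_intros\<close>)
  then have "(\<lambda>t. ?g (Complex c t)) integrable_on {-T..T}" by (rule integrable_continuous_interval)
  then have "norm (integral {-T..T} (\<lambda>t. ?g (Complex c t))) \<le> integral {-T..T} (\<lambda>t. 2 * M * y powr c * (2 * (1 + \<bar>t\<bar>) powr (-3/2)))"
  proof (rule integral_norm_bound_integral)
    show "(\<lambda>t. 2 * M * y powr c * (2 * (1 + \<bar>t\<bar>) powr (-3/2))) integrable_on {-T..T}"
      using has_integral_mult_right[OF integral_sqrt_growth_le[OF T], of "2 * M * y powr c"] by (rule has_integral_integrable)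
    fix t
    have "norm (?g (Complex c t)) \<le> (M * (1 + \<bar>t\<bar>) powr (1/2)) * (2 * y powr c / (1 + t\<^sup>2))"
      unfolding norm_mult using f[of t] perron_kernel_le[OF y, of "Complex c t"] c M by (intro mult_mono) auto
    also have "\<dots> = 2 * M * y powr c * ((1 + \<bar>t\<bar>) powr (1/2) / (1 + t\<^sup>2))" by simp
    also have "\<dots> \<le> 2 * M * y powr c * (2 * (1 + \<bar>t\<bar>) powr (-3/2))"
      using M by (intro mult_left_mono sqrt_growth_le) auto
    finally show "norm (?g (Complex c t)) \<le> 2 * M * y powr c * (2 * (1 + \<bar>t\<bar>) powr (-3/2))" .
  qed
  also have "\<dots> = 2 * M * y powr c * (8 - 8 * (1 + T) powr (-1/2))"
    using has_integral_mult_right[OF integral_sqrt_growth_le[OF T], of "2 * M * y powr c"] by (rule integral_unique)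
  also have "\<dots> \<le> 2 * M * y powr c * 8" using M by (intro mult_left_mono) auto
  finally show ?thesis unfolding eq by (simp add: norm_mult)
qed

lemma perron_horizontal_bound:
  assumes y: "y \<ge> 1" and c: "1/2 \<le> c" "c \<le> 2" and T: "\<bar>t\<bar> = T" "T \<ge> 1" and M: "M \<ge> 0"
    and cont: "continuous_on (closed_segment (Complex c t) (Complex 2 t)) f"
    and f: "\<And>s. c \<le> Re s \<Longrightarrow> Re s \<le> 2 \<Longrightarrow> norm (f s) \<le> M * (1 + \<bar>Im s\<bar>) powr (1/2)"
  shows "norm (contour_integral (linepath (Complex c t) (Complex 2 t)) (\<lambda>s. f s * perron_kernel y s)) \<le> 8 * M * y\<^sup>2 / T"
proof -
  let ?g = "\<lambda>s. f s * perron_kernel y s"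
  have cg: "continuous_on (closed_segment (Complex c t) (Complex 2 t)) ?g"
    using y T by (intro continuous_intros cont holomorphic_on_imp_continuous_on perron_kernel_holomorphic)
     (auto simp: closed_segment_same_Im_iff)
  have "norm (contour_integral (linepath (Complex c t) (Complex 2 t)) ?g) \<le> (4 * M * y\<^sup>2 / T) * norm (Complex 2 t - Complex c t)"
  proof (rule contour_integral_bound_linepath)
    show "?g contour_integrable_on linepath (Complex c t) (Complex 2 t)" by (rule contour_integrable_continuous_linepath[OF cg])
    fix s assume s: "s \<in> closed_segment (Complex c t) (Complex 2 t)"
    then have s: "Im s = t" "c \<le> Re s" "Re s \<le> 2" using c by (auto simp: closed_segment_same_Im_iff closed_segment_eq_real_ivl)
    have "norm (?g s) \<le> (M * (1 + \<bar>t\<bar>) powr (1/2)) * (2 * y powr Re s / (1 + t\<^sup>2))"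
      unfolding norm_mult using f[of s] perron_kernel_le[of y s] c M s y by (intro mult_mono) auto
    also have "\<dots> \<le> (M * (1 + \<bar>t\<bar>) powr 1) * (2 * y powr 2 / (1 + t\<^sup>2))"
      using s y M by (intro mult_mono divide_right_mono powr_mono) auto
    also have "\<dots> = M * 2 * y\<^sup>2 * ((1 + T) / (1 + T\<^sup>2))"
    proof -
      have "t\<^sup>2 = T\<^sup>2" using T(1) by (metis power2_abs)
      moreover have "y powr 2 = y\<^sup>2" using y by simp
      ultimately show ?thesis using T by simp
    qed
    also have "(1 + T) / (1 + T\<^sup>2) \<le> 2 / T"
    proof -
      have "T \<le> 1 + T * T" using zero_le_square[of "T - 1"] T(2) by (simp add: algebra_simps)
      then have "(1 + T) * T \<le> 2 * (1 + T\<^sup>2)" using zero_le_square[of T] unfolding power2_eq_square distrib_right distrib_left mult_1_left mult_1_right by linarith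
      then show ?thesis using T(2) by (simp add: frac_le_eq divide_simps add_pos_nonneg)
    qed
    then have "M * 2 * y\<^sup>2 * ((1 + T) / (1 + T\<^sup>2)) \<le> M * 2 * y\<^sup>2 * (2 / T)" using M by (intro mult_left_mono) auto
    finally show "norm (?g s) \<le> 4 * M * y\<^sup>2 / T" by simp
  qed (use M T in auto)
  also have "norm (Complex 2 t - Complex c t) \<le> 2" using c by (simp add: cmod_def)
  then have "(4 * M * y\<^sup>2 / T) * norm (Complex 2 t - Complex c t) \<le> (4 * M * y\<^sup>2 / T) * 2"
    using M T by (intro mult_left_mono) auto
  finally show ?thesis by simp
qed

text \<open>The line of integration moves from 2 to c through a region where f is holomorphic. The
  horizontal sides are only bounded crudely by a multiple of \<open>y\<^sup>2 / T\<close>, since T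
  later tends to infinity with y fixed.\<close>

lemma perron_shift:
  assumes y: "y \<ge> 1" and c: "1/2 \<le> c" "c \<le> 2" and T: "T \<ge> 1" and M: "M \<ge> 0"
    and hol: "f holomorphic_on {s. Re s > \<sigma>\<^sub>1}" and \<sigma>: "\<sigma>\<^sub>1 < c" "0 \<le> \<sigma>\<^sub>1"
    and f: "\<And>s. c \<le> Re s \<Longrightarrow> Re s \<le> 2 \<Longrightarrow> norm (f s) \<le> M * (1 + \<bar>Im s\<bar>) powr (1/2)"
  shows "norm (contour_integral (linepath (Complex 2 (-T)) (Complex 2 T)) (\<lambda>s. f s * perron_kernel y s)) \<le> 16 * M * y powr c + 16 * M * y\<^sup>2 / T"
proof -
  let ?g = "\<lambda>s. f s * perron_kernel y s"
  let ?S = "{s. Re s > \<sigma>\<^sub>1}"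
  let ?R = "rectpath (Complex c (-T)) (Complex 2 T)"
  let ?I = "\<lambda>a b. contour_integral (linepath a b) ?g"
  have gh: "?g holomorphic_on ?S" using y \<sigma> by (intro holomorphic_intros hol perron_kernel_holomorphic) auto
  have sub: "path_image ?R \<subseteq> ?S"
    by (rule order_trans[OF path_image_rectpath_subset_cbox]) (use assms in \<open>auto simp: in_cbox_complex_iff\<close>)
  have "(?g has_contour_integral 0) ?R"
    by (rule Cauchy_theorem_convex_simple[OF gh _ _ sub]) (auto simp: convex_halfspace_Re_gt)
  then have "contour_integral ?R ?g = 0" by (rule contour_integral_unique)
  moreover have "contour_integral ?R ?g = ?I (Complex c (-T)) (Complex 2 (-T)) + ?I (Complex 2 (-T)) (Complex 2 T)
    + ?I (Complex 2 T) (Complex c T) + ?I (Complex c T) (Complex c (-T))"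
    by (rule contour_integral_rectpath_eq[OF holomorphic_on_imp_continuous_on[OF holomorphic_on_subset[OF gh sub]]])
  moreover have "?I b a = - ?I a b" for a b
    using contour_integral_reversepath[OF valid_path_linepath, of a b ?g] by (simp add: reversepath_linepath)
  from this[of "Complex c T" "Complex c (-T)"] this[of "Complex 2 T" "Complex c T"]
  have "?I (Complex c T) (Complex c (-T)) = - ?I (Complex c (-T)) (Complex c T)"
    "?I (Complex 2 T) (Complex c T) = - ?I (Complex c T) (Complex 2 T)" by auto
  ultimately have eq: "?I (Complex 2 (-T)) (Complex 2 T) = ?I (Complex c (-T)) (Complex c T) - ?I (Complex c (-T)) (Complex 2 (-T)) + ?I (Complex c T) (Complex 2 T)"
    by (simp add: algebra_simps eq_neg_iff_add_eq_0)
  have cont: "continuous_on A f" if "A \<subseteq> ?S" for A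
    using hol that holomorphic_on_imp_continuous_on holomorphic_on_subset by blast
  have fc: "norm (f (Complex c t)) \<le> M * (1 + \<bar>t\<bar>) powr (1/2)" for t using f[of "Complex c t"] c by simp
  have 1: "norm (?I (Complex c (-T)) (Complex c T)) \<le> 16 * M * y powr c"
    using assms fc by (intro perron_vertical_bound cont) (auto simp: closed_segment_same_Re_iff)
  have 2: "norm (?I (Complex c (-T)) (Complex 2 (-T))) \<le> 8 * M * y\<^sup>2 / T"
    using assms by (intro perron_horizontal_bound cont) (auto simp: closed_segment_same_Im_iff closed_segment_eq_real_ivl)
  have 3: "norm (?I (Complex c T) (Complex 2 T)) \<le> 8 * M * y\<^sup>2 / T"
    using assms by (intro perron_horizontal_bound cont) (auto simp: closed_segment_same_Im_iff closed_segment_eq_real_ivl)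
  have "norm (?I (Complex 2 (-T)) (Complex 2 T)) \<le> 16 * M * y powr c + 8 * M * y\<^sup>2 / T + 8 * M * y\<^sup>2 / T"
    unfolding eq using 1 2 3 by (intro norm_triangle_le order_trans[OF norm_triangle_ineq4] add_mono)
  then show ?thesis by simp
qed

lemma perron_pole:
  assumes y: "y \<ge> 1" and T: "T \<ge> 2"
  shows "norm (contour_integral (linepath (Complex 2 (-T)) (Complex 2 T)) (\<lambda>s. perron_kernel y s / (s - 1))
    - 2 * pi * \<i> * of_real ((y - 1)\<^sup>2 / (2 * y))) \<le> 8 * y\<^sup>2 / T"
proof -
  let ?I = "\<lambda>c f. contour_integral (linepath (Complex c (-T)) (Complex c T)) f"
  have int: "perron_kernel y contour_integrable_on (linepath (Complex c (-T)) (Complex c T))" if "c > 0" for c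
    using y that by (intro contour_integrable_continuous_linepath holomorphic_on_imp_continuous_on perron_kernel_holomorphic)
      (auto simp: closed_segment_same_Re_iff)
  have int1: "(\<lambda>s. perron_kernel y (s - 1)) contour_integrable_on (linepath (Complex 2 (-T)) (Complex 2 T))"
    unfolding perron_kernel_def using y
    by (intro contour_integrable_continuous_linepath continuous_intros)
      (auto simp: closed_segment_same_Re_iff)
  have eq1: "?I 2 (\<lambda>s. perron_kernel y (s - 1)) = ?I 1 (perron_kernel y)"
  proof -
    have "Complex 2 t - 1 = Complex 1 t" for t by (simp add: complex_eq_iff)
    moreover have "?I c f = \<i> * integral {-T..T} (\<lambda>t. f (Complex c t))" for c f
      using T by (intro contour_integral_linepath_same_Re) auto
    ultimately show ?thesis by simp
  qed
  have "?I 2 (\<lambda>s. perron_kernel y s / (s - 1)) = ?I 2 (\<lambda>s. of_real y / 2 * perron_kernel y (s - 1) - 1/2 * perron_kernel y s)"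
  proof (rule contour_integral_eq)
    fix s assume "s \<in> path_image (linepath (Complex 2 (-T)) (Complex 2 T))"
    then have "Re s = 2" by (simp add: closed_segment_same_Re_iff)
    then have *: "s \<noteq> 0" "s - 1 \<noteq> 0" "s + 1 \<noteq> 0" by (auto simp: complex_eq_iff)
    have p: "of_real y powr (s - 1) = of_real y powr s / of_real y" using y by (simp add: powr_diff)
    show "perron_kernel y s / (s - 1) = of_real y / 2 * perron_kernel y (s - 1) - 1/2 * perron_kernel y s"
    proof -
      have aux: "P / (s * (s + 1)) / (s - 1) = Y / 2 * (P / Y / ((s - 1) * (s - 1 + 1))) - 1 / 2 * (P / (s * (s + 1)))"
        if "Y \<noteq> 0" for P Y :: complex
        using * that by (simp add: divide_simps) (simp add: algebra_simps)
      show ?thesis unfolding perron_kernel_def p by (rule aux) (use y in simp)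
    qed
  qed
  also have "\<dots> = of_real y / 2 * ?I 1 (perron_kernel y) - 1/2 * ?I 2 (perron_kernel y)"
  proof -
    have "?I 2 (\<lambda>s. of_real y / 2 * perron_kernel y (s - 1) - 1/2 * perron_kernel y s) =
      ?I 2 (\<lambda>s. of_real y / 2 * perron_kernel y (s - 1)) - ?I 2 (\<lambda>s. 1/2 * perron_kernel y s)"
      by (intro contour_integral_diff contour_integrable_lmul int1 int) simp
    moreover have "?I 2 (\<lambda>s. of_real y / 2 * perron_kernel y (s - 1)) = of_real y / 2 * ?I 1 (perron_kernel y)"
      unfolding eq1[symmetric] by (rule contour_integral_lmul[OF int1])
    moreover have "?I 2 (\<lambda>s. 1/2 * perron_kernel y s) = 1/2 * ?I 2 (perron_kernel y)"
      by (rule contour_integral_lmul[OF int]) simp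
    ultimately show ?thesis by (simp only:)
  qed
  finally have eq: "?I 2 (\<lambda>s. perron_kernel y s / (s - 1)) = of_real y / 2 * ?I 1 (perron_kernel y) - 1/2 * ?I 2 (perron_kernel y)" .
  define K where "K = 2 * pi * \<i> * of_real (1 - 1 / y)"
  have mx: "max 0 (1 - 1 / y) = 1 - 1 / y" using y by (simp add: max_def field_simps)
  have k1: "norm (?I 1 (perron_kernel y) - K) \<le> 8 * y powr 1 / T"
    unfolding K_def by (rule perron_kernel_integral[of y 1 T, unfolded mx]) (use y T in auto)
  have k2: "norm (?I 2 (perron_kernel y) - K) \<le> 8 * y powr 2 / T"
    unfolding K_def by (rule perron_kernel_integral[of y 2 T, unfolded mx]) (use y T in auto)
  have "(y - 1)\<^sup>2 / (2 * y) = y / 2 * (1 - 1 / y) - 1 / 2 * (1 - 1 / y)"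
    using y by (simp add: field_simps power2_eq_square)
  then have "2 * pi * \<i> * of_real ((y - 1)\<^sup>2 / (2 * y)) = 2 * pi * \<i> * of_real (y / 2 * (1 - 1 / y) - 1 / 2 * (1 - 1 / y))"
    by (simp only:)
  also have "\<dots> = of_real y / 2 * K - 1/2 * K"
  proof -
    have "\<kappa> * of_real (y / 2 * m - 1 / 2 * m) = of_real y / 2 * (\<kappa> * of_real m) - 1/2 * (\<kappa> * of_real m)" for \<kappa> :: complex and m
      by (simp add: algebra_simps)
    then show ?thesis unfolding K_def by (simp only:)
  qed
  finally have "2 * pi * \<i> * of_real ((y - 1)\<^sup>2 / (2 * y)) = of_real y / 2 * K - 1/2 * K" .
  moreover have "a * x - b * z - (a * k - b * k) = a * (x - k) - b * (z - k)" for a b x z k :: complex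
    by (simp add: algebra_simps)
  ultimately have eq2: "?I 2 (\<lambda>s. perron_kernel y s / (s - 1)) - 2 * pi * \<i> * of_real ((y - 1)\<^sup>2 / (2 * y)) =
    of_real y / 2 * (?I 1 (perron_kernel y) - K) - 1/2 * (?I 2 (perron_kernel y) - K)"
    unfolding eq by (simp only:)
  have "norm (of_real y / 2 * (?I 1 (perron_kernel y) - K) - 1/2 * (?I 2 (perron_kernel y) - K))
    \<le> norm (of_real y / 2 * (?I 1 (perron_kernel y) - K)) + norm (1/2 * (?I 2 (perron_kernel y) - K))" by (rule norm_triangle_ineq4)
  also have "\<dots> \<le> y / 2 * (8 * y powr 1 / T) + 1/2 * (8 * y powr 2 / T)"
  proof -
    have n: "norm (complex_of_real y / 2) = y / 2" "norm (1 / 2 :: complex) = 1 / 2" using y by (simp_all add: norm_divide)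
    have "y / 2 * norm (?I 1 (perron_kernel y) - K) \<le> y / 2 * (8 * y powr 1 / T)" by (rule mult_left_mono[OF k1]) (use y in simp)
    moreover have "1 / 2 * norm (?I 2 (perron_kernel y) - K) \<le> 1 / 2 * (8 * y powr 2 / T)" by (rule mult_left_mono[OF k2]) simp
    ultimately show ?thesis unfolding norm_mult n by (rule add_mono)
  qed
  also have "\<dots> = 8 * y\<^sup>2 / T" using y by (simp add: power2_eq_square)
  finally show ?thesis unfolding eq2 .
qed

text \<open>On the line of real part 2 the series converges uniformly by the Weierstrass test, so it
  may be integrated term by term. The truncation errors \<open>(y / n) powr 2 / T\<close> of the
  single terms sum up with the same majorant.\<close>

lemma perron_series:
  fixes a :: "nat \<Rightarrow> complex"
  assumes y: "y > 0" and T: "T \<ge> 2"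
    and sm: "summable (\<lambda>n. norm (a (Suc n)) / (real (Suc n))\<^sup>2)"
    and D: "\<And>s. Re s = 2 \<Longrightarrow> (\<lambda>n. a (Suc n) / of_nat (Suc n) powr s) sums D s"
    and N: "y \<le> real N"
  shows "norm (contour_integral (linepath (Complex 2 (-T)) (Complex 2 T)) (\<lambda>s. D s * perron_kernel y s)
    - 2 * pi * \<i> * (\<Sum>n<N. a (Suc n) * of_real (max 0 (1 - real (Suc n) / y)))) \<le> 8 * y\<^sup>2 / T * (\<Sum>n. norm (a (Suc n)) / (real (Suc n))\<^sup>2)"
proof -
  let ?l = "linepath (Complex 2 (-T)) (Complex 2 T)"
  let ?I = "contour_integral ?l"
  define P where "P M s = (\<Sum>n<M. a (Suc n) / of_nat (Suc n) powr s) * perron_kernel y s" for M s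
  define m where "m n = max 0 (1 - real (Suc n) / y)" for n
  have pk: "perron_kernel x contour_integrable_on ?l" if "x > 0" for x
    using that by (intro contour_integrable_continuous_linepath holomorphic_on_imp_continuous_on perron_kernel_holomorphic)
      (auto simp: closed_segment_same_Re_iff)
  have Peq: "P M = (\<lambda>s. \<Sum>n<M. a (Suc n) * perron_kernel (y / real (Suc n)) s)" for M
  proof
    fix s :: complex
    have "of_real (y / real (Suc n)) powr s = of_real y powr s / of_nat (Suc n) powr s" for n
    proof -
      have "Ln (of_nat (Suc n)) = of_real (ln (real (Suc n)))" using Ln_of_real[of "real (Suc n)"] by simp
      moreover have "of_real (y / real (Suc n)) powr s = exp (s * of_real (ln y - ln (real (Suc n))))"
        using y Ln_of_real[of "y / real (Suc n)"] of_nat_neq_0[of n, where 'a=complex] by (simp add: powr_def ln_div del: of_nat_Suc)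
      moreover have "of_real y powr s = exp (s * of_real (ln y))" using y by (simp add: powr_def Ln_of_real)
      moreover have "of_nat (Suc n) powr s = exp (s * Ln (of_nat (Suc n)))" using of_nat_neq_0[of n, where 'a=complex] by (simp add: powr_def del: of_nat_Suc)
      ultimately show ?thesis by (simp add: right_diff_distrib exp_diff del: of_nat_Suc)
    qed
    then show "P M s = (\<Sum>n<M. a (Suc n) * perron_kernel (y / real (Suc n)) s)"
      by (simp add: P_def perron_kernel_def sum_distrib_right sum_divide_distrib del: of_nat_Suc)
  qed
  have IP: "?I (P M) = (\<Sum>n<M. a (Suc n) * ?I (perron_kernel (y / real (Suc n))))" for M
    unfolding Peq using y by (subst contour_integral_sum) (auto intro!: contour_integrable_lmul pk contour_integral_lmul sum.cong)
  have bnd: "norm (?I (P M) - 2 * pi * \<i> * (\<Sum>n<M. a (Suc n) * of_real (m n))) \<le> 8 * y\<^sup>2 / T * (\<Sum>n. norm (a (Suc n)) / (real (Suc n))\<^sup>2)" for M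
  proof -
    have "?I (P M) - 2 * pi * \<i> * (\<Sum>n<M. a (Suc n) * of_real (m n)) = (\<Sum>n<M. a (Suc n) * (?I (perron_kernel (y / real (Suc n))) - 2 * pi * \<i> * of_real (m n)))"
      unfolding IP by (simp add: sum_subtractf sum_distrib_left algebra_simps)
    also have "norm \<dots> \<le> (\<Sum>n<M. norm (a (Suc n)) * (8 * (y / real (Suc n)) powr 2 / T))"
    proof (rule sum_norm_le)
      fix n
      have "norm (?I (perron_kernel (y / real (Suc n))) - 2 * pi * \<i> * of_real (m n)) \<le> 8 * (y / real (Suc n)) powr 2 / T"
        using perron_kernel_integral[of "y / real (Suc n)" 2 T] y T by (simp add: m_def)
      then show "norm (a (Suc n) * (?I (perron_kernel (y / real (Suc n))) - 2 * pi * \<i> * of_real (m n))) \<le> norm (a (Suc n)) * (8 * (y / real (Suc n)) powr 2 / T)"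
        unfolding norm_mult by (rule mult_left_mono) auto
    qed
    also have "\<dots> = 8 * y\<^sup>2 / T * (\<Sum>n<M. norm (a (Suc n)) / (real (Suc n))\<^sup>2)"
      using y by (simp add: sum_distrib_left power_divide mult_ac del: of_nat_Suc)
    also have "\<dots> \<le> 8 * y\<^sup>2 / T * (\<Sum>n. norm (a (Suc n)) / (real (Suc n))\<^sup>2)"
      using T by (intro mult_left_mono sum_le_suminf sm) auto
    finally show ?thesis .
  qed
  have lim: "(\<lambda>M. ?I (P M)) \<longlonglongrightarrow> ?I (\<lambda>s. D s * perron_kernel y s)"
  proof (rule contour_integral_uniform_limit(2))
    show "\<forall>\<^sub>F M in sequentially. P M contour_integrable_on ?l"
      unfolding Peq using y by (intro always_eventually allI contour_integrable_sum contour_integrable_lmul pk) auto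
    have "uniform_limit {s. Re s = 2} (\<lambda>M s. \<Sum>n<M. a (Suc n) / of_nat (Suc n) powr s) (\<lambda>s. \<Sum>n. a (Suc n) / of_nat (Suc n) powr s) sequentially"
      by (rule Weierstrass_m_test[OF _ sm]) (auto simp: norm_divide norm_powr_real_powr simp del: of_nat_Suc)
    also have "?this \<longleftrightarrow> uniform_limit {s. Re s = 2} (\<lambda>M s. \<Sum>n<M. a (Suc n) / of_nat (Suc n) powr s) D sequentially"
      by (rule uniform_limit_cong') (use sums_unique[OF D] in auto)
    finally have ul: "uniform_limit {s. Re s = 2} (\<lambda>M s. \<Sum>n<M. a (Suc n) / of_nat (Suc n) powr s) D sequentially" .
    have sub: "path_image ?l \<subseteq> {s. Re s = 2}" by (auto simp: closed_segment_same_Re_iff)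
    have "bounded (perron_kernel y ` path_image ?l)"
      using y by (intro compact_imp_bounded compact_continuous_image holomorphic_on_imp_continuous_on perron_kernel_holomorphic)
      (auto simp: closed_segment_same_Re_iff)
    moreover have "bounded (D ` path_image ?l)"
    proof -
      have "norm (D s) \<le> (\<Sum>n. norm (a (Suc n)) / (real (Suc n))\<^sup>2)" if "Re s = 2" for s
      proof -
        have eq: "norm (a (Suc n) / of_nat (Suc n) powr s) = norm (a (Suc n)) / (real (Suc n))\<^sup>2" for n
          using that by (simp add: norm_divide norm_powr_real_powr del: of_nat_Suc)
        have "norm (D s) = norm (\<Sum>n. a (Suc n) / of_nat (Suc n) powr s)" using sums_unique[OF D[OF that]] by simp
        also have "\<dots> \<le> (\<Sum>n. norm (a (Suc n) / of_nat (Suc n) powr s))" by (rule summable_norm) (use eq sm in auto)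
        finally show ?thesis by (simp only: eq)
      qed
      then show ?thesis using sub by (intro boundedI[where B="(\<Sum>n. norm (a (Suc n)) / (real (Suc n))\<^sup>2)"]) auto
    qed
    ultimately show "uniform_limit (path_image ?l) P (\<lambda>s. D s * perron_kernel y s) sequentially"
      unfolding P_def
      by (intro uniform_lim_mult uniform_limit_on_subset[OF ul sub] uniform_limit_const)
    show "norm (vector_derivative ?l (at t)) \<le> 2 * T" for t
    proof -
      have "Complex 2 T - Complex 2 (-T) = of_real (2 * T) * \<i>" by (simp add: complex_eq_iff)
      then have "norm (Complex 2 T - Complex 2 (-T)) = 2 * T" using T by (simp only: norm_mult norm_of_real) simp
      then show ?thesis by simp
    qed
  qed auto
  have ev: "\<forall>\<^sub>F M in sequentially. (\<Sum>n<M. a (Suc n) * of_real (m n)) = (\<Sum>n<N. a (Suc n) * of_real (m n))"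
    using eventually_ge_at_top[of N]
  proof eventually_elim
    case (elim M)
    have "m n = 0" if "n \<ge> N" for n
    proof -
      have "real N \<le> real n" using that by simp
      then have "y \<le> real (Suc n)" using N by simp
      then show ?thesis using y by (simp add: m_def max_def field_simps)
    qed
    then show ?case using elim by (intro sum.mono_neutral_right) auto
  qed
  have lim2: "(\<lambda>M. ?I (P M) - 2 * pi * \<i> * (\<Sum>n<M. a (Suc n) * of_real (m n))) \<longlonglongrightarrow> ?I (\<lambda>s. D s * perron_kernel y s) - 2 * pi * \<i> * (\<Sum>n<N. a (Suc n) * of_real (m n))"
    by (intro tendsto_intros lim tendsto_eventually ev)
  show ?thesis
    by (rule LIMSEQ_le_const2[OF tendsto_norm[OF lim2[unfolded m_def]]]) (use bnd in \<open>auto simp: m_def\<close>)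
qed

text \<open>For fixed y all terms carrying \<open>1 / T\<close> are collected in a constant C and
  vanish as T tends to infinity; what survives is the integral on the line c. The residue \<rho> is
  kept as a parameter so that principal and nonprincipal characters are treated together.\<close>

theorem riesz_mean_bound:
  fixes a :: "nat \<Rightarrow> complex"
  assumes y: "y \<ge> 1" and c: "1/2 \<le> c" "c \<le> 2" and M: "M \<ge> 0"
    and hol: "f holomorphic_on {s. Re s > \<sigma>\<^sub>1}" and \<sigma>: "\<sigma>\<^sub>1 < c" "0 \<le> \<sigma>\<^sub>1"
    and f: "\<And>s. c \<le> Re s \<Longrightarrow> Re s \<le> 2 \<Longrightarrow> norm (f s) \<le> M * (1 + \<bar>Im s\<bar>) powr (1/2)"
    and sm: "summable (\<lambda>n. norm (a (Suc n)) / (real (Suc n))\<^sup>2)"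
    and D: "\<And>s. Re s = 2 \<Longrightarrow> (\<lambda>n. a (Suc n) / of_nat (Suc n) powr s) sums (f s + \<rho> / (s - 1))"
    and N: "y \<le> real N"
  shows "norm ((\<Sum>n<N. a (Suc n) * of_real (max 0 (1 - real (Suc n) / y))) - \<rho> * of_real ((y - 1)\<^sup>2 / (2 * y))) \<le> 3 * M * y powr c"
proof -
  define S where "S = (\<Sum>n<N. a (Suc n) * of_real (max 0 (1 - real (Suc n) / y)))"
  define Z where "Z = S - \<rho> * of_real ((y - 1)\<^sup>2 / (2 * y))"
  define A where "A = (\<Sum>n. norm (a (Suc n)) / (real (Suc n))\<^sup>2)"
  define C where "C = 8 * y\<^sup>2 * A + 16 * M * y\<^sup>2 + norm \<rho> * (8 * y\<^sup>2)"
  have main: "norm (2 * pi * \<i> * Z) \<le> 16 * M * y powr c + C / T" if T: "T \<ge> 2" for T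
  proof -
    let ?I = "contour_integral (linepath (Complex 2 (-T)) (Complex 2 T))"
    have i1: "(\<lambda>s. f s * perron_kernel y s) contour_integrable_on linepath (Complex 2 (-T)) (Complex 2 T)"
    proof (intro contour_integrable_continuous_linepath continuous_intros)
      show "continuous_on (closed_segment (Complex 2 (-T)) (Complex 2 T)) f"
        by (rule holomorphic_on_imp_continuous_on[OF holomorphic_on_subset[OF hol]]) (use \<sigma> c in \<open>auto simp: closed_segment_same_Re_iff\<close>)
      show "continuous_on (closed_segment (Complex 2 (-T)) (Complex 2 T)) (perron_kernel y)"
        using y by (intro holomorphic_on_imp_continuous_on perron_kernel_holomorphic) (auto simp: closed_segment_same_Re_iff)
    qed
    have i2: "(\<lambda>s. perron_kernel y s / (s - 1)) contour_integrable_on linepath (Complex 2 (-T)) (Complex 2 T)"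
      unfolding perron_kernel_def using y
      by (intro contour_integrable_continuous_linepath continuous_intros)
        (auto simp: closed_segment_same_Re_iff complex_eq_iff)
    have "?I (\<lambda>s. (f s + \<rho> / (s - 1)) * perron_kernel y s) = ?I (\<lambda>s. f s * perron_kernel y s + \<rho> * (perron_kernel y s / (s - 1)))"
      by (intro arg_cong[where f="?I"]) (auto simp: algebra_simps add_divide_distrib)
    also have "\<dots> = ?I (\<lambda>s. f s * perron_kernel y s) + \<rho> * ?I (\<lambda>s. perron_kernel y s / (s - 1))"
      by (simp only: contour_integral_add[OF i1 contour_integrable_lmul[OF i2]] contour_integral_lmul[OF i2])
    finally have eq: "?I (\<lambda>s. (f s + \<rho> / (s - 1)) * perron_kernel y s) = ?I (\<lambda>s. f s * perron_kernel y s) + \<rho> * ?I (\<lambda>s. perron_kernel y s / (s - 1))" .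
    define Q where "Q = ?I (\<lambda>s. perron_kernel y s / (s - 1)) - 2 * pi * \<i> * of_real ((y - 1)\<^sup>2 / (2 * y))"
    have q: "norm Q \<le> 8 * y\<^sup>2 / T" unfolding Q_def by (rule perron_pole[OF y T])
    define W where "W = ?I (\<lambda>s. (f s + \<rho> / (s - 1)) * perron_kernel y s) - 2 * pi * \<i> * S"
    have w: "norm W \<le> 8 * y\<^sup>2 / T * A" unfolding W_def S_def A_def using y T by (intro perron_series sm D N) auto
    define J where "J = ?I (\<lambda>s. f s * perron_kernel y s)"
    have j: "norm J \<le> 16 * M * y powr c + 16 * M * y\<^sup>2 / T"
      unfolding J_def using T by (intro perron_shift[OF y c _ M hol \<sigma> f]) auto
    have Zeq: "2 * pi * \<i> * Z = J + \<rho> * Q - W"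
      unfolding W_def Q_def eq Z_def J_def[symmetric] by (simp add: algebra_simps)
    have "norm (2 * pi * \<i> * Z) \<le> norm J + norm (\<rho> * Q) + norm W"
      unfolding Zeq by (meson norm_triangle_ineq norm_triangle_ineq4 add_right_mono order_trans)
    also have "\<dots> \<le> (16 * M * y powr c + 16 * M * y\<^sup>2 / T) + norm \<rho> * (8 * y\<^sup>2 / T) + 8 * y\<^sup>2 / T * A"
      unfolding norm_mult by (intro add_mono mult_left_mono j q w norm_ge_zero)
    also have "\<dots> = 16 * M * y powr c + C / T" by (simp add: C_def add_divide_distrib algebra_simps)
    finally show ?thesis .
  qed
  have "((\<lambda>T. 16 * M * y powr c + C / T) \<longlongrightarrow> 16 * M * y powr c + 0) at_top"
    by (intro tendsto_intros real_tendsto_divide_at_top[OF tendsto_const filterlim_ident])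
  then have "norm (2 * pi * \<i> * Z) \<le> 16 * M * y powr c + 0"
  proof (rule tendsto_lowerbound)
    show "\<forall>\<^sub>F T in at_top. norm (2 * pi * \<i> * Z) \<le> 16 * M * y powr c + C / T"
      using eventually_ge_at_top[of "2::real"] by eventually_elim (rule main)
  qed simp
  then have "2 * pi * norm Z \<le> 16 * M * y powr c" by (simp add: norm_mult)
  \<comment> \<open>Replacing \<open>2 * pi\<close> by 6 bounds \<open>16 / (2 * pi)\<close> by
    3.\<close>
  moreover have "2 * pi * norm Z \<ge> 6 * norm Z" using pi_gt3 by (intro mult_right_mono) auto
  moreover have "0 \<le> M * y powr c" using M by simp
  ultimately have "norm Z \<le> 3 * (M * y powr c)" by linarith
  then show ?thesis by (simp only: Z_def S_def mult.assoc)
qed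

section \<open>Analytic continuation of Dirichlet series of characters\<close>

lemma has_field_derivative_of_nat_powr:
  "((\<lambda>s. 1 / of_nat (Suc n) powr s) has_field_derivative (- of_real (ln (real (Suc n))) / of_nat (Suc n) powr s)) (at (s :: complex))"
proof -
  have "((\<lambda>s. exp (- s * of_real (ln (real (Suc n))))) has_field_derivative exp (- s * of_real (ln (real (Suc n)))) * (- of_real (ln (real (Suc n))))) (at s)"
    by (auto intro!: derivative_eq_intros)
  moreover have "1 / of_nat (Suc n) powr s = exp (- s * of_real (ln (real (Suc n))))" for s :: complex
    using Ln_of_real[of "real (Suc n)"] by (simp add: powr_def exp_minus divide_inverse del: of_nat_Suc)
  ultimately show ?thesis by (simp add: divide_inverse mult_ac del: of_nat_Suc)
qed

definition dirichlet_abs_conv :: "(nat \<Rightarrow> complex) \<Rightarrow> bool" where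
  "dirichlet_abs_conv a \<longleftrightarrow> (\<forall>\<sigma>>1. summable (\<lambda>n. norm (a (Suc n)) / real (Suc n) powr \<sigma>))"

definition dser :: "(nat \<Rightarrow> complex) \<Rightarrow> complex \<Rightarrow> complex" where
  "dser a s = (\<Sum>n. a (Suc n) / of_nat (Suc n) powr s)"

lemma norm_dser_term:
  "norm (a (Suc n) / of_nat (Suc n) powr s) = norm (a (Suc n)) / real (Suc n) powr Re s"
  by (simp add: norm_divide norm_powr_real_powr del: of_nat_Suc)

lemma dser_abs_summable:
  "dirichlet_abs_conv a \<Longrightarrow> Re s > 1 \<Longrightarrow> summable (\<lambda>n. norm (a (Suc n) / of_nat (Suc n) powr s))"
  unfolding norm_dser_term dirichlet_abs_conv_def by auto

lemma dser_sums:
  "dirichlet_abs_conv a \<Longrightarrow> Re s > 1 \<Longrightarrow> (\<lambda>n. a (Suc n) / of_nat (Suc n) powr s) sums dser a s"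
  unfolding dser_def by (intro summable_sums summable_norm_cancel[OF dser_abs_summable])

lemma dser_deriv:
  assumes a: "dirichlet_abs_conv a" and s: "Re s > 1"
  shows "(dser a has_field_derivative dser (\<lambda>n. - of_real (ln (real n)) * a n) s) (at s)"
proof -
  let ?f = "\<lambda>n s. a (Suc n) / of_nat (Suc n) powr s"
  let ?f' = "\<lambda>n s. (- of_real (ln (real (Suc n))) * a (Suc n)) / of_nat (Suc n) powr s"
  have "\<exists>g g'. \<forall>x\<in>{s. Re s > 1}. ((\<lambda>n. ?f n x) sums g x) \<and> ((\<lambda>n. ?f' n x) sums g' x) \<and> (g has_field_derivative g' x) (at x)"
  proof (rule series_and_derivative_comparison_complex)
    show "open {s. Re s > 1}" by (simp add: open_halfspace_Re_gt)
    show "(?f n has_field_derivative ?f' n x) (at x)" for n x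
      using DERIV_cmult[OF has_field_derivative_of_nat_powr[of n x], of "a (Suc n)"] by (simp add: mult.commute del: of_nat_Suc)
    fix x assume "x \<in> {s. Re s > 1}"
    then have x: "Re x > 1" by simp
    define \<sigma> where "\<sigma> = (1 + Re x) / 2"
    have \<sigma>: "\<sigma> > 1" using x by (simp add: \<sigma>_def)
    show "\<exists>d h. 0 < d \<and> summable h \<and> range h \<subseteq> \<real>\<^sub>\<ge>\<^sub>0 \<and> (\<forall>\<^sub>F n in sequentially. \<forall>y\<in>ball x d \<inter> {s. Re s > 1}. cmod (?f n y) \<le> cmod (h n))"
    proof (intro exI conjI always_eventually allI ballI)
      show "0 < Re x - \<sigma>" using x by (simp add: \<sigma>_def)
      show "summable (\<lambda>n. complex_of_real (norm (a (Suc n)) / real (Suc n) powr \<sigma>))"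
        using a \<sigma> unfolding dirichlet_abs_conv_def by (subst summable_of_real_iff) auto
      show "range (\<lambda>n. complex_of_real (norm (a (Suc n)) / real (Suc n) powr \<sigma>)) \<subseteq> \<real>\<^sub>\<ge>\<^sub>0"
        by auto
      fix n y assume "y \<in> ball x (Re x - \<sigma>) \<inter> {s. Re s > 1}"
      then have "Re x - Re y \<le> Re x - \<sigma>" using abs_Re_le_cmod[of "x - y"] by (auto simp: dist_norm)
      then have "\<sigma> \<le> Re y" by simp
      then have "norm (a (Suc n)) / real (Suc n) powr Re y \<le> norm (a (Suc n)) / real (Suc n) powr \<sigma>"
        by (intro divide_left_mono powr_mono) auto
      then show "cmod (?f n y) \<le> cmod (complex_of_real (norm (a (Suc n)) / real (Suc n) powr \<sigma>))"
        unfolding norm_dser_term norm_of_real by simp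
    qed
  qed
  then obtain g g' where g: "\<And>x. Re x > 1 \<Longrightarrow> (\<lambda>n. ?f n x) sums g x" "\<And>x. Re x > 1 \<Longrightarrow> (\<lambda>n. ?f' n x) sums g' x"
    "\<And>x. Re x > 1 \<Longrightarrow> (g has_field_derivative g' x) (at x)" by auto
  have "(dser a has_field_derivative g' s) (at s)"
  proof (rule has_field_derivative_transform_within_open[OF g(3)[OF s] open_halfspace_Re_gt[of 1]])
    show "s \<in> {x. 1 < Re x}" using s by simp
    show "g x = dser a x" if "x \<in> {x. 1 < Re x}" for x
      using g(1)[of x] that by (simp add: dser_def sums_iff)
  qed
  moreover have "g' s = dser (\<lambda>n. - of_real (ln (real n)) * a n) s" using g(2)[OF s] unfolding dser_def sums_iff by simp
  ultimately show ?thesis by simp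
qed

lemma dser_holomorphic:
  assumes "dirichlet_abs_conv a" shows "dser a holomorphic_on {s. Re s > 1}"
  by (auto simp: holomorphic_on_open open_halfspace_Re_gt intro!: exI dser_deriv[OF assms])

lemma ln_le_powr: "ln x \<le> x powr \<epsilon> / \<epsilon>" if "x \<ge> 1" "\<epsilon> > 0" for x :: real
proof -
  have "ln (x powr \<epsilon>) \<le> x powr \<epsilon>" using that ln_le_minus_one[of "x powr \<epsilon>"] by simp
  then show ?thesis using that by (simp add: ln_powr field_simps)
qed

text \<open>The logarithm is absorbed by half of the excess of \<sigma> over 1.\<close>

lemma dirichlet_abs_conv_log:
  assumes "\<And>n. n > 0 \<Longrightarrow> norm (a n) \<le> C * (1 + ln (real n))"
  shows "dirichlet_abs_conv a"
  unfolding dirichlet_abs_conv_def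
proof (intro allI impI)
  fix \<sigma> :: real assume \<sigma>: "\<sigma> > 1"
  define \<epsilon> where "\<epsilon> = (\<sigma> - 1) / 2"
  have \<epsilon>: "\<epsilon> > 0" "\<sigma> - \<epsilon> > 1" using \<sigma> by (auto simp: \<epsilon>_def field_simps)
  have "0 \<le> C" using order_trans[OF norm_ge_zero assms[of 1]] by simp
  have "summable (\<lambda>n. real n powr -(\<sigma> - \<epsilon>))" using \<epsilon> by (subst summable_real_powr_iff) auto
  then have sm: "summable (\<lambda>n. real (Suc n) powr -(\<sigma> - \<epsilon>))" by (subst summable_Suc_iff)
  show "summable (\<lambda>n. norm (a (Suc n)) / real (Suc n) powr \<sigma>)"
  proof (rule summable_comparison_test'[OF summable_mult[OF sm, of "C * (1 + 1 / \<epsilon>)"]])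
    fix n :: nat
    let ?x = "real (Suc n)"
    have "norm (a (Suc n)) \<le> C * (1 + ln ?x)" by (rule assms) simp
    also have "\<dots> \<le> C * (?x powr \<epsilon> + ?x powr \<epsilon> / \<epsilon>)"
      using \<epsilon> \<open>0 \<le> C\<close> by (intro mult_left_mono add_mono ln_le_powr ge_one_powr_ge_zero) auto
    also have "\<dots> = C * (1 + 1/\<epsilon>) * ?x powr \<epsilon>" by (simp add: algebra_simps)
    finally have "norm (a (Suc n)) / ?x powr \<sigma> \<le> C * (1 + 1/\<epsilon>) * ?x powr \<epsilon> / ?x powr \<sigma>"
      by (rule divide_right_mono) simp
    also have "\<dots> = C * (1 + 1/\<epsilon>) * (?x powr \<epsilon> / ?x powr \<sigma>)" by simp
    also have "?x powr \<epsilon> / ?x powr \<sigma> = ?x powr (\<epsilon> - \<sigma>)" by (rule powr_diff[symmetric])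
    finally show "norm (norm (a (Suc n)) / ?x powr \<sigma>) \<le> C * (1 + 1/\<epsilon>) * ?x powr -(\<sigma> - \<epsilon>)" by simp
  qed
qed

locale dchar =
  fixes q :: nat and chi :: "nat \<Rightarrow> complex"
  assumes dc: "dirichlet_character q chi"
begin

lemma q_pos: "q > 0" and chi_mult: "chi (m * n) = chi m * chi n" and chi_period: "chi (n + q) = chi n"
  and chi_eq_0_iff: "chi n = 0 \<longleftrightarrow> \<not> coprime n q"
  using dc by (auto simp: dirichlet_character_def)

lemma chi_1 [simp]: "chi (Suc 0) = 1"
proof -
  have "chi 1 = chi 1 * chi 1" using chi_mult[of 1 1] by simp
  moreover have "chi 1 \<noteq> 0" by (simp add: chi_eq_0_iff)
  ultimately show ?thesis by simp
qed

lemma chi_power: "chi (n ^ k) = chi n ^ k"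
  by (induction k) (auto simp: chi_mult)

lemma chi_add_mult: "chi (n + k * q) = chi n"
  by (induction k) (auto simp: add.assoc[symmetric] chi_period add.commute[of q] add.left_commute)

lemma chi_mod: "chi (n mod q) = chi n"
  using chi_add_mult[of "n mod q" "n div q"] by (simp add: add.commute)

lemma chi_cong: "[m = n] (mod q) \<Longrightarrow> chi m = chi n"
  by (metis chi_mod cong_def)

text \<open>By Euler's theorem the values on residues coprime to q are roots of unity.\<close>

lemma norm_chi: "norm (chi n) = (if coprime n q then 1 else 0)"
proof (cases "coprime n q")
  case True
  have "[n ^ totient q = 1] (mod q)" by (rule euler_theorem[OF True])
  then have "chi n ^ totient q = 1" using chi_cong[of "n ^ totient q" 1] by (simp add: chi_power)
  then have "norm (chi n) ^ totient q = 1 ^ totient q" by (metis norm_one norm_power power_one)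
  then have "norm (chi n) = 1" using q_pos by (intro power_eq_imp_eq_base[of "norm (chi n)" "totient q" 1]) auto
  then show ?thesis using True by simp
qed (use chi_eq_0_iff in auto)

lemma norm_chi_le: "norm (chi n) \<le> 1" by (simp add: norm_chi)

lemma chi_abs_conv: "dirichlet_abs_conv chi"
  by (rule dirichlet_abs_conv_log[of _ 1]) (auto intro: order_trans[OF norm_chi_le])

lemma chi_log_abs_conv: "dirichlet_abs_conv (\<lambda>n. of_real (ln (real n)) * chi n)"
proof (rule dirichlet_abs_conv_log[of _ 1])
  fix n :: nat assume "n > 0"
  then have "ln (real n) \<ge> 0" by simp
  then have "norm (of_real (ln (real n)) * chi n) \<le> ln (real n) * 1"
    unfolding norm_mult norm_of_real using norm_chi_le[of n] by (intro mult_mono) auto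
  then show "norm (of_real (ln (real n)) * chi n) \<le> 1 * (1 + ln (real n))" by simp
qed

lemma chi_mangoldt_abs_conv: "dirichlet_abs_conv (\<lambda>n. mangoldt n * chi n)"
proof (rule dirichlet_abs_conv_log[of _ 1])
  fix n :: nat assume "n > 0"
  then have "norm (mangoldt n * chi n) \<le> ln (real n) * 1"
    unfolding norm_mult norm_mangoldt using norm_chi_le[of n] mangoldt_le[of n] mangoldt_nonneg[of n] by (intro mult_mono) auto
  then show "norm (mangoldt n * chi n) \<le> 1 * (1 + ln (real n))" by simp
qed

text \<open>Multiplying the two series and grouping by the product of the indices uses
  \<open>\<Sum>d dvd n. mangoldt d = ln n\<close>.\<close>
lemma dser_mult_mangoldt:
  assumes s: "Re s > 1"
  shows "dser chi s * dser (\<lambda>n. mangoldt n * chi n) s = dser (\<lambda>n. of_real (ln (real n)) * chi n) s"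
proof -
  define f where "f n = chi n / of_nat n powr s" for n
  define L where "L n = mangoldt n * f n" for n
  let ?P = "{0<..} :: nat set"
  have f_mult: "f (m * n) = f m * f n" for m n
    using powr_times_real[of "of_nat m" "of_nat n" s] by (simp add: f_def chi_mult)
  have hs: "((\<lambda>n. a n / of_nat n powr s) has_sum dser a s) ?P" if "dirichlet_abs_conv a" for a
  proof -
    have "((\<lambda>n. a (Suc n) / of_nat (Suc n) powr s) has_sum dser a s) UNIV"
      by (rule norm_summable_imp_has_sum[OF dser_abs_summable[OF that s] dser_sums[OF that s]])
    also have "?this \<longleftrightarrow> ?thesis"
      by (rule has_sum_reindex_bij_witness[of _ "\<lambda>n. n - 1" Suc]) auto
    finally show ?thesis .
  qed
  have abs: "(\<lambda>n. norm (a n / of_nat n powr s)) summable_on ?P" if "dirichlet_abs_conv a" for a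
  proof -
    have "(\<lambda>n. norm (a (Suc n) / of_nat (Suc n) powr s)) summable_on UNIV"
      using dser_abs_summable[OF that s] by (subst summable_on_UNIV_nonneg_real_iff) auto
    also have "?this \<longleftrightarrow> ?thesis"
      by (rule summable_on_reindex_bij_witness[of _ "\<lambda>n. n - 1" Suc]) auto
    finally show ?thesis .
  qed
  have f1: "(f has_sum dser chi s) ?P" using hs[OF chi_abs_conv] by (simp add: f_def[abs_def])
  have f1a: "(\<lambda>n. norm (f n)) summable_on ?P" using abs[OF chi_abs_conv] by (simp add: f_def[abs_def])
  have L1: "(L has_sum dser (\<lambda>n. mangoldt n * chi n) s) ?P" using hs[OF chi_mangoldt_abs_conv] by (simp add: L_def[abs_def] f_def)
  have L1a: "(\<lambda>n. norm (L n)) summable_on ?P" using abs[OF chi_mangoldt_abs_conv] by (simp add: L_def[abs_def] f_def)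
  have prod_sum: "((\<lambda>(m, d). f m * L d) has_sum (dser chi s * dser (\<lambda>n. mangoldt n * chi n) s)) (?P \<times> ?P)"
  proof (rule has_sum_SigmaI)
    fix m assume "m \<in> ?P"
    show "((\<lambda>d. case (m, d) of (m, d) \<Rightarrow> f m * L d) has_sum (f m * dser (\<lambda>n. mangoldt n * chi n) s)) ?P"
      using has_sum_cmult_right[OF L1, of "f m"] by simp
  next
    show "((\<lambda>m. f m * dser (\<lambda>n. mangoldt n * chi n) s) has_sum (dser chi s * dser (\<lambda>n. mangoldt n * chi n) s)) ?P"
      by (rule has_sum_cmult_left[OF f1])
  next
    show "(\<lambda>(m, d). f m * L d) summable_on ?P \<times> ?P"
    proof (rule abs_summable_summable, rule summable_on_SigmaI)
      fix m assume "m \<in> ?P"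
      show "((\<lambda>d. norm (case (m, d) of (m, d) \<Rightarrow> f m * L d)) has_sum (norm (f m) * infsum (\<lambda>d. norm (L d)) ?P)) ?P"
        using has_sum_cmult_right[OF has_sum_infsum[OF L1a], of "norm (f m)"] by (simp add: norm_mult)
    next
      show "(\<lambda>m. norm (f m) * infsum (\<lambda>d. norm (L d)) ?P) summable_on ?P"
        by (rule summable_on_cmult_left[OF f1a])
    qed auto
  qed
  also have "?this \<longleftrightarrow> ((\<lambda>(n, d). f n * mangoldt d) has_sum (dser chi s * dser (\<lambda>n. mangoldt n * chi n) s)) (SIGMA n:?P. {d. d dvd n})"
    by (rule has_sum_reindex_bij_witness[of _ "\<lambda>(n, d). (n div d, d)" "\<lambda>(m, d). (m * d, d)"])
      (auto simp: f_mult L_def dvd_div_mult_self intro: dvd_pos_nat intro!: Nat.gr0I elim!: dvdE)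
  finally have "((\<lambda>n. \<Sum>d | d dvd n. f n * mangoldt d) has_sum (dser chi s * dser (\<lambda>n. mangoldt n * chi n) s)) ?P"
    by (rule has_sum_SigmaD) (auto intro!: has_sum_finite)
  also have "?this \<longleftrightarrow> ((\<lambda>n. of_real (ln (real n)) * chi n / of_nat n powr s) has_sum (dser chi s * dser (\<lambda>n. mangoldt n * chi n) s)) ?P"
  proof (rule has_sum_cong)
    fix n assume "n \<in> ?P"
    then have "(\<Sum>d | d dvd n. f n * mangoldt d) = f n * of_real (ln (real n))"
      by (simp add: sum_distrib_left[symmetric] mangoldt_sum)
    then show "(\<Sum>d | d dvd n. f n * mangoldt d) = of_real (ln (real n)) * chi n / of_nat n powr s"
      by (simp add: f_def)
  qed
  finally show ?thesis using hs[OF chi_log_abs_conv] by (rule has_sum_unique)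
qed

definition "F = dser chi"
definition "D = dser (\<lambda>n. mangoldt n * chi n)"

text \<open>The logarithmic derivative is stated in product form, since the nonvanishing of F is not
  yet known; it is deduced from this identity in \<open>F_nonzero\<close>.\<close>

lemma F_deriv: "Re s > 1 \<Longrightarrow> (F has_field_derivative - F s * D s) (at s)"
proof -
  assume s: "Re s > 1"
  have "dser (\<lambda>n. - of_real (ln (real n)) * chi n) s = - dser (\<lambda>n. of_real (ln (real n)) * chi n) s"
    unfolding dser_def using summable_norm_cancel[OF dser_abs_summable[OF chi_log_abs_conv s]]
    by (subst suminf_minus[symmetric]) auto
  then show ?thesis using dser_deriv[OF chi_abs_conv s] dser_mult_mangoldt[OF s] by (simp add: F_def D_def)
qed

lemma F_holo: "F holomorphic_on {s. Re s > 1}" and D_holo: "D holomorphic_on {s. Re s > 1}"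
  unfolding F_def D_def by (intro dser_holomorphic chi_abs_conv chi_mangoldt_abs_conv)+

lemma F_sums: "Re s > 1 \<Longrightarrow> (\<lambda>n. chi (Suc n) / of_nat (Suc n) powr s) sums F s"
  unfolding F_def by (intro dser_sums chi_abs_conv)

text \<open>The first term is 1 and the others are dominated by 1/4 + 1/9 + ..., which a telescoping
  comparison bounds by 3/4.\<close>

lemma F_ge: "Re s \<ge> 2 \<Longrightarrow> norm (F s) \<ge> 1/4"
proof -
  assume s: "Re s \<ge> 2"
  have fin: "(\<Sum>n<Suc M. 1 / (real (Suc (Suc n)))\<^sup>2) \<le> 3/4 - 1 / (real M + 2)" for M
  proof (induction M)
    case (Suc M)
    have "1 / (real M + 2) - 1 / (real M + 3) = 1 / ((real M + 2) * (real M + 3))" by (simp add: field_simps)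
    also have "\<dots> \<ge> 1 / ((real M + 3) * (real M + 3))" by (intro divide_left_mono mult_right_mono mult_pos_pos) auto
    finally have "1 / (real (Suc (Suc (Suc M))))\<^sup>2 \<le> 1 / (real M + 2) - 1 / (real M + 3)"
      by (simp add: power2_eq_square add.commute)
    moreover have "(\<Sum>n<Suc (Suc M). 1 / (real (Suc (Suc n)))\<^sup>2) = (\<Sum>n<Suc M. 1 / (real (Suc (Suc n)))\<^sup>2) + 1 / (real (Suc (Suc (Suc M))))\<^sup>2"
      by simp
    moreover have "1 / (real (Suc M) + 2) = 1 / (real M + 3)" by (simp add: add.commute)
    ultimately show ?case using Suc.IH by linarith
  qed simp
  have tail: "(\<Sum>n<M. 1 / (real (Suc (Suc n)))\<^sup>2) \<le> 3/4" for M
  proof (cases M)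
    case (Suc M')
    have "1 / (real M' + 2) \<ge> 0" by simp
    then have "(\<Sum>n<Suc M'. 1 / (real (Suc (Suc n)))\<^sup>2) \<le> 3/4" using fin[of M'] by linarith
    then show ?thesis using Suc by (simp only:)
  qed simp
  have sm: "summable (\<lambda>n. 1 / (real (Suc (Suc n)))\<^sup>2)"
  proof (rule bounded_imp_summable)
    show "(\<Sum>n\<le>M. 1 / (real (Suc (Suc n)))\<^sup>2) \<le> 3/4" for M
      using tail[of "Suc M"] unfolding lessThan_Suc_atMost .
  qed auto
  have F1: "(\<lambda>n. chi (Suc (Suc n)) / of_nat (Suc (Suc n)) powr s) sums (F s - 1)"
    using F_sums[of s] s by (subst sums_Suc_iff) simp
  have le: "norm (chi (Suc (Suc n)) / of_nat (Suc (Suc n)) powr s) \<le> 1 / (real (Suc (Suc n)))\<^sup>2" for n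
  proof -
    have "norm (chi (Suc (Suc n)) / of_nat (Suc (Suc n)) powr s) \<le> 1 / real (Suc (Suc n)) powr Re s"
      unfolding norm_dser_term by (intro divide_right_mono norm_chi_le) simp
    also have "\<dots> \<le> 1 / real (Suc (Suc n)) powr 2" using s by (intro divide_left_mono powr_mono) auto
    finally show ?thesis by simp
  qed
  have "norm (F s - 1) \<le> (\<Sum>n. 1 / (real (Suc (Suc n)))\<^sup>2)"
    unfolding sums_unique[OF F1] by (rule norm_suminf_le[OF le sm])
  also have "\<dots> \<le> 3/4" by (rule suminf_le_const[OF sm tail])
  finally show ?thesis using norm_triangle_ineq2[of 1 "1 - F s"] by (simp add: norm_minus_commute)
qed

text \<open>This takes the place of the Euler product: if P is a primitive of D, then
  \<open>F x * exp (P x)\<close> has derivative 0 and is constant, and the constant is not 0 because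
  \<open>F 2\<close> is not.\<close>

lemma F_nonzero: "Re s > 1 \<Longrightarrow> F s \<noteq> 0"
proof -
  assume s: "Re s > 1"
  let ?S = "{s. Re s > 1}"
  obtain P where P: "\<And>x. x \<in> ?S \<Longrightarrow> (P has_field_derivative D x) (at x within ?S)"
    using holomorphic_convex_primitive'[OF convex_halfspace_Re_gt open_halfspace_Re_gt D_holo] by blast
  have "(\<lambda>x. F x * exp (P x)) constant_on ?S"
  proof (rule has_field_derivative_0_imp_constant_on)
    fix x assume x: "x \<in> ?S"
    have "(F has_field_derivative - F x * D x) (at x)" "(P has_field_derivative D x) (at x)"
      using F_deriv x P[OF x] at_within_open[OF x open_halfspace_Re_gt] by auto
    then show "((\<lambda>x. F x * exp (P x)) has_field_derivative 0) (at x)"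
      by (auto intro!: derivative_eq_intros)
  qed (auto simp: open_halfspace_Re_gt intro!: convex_connected convex_halfspace_Re_gt)
  then obtain c where c: "\<And>x. Re x > 1 \<Longrightarrow> F x * exp (P x) = c" by (auto simp: constant_on_def)
  have "c \<noteq> 0" using c[of 2] F_ge[of 2] by auto
  then show ?thesis using c[OF s] by auto
qed

end

section \<open>Continuation by binomial expansion of shifted powers\<close>

lemma binomial_series_step:
  fixes s x :: complex
  assumes "x \<notin> \<real>\<^sub>\<le>\<^sub>0"
  shows "((\<lambda>x. fact i * ((1 - s) gchoose i) * x powr (1 - s - of_nat i)) has_field_derivative
     fact (Suc i) * ((1 - s) gchoose Suc i) * x powr (1 - s - of_nat (Suc i))) (at x within A)"
proof -
  have g: "(1 - s) * ((1 - s) gchoose i) = of_nat i * ((1 - s) gchoose i) + of_nat (Suc i) * ((1 - s) gchoose Suc i)"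
    by (rule gbinomial_mult_1)
  have "((\<lambda>x. x powr (1 - s - of_nat i)) has_field_derivative (1 - s - of_nat i) * x powr (1 - s - of_nat i - 1)) (at x)"
    by (rule has_field_derivative_powr[OF assms])
  then have "((\<lambda>x. fact i * ((1 - s) gchoose i) * x powr (1 - s - of_nat i)) has_field_derivative
     fact i * ((1 - s) gchoose i) * ((1 - s - of_nat i) * x powr (1 - s - of_nat i - 1))) (at x within A)"
    by (intro DERIV_cmult) (rule has_field_derivative_at_within)
  moreover have "((1 - s) gchoose i) * (1 - s - of_nat i) = of_nat (Suc i) * ((1 - s) gchoose Suc i)"
    using g by (simp add: algebra_simps)
  then have "fact i * ((1 - s) gchoose i) * ((1 - s - of_nat i) * x powr (1 - s - of_nat i - 1)) =
     fact (Suc i) * ((1 - s) gchoose Suc i) * x powr (1 - s - of_nat (Suc i))"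
  proof -
    assume a: "((1 - s) gchoose i) * (1 - s - of_nat i) = of_nat (Suc i) * ((1 - s) gchoose Suc i)"
    have e: "1 - s - of_nat i - 1 = 1 - s - of_nat (Suc i)" by simp
    have "fact i * ((1 - s) gchoose i) * ((1 - s - of_nat i) * x powr (1 - s - of_nat (Suc i))) =
      fact i * (((1 - s) gchoose i) * (1 - s - of_nat i)) * x powr (1 - s - of_nat (Suc i))" by (simp only: mult.assoc)
    then show ?thesis unfolding a e by (simp only: fact_Suc mult_ac of_nat_mult)
  qed
  ultimately show ?thesis by (simp only:)
qed

definition taylor_rem :: "nat \<Rightarrow> nat \<Rightarrow> complex \<Rightarrow> nat \<Rightarrow> complex" where
  "taylor_rem q K s n = of_nat (n + q) powr (1 - s) - (\<Sum>k\<le>K. ((1 - s) gchoose k) * of_nat q ^ k * of_nat n powr (1 - s - of_nat k))"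

text \<open>Taylor's formula for the power function on the real ray that starts at n. Every further
  order gains a factor of size \<open>q / n\<close>, so the remainders are summable over n as soon
  as \<open>Re s + K > 1\<close>; this is what moves the half-plane of convergence to the
  left.\<close>

lemma norm_taylor_rem:
  assumes n: "n > 0" and \<sigma>: "Re s + real K \<ge> 0"
  shows "norm (taylor_rem q K s n) \<le> real (Suc K) * norm ((1 - s) gchoose Suc K) * real q ^ Suc K / real n powr (Re s + real K)"
proof -
  let ?f = "\<lambda>i x. fact i * ((1 - s) gchoose i) * x powr (1 - s - of_nat i)"
  let ?S = "{z. Im z = 0 \<and> real n \<le> Re z}"
  let ?B = "fact (Suc K) * norm ((1 - s) gchoose Suc K) / real n powr (Re s + real K)"
  have S: "x = of_real (Re x) \<and> Re x > 0 \<and> x \<notin> \<real>\<^sub>\<le>\<^sub>0" if "x \<in> ?S" for x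
    using that n by (auto simp: complex_eq_iff complex_nonpos_Reals_iff)
  have "norm (?f 0 (of_nat (n + q)) - (\<Sum>i\<le>K. ?f i (of_nat n) * (of_nat (n + q) - of_nat n) ^ i / fact i)) \<le> ?B * norm (of_nat (n + q) - of_nat n :: complex) ^ Suc K / fact K"
  proof (rule complex_Taylor)
    have "?S = ({z. Im z \<ge> 0} \<inter> {z. Im z \<le> 0}) \<inter> {z. Re z \<ge> real n}" by auto
    then show "convex ?S" by (simp only: convex_Int convex_halfspace_Im_ge convex_halfspace_Im_le convex_halfspace_Re_ge)
    show "(?f i has_field_derivative ?f (Suc i) x) (at x within ?S)" if "x \<in> ?S" for i x
      using S[OF that] by (intro binomial_series_step) auto
    show "norm (?f (Suc K) x) \<le> ?B" if x: "x \<in> ?S" for x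
    proof -
      have "x \<in> \<real>" using S[OF x] by (metis Reals_of_real)
      then have "norm (x powr (1 - s - of_nat (Suc K))) = Re x powr Re (1 - s - of_nat (Suc K))"
        using S[OF x] by (intro norm_powr_real_powr) auto
      also have "Re (1 - s - of_nat (Suc K)) = - (Re s + real K)" by simp
      also have "Re x powr \<dots> \<le> real n powr - (Re s + real K)" using x n \<sigma> by (intro powr_mono2') auto
      also have "\<dots> = 1 / real n powr (Re s + real K)" by (rule powr_minus_divide)
      finally have "norm (x powr (1 - s - of_nat (Suc K))) \<le> 1 / real n powr (Re s + real K)" .
      then have "norm (fact (Suc K) * ((1 - s) gchoose Suc K)) * norm (x powr (1 - s - of_nat (Suc K))) \<le> norm (fact (Suc K) * ((1 - s) gchoose Suc K)) * (1 / real n powr (Re s + real K))"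
        by (rule mult_left_mono) simp
      then show ?thesis by (simp add: norm_mult del: fact_Suc)
    qed
    show "of_nat n \<in> ?S" "of_nat (n + q) \<in> ?S" by auto
  qed
  moreover have "?f 0 (of_nat (n + q)) - (\<Sum>i\<le>K. ?f i (of_nat n) * (of_nat (n + q) - of_nat n) ^ i / fact i) = taylor_rem q K s n"
    unfolding taylor_rem_def by (simp add: mult_ac)
  moreover have "?B * norm (of_nat (n + q) - of_nat n :: complex) ^ Suc K / fact K = real (Suc K) * norm ((1 - s) gchoose Suc K) * real q ^ Suc K / real n powr (Re s + real K)"
  proof -
    have "norm (of_nat (n + q) - of_nat n :: complex) = real q" by simp
    then show ?thesis by (simp add: fact_Suc)
  qed
  ultimately show ?thesis by simp
qed

lemma gbinomial_holomorphic [holomorphic_intros]: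
  "f holomorphic_on A \<Longrightarrow> (\<lambda>s. f s gchoose k) holomorphic_on A" for f :: "complex \<Rightarrow> complex"
  unfolding gbinomial_prod_rev by (intro holomorphic_intros) auto

lemma taylor_rem_holomorphic: "n > 0 \<Longrightarrow> (\<lambda>s. taylor_rem q K s n) holomorphic_on A"
  unfolding taylor_rem_def by (intro holomorphic_intros) auto

context dchar
begin

definition remainder_sum :: "nat \<Rightarrow> complex \<Rightarrow> complex" where
  "remainder_sum K s = (\<Sum>n. chi (Suc n) * taylor_rem q K s (Suc n))"

lemma norm_remainder_sum_term:
  "Re s + real K \<ge> 0 \<Longrightarrow> norm (chi (Suc n) * taylor_rem q K s (Suc n)) \<le> real (Suc K) * norm ((1 - s) gchoose Suc K) * real q ^ Suc K * (1 / real (Suc n) powr (Re s + real K))"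
  using norm_taylor_rem[of "Suc n" s K q] norm_chi_le[of "Suc n"]
  by (auto simp: norm_mult simp del: of_nat_Suc power_Suc intro: order_trans[OF mult_mono[of _ 1]])

lemma summable_powr_Suc: "\<sigma> > 1 \<Longrightarrow> summable (\<lambda>n. 1 / real (Suc n) powr \<sigma>)"
proof -
  assume "\<sigma> > 1"
  then have "summable (\<lambda>n. real n powr -\<sigma>)" by (subst summable_real_powr_iff) auto
  then have "summable (\<lambda>n. real (Suc n) powr -\<sigma>)" by (subst summable_Suc_iff)
  then show ?thesis by (simp add: powr_minus_divide)
qed

lemma remainder_sum_sums: "Re s + real K > 1 \<Longrightarrow> (\<lambda>n. chi (Suc n) * taylor_rem q K s (Suc n)) sums remainder_sum K s"
  unfolding remainder_sum_def
  by (intro summable_sums summable_comparison_test'[OF summable_mult[OF summable_powr_Suc[of "Re s + real K"]] norm_remainder_sum_term]) auto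

lemma norm_remainder_sum_le:
  assumes "Re s + real K \<ge> \<sigma>" "\<sigma> > 1"
  shows "norm (remainder_sum K s) \<le> real (Suc K) * norm ((1 - s) gchoose Suc K) * real q ^ Suc K * (\<Sum>n. 1 / real (Suc n) powr \<sigma>)"
proof -
  let ?C = "real (Suc K) * norm ((1 - s) gchoose Suc K) * real q ^ Suc K"
  have "norm (remainder_sum K s) \<le> (\<Sum>n. ?C * (1 / real (Suc n) powr \<sigma>))"
    unfolding remainder_sum_def
  proof (rule norm_suminf_le)
    fix n
    have "norm (chi (Suc n) * taylor_rem q K s (Suc n)) \<le> ?C * (1 / real (Suc n) powr (Re s + real K))"
      by (rule norm_remainder_sum_term) (use assms in auto)
    also have "\<dots> \<le> ?C * (1 / real (Suc n) powr \<sigma>)"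
      using assms by (intro mult_left_mono divide_left_mono powr_mono) auto
    finally show "norm (chi (Suc n) * taylor_rem q K s (Suc n)) \<le> ?C * (1 / real (Suc n) powr \<sigma>)" .
  qed (intro summable_mult summable_powr_Suc assms)
  also have "\<dots> = ?C * (\<Sum>n. 1 / real (Suc n) powr \<sigma>)" by (rule suminf_mult[OF summable_powr_Suc[OF assms(2)]])
  finally show ?thesis .
qed

text \<open>The binomial factor depends on s but is bounded on a small closed ball, which provides
  the locally uniform majorant.\<close>

lemma remainder_sum_holomorphic: "remainder_sum K holomorphic_on {s. Re s > 1 - real K}"
proof -
  let ?S = "{s. Re s > 1 - real K}"
  let ?f = "\<lambda>n s. chi (Suc n) * taylor_rem q K s (Suc n)"
  have op: "open ?S" by (simp add: open_halfspace_Re_gt)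
  obtain g where g: "\<forall>x\<in>?S. ((\<lambda>n. ?f n x) sums g x) \<and> g field_differentiable (at x)"
  proof (rule series_differentiable_comparison_complex[OF op, of ?f])
    show "?f n field_differentiable at x" if "x \<in> ?S" for n x
      by (rule holomorphic_on_imp_differentiable_at[of _ UNIV]) (auto intro!: holomorphic_intros taylor_rem_holomorphic)
    fix x assume "x \<in> ?S"
    then have x: "Re x + real K > 1" by simp
    define \<sigma> where "\<sigma> = (1 + (Re x + real K)) / 2"
    define d where "d = Re x + real K - \<sigma>"
    have \<sigma>: "\<sigma> > 1" "d > 0" using x by (auto simp: \<sigma>_def d_def field_simps)
    let ?b = "\<lambda>s. norm ((1 - s) gchoose Suc K)"
    have "compact (?b ` cball x d)"
      by (intro compact_continuous_image continuous_on_norm holomorphic_on_imp_continuous_on holomorphic_intros) auto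
    then obtain B where B: "\<And>s. s \<in> cball x d \<Longrightarrow> ?b s \<le> B"
      using compact_imp_bounded[unfolded bounded_iff] by (fastforce dest: compact_imp_bounded simp: bounded_iff)
    have B0: "B \<ge> 0" using B[of x] \<sigma> norm_ge_zero order_trans by (metis centre_in_cball less_imp_le)
    let ?h = "\<lambda>n. complex_of_real (real (Suc K) * B * real q ^ Suc K * (1 / real (Suc n) powr \<sigma>))"
    show "\<exists>d h. 0 < d \<and> summable h \<and> range h \<subseteq> \<real>\<^sub>\<ge>\<^sub>0 \<and> (\<forall>\<^sub>F n in sequentially. \<forall>y\<in>ball x d \<inter> ?S. cmod (?f n y) \<le> cmod (h n))"
    proof (intro exI[of _ d] exI[of _ ?h] conjI always_eventually allI ballI)
      show "summable ?h" by (subst summable_of_real_iff) (intro summable_mult summable_powr_Suc \<sigma>)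
      show "range ?h \<subseteq> \<real>\<^sub>\<ge>\<^sub>0" using B0 by auto
      fix n y assume y: "y \<in> ball x d \<inter> ?S"
      then have "Re x - Re y \<le> d" using abs_Re_le_cmod[of "x - y"] by (auto simp: dist_norm)
      then have y2: "\<sigma> \<le> Re y + real K" by (simp add: d_def)
      have "cmod (?f n y) \<le> real (Suc K) * ?b y * real q ^ Suc K * (1 / real (Suc n) powr (Re y + real K))"
        by (rule norm_remainder_sum_term) (use y2 \<sigma> in auto)
      also have "\<dots> \<le> real (Suc K) * B * real q ^ Suc K * (1 / real (Suc n) powr \<sigma>)"
        using y y2 B0 by (intro mult_mono mult_right_mono mult_left_mono divide_left_mono powr_mono B) auto
      finally show "cmod (?f n y) \<le> cmod (?h n)" unfolding norm_of_real using B0 by simp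
    qed (use \<sigma> in auto)
  qed
  have "g field_differentiable (at x)" "g x = remainder_sum K x" if "x \<in> ?S" for x
    using that g remainder_sum_sums[of x K] by (auto dest: sums_unique2)
  then have "g holomorphic_on ?S" using field_differentiable_at_within holomorphic_on_def by blast
  then show ?thesis using \<open>\<And>x. x \<in> ?S \<Longrightarrow> g x = remainder_sum K x\<close> by (rule holomorphic_transform)
qed

definition boundary_sum :: "complex \<Rightarrow> complex" where
  "boundary_sum s = (\<Sum>n<q. chi (Suc n) * of_nat (Suc n) powr (1 - s))"

lemma boundary_sum_holomorphic: "boundary_sum holomorphic_on A"
  unfolding boundary_sum_def by (intro holomorphic_intros) (auto simp del: of_nat_Suc)

text \<open>Since chi has period q, the N-th partial sum telescopes to the first q terms minus a
  block of q terms that starts at N; the latter tend to 0 because \<open>1 - s\<close> has negative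
  real part.\<close>

lemma boundary_sum_sums:
  assumes s: "Re s > 1"
  shows "(\<lambda>n. chi (Suc n) * (of_nat (Suc n) powr (1 - s) - of_nat (Suc n + q) powr (1 - s))) sums boundary_sum s"
proof -
  let ?g = "\<lambda>n. chi (Suc n) * of_nat (Suc n) powr (1 - s)"
  define g where "g n = ?g n" for n
  have g: "chi (Suc n) * (of_nat (Suc n) powr (1 - s) - of_nat (Suc n + q) powr (1 - s)) = g n - g (n + q)" for n
    using chi_period[of "Suc n"] by (simp add: g_def right_diff_distrib del: of_nat_Suc)
  have "(\<Sum>n<N. g n - g (n + q)) = (\<Sum>i<q. g i) - (\<Sum>i<q. g (N + i))" for N
  proof (induction N)
    case (Suc N)
    have "(\<Sum>i<q. g (Suc N + i)) = (\<Sum>i<q. g (N + i)) - g N + g (N + q)"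
      using sum.lessThan_Suc_shift[of "\<lambda>i. g (N + i)" q] by (simp add: sum.lessThan_Suc algebra_simps)
    then show ?case using Suc.IH by simp
  qed simp
  then have part: "(\<Sum>n<N. chi (Suc n) * (of_nat (Suc n) powr (1 - s) - of_nat (Suc n + q) powr (1 - s))) = boundary_sum s - (\<Sum>i<q. ?g (N + i))" for N
    unfolding g by (simp add: boundary_sum_def g_def)
  have "(\<lambda>N. \<Sum>i<q. ?g (N + i)) \<longlonglongrightarrow> (\<Sum>i<q. 0)"
  proof (intro tendsto_sum)
    fix i
    show "(\<lambda>N. ?g (N + i)) \<longlonglongrightarrow> 0"
    proof (rule Lim_null_comparison)
      have "(\<lambda>N. real (Suc (N + i)) powr (1 - Re s)) \<longlonglongrightarrow> 0"
        using s by (intro tendsto_neg_powr filterlim_compose[OF filterlim_real_sequentially] filterlim_subseq) (auto simp: strict_mono_def)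
      then show "(\<lambda>N. real (Suc (N + i)) powr (1 - Re s)) \<longlonglongrightarrow> 0" .
      show "\<forall>\<^sub>F N in sequentially. norm (?g (N + i)) \<le> real (Suc (N + i)) powr (1 - Re s)"
      proof (intro always_eventually allI)
        fix N
        have "norm (?g (N + i)) = norm (chi (Suc (N + i))) * real (Suc (N + i)) powr (1 - Re s)"
          by (simp add: norm_mult norm_powr_real_powr del: of_nat_Suc)
        also have "\<dots> \<le> 1 * real (Suc (N + i)) powr (1 - Re s)" by (intro mult_right_mono norm_chi_le) simp
        finally show "norm (?g (N + i)) \<le> real (Suc (N + i)) powr (1 - Re s)" by simp
      qed
    qed
  qed
  then have "(\<lambda>N. boundary_sum s - (\<Sum>i<q. ?g (N + i))) \<longlonglongrightarrow> boundary_sum s - 0" by (intro tendsto_diff tendsto_const) simp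
  then show ?thesis unfolding sums_def part by simp
qed

text \<open>
  The sum of \<open>chi n (n^(1-s) - (n + q)^(1-s))\<close> telescopes to \<open>boundary_sum\<close>; expanding \<open>(n + q)^(1-s)\<close> by the
  binomial series expresses \<open>F s\<close> through the values of \<open>F\<close> further to the right.
\<close>
lemma F_recursion:
  assumes s: "Re s > 1" and K: "K \<ge> 1"
  shows "of_nat q * (s - 1) * F s = boundary_sum s + remainder_sum K s + (\<Sum>k=2..K. ((1 - s) gchoose k) * of_nat q ^ k * F (s + of_nat k - 1))"
proof -
  let ?c = "\<lambda>k. ((1 - s) gchoose k) * of_nat q ^ k"
  have Fk: "(\<lambda>n. chi (Suc n) * of_nat (Suc n) powr (1 - s - of_nat k)) sums F (s + of_nat k - 1)" if "k \<ge> 1" for k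
  proof -
    have "Re (s + of_nat k - 1) > 1" using s that by simp
    moreover have "chi (Suc n) / of_nat (Suc n) powr (s + of_nat k - 1) = chi (Suc n) * of_nat (Suc n) powr (1 - s - of_nat k)" for n
    proof -
      have "1 - s - of_nat k = - (s + of_nat k - 1)" by simp
      then show ?thesis by (simp only: powr_minus divide_inverse)
    qed
    ultimately show ?thesis using F_sums[of "s + of_nat k - 1"] by (simp only:)
  qed
  have "(\<lambda>n. - (chi (Suc n) * taylor_rem q K s (Suc n)) - (\<Sum>k=1..K. ?c k * (chi (Suc n) * of_nat (Suc n) powr (1 - s - of_nat k))))
     sums (- remainder_sum K s - (\<Sum>k=1..K. ?c k * F (s + of_nat k - 1)))"
    using s K by (intro sums_diff sums_minus sums_sum sums_mult Fk remainder_sum_sums) auto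
  also have "(\<lambda>n. - (chi (Suc n) * taylor_rem q K s (Suc n)) - (\<Sum>k=1..K. ?c k * (chi (Suc n) * of_nat (Suc n) powr (1 - s - of_nat k)))) =
     (\<lambda>n. chi (Suc n) * (of_nat (Suc n) powr (1 - s) - of_nat (Suc n + q) powr (1 - s)))"
  proof
    fix n
    have "{..K} = insert 0 {1..K}" by auto
    then have "taylor_rem q K s (Suc n) = of_nat (Suc n + q) powr (1 - s) - of_nat (Suc n) powr (1 - s) - (\<Sum>k=1..K. ?c k * of_nat (Suc n) powr (1 - s - of_nat k))"
      unfolding taylor_rem_def by simp
    moreover have "(\<Sum>k=1..K. ?c k * (chi (Suc n) * of_nat (Suc n) powr (1 - s - of_nat k))) =
      chi (Suc n) * (\<Sum>k=1..K. ?c k * of_nat (Suc n) powr (1 - s - of_nat k))"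
      by (simp only: sum_distrib_left mult_ac)
    moreover have "- (c * (X - Y - Z)) - c * Z = c * (Y - X)" for c X Y Z :: complex by (simp add: algebra_simps)
    ultimately show "- (chi (Suc n) * taylor_rem q K s (Suc n)) - (\<Sum>k=1..K. ?c k * (chi (Suc n) * of_nat (Suc n) powr (1 - s - of_nat k))) =
      chi (Suc n) * (of_nat (Suc n) powr (1 - s) - of_nat (Suc n + q) powr (1 - s))"
      by (simp only:)
  qed
  finally have "boundary_sum s = - remainder_sum K s - (\<Sum>k=1..K. ?c k * F (s + of_nat k - 1))"
    using boundary_sum_sums[OF s] by (rule sums_unique2[symmetric])
  moreover have "(\<Sum>k=1..K. ?c k * F (s + of_nat k - 1)) = (1 - s) * of_nat q * F s + (\<Sum>k=2..K. ?c k * F (s + of_nat k - 1))"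
  proof -
    have "{1..K} = insert 1 {2..K}" using K by auto
    then show ?thesis by simp
  qed
  ultimately have "boundary_sum s = - remainder_sum K s - ((1 - s) * of_nat q * F s + (\<Sum>k=2..K. ?c k * F (s + of_nat k - 1)))" by (simp only:)
  then show ?thesis by (simp add: algebra_simps)
qed

end

lemma identity_right_half_plane:
  assumes "f holomorphic_on {s. Re s > b}" "g holomorphic_on {s. Re s > b}" "b \<le> c"
    and "\<And>s. Re s > c \<Longrightarrow> f s = g s" and "Re s > b"
  shows "f s = g s"
proof (rule analytic_continuation_open[of "{s. Re s > c}" "{s. Re s > b}" f g])
  have "Re (of_real (c + 1)) > c" by simp
  then show "{s. Re s > c} \<noteq> {}" by blast
qed (use assms in \<open>auto simp: open_halfspace_Re_gt intro!: convex_connected convex_halfspace_Re_gt\<close>)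

context dchar
begin

text \<open>The recursion expresses \<open>(s - 1) * F s\<close> through values at
  \<open>s + 1\<close> and further to the right, so each application wins a strip of width 1. The
  function continued is \<open>(s - 1) * F s\<close> rather than F, because it has no pole.\<close>

lemma extension_step:
  assumes H: "H holomorphic_on {s. Re s > 1 - real K}" "\<And>s. Re s > 1 \<Longrightarrow> H s = (s - 1) * F s"
  shows "\<exists>H'. H' holomorphic_on {s. Re s > 1 - real (Suc K)} \<and> (\<forall>s. Re s > 1 \<longrightarrow> H' s = (s - 1) * F s)"
proof -
  let ?S = "{s. Re s > 1 - real (Suc K)}"
  \<comment> \<open>The last factor of \<open>(1 - s) gchoose k\<close> is
    \<open>- (s + of_nat k - 2)\<close>, exactly what turns \<open>F (s + of_nat k - 1)\<close> into
    \<open>H (s + of_nat k - 1)\<close> up to sign. Hence only the binomial of order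
    \<open>k - 1\<close> remains and nothing is divided by a factor that may vanish.\<close>
  let ?T = "\<lambda>s k. ((1 - s) gchoose (k - 1)) / of_nat k * of_nat q ^ k * H (s + of_nat k - 1)"
  define H' where "H' s = (boundary_sum s + remainder_sum (Suc K) s - (\<Sum>k=2..Suc K. ?T s k)) / of_nat q" for s
  have "(\<lambda>s. H (s + of_nat k - 1)) holomorphic_on ?S" if "k \<in> {2..Suc K}" for k
  proof -
    have "(H \<circ> (\<lambda>s. s + of_nat k - 1)) holomorphic_on ?S"
      by (rule holomorphic_on_compose_gen[OF _ H(1)]) (use that in \<open>auto intro!: holomorphic_intros\<close>)
    then show ?thesis by (simp only: o_def)
  qed
  then have "H' holomorphic_on ?S"
    unfolding H'_def by (intro holomorphic_intros boundary_sum_holomorphic remainder_sum_holomorphic) (use q_pos in auto)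
  moreover have "H' s = (s - 1) * F s" if s: "Re s > 1" for s
  proof -
    have T: "?T s k = - (((1 - s) gchoose k) * of_nat q ^ k * F (s + of_nat k - 1))" if k: "k \<in> {2..Suc K}" for k
    proof -
      obtain j where j: "k = Suc j" using k by (cases k) auto
      have b: "((1 - s) gchoose j) * (1 - s - of_nat j) = of_nat (Suc j) * ((1 - s) gchoose Suc j)"
        using gbinomial_mult_1[of "1 - s" j] by (simp add: algebra_simps)
      have h: "H (s + of_nat k - 1) = - (1 - s - of_nat j) * F (s + of_nat k - 1)"
        using H(2)[of "s + of_nat k - 1"] s k by (simp add: j algebra_simps)
      have "?T s k = - ((((1 - s) gchoose j) * (1 - s - of_nat j)) / of_nat k * of_nat q ^ k * F (s + of_nat k - 1))"
      proof -
        have "a / d * b * (- c * e) = - (a * c / d * b * e)" for a b c d e :: complex by simp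
        then show ?thesis unfolding h by (simp only: j diff_Suc_1)
      qed
      also have "\<dots> = - (((1 - s) gchoose k) * of_nat q ^ k * F (s + of_nat k - 1))"
        unfolding b by (simp add: j del: of_nat_Suc power_Suc)
      finally show ?thesis .
    qed
    have "(\<Sum>k=2..Suc K. ?T s k) = - (\<Sum>k=2..Suc K. ((1 - s) gchoose k) * of_nat q ^ k * F (s + of_nat k - 1))"
      unfolding sum_negf[symmetric] by (rule sum.cong[OF refl T])
    then have "H' s = (of_nat q * (s - 1) * F s) / of_nat q"
      unfolding H'_def by (subst F_recursion[OF s, of "Suc K"]) simp_all
    then show ?thesis using q_pos by simp
  qed
  ultimately show ?thesis by blast
qed

lemma extension: "\<exists>H. H holomorphic_on {s. Re s > 1 - real K} \<and> (\<forall>s. Re s > 1 \<longrightarrow> H s = (s - 1) * F s)"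
proof (induction K)
  case 0
  have "(\<lambda>s. (s - 1) * F s) holomorphic_on {s. Re s > 1}" by (intro holomorphic_intros F_holo)
  then show ?case by auto
next
  case (Suc K)
  then show ?case using extension_step by blast
qed

definition "Hfun = (SOME H. H holomorphic_on UNIV \<and> (\<forall>s. Re s > 1 \<longrightarrow> H s = (s - 1) * F s))"

text \<open>The continuations to the half-planes are glued by taking the value at s from an index
  that depends on s; the identity theorem makes the choice of index immaterial.\<close>

lemma Hfun: "Hfun holomorphic_on UNIV" "Re s > 1 \<Longrightarrow> Hfun s = (s - 1) * F s"
proof -
  obtain G where G: "\<And>K. G K holomorphic_on {s. Re s > 1 - real K}" "\<And>K s. Re s > 1 \<Longrightarrow> G K s = (s - 1) * F s"
    using extension by metis
  define k where "k s = nat \<lceil>2 + \<bar>Re s\<bar>\<rceil>" for s :: complex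
  have k: "Re s > 1 - real (k s)" for s
  proof -
    have "real (k s) \<ge> 2 + \<bar>Re s\<bar>" unfolding k_def by (rule real_nat_ceiling_ge)
    then show ?thesis by linarith
  qed
  have eq: "G (k s) s = G K s" if "Re s > 1 - real K" for s K
  proof (rule identity_right_half_plane[of "G (k s)" "1 - real (min (k s) K)" "G K" 1 s])
    show "G (k s) holomorphic_on {sa. Re sa > 1 - real (min (k s) K)}" by (rule holomorphic_on_subset[OF G(1)]) auto
    show "G K holomorphic_on {sa. Re sa > 1 - real (min (k s) K)}" by (rule holomorphic_on_subset[OF G(1)]) auto
  qed (use G(2) k[of s] that in \<open>auto simp: min_def\<close>)
  have "(\<lambda>s. G (k s) s) holomorphic_on {s. Re s > 1 - real K}" for K
    by (rule holomorphic_transform[OF G(1)]) (simp add: eq)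
  then have "(\<lambda>s. G (k s) s) holomorphic_on (\<Union>K. {s. Re s > 1 - real K})"
    by (intro holomorphic_on_UN_open) (auto simp: open_halfspace_Re_gt)
  moreover have "(\<Union>K. {s. Re s > 1 - real K}) = UNIV" using k by blast
  ultimately have "\<exists>H. H holomorphic_on UNIV \<and> (\<forall>s. Re s > 1 \<longrightarrow> H s = (s - 1) * F s)"
    using G(2) by (intro exI[of _ "\<lambda>s. G (k s) s"]) auto
  from someI_ex[OF this] show "Hfun holomorphic_on UNIV" "Re s > 1 \<Longrightarrow> Hfun s = (s - 1) * F s" for s
    unfolding Hfun_def by auto
qed

lemma Hfun_eq: "Re s > 0 \<Longrightarrow> Hfun s = (boundary_sum s + remainder_sum 1 s) / of_nat q"
proof (rule identity_right_half_plane[of Hfun 0 "\<lambda>s. (boundary_sum s + remainder_sum 1 s) / of_nat q" 1 s])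
  show "(\<lambda>s. (boundary_sum s + remainder_sum 1 s) / of_nat q) holomorphic_on {s. Re s > 0}"
    using remainder_sum_holomorphic[of 1] q_pos by (intro holomorphic_intros boundary_sum_holomorphic) auto
  show "Hfun holomorphic_on {s. Re s > 0}" using Hfun(1) by (rule holomorphic_on_subset) auto
  show "Hfun s = (boundary_sum s + remainder_sum 1 s) / of_nat q" if "Re s > 1" for s
  proof -
    have "of_nat q * Hfun s = of_nat q * (s - 1) * F s" using Hfun(2)[OF that] by simp
    also have "\<dots> = boundary_sum s + remainder_sum 1 s" using F_recursion[OF that, of 1] by simp
    finally show ?thesis using q_pos by (simp add: field_simps)
  qed
qed auto

text \<open>At \<open>s = 1\<close> every power in the recursion of order 1 equals 1, so the Taylor
  remainders vanish and only the sum over one period is left. This is the residue of the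
  L-function.\<close>

lemma Hfun_1: "Hfun 1 = (\<Sum>n<q. chi (Suc n)) / of_nat q"
proof -
  have "taylor_rem q 1 1 (Suc n) = 0" for n by (simp add: taylor_rem_def del: of_nat_Suc)
  then have "remainder_sum 1 1 = 0" by (simp add: remainder_sum_def)
  moreover have "boundary_sum 1 = (\<Sum>n<q. chi (Suc n))" by (simp add: boundary_sum_def del: of_nat_Suc)
  ultimately show ?thesis using Hfun_eq[of 1] by simp
qed

text \<open>Polynomial growth in q and s is enough, since only the logarithm of this bound enters
  the estimate of the logarithmic derivative.\<close>

lemma Hfun_bound:
  assumes "1/2 \<le> Re s"
  shows "norm (Hfun s) \<le> real q * (1 + norm (s - 1) * norm s * (\<Sum>n. 1 / real (Suc n) powr (3/2)))"
proof -
  let ?Z = "\<Sum>n. 1 / real (Suc n) powr (3/2)"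
  have "norm (boundary_sum s) \<le> (\<Sum>n<q. real q)"
    unfolding boundary_sum_def
  proof (rule sum_norm_le)
    fix n assume n: "n \<in> {..<q}"
    have "norm (chi (Suc n) * of_nat (Suc n) powr (1 - s)) = norm (chi (Suc n)) * real (Suc n) powr (1 - Re s)"
      by (simp add: norm_mult norm_powr_real_powr del: of_nat_Suc)
    also have "\<dots> \<le> 1 * real (Suc n) powr 1" using assms by (intro mult_mono norm_chi_le powr_mono) auto
    also have "\<dots> \<le> real q" using n by simp
    finally show "norm (chi (Suc n) * of_nat (Suc n) powr (1 - s)) \<le> real q" .
  qed
  then have E: "norm (boundary_sum s) \<le> real q * real q" by simp
  have "norm (remainder_sum 1 s) \<le> real (Suc 1) * norm ((1 - s) gchoose Suc 1) * real q ^ Suc 1 * ?Z"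
    by (rule norm_remainder_sum_le) (use assms in auto)
  also have "norm ((1 - s) gchoose Suc 1) = norm (s - 1) * norm s / 2"
  proof -
    have "{0..<Suc 1} = {0, 1::nat}" by auto
    then have "(1 - s) gchoose Suc 1 = (1 - s) * (- s) / 2"
      unfolding gbinomial_prod_rev by (simp add: fact_2)
    then show ?thesis by (simp add: norm_mult norm_divide norm_minus_commute)
  qed
  finally have R: "norm (remainder_sum 1 s) \<le> real q * real q * (norm (s - 1) * norm s * ?Z)" by (simp add: power2_eq_square mult_ac)
  have "norm (boundary_sum s + remainder_sum 1 s) \<le> real q * real q * (1 + norm (s - 1) * norm s * ?Z)"
    using norm_triangle_ineq[of "boundary_sum s" "remainder_sum 1 s"] E R by (simp add: algebra_simps)
  moreover have "norm (boundary_sum s + remainder_sum 1 s) = real q * norm (Hfun s)"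
    using Hfun_eq[of s] assms q_pos by (simp add: norm_divide)
  ultimately have "real q * norm (Hfun s) \<le> real q * (real q * (1 + norm (s - 1) * norm s * ?Z))"
    by (simp only: mult.assoc)
  then show ?thesis using q_pos by (simp only: mult_le_cancel_left_pos of_nat_0_less_iff)
qed

text \<open>\<open>remove_sings\<close> takes the limit at a removable singularity and 0 at a pole,
  which is the convention built into nicely meromorphic functions; together with uniqueness this
  identifies \<open>dirichlet_L\<close>.\<close>

lemma is_dirichlet_L_remove_sings: "is_dirichlet_L chi (remove_sings (\<lambda>s. Hfun s / (s - 1)))"
proof -
  have mero: "(\<lambda>s. Hfun s / (s - 1)) meromorphic_on UNIV"
  proof (rule meromorphic_on_divide)
    show "Hfun meromorphic_on UNIV"
      by (rule analytic_on_imp_meromorphic_on) (simp add: analytic_on_open Hfun(1))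
    show "(\<lambda>s. s - 1) meromorphic_on UNIV"
      by (rule analytic_on_imp_meromorphic_on) (simp add: analytic_on_open holomorphic_intros)
  qed
  moreover have "(\<lambda>n. chi (Suc n) / of_nat (Suc n) powr s) sums remove_sings (\<lambda>s. Hfun s / (s - 1)) s" if s: "Re s > 1" for s
  proof -
    have "(\<lambda>s. Hfun s / (s - 1)) holomorphic_on UNIV - {1}"
      by (intro holomorphic_intros holomorphic_on_subset[OF Hfun(1)]) auto
    then have "(\<lambda>s. Hfun s / (s - 1)) analytic_on {s}"
      unfolding analytic_at using s by (intro exI[of _ "UNIV - {1}"]) (auto simp: open_delete)
    then have "remove_sings (\<lambda>s. Hfun s / (s - 1)) s = Hfun s / (s - 1)" by (rule remove_sings_at_analytic)
    also have "\<dots> = F s" using s Hfun(2)[OF s] by auto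
    finally show ?thesis using F_sums[OF s] by simp
  qed
  ultimately show ?thesis unfolding is_dirichlet_L_def
    by (intro conjI allI impI remove_sings_nicely_meromorphic)
qed

lemma dirichlet_L_eq: "s \<noteq> 1 \<Longrightarrow> dirichlet_L chi s = Hfun s / (s - 1)"
proof -
  assume s: "s \<noteq> 1"
  have "dirichlet_L chi = remove_sings (\<lambda>s. Hfun s / (s - 1))"
    unfolding dirichlet_L_def using is_dirichlet_L_remove_sings is_dirichlet_L_unique by blast
  moreover have "(\<lambda>s. Hfun s / (s - 1)) holomorphic_on UNIV - {1}"
    by (intro holomorphic_intros holomorphic_on_subset[OF Hfun(1)]) auto
  then have "(\<lambda>s. Hfun s / (s - 1)) analytic_on {s}"
    unfolding analytic_at using s by (intro exI[of _ "UNIV - {1}"]) (auto simp: open_delete)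
  then have "remove_sings (\<lambda>s. Hfun s / (s - 1)) s = Hfun s / (s - 1)" by (rule remove_sings_at_analytic)
  ultimately show ?thesis by simp
qed

lemma GRH_Hfun_nonzero:
  assumes "GRH" "1/2 < Re s" "Re s < 1" shows "Hfun s \<noteq> 0"
proof
  assume "Hfun s = 0"
  moreover have "s \<noteq> 1" using assms by auto
  ultimately have "dirichlet_L chi s = 0" by (simp add: dirichlet_L_eq)
  then have "Re s = 1/2" using assms dc by (intro assms(1)[unfolded GRH_def, rule_format, of q chi s]) simp
  then show False using assms by simp
qed

end

section \<open>Nonvanishing on the line of real part 1\<close>

lemma abel_summation_bound:
  fixes f :: "nat \<Rightarrow> complex" and g :: "nat \<Rightarrow> real"
  assumes B: "\<And>k. norm (\<Sum>i<k. f i) \<le> B" and g: "\<And>i. g (Suc i) \<le> g i" "\<And>i. g i \<ge> 0"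
  shows "norm (\<Sum>i<n. f i * of_real (g i)) \<le> B * g 0"
proof -
  let ?S = "\<lambda>k. \<Sum>i<k. f i"
  have eq: "(\<Sum>i<n. f i * of_real (g i)) = ?S n * of_real (g n) + (\<Sum>i<n. ?S (Suc i) * of_real (g i - g (Suc i)))" for n
    by (induction n) (auto simp: algebra_simps)
  have "norm (\<Sum>i<n. f i * of_real (g i)) \<le> norm (?S n * of_real (g n)) + (\<Sum>i<n. norm (?S (Suc i) * of_real (g i - g (Suc i))))"
    unfolding eq by (rule norm_triangle_le[OF add_left_mono[OF norm_sum]])
  also have "\<dots> \<le> B * g n + (\<Sum>i<n. B * (g i - g (Suc i)))"
  proof -
    have B0: "0 \<le> B" using B[of 0] by simp
    have "norm (?S (Suc i)) * \<bar>g i - g (Suc i)\<bar> \<le> B * (g i - g (Suc i))" for i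
      using mult_right_mono[OF B[of "Suc i"], of "g i - g (Suc i)"] g(1)[of i] by simp
    moreover have "norm (?S n) * \<bar>g n\<bar> \<le> B * g n" using mult_right_mono[OF B[of n] g(2)[of n]] g(2)[of n] by simp
    ultimately show ?thesis unfolding norm_mult norm_of_real by (intro add_mono sum_mono)
  qed
  also have "\<dots> = B * g n + B * (\<Sum>i<n. g i - g (Suc i))" by (simp add: sum_distrib_left)
  also have "(\<Sum>i<n. g i - g (Suc i)) = g 0 - g n" by (rule sum_lessThan_telescope')
  finally show ?thesis by (simp add: algebra_simps)
qed

text \<open>Writing f as \<open>(w - z) ^ n * g w\<close> with g not 0 near z shows that the limit
  is the order of vanishing. The limit is taken only from the right, because the Dirichlet series
  are available only there.\<close>

lemma log_deriv_order:
  fixes f :: "complex \<Rightarrow> complex"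
  assumes hol: "f holomorphic_on UNIV" and nz: "f w \<noteq> 0"
  obtains m :: nat where "((\<lambda>x::real. of_real x * (deriv f (z + of_real x) / f (z + of_real x))) \<longlongrightarrow> of_nat m) (at_right 0)"
    and "m = 0 \<longleftrightarrow> f z \<noteq> 0"
proof -
  have zx: "((\<lambda>x::real. z + of_real x) \<longlongrightarrow> z) (at_right 0)"
    by (auto intro!: tendsto_eq_intros)
  have dh: "deriv f holomorphic_on UNIV" using hol by (rule holomorphic_deriv) simp
  show ?thesis
  proof (cases "f z = 0")
    case False
    have "((\<lambda>x::real. of_real x * (deriv f (z + of_real x) / f (z + of_real x))) \<longlongrightarrow> of_real 0 * (deriv f z / f z)) (at_right 0)"
      using dh hol False
      by (intro tendsto_intros isCont_tendsto_compose[OF _ zx])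
        (auto intro!: holomorphic_on_imp_continuous_on[THEN continuous_on_interior])
    then show ?thesis using that[of 0] False by simp
  next
    case True
    obtain g r n where grn: "0 < n" "0 < r" "g holomorphic_on ball z r"
      "\<And>w. w \<in> ball z r \<Longrightarrow> f w = (w - z) ^ n * g w" "\<And>w. w \<in> ball z r \<Longrightarrow> g w \<noteq> 0"
    proof (rule holomorphic_factor_zero_nonconstant[of f UNIV z])
      show "\<not> f constant_on UNIV" using True nz unfolding constant_on_def by (metis UNIV_I)
    qed (use hol True in auto)
    have dg: "deriv g holomorphic_on ball z r" using grn(3) by (rule holomorphic_deriv) simp
    have "eventually (\<lambda>x::real. 0 < x \<and> x < r) (at_right 0)"
      using grn(2) by (simp add: eventually_at_right_field) blast
    then have ev: "\<forall>\<^sub>F x in at_right 0. of_nat n + of_real x * (deriv g (z + of_real x) / g (z + of_real x)) = of_real x * (deriv f (z + of_real x) / f (z + of_real x))"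
    proof eventually_elim
      case (elim x)
      define w where "w = z + of_real x"
      have w: "w \<in> ball z r" using elim by (simp add: w_def dist_norm)
      have wz: "w - z = of_real x" "of_real x \<noteq> (0::complex)" using elim by (auto simp: w_def)
      have "((\<lambda>w. (w - z) ^ n * g w) has_field_derivative of_nat n * (w - z) ^ (n - 1) * g w + (w - z) ^ n * deriv g w) (at w)"
        using holomorphic_derivI[OF grn(3) open_ball w] by (auto intro!: derivative_eq_intros)
      then have "(f has_field_derivative of_nat n * (w - z) ^ (n - 1) * g w + (w - z) ^ n * deriv g w) (at w)"
        by (rule has_field_derivative_transform_within_open[OF _ open_ball w]) (simp add: grn(4))
      then have d: "deriv f w = of_nat n * (w - z) ^ (n - 1) * g w + (w - z) ^ n * deriv g w" by (rule DERIV_imp_deriv)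
      obtain k where k: "n = Suc k" using grn(1) by (cases n) auto
      have "of_real x * deriv f w = (of_nat n * g w + of_real x * deriv g w) * (w - z) ^ n"
        unfolding d wz k by (simp add: algebra_simps)
      moreover have "f w = (w - z) ^ n * g w" "g w \<noteq> 0" using grn(4,5)[OF w] by auto
      ultimately have "of_real x * (deriv f w / f w) = of_nat n + of_real x * (deriv g w / g w)"
        using wz by (simp add: field_simps)
      then show ?case by (simp add: w_def)
    qed
    have "((\<lambda>x::real. of_nat n + of_real x * (deriv g (z + of_real x) / g (z + of_real x))) \<longlongrightarrow> of_nat n + of_real 0 * (deriv g z / g z)) (at_right 0)"
      using grn(2,5) holomorphic_on_imp_continuous_on[OF dg] holomorphic_on_imp_continuous_on[OF grn(3)]
      by (intro tendsto_intros isCont_tendsto_compose[OF _ zx]) (auto simp: continuous_on_eq_continuous_at)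
    then have "((\<lambda>x::real. of_real x * (deriv f (z + of_real x) / f (z + of_real x))) \<longlongrightarrow> of_nat n) (at_right 0)"
      using Lim_transform_eventually[OF _ ev] by simp
    then show ?thesis using that[of n] grn(1) True by simp
  qed
qed

definition principal :: "nat \<Rightarrow> (nat \<Rightarrow> complex) \<Rightarrow> bool" where
  "principal q chi \<longleftrightarrow> (\<forall>n. coprime n q \<longrightarrow> chi n = 1)"

context dchar
begin

lemma sum_period: "(\<Sum>n<q. chi (Suc n)) = (\<Sum>n<q. chi n)"
proof -
  have "(\<Sum>n<q. chi (Suc n)) + chi 0 = (\<Sum>n<Suc q. chi n)" by (subst sum.lessThan_Suc_shift) simp
  then show ?thesis using chi_period[of 0] by simp
qed

lemma sum_nonprincipal:
  assumes "\<not> principal q chi" shows "(\<Sum>n<q. chi n) = 0"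
proof -
  obtain m where m: "coprime m q" "chi m \<noteq> 1" using assms by (auto simp: principal_def)
  have inj: "inj_on (\<lambda>n. (m * n) mod q) {..<q}"
  proof
    fix x y assume xy: "x \<in> {..<q}" "y \<in> {..<q}" "(m * x) mod q = (m * y) mod q"
    then have "[m * x = m * y] (mod q)" by (simp add: cong_def)
    then have "[x = y] (mod q)" using m(1) cong_mult_lcancel_nat by blast
    then show "x = y" using xy by (simp add: cong_def)
  qed
  have sub: "(\<lambda>n. (m * n) mod q) ` {..<q} \<subseteq> {..<q}" using q_pos by auto
  have img: "(\<lambda>n. (m * n) mod q) ` {..<q} = {..<q}" by (rule endo_inj_surj[OF finite_lessThan sub inj])
  have "(\<Sum>n<q. chi n) = (\<Sum>n\<in>(\<lambda>n. (m * n) mod q) ` {..<q}. chi n)" by (simp only: img)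
  also have "\<dots> = (\<Sum>n<q. chi ((m * n) mod q))" by (simp add: sum.reindex[OF inj])
  also have "\<dots> = chi m * (\<Sum>n<q. chi n)" by (simp add: chi_mod chi_mult sum_distrib_left)
  finally show ?thesis using m(2) by simp
qed

lemma Hfun_1_nonprincipal: "\<not> principal q chi \<Longrightarrow> Hfun 1 = 0"
  by (simp add: Hfun_1 sum_period sum_nonprincipal)

lemma Hfun_1_principal: assumes "principal q chi" shows "Hfun 1 \<noteq> 0"
proof -
  have "Re (\<Sum>n<q. chi (Suc n)) = (\<Sum>n<q. if coprime (Suc n) q then 1 else 0)"
  proof -
    have "chi n = (if coprime n q then 1 else 0)" for n using assms chi_eq_0_iff[of n] by (auto simp: principal_def)
    then show ?thesis unfolding Re_sum by (intro sum.cong) simp_all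
  qed
  also have "\<dots> \<ge> (\<Sum>n\<in>{0}. if coprime (Suc n) q then 1 else 0)" by (rule sum_mono2) (use q_pos in auto)
  finally have "Re (\<Sum>n<q. chi (Suc n)) \<ge> 1" by simp
  then have "(\<Sum>n<q. chi (Suc n)) \<noteq> 0" by (metis not_one_le_zero zero_complex.sel(1))
  then show ?thesis using q_pos by (simp add: Hfun_1)
qed

text \<open>The L-function with exactly its pole removed. For a principal character the factor
  \<open>s - 1\<close> cancels the pole. For the others that factor has put an artificial zero of
  \<open>Hfun\<close> at 1, which is divided out again, so that a zero of \<open>Gfun\<close> at 1
  is a genuine one.\<close>

definition Gfun :: "complex \<Rightarrow> complex" where
  "Gfun = (if principal q chi then Hfun else (\<lambda>s. if s = 1 then deriv Hfun 1 else (Hfun s - Hfun 1) / (s - 1)))"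

definition rho :: complex where "rho = (if principal q chi then 1 else 0)"

lemma Gfun_holo: "Gfun holomorphic_on UNIV"
  unfolding Gfun_def using Hfun(1) pole_lemma[OF Hfun(1), of 1] by simp

lemma Gfun_eq: "s \<noteq> 1 \<Longrightarrow> Gfun s = (if principal q chi then Hfun s else Hfun s / (s - 1))"
  by (simp add: Gfun_def Hfun_1_nonprincipal)

lemma Gfun_eq_F: "Re s > 1 \<Longrightarrow> Gfun s = (if principal q chi then (s - 1) * F s else F s)"
proof -
  assume "Re s > 1"
  then have "s \<noteq> 1" by auto
  then show ?thesis using Gfun_eq[of s] Hfun(2)[of s] \<open>Re s > 1\<close> by auto
qed

lemma Gfun_nonzero_gt1: "Re s > 1 \<Longrightarrow> Gfun s \<noteq> 0"
  using Gfun_eq_F[of s] F_nonzero[of s] by auto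

lemma D_eq:
  assumes s: "Re s > 1" shows "D s = rho / (s - 1) - deriv Gfun s / Gfun s"
proof -
  have s1: "s \<noteq> 1" using s by auto
  have "(F has_field_derivative - F s * D s) (at s)" by (rule F_deriv[OF s])
  then have "((\<lambda>s. if principal q chi then (s - 1) * F s else F s) has_field_derivative
    (if principal q chi then F s + (s - 1) * (- F s * D s) else - F s * D s)) (at s)"
    by (cases "principal q chi") (auto intro!: derivative_eq_intros)
  then have "(Gfun has_field_derivative (if principal q chi then F s + (s - 1) * (- F s * D s) else - F s * D s)) (at s)"
    by (rule has_field_derivative_transform_within_open[OF _ open_halfspace_Re_gt[of 1]]) (use s Gfun_eq_F in auto)
  then have "deriv Gfun s = (if principal q chi then F s + (s - 1) * (- F s * D s) else - F s * D s)"
    by (rule DERIV_imp_deriv)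
  then show ?thesis using Gfun_eq_F[OF s] F_nonzero[OF s] s1 by (auto simp: rho_def field_simps)
qed

lemma D_sums: "Re s > 1 \<Longrightarrow> (\<lambda>n. mangoldt (Suc n) * chi (Suc n) / of_nat (Suc n) powr s) sums D s"
  unfolding D_def by (rule dser_sums[OF chi_mangoldt_abs_conv])

text \<open>D is minus the logarithmic derivative, so the limit is the order of the pole minus the
  order of the zero at \<open>Complex 1 t\<close>.\<close>

lemma D_limit:
  obtains m :: nat where
    "((\<lambda>x::real. of_real x * D (Complex (1 + x) t)) \<longlongrightarrow> (if t = 0 then rho else 0) - of_nat m) (at_right 0)"
    "m = 0 \<longleftrightarrow> Gfun (Complex 1 t) \<noteq> 0"
proof -
  define z where "z = Complex 1 t"
  obtain m :: nat where m: "((\<lambda>x::real. of_real x * (deriv Gfun (z + of_real x) / Gfun (z + of_real x))) \<longlongrightarrow> of_nat m) (at_right 0)"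
     "m = 0 \<longleftrightarrow> Gfun z \<noteq> 0"
    by (rule log_deriv_order[OF Gfun_holo Gfun_nonzero_gt1[of 2], of z]) auto
  have zx: "z + of_real x = Complex (1 + x) t" for x by (simp add: z_def complex_eq_iff)
  have r: "((\<lambda>x::real. of_real x * (rho / (z + of_real x - 1))) \<longlongrightarrow> (if t = 0 then rho else 0)) (at_right 0)"
  proof (cases "t = 0")
    case True
    have "\<forall>\<^sub>F x in at_right (0::real). rho = of_real x * (rho / (z + of_real x - 1))"
      using eventually_at_right_less[of "0::real"] by eventually_elim (use True in \<open>auto simp: z_def complex_eq_iff Complex_eq\<close>)
    then show ?thesis using True by (simp add: tendsto_eventually eventually_mono[OF _ sym])
  next
    case False
    have "z \<noteq> 1" using False by (auto simp: z_def complex_eq_iff)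
    then have "((\<lambda>x::real. of_real x * (rho / (z + of_real x - 1))) \<longlongrightarrow> of_real 0 * (rho / (z + of_real 0 - 1))) (at_right 0)"
      by (intro tendsto_intros) auto
    then show ?thesis using False by simp
  qed
  have ev: "\<forall>\<^sub>F x in at_right (0::real). of_real x * (rho / (z + of_real x - 1)) - of_real x * (deriv Gfun (z + of_real x) / Gfun (z + of_real x)) = of_real x * D (Complex (1 + x) t)"
    using eventually_at_right_less[of "0::real"]
  proof eventually_elim
    case (elim x)
    then have "D (Complex (1 + x) t) = rho / (Complex (1 + x) t - 1) - deriv Gfun (Complex (1 + x) t) / Gfun (Complex (1 + x) t)"
      by (intro D_eq) simp
    then show ?case by (simp only: zx right_diff_distrib)
  qed
  have "((\<lambda>x::real. of_real x * D (Complex (1 + x) t)) \<longlongrightarrow> (if t = 0 then rho else 0) - of_nat m) (at_right 0)"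
    by (rule Lim_transform_eventually[OF tendsto_diff[OF r m(1)] ev])
  then show ?thesis using that m(2) by (simp add: z_def)
qed

end

section \<open>Nonvanishing from the trigonometric inequality\<close>

lemma three_four_one: "norm z = 1 \<Longrightarrow> 0 \<le> 3 + 4 * Re z + Re (z\<^sup>2)"
proof -
  assume "norm z = 1"
  then have "(Re z)\<^sup>2 + (Im z)\<^sup>2 = 1" by (simp add: cmod_power2[symmetric])
  then have "3 + 4 * Re z + Re (z\<^sup>2) = 2 * (1 + Re z)\<^sup>2"
    by (simp add: power2_eq_square algebra_simps)
  then show ?thesis by simp
qed

context dchar
begin

definition chi0 :: "nat \<Rightarrow> complex" where "chi0 n = (if coprime n q then 1 else 0)"
definition chi2 :: "nat \<Rightarrow> complex" where "chi2 n = (chi n)\<^sup>2"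

lemma coprime_add_q: "coprime (n + q) q \<longleftrightarrow> coprime n q"
  using chi_eq_0_iff[of "n + q"] chi_eq_0_iff[of n] chi_period[of n] by simp

lemma dchar_chi0: "dchar q chi0"
  by unfold_locales (auto simp: dirichlet_character_def chi0_def q_pos coprime_add_q)

lemma dchar_chi2: "dchar q chi2"
  by unfold_locales (auto simp: dirichlet_character_def chi2_def q_pos chi_mult chi_period chi_eq_0_iff power_mult_distrib)

lemma principal_chi0: "principal q chi0" by (simp add: principal_def chi0_def)

lemma norm_chi_twist:
  assumes "coprime (Suc n) q"
  shows "norm (chi (Suc n) / of_nat (Suc n) powr (\<i> * of_real t)) = 1"
  using assms by (simp add: norm_divide norm_chi norm_powr_real_powr del: of_nat_Suc)

lemma mangoldt_combination_nonneg:
  assumes x: "x > 0"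
  shows "0 \<le> Re (3 * dchar.D chi0 (Complex (1 + x) 0) + 4 * D (Complex (1 + x) t) + dchar.D chi2 (Complex (1 + x) (2 * t)))"
proof -
  let ?f = "\<lambda>n. 3 * (mangoldt (Suc n) * chi0 (Suc n) / of_nat (Suc n) powr Complex (1 + x) 0) +
     4 * (mangoldt (Suc n) * chi (Suc n) / of_nat (Suc n) powr Complex (1 + x) t) +
     mangoldt (Suc n) * chi2 (Suc n) / of_nat (Suc n) powr Complex (1 + x) (2 * t)"
  have "?f sums (3 * dchar.D chi0 (Complex (1 + x) 0) + 4 * D (Complex (1 + x) t) + dchar.D chi2 (Complex (1 + x) (2 * t)))"
    using x by (intro sums_add sums_mult D_sums dchar.D_sums[OF dchar_chi0] dchar.D_sums[OF dchar_chi2]) auto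
  then have "(\<lambda>n. Re (?f n)) sums Re (3 * dchar.D chi0 (Complex (1 + x) 0) + 4 * D (Complex (1 + x) t) + dchar.D chi2 (Complex (1 + x) (2 * t)))"
    by (rule sums_Re)
  moreover have "0 \<le> Re (?f n)" for n
  proof (cases "coprime (Suc n) q")
    case False
    then show ?thesis using chi_eq_0_iff[of "Suc n"] by (simp add: chi0_def chi2_def)
  next
    case True
    define r where "r = real (Suc n) powr (1 + x)"
    define z where "z = chi (Suc n) / of_nat (Suc n) powr (\<i> * of_real t)"
    have r: "r > 0" by (simp add: r_def)
    have z: "norm z = 1" unfolding z_def by (rule norm_chi_twist[OF True])
    have pw: "of_nat (Suc n) powr Complex (1 + x) u = of_real r * of_nat (Suc n) powr (\<i> * of_real u)" for u
    proof -
      have "Complex (1 + x) u = of_real (1 + x) + \<i> * of_real u" by (simp add: Complex_eq)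
      moreover have "of_nat (Suc n) powr (of_real (1 + x)) = (of_real r :: complex)"
        unfolding r_def using powr_of_real[of "real (Suc n)" "1 + x"] by simp
      ultimately show ?thesis by (simp add: powr_add del: of_nat_Suc of_real_add)
    qed
    have p2: "of_nat (Suc n) powr (\<i> * of_real (2 * t)) = (of_nat (Suc n) powr (\<i> * of_real t))\<^sup>2"
      by (simp add: powr_def exp_double[symmetric] mult_ac exp_of_nat_mult[symmetric] power2_eq_square exp_add[symmetric] del: of_nat_Suc)
    have L: "mangoldt (Suc n) = (of_real (mangoldt (Suc n)) :: complex)" by (simp add: of_real_mangoldt)
    have "?f n = of_real (mangoldt (Suc n) / r) * (3 + 4 * z + z\<^sup>2)"
      unfolding pw p2 L using True r by (simp add: chi0_def chi2_def z_def field_simps power_divide del: of_nat_Suc)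
    then have "Re (?f n) = mangoldt (Suc n) / r * (3 + 4 * Re z + Re (z\<^sup>2))"
    proof -
      assume "?f n = of_real (mangoldt (Suc n) / r) * (3 + 4 * z + z\<^sup>2)"
      moreover have "Re (of_real a * (3 + 4 * z + w)) = a * (3 + 4 * Re z + Re w)" for a w by simp
      ultimately show ?thesis by (simp only:)
    qed
    also have "\<dots> \<ge> 0" using three_four_one[OF z] r mangoldt_nonneg[of "Suc n"] by (intro mult_nonneg_nonneg) auto
    finally show ?thesis .
  qed
  ultimately show ?thesis by (rule sums_le[OF _ sums_zero, rotated])
qed

text \<open>With m the order at \<open>Complex 1 t\<close>, the nonnegative combination yields
  \<open>3 - 4 * m - m2 \<ge> 0\<close>, hence \<open>m = 0\<close>. The hypothesis guarantees that
  the term of \<open>chi2\<close> brings no pole; a pole there would add 1 on the left and permit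
  \<open>m = 1\<close>, which is why real characters at 1 need a separate argument.\<close>

lemma nonvanishing_line_1:
  assumes "t \<noteq> 0 \<or> \<not> principal q chi2"
  shows "Gfun (Complex 1 t) \<noteq> 0"
proof -
  interpret c0: dchar q chi0 by (rule dchar_chi0)
  interpret c2: dchar q chi2 by (rule dchar_chi2)
  obtain m0 where m0: "((\<lambda>x::real. of_real x * c0.D (Complex (1 + x) 0)) \<longlongrightarrow> (if (0::real) = 0 then c0.rho else 0) - of_nat m0) (at_right 0)"
    "m0 = 0 \<longleftrightarrow> c0.Gfun (Complex 1 0) \<noteq> 0" by (rule c0.D_limit[of 0])
  obtain m where m: "((\<lambda>x::real. of_real x * D (Complex (1 + x) t)) \<longlongrightarrow> (if t = 0 then rho else 0) - of_nat m) (at_right 0)"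
    "m = 0 \<longleftrightarrow> Gfun (Complex 1 t) \<noteq> 0" by (rule D_limit[of t])
  obtain m2 where m2: "((\<lambda>x::real. of_real x * c2.D (Complex (1 + x) (2 * t))) \<longlongrightarrow> (if 2 * t = 0 then c2.rho else 0) - of_nat m2) (at_right 0)"
    by (rule c2.D_limit[of "2 * t"])
  have "Complex 1 0 = 1" by (simp add: complex_eq_iff)
  then have m0_0: "m0 = 0" using m0(2) c0.Hfun_1_principal[OF principal_chi0] principal_chi0 by (simp add: c0.Gfun_def)
  have "principal q chi \<Longrightarrow> principal q chi2" by (simp add: principal_def chi2_def)
  then have r: "(if t = 0 then rho else 0) = 0" "(if 2 * t = 0 then c2.rho else 0) = 0"
    using assms by (auto simp: rho_def c2.rho_def)
  have lim: "((\<lambda>x::real. 3 * (of_real x * c0.D (Complex (1 + x) 0)) + 4 * (of_real x * D (Complex (1 + x) t)) + of_real x * c2.D (Complex (1 + x) (2 * t)))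
     \<longlongrightarrow> 3 * (1 - of_nat 0) + 4 * (0 - of_nat m) + (0 - of_nat m2)) (at_right 0)"
    using m0(1) m(1) m2 principal_chi0 unfolding r m0_0 c0.rho_def by (intro tendsto_intros) simp_all
  have "0 \<le> Re (3 * (1 - of_nat 0) + 4 * (0 - of_nat m) + (0 - of_nat m2))"
  proof (rule tendsto_lowerbound[OF tendsto_Re[OF lim]])
    show "\<forall>\<^sub>F x in at_right (0::real). 0 \<le> Re (3 * (of_real x * c0.D (Complex (1 + x) 0)) + 4 * (of_real x * D (Complex (1 + x) t)) + of_real x * c2.D (Complex (1 + x) (2 * t)))"
      using eventually_at_right_less[of "0::real"]
    proof eventually_elim
      case (elim x)
      have "3 * (of_real x * a) + 4 * (of_real x * b) + of_real x * c = of_real x * (3 * a + 4 * b + c)" for a b c :: complex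
        by (simp add: algebra_simps)
      moreover have "Re (of_real x * w) = x * Re w" for w by simp
      ultimately show ?case using mangoldt_combination_nonneg[OF elim, of t] elim by (simp only: mult_nonneg_nonneg less_imp_le)
    qed
  qed simp
  then have "4 * real m + real m2 \<le> 3" by simp
  then have "m = 0" by linarith
  then show ?thesis using m(2) by simp
qed

end

section \<open>Real characters at the point 1\<close>

lemma divisor_sum_prime_power:
  fixes f :: "nat \<Rightarrow> 'a :: comm_ring_1"
  assumes mult: "\<And>m n. f (m * n) = f m * f n" and p: "prime p" and M: "\<not> p dvd M" "M > 0"
  shows "(\<Sum>d | d dvd p ^ a * M. f d) = (\<Sum>i\<le>a. f (p ^ i)) * (\<Sum>d | d dvd M. f d)"
proof -
  have mx: "multiplicity p (p ^ i * d) = i" if "\<not> p dvd d" for i d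
  proof -
    have "d \<noteq> 0" using that by (intro notI) simp
    then show ?thesis using p that prime_elem_multiplicity_mult_distrib[of p "p ^ i" d] prime_gt_0_nat[OF p]
      by (simp add: not_dvd_imp_multiplicity_0 multiplicity_same_power)
  qed
  have bij: "bij_betw (\<lambda>x. p ^ fst x * snd x) ({..a} \<times> {d. d dvd M}) {d. d dvd p ^ a * M}"
  proof (rule bij_betwI')
    fix x y assume xy: "x \<in> {..a} \<times> {d. d dvd M}" "y \<in> {..a} \<times> {d. d dvd M}"
    have nd: "\<not> p dvd snd x" "\<not> p dvd snd y" using xy M by (auto intro: dvd_trans)
    show "(p ^ fst x * snd x = p ^ fst y * snd y) = (x = y)"
    proof
      assume e: "p ^ fst x * snd x = p ^ fst y * snd y"
      then have "fst x = fst y" using mx[OF nd(1), of "fst x"] mx[OF nd(2), of "fst y"] by simp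
      then show "x = y" using e prime_gt_0_nat[OF p] by (simp add: prod_eq_iff)
    qed simp
  next
    fix x assume "x \<in> {..a} \<times> {d. d dvd M}"
    then show "p ^ fst x * snd x \<in> {d. d dvd p ^ a * M}" by (auto intro!: mult_dvd_mono le_imp_power_dvd)
  next
    fix d assume "d \<in> {d. d dvd p ^ a * M}"
    then obtain u v where uv: "d = u * v" "u dvd p ^ a" "v dvd M" using division_decomp[of d "p ^ a" M] by blast
    then obtain i where "i \<le> a" "u = p ^ i" using p divides_primepow_nat by blast
    then show "\<exists>x\<in>{..a} \<times> {d. d dvd M}. d = p ^ fst x * snd x" using uv by (intro bexI[of _ "(i, v)"]) auto
  qed
  have "(\<Sum>i\<le>a. f (p ^ i)) * (\<Sum>d | d dvd M. f d) = (\<Sum>x\<in>{..a} \<times> {d. d dvd M}. f (p ^ fst x * snd x))"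
    by (simp add: sum_product sum.cartesian_product mult case_prod_unfold)
  also have "\<dots> = (\<Sum>d | d dvd p ^ a * M. f d)" by (rule sum.reindex_bij_betw[OF bij])
  finally show ?thesis ..
qed

text \<open>By multiplicativity the divisor sum is a product of sums of \<open>f p ^ i\<close> over
  \<open>i \<le> a\<close>. Each factor is nonnegative for \<open>f p\<close> in -1, 0, 1 and at
  least 1 when the exponent a is even, as it always is in a square.\<close>

lemma divisor_sum_nonneg_square:
  fixes f :: "nat \<Rightarrow> real"
  assumes mult: "\<And>m n. f (m * n) = f m * f n" and f1: "f 1 = 1" and vals: "\<And>n. f n \<in> {-1, 0, 1}" and N: "N > 0"
  shows "0 \<le> (\<Sum>d | d dvd N. f d) \<and> ((\<exists>k. N = k\<^sup>2) \<longrightarrow> 1 \<le> (\<Sum>d | d dvd N. f d))"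
  using N
proof (induction N rule: less_induct)
  case (less N)
  have pw: "f (p ^ i) = f p ^ i" for p i by (induction i) (use f1 in \<open>auto simp: mult\<close>)
  show ?case
  proof (cases "N = 1")
    case True
    then show ?thesis using f1 by simp
  next
    case False
    then obtain p where p: "prime p" "p dvd N" using prime_factor_nat by blast
    define a where "a = multiplicity p N"
    obtain M where M: "N = p ^ a * M" "\<not> p dvd M"
    proof (rule multiplicity_decompose'[of N p])
      show "\<not> is_unit p" using p(1) not_prime_unit by blast
    qed (use less.prems in \<open>auto simp: a_def\<close>)
    have M0: "M > 0" using M(1) less.prems by (cases M) auto
    have a0: "a > 0"
    proof (rule ccontr)
      assume "\<not> a > 0"
      then show False using M p by simp
    qed
    have "1 < p ^ a" by (rule one_less_power[OF prime_gt_1_nat[OF p(1)] a0])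
    then have "M * 1 < M * p ^ a" using M0 by (intro mult_strict_left_mono)
    then have "M < N" unfolding M(1) by (simp only: mult_1_right mult.commute)
    note IH = less.IH[OF this M0]
    have S: "(\<Sum>d | d dvd N. f d) = (\<Sum>i\<le>a. f p ^ i) * (\<Sum>d | d dvd M. f d)"
      unfolding M(1) by (subst divisor_sum_prime_power[OF mult p(1) M(2) M0]) (simp add: pw)
    have alt: "(\<Sum>i\<le>a. (-1::real) ^ i) = (if even a then 1 else 0)" by (induction a) auto
    have P: "0 \<le> (\<Sum>i\<le>a. f p ^ i) \<and> (even a \<longrightarrow> 1 \<le> (\<Sum>i\<le>a. f p ^ i))"
    proof -
      consider "f p = -1" | "f p = 0" | "f p = 1" using vals[of p] by auto
      then show ?thesis
      proof cases
        case 2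
        have "(\<Sum>i\<le>a. (0::real) ^ i) = (\<Sum>i\<in>{0}. 0 ^ i)" by (rule sum.mono_neutral_right) auto
        then show ?thesis using 2 by simp
      qed (auto simp: alt)
    qed
    show ?thesis
    proof (intro conjI impI)
      show "0 \<le> (\<Sum>d | d dvd N. f d)" unfolding S using P IH by simp
      assume "\<exists>k. N = k\<^sup>2"
      then obtain k where k: "N = k\<^sup>2" by blast
      have k0: "k \<noteq> 0" using k less.prems by auto
      have ak: "a = 2 * multiplicity p k" unfolding a_def k using p(1) k0 by (simp add: prime_elem_multiplicity_power_distrib)
      obtain l where l: "k = p ^ multiplicity p k * l" using multiplicity_dvd[of p k] by (auto elim: dvdE)
      have "k\<^sup>2 = (p ^ multiplicity p k * l)\<^sup>2" by (rule arg_cong[OF l])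
      also have "\<dots> = p ^ a * l\<^sup>2" unfolding ak by (simp only: power_mult_distrib power_mult[symmetric] mult.commute)
      finally have "p ^ a * M = p ^ a * l\<^sup>2" by (simp only: M(1)[symmetric] k[symmetric])
      then have "M = l\<^sup>2" using prime_gt_0_nat[OF p(1)] by auto
      then have "1 \<le> (\<Sum>i\<le>a. f p ^ i)" "1 \<le> (\<Sum>d | d dvd M. f d)" using P IH ak by auto
      then show "1 \<le> (\<Sum>d | d dvd N. f d)" unfolding S using mult_mono[of 1 "\<Sum>i\<le>a. f p ^ i" 1 "\<Sum>d | d dvd M. f d"] by simp
    qed
  qed
qed

lemma sum_divisors_reindex:
  fixes f g :: "nat \<Rightarrow> real"
  shows "(\<Sum>n=1..N. \<Sum>k=1..N div n. f n * g (n * k)) = (\<Sum>m=1..N. (\<Sum>n | n dvd m. f n) * g m)"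
proof -
  have "(\<Sum>n=1..N. \<Sum>k=1..N div n. f n * g (n * k)) = (\<Sum>(n, k)\<in>(SIGMA n:{1..N}. {1..N div n}). f n * g (n * k))"
    by (rule sum.Sigma) auto
  also have "\<dots> = (\<Sum>(m, n)\<in>(SIGMA m:{1..N}. {n. n dvd m}). f n * g m)"
  proof (rule sum.reindex_bij_witness[of _ "\<lambda>(m, n). (n, m div n)" "\<lambda>(n, k). (n * k, n)"])
    fix a assume "a \<in> (SIGMA n:{1..N}. {1..N div n})"
    then obtain n k where a: "a = (n, k)" "1 \<le> n" "1 \<le> k" "k \<le> N div n" by auto
    have "n * k \<le> n * (N div n)" using a by simp
    also have "\<dots> \<le> N" by simp
    finally show "(case a of (n, k) \<Rightarrow> (n * k, n)) \<in> (SIGMA m:{1..N}. {n. n dvd m})" using a by auto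
    show "(case case a of (n, k) \<Rightarrow> (n * k, n) of (m, n) \<Rightarrow> (n, m div n)) = a" using a by simp
    show "(case case a of (n, k) \<Rightarrow> (n * k, n) of (m, n) \<Rightarrow> f n * g m) = (case a of (n, k) \<Rightarrow> f n * g (n * k))" using a by simp
  next
    fix b assume "b \<in> (SIGMA m:{1..N}. {n. n dvd m})"
    then obtain m n where b: "b = (m, n)" "1 \<le> m" "m \<le> N" "n dvd m" by auto
    have n: "1 \<le> n" using b by (metis One_nat_def Suc_leI dvd_pos_nat less_le_trans zero_less_one)
    have "n \<le> m" using b by (intro dvd_imp_le) auto
    then have "1 \<le> m div n" using n by (simp add: Suc_leI div_greater_zero_iff)
    moreover have "m div n \<le> N div n" using b by (intro div_le_mono)
    ultimately show "(case b of (m, n) \<Rightarrow> (n, m div n)) \<in> (SIGMA n:{1..N}. {1..N div n})" using b n \<open>n \<le> m\<close> by auto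
    show "(case case b of (m, n) \<Rightarrow> (n, m div n) of (n, k) \<Rightarrow> (n * k, n)) = b" using b by simp
  qed
  also have "\<dots> = (\<Sum>m=1..N. \<Sum>n | n dvd m. f n * g m)"
    by (rule sum.Sigma[symmetric]) auto
  finally show ?thesis by (simp add: sum_distrib_right)
qed

text \<open>The inequality of arithmetic and geometric means, applied to the terms with indices i
  and \<open>n - 1 - i\<close>.\<close>

lemma geometric_sum_ge:
  fixes r :: real assumes "0 \<le> r"
  shows "real n * r ^ (n - 1) \<le> (\<Sum>i<n. (r\<^sup>2) ^ i)"
proof -
  have "(\<Sum>i<n. 2 * r ^ (n - 1)) \<le> (\<Sum>i<n. (r\<^sup>2) ^ i + (r\<^sup>2) ^ (n - Suc i))"
  proof (rule sum_mono)
    fix i assume "i \<in> {..<n}"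
    then have "n - 1 = i + (n - Suc i)" by auto
    then have "2 * r ^ (n - 1) = 2 * (r ^ i * r ^ (n - Suc i))" by (simp only: power_add)
    also have "\<dots> \<le> (r ^ i)\<^sup>2 + (r ^ (n - Suc i))\<^sup>2" using zero_le_power2[of "r ^ i - r ^ (n - Suc i)"] by (simp add: power2_diff)
    finally show "2 * r ^ (n - 1) \<le> (r\<^sup>2) ^ i + (r\<^sup>2) ^ (n - Suc i)" by (simp only: power_mult[symmetric] mult.commute)
  qed
  also have "\<dots> = 2 * (\<Sum>i<n. (r\<^sup>2) ^ i)"
    using sum.nat_diff_reindex[of "\<lambda>i. (r\<^sup>2) ^ i" n] by (simp add: sum.distrib)
  finally show ?thesis by simp
qed

text \<open>The polar part at \<open>t = 1\<close> of the Lambert term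
  \<open>t ^ n / (1 - t ^ n)\<close>, minus that term. If the sum of \<open>f n / n\<close> is 0,
  the polar parts cancel, and the Lambert series is minus the sum of
  \<open>f n * monsky t n\<close>.\<close>

definition monsky :: "real \<Rightarrow> nat \<Rightarrow> real" where
  "monsky t n = 1 / (real n * (1 - t)) - t ^ n / (1 - t ^ n)"

context
  fixes t :: real assumes t: "0 < t" "t < 1"
begin

lemma one_minus_power: "1 - t ^ n = (1 - t) * (\<Sum>i<n. t ^ i)"
  using sum_gp_strict[of t n] t by (simp add: field_simps)

lemma geometric_pos: "n > 0 \<Longrightarrow> (\<Sum>i<n. t ^ i) > 0"
  using t by (intro sum_pos) auto

lemma monsky_nonneg: assumes "n > 0" shows "monsky t n \<ge> 0"
proof -
  have "real n * t ^ n = (\<Sum>i<n. t ^ n)" by simp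
  also have "\<dots> \<le> (\<Sum>i<n. t ^ i)" using t by (intro sum_mono power_decreasing) auto
  finally have "(1 - t) * (real n * t ^ n) \<le> (1 - t) * (\<Sum>i<n. t ^ i)" using t by (intro mult_left_mono) auto
  then have "real n * (1 - t) * t ^ n \<le> 1 - t ^ n" unfolding one_minus_power by (simp add: mult_ac)
  moreover have "0 < 1 - t ^ n" using t assms by (simp add: power_less_one_iff)
  moreover have "real n * (1 - t) > 0" using t assms by simp
  ultimately have "t ^ n / (1 - t ^ n) \<le> 1 / (real n * (1 - t))"
    by (simp only: divide_le_eq le_divide_eq if_True) (simp add: mult_ac)
  then show ?thesis unfolding monsky_def by simp
qed

text \<open>With \<open>s n\<close> the geometric sum, the claim reduces to
  \<open>n * (n + 1) * t ^ n \<le> s n * s (n + 1)\<close>. This follows from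
  \<open>geometric_sum_ge\<close> for both factors with the square root of t, and a spare factor of
  at most 1. Monotonicity is what permits summation by parts.\<close>

lemma monsky_decreasing: assumes n: "n > 0" shows "monsky t (Suc n) \<le> monsky t n"
proof -
  define s where "s n = (\<Sum>i<n. t ^ i)" for n
  define r where "r = sqrt t"
  have r: "0 \<le> r" "r \<le> 1" "r\<^sup>2 = t" using t by (auto simp: r_def)
  have s: "s n > 0" "s (Suc n) > 0" unfolding s_def using geometric_pos[of n] geometric_pos[of "Suc n"] n by auto
  have rec: "s (Suc n) = 1 + t * s n" unfolding s_def by (subst sum.lessThan_Suc_shift) (simp add: sum_distrib_left)
  have "(real n * r ^ (n - 1)) * (real (Suc n) * r ^ (Suc n - 1)) \<le> s n * s (Suc n)"
  proof (rule mult_mono)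
    show "real n * r ^ (n - 1) \<le> s n" "real (Suc n) * r ^ (Suc n - 1) \<le> s (Suc n)"
      unfolding s_def using geometric_sum_ge[OF r(1)] r(3) by metis+
  qed (use r s in auto)
  moreover have "t ^ n \<le> r ^ (n - 1) * r ^ (Suc n - 1)"
  proof -
    have "t ^ n = r ^ (2 * n)" unfolding r(3)[symmetric] by (rule power_mult[symmetric])
    also have "\<dots> \<le> r ^ (n - 1 + (Suc n - 1))" using r by (intro power_decreasing) auto
    finally show ?thesis by (simp only: power_add)
  qed
  then have "real n * real (Suc n) * t ^ n \<le> real n * real (Suc n) * (r ^ (n - 1) * r ^ (Suc n - 1))"
    by (intro mult_left_mono) auto
  moreover have "real n * real (Suc n) * (r ^ (n - 1) * r ^ (Suc n - 1)) = (real n * r ^ (n - 1)) * (real (Suc n) * r ^ (Suc n - 1))"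
    by (simp only: mult_ac)
  ultimately have key: "real n * real (Suc n) * t ^ n \<le> s n * s (Suc n)" by linarith
  have "t ^ n / s n - t ^ Suc n / s (Suc n) = t ^ n * (s (Suc n) - t * s n) / (s n * s (Suc n))"
    using s by (simp add: field_simps)
  also have "s (Suc n) - t * s n = 1" by (simp add: rec)
  finally have e1: "t ^ n / s n - t ^ Suc n / s (Suc n) = t ^ n / (s n * s (Suc n))" by simp
  have e2: "1 / real n - 1 / real (Suc n) = 1 / (real n * real (Suc n))" using n by (simp add: field_simps)
  have "0 < s n * s (Suc n)" "0 < real n * real (Suc n)" using s n by auto
  then have "t ^ n / (s n * s (Suc n)) \<le> 1 / (real n * real (Suc n))"
    using key by (simp only: divide_le_eq le_divide_eq if_True) (simp add: mult_ac)
  then have "0 \<le> (1 / real n - 1 / real (Suc n)) - (t ^ n / s n - t ^ Suc n / s (Suc n))"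
    unfolding e1 e2 by simp
  moreover have "monsky t n - monsky t (Suc n) = ((1 / real n - 1 / real (Suc n)) - (t ^ n / s n - t ^ Suc n / s (Suc n))) / (1 - t)"
    unfolding monsky_def one_minus_power s_def using t by (simp add: diff_divide_distrib mult.commute)
  ultimately have "monsky t n - monsky t (Suc n) \<ge> 0" using t by simp
  then show ?thesis by simp
qed

lemma monsky_1: "monsky t 1 = 1"
  using t by (simp add: monsky_def field_simps)

end

context dchar
begin

lemma norm_chi_interval_sum:
  assumes "\<not> principal q chi" shows "norm (\<Sum>i<k. chi (N + i)) \<le> real q"
proof -
  have z: "(\<Sum>i<q. chi (N + i)) = 0" for N
  proof (induction N)
    case (Suc N)
    have "(\<Sum>i<q. chi (Suc N + i)) + chi N = (\<Sum>i<Suc q. chi (N + i))" by (subst sum.lessThan_Suc_shift) simp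
    then show ?case using Suc.IH chi_period[of N] by simp
  qed (simp add: sum_nonprincipal[OF assms])
  show ?thesis
  proof (induction k arbitrary: N rule: less_induct)
    case (less k)
    show ?case
    proof (cases "k < q")
      case True
      have "norm (\<Sum>i<k. chi (N + i)) \<le> (\<Sum>i<k. 1)" by (rule sum_norm_le) (rule norm_chi_le)
      then show ?thesis using True by simp
    next
      case False
      then obtain j where j: "k = q + j" by (metis le_Suc_ex not_less)
      have "(\<Sum>i<q + j. chi (N + i)) = (\<Sum>i<q. chi (N + i)) + (\<Sum>i<j. chi (N + q + i))"
        by (induction j) (auto simp: add_ac)
      then show ?thesis using less.IH[of j "N + q"] z[of N] j q_pos by simp
    qed
  qed
qed

text \<open>At 1 the series is reached only as a limit of \<open>1 + x\<close> with x decreasing to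
  0. Summation by parts bounds the tail uniformly in x by the bounded character sums, so the
  estimate survives the limit.\<close>

lemma partial_sums_at_1:
  assumes np: "\<not> principal q chi"
  shows "norm (Gfun 1 - (\<Sum>n<N. chi (Suc n) / of_nat (Suc n))) \<le> real q / real (Suc N)"
proof -
  have tail: "norm (F (of_real (1 + x)) - (\<Sum>n<N. chi (Suc n) / of_nat (Suc n) powr of_real (1 + x))) \<le> real q / real (Suc N)"
    if x: "x > 0" for x :: real
  proof -
    let ?f = "\<lambda>n. chi (Suc n) / of_nat (Suc n) powr of_real (1 + x)"
    let ?g = "\<lambda>i. 1 / real (Suc (N + i)) powr (1 + x)"
    have s: "?f sums F (of_real (1 + x))" using x by (intro F_sums) simp
    have "(\<lambda>i. ?f (i + N)) sums (F (of_real (1 + x)) - (\<Sum>n<N. ?f n))" using s by (rule sums_split_initial_segment)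
    then have lim: "(\<lambda>k. \<Sum>i<k. ?f (i + N)) \<longlonglongrightarrow> F (of_real (1 + x)) - (\<Sum>n<N. ?f n)" by (simp add: sums_def)
    have "norm (\<Sum>i<k. ?f (i + N)) \<le> real q / real (Suc N)" for k
    proof -
      have e: "?f (i + N) = chi (Suc N + i) * of_real (?g i)" for i
      proof -
        have "of_nat (Suc (N + i)) powr of_real (1 + x) = (of_real (real (Suc (N + i)) powr (1 + x)) :: complex)"
          using powr_of_real[of "real (Suc (N + i))" "1 + x"] by simp
        then show ?thesis by (simp add: add.commute del: of_nat_Suc of_real_add)
      qed
      have "norm (\<Sum>i<k. chi (Suc N + i) * of_real (?g i)) \<le> real q * ?g 0"
        by (rule abel_summation_bound[OF norm_chi_interval_sum[OF np]]) (use x in \<open>auto intro!: divide_left_mono powr_mono2 simp del: of_nat_Suc\<close>)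
      also have "\<dots> \<le> real q * (1 / real (Suc N) powr 1)"
      proof (intro mult_left_mono divide_left_mono)
        show "real (Suc N) powr 1 \<le> real (Suc (N + 0)) powr (1 + x)" unfolding add_0_right using x by (intro powr_mono) auto
      qed auto
      finally show ?thesis unfolding e by simp
    qed
    then show ?thesis by (intro LIMSEQ_le_const2[OF tendsto_norm[OF lim]]) auto
  qed
  have x1: "((\<lambda>x::real. complex_of_real (1 + x)) \<longlongrightarrow> 1) (at_right 0)" by (auto intro!: tendsto_eq_intros)
  have cont: "isCont Gfun 1" using holomorphic_on_imp_continuous_on[OF Gfun_holo] by (simp add: continuous_on_eq_continuous_at)
  have lim: "((\<lambda>x::real. Gfun (of_real (1 + x)) - (\<Sum>n<N. chi (Suc n) / of_nat (Suc n) powr of_real (1 + x))) \<longlongrightarrow> Gfun 1 - (\<Sum>n<N. chi (Suc n) / of_nat (Suc n) powr 1)) (at_right 0)"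
    by (intro tendsto_diff tendsto_sum tendsto_divide tendsto_const tendsto_powr_complex[OF _ tendsto_const x1] isCont_tendsto_compose[OF cont x1])
      (auto simp: complex_nonpos_Reals_iff simp del: of_nat_Suc)
  have "norm (Gfun 1 - (\<Sum>n<N. chi (Suc n) / of_nat (Suc n) powr 1)) \<le> real q / real (Suc N)"
  proof (rule tendsto_upperbound[OF tendsto_norm[OF lim]])
    show "\<forall>\<^sub>F x in at_right (0::real). norm (Gfun (of_real (1 + x)) - (\<Sum>n<N. chi (Suc n) / of_nat (Suc n) powr of_real (1 + x))) \<le> real q / real (Suc N)"
      using eventually_at_right_less[of "0::real"]
    proof eventually_elim
      case (elim x)
      have "Gfun (of_real (1 + x)) = F (of_real (1 + x))" using elim np by (subst Gfun_eq_F) auto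
      then show ?case using tail[OF elim] by simp
    qed
  qed simp
  then show ?thesis by (simp del: of_nat_Suc)
qed

text \<open>Monsky's argument: if the value at 1 vanished, the Lambert series of the divisor sums of the
  real character would stay bounded by \<open>q\<close> as \<open>t\<close> tends to 1, although it dominates the theta series.\<close>
lemma nonvanishing_at_1_real:
  assumes np: "\<not> principal q chi" and p2: "principal q chi2"
  shows "Gfun 1 \<noteq> 0"
proof
  assume z: "Gfun 1 = 0"
  define f where "f n = Re (chi n)" for n
  have vals: "f n \<in> {-1, 0, 1} \<and> chi n = of_real (f n)" for n
  proof (cases "coprime n q")
    case True
    then have "(chi n)\<^sup>2 = 1" using p2 by (simp add: principal_def chi2_def)
    then have "chi n = 1 \<or> chi n = -1" by (simp add: power2_eq_1_iff)
    then show ?thesis by (auto simp: f_def)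
  next
    case False
    then have "chi n = 0" using chi_eq_0_iff by blast
    then show ?thesis by (simp add: f_def)
  qed
  have chi_f: "chi n = of_real (f n)" for n using vals by blast
  have f_mult: "f (m * n) = f m * f n" for m n
  proof -
    have "complex_of_real (f (m * n)) = of_real (f m * f n)" using chi_mult[of m n] unfolding chi_f by simp
    then show ?thesis by (simp only: of_real_eq_iff)
  qed
  have f1: "f 1 = 1" by (simp add: f_def)
  have fle: "\<bar>f n\<bar> \<le> 1" for n using vals[of n] by auto
  note r = divisor_sum_nonneg_square[of f, OF f_mult f1 conjunct1[OF vals]]
  have sum1: "\<bar>\<Sum>n=1..N. f n / real n\<bar> \<le> real q / real (Suc N)" for N
  proof -
    have "(\<Sum>n<N. chi (Suc n) / of_nat (Suc n)) = of_real (\<Sum>n<N. f (Suc n) / real (Suc n))"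
      by (simp add: chi_f del: of_nat_Suc)
    moreover have "(\<Sum>n<N. f (Suc n) / real (Suc n)) = (\<Sum>n=1..N. f n / real n)"
      by (rule sum.reindex_bij_witness[of _ "\<lambda>n. n - 1" Suc]) auto
    ultimately have e: "(\<Sum>n<N. chi (Suc n) / of_nat (Suc n)) = of_real (\<Sum>n=1..N. f n / real n)" by (simp only:)
    show ?thesis using partial_sums_at_1[OF np, of N] unfolding e z by (simp only: diff_0 norm_minus_cancel norm_of_real)
  qed
  \<comment> \<open>Everything is cut off at N, so that all rearrangements are of finite sums. The
    two additional terms are the cost: one from the partial sum at 1, the other from the incomplete
    geometric series; both vanish as N grows with t fixed.\<close>
  have upper: "(\<Sum>m=1..N. (\<Sum>n | n dvd m. f n) * t ^ m) \<le> real q + real q / real (Suc N) / (1 - t) + real N * t ^ N / (1 - t)"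
    if t: "0 < t" "t < 1" for t N
  proof -
    have b: "\<bar>\<Sum>n=1..N. f n * monsky t n\<bar> \<le> real q"
    proof -
      have "norm (\<Sum>i<N. chi (1 + i) * of_real (monsky t (1 + i))) \<le> real q * monsky t (1 + 0)"
        by (rule abel_summation_bound[OF norm_chi_interval_sum[OF np]]) (auto intro: monsky_decreasing[OF t] monsky_nonneg[OF t])
      moreover have "(\<Sum>i<N. chi (1 + i) * of_real (monsky t (1 + i))) = of_real (\<Sum>i<N. f (1 + i) * monsky t (1 + i))"
        by (simp add: chi_f)
      moreover have "(\<Sum>i<N. f (1 + i) * monsky t (1 + i)) = (\<Sum>n=1..N. f n * monsky t n)"
        by (rule sum.reindex_bij_witness[of _ "\<lambda>n. n - 1" Suc]) auto
      ultimately show ?thesis using monsky_1[OF t] by (simp only: norm_of_real add_0_right mult_1_right)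
    qed
    have geo: "(\<Sum>k=1..K. t ^ (n * k)) = t ^ n / (1 - t ^ n) - t ^ (n * Suc K) / (1 - t ^ n)" if n: "n > 0" for n K
    proof -
      have tn: "1 - t ^ n > 0" using t n by (simp add: power_less_one_iff)
      show ?thesis
      proof (induction K)
        case (Suc K)
        have "t ^ (n * Suc (Suc K)) = t ^ (n * Suc K) * t ^ n" by (simp add: power_add[symmetric] add.commute)
        moreover have "t ^ (n * Suc K) = t ^ (n * Suc K) * (1 - t ^ n) / (1 - t ^ n)" using tn by simp
        ultimately have "t ^ (n * Suc K) = t ^ (n * Suc K) / (1 - t ^ n) - t ^ (n * Suc (Suc K)) / (1 - t ^ n)"
          by (simp only: right_diff_distrib diff_divide_distrib mult_1_right)
        then show ?case using Suc.IH by simp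
      qed simp
    qed
    have "(\<Sum>m=1..N. (\<Sum>n | n dvd m. f n) * t ^ m) = (\<Sum>n=1..N. \<Sum>k=1..N div n. f n * t ^ (n * k))"
      by (rule sum_divisors_reindex[symmetric])
    also have "\<dots> = (\<Sum>n=1..N. f n / real n / (1 - t) - f n * monsky t n - f n * (t ^ (n * Suc (N div n)) / (1 - t ^ n)))"
    proof (rule sum.cong[OF refl])
      fix n assume "n \<in> {1..N}"
      then have n: "n > 0" by simp
      have "t ^ n / (1 - t ^ n) = 1 / (real n * (1 - t)) - monsky t n" by (simp add: monsky_def)
      then show "(\<Sum>k=1..N div n. f n * t ^ (n * k)) = f n / real n / (1 - t) - f n * monsky t n - f n * (t ^ (n * Suc (N div n)) / (1 - t ^ n))"
        unfolding sum_distrib_left[symmetric] geo[OF n] by (simp add: right_diff_distrib)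
    qed
    also have "\<dots> = (\<Sum>n=1..N. f n / real n) / (1 - t) - (\<Sum>n=1..N. f n * monsky t n) - (\<Sum>n=1..N. f n * (t ^ (n * Suc (N div n)) / (1 - t ^ n)))"
      by (simp add: sum_subtractf sum_divide_distrib)
    also have "\<dots> \<le> real q / real (Suc N) / (1 - t) + real q + real N * t ^ N / (1 - t)"
    proof -
      have a: "(\<Sum>n=1..N. f n / real n) / (1 - t) \<le> real q / real (Suc N) / (1 - t)"
        using sum1[of N] t by (intro divide_right_mono) (auto simp: abs_le_iff)
      have "\<bar>f n * (t ^ (n * Suc (N div n)) / (1 - t ^ n))\<bar> \<le> t ^ N / (1 - t)" if "n \<in> {1..N}" for n
      proof -
        have n: "n > 0" using that by simp
        have "N \<le> n * Suc (N div n)" using n by (metis dividend_less_times_div less_imp_le mult_Suc_right)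
        then have 1: "t ^ (n * Suc (N div n)) \<le> t ^ N" using t by (intro power_decreasing) auto
        have "t ^ n \<le> t ^ 1" using t n by (intro power_decreasing) auto
        then have 2: "1 - t \<le> 1 - t ^ n" by simp
        have "\<bar>f n\<bar> * (t ^ (n * Suc (N div n)) / (1 - t ^ n)) \<le> 1 * (t ^ N / (1 - t))"
          using fle[of n] 1 2 t by (intro mult_mono frac_le) auto
        then show ?thesis using 2 t by (simp add: abs_mult)
      qed
      then have "\<bar>\<Sum>n=1..N. f n * (t ^ (n * Suc (N div n)) / (1 - t ^ n))\<bar> \<le> (\<Sum>n=1..N. t ^ N / (1 - t))"
        by (rule order_trans[OF sum_abs sum_mono])
      then have c: "\<bar>\<Sum>n=1..N. f n * (t ^ (n * Suc (N div n)) / (1 - t ^ n))\<bar> \<le> real N * t ^ N / (1 - t)" by simp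
      show ?thesis using a b c by linarith
    qed
    finally show ?thesis by simp
  qed
  \<comment> \<open>Only squares are kept: their divisor sums are at least 1, and all others are
    nonnegative.\<close>
  have lower: "real M * t ^ (M\<^sup>2) \<le> (\<Sum>m=1..N. (\<Sum>n | n dvd m. f n) * t ^ m)"
    if t: "0 < t" "t < 1" and N: "M\<^sup>2 \<le> N" for t N M
  proof -
    have inj: "inj_on (\<lambda>k::nat. k\<^sup>2) {1..M}" by (auto simp: inj_on_def)
    have "real M * t ^ (M\<^sup>2) = (\<Sum>k=1..M. 1 * t ^ (M\<^sup>2))" by simp
    also have "\<dots> \<le> (\<Sum>k=1..M. (\<Sum>n | n dvd k\<^sup>2. f n) * t ^ (k\<^sup>2))"
    proof (rule sum_mono)
      fix k assume k: "k \<in> {1..M}"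
      have "1 \<le> (\<Sum>n | n dvd k\<^sup>2. f n)" using r[of "k\<^sup>2"] k by auto
      moreover have "t ^ (M\<^sup>2) \<le> t ^ (k\<^sup>2)" using k t by (intro power_decreasing) (auto intro: power_mono)
      ultimately show "1 * t ^ (M\<^sup>2) \<le> (\<Sum>n | n dvd k\<^sup>2. f n) * t ^ (k\<^sup>2)" using t by (intro mult_mono) auto
    qed
    also have "\<dots> = (\<Sum>m\<in>(\<lambda>k. k\<^sup>2) ` {1..M}. (\<Sum>n | n dvd m. f n) * t ^ m)" unfolding sum.reindex[OF inj] o_def ..
    also have "\<dots> \<le> (\<Sum>m=1..N. (\<Sum>n | n dvd m. f n) * t ^ m)"
    proof (rule sum_mono2)
      show "(\<lambda>k. k\<^sup>2) ` {1..M} \<subseteq> {1..N}"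
      proof
        fix x assume "x \<in> (\<lambda>k. k\<^sup>2) ` {1..M}"
        then obtain k where k: "x = k\<^sup>2" "1 \<le> k" "k \<le> M" by auto
        then have "k\<^sup>2 \<le> N" by (intro order_trans[OF _ N] power_mono) auto
        then show "x \<in> {1..N}" using k by auto
      qed
      fix m assume "m \<in> {1..N} - (\<lambda>k. k\<^sup>2) ` {1..M}"
      then show "0 \<le> (\<Sum>n | n dvd m. f n) * t ^ m" using r[of m] t by auto
    qed simp
    finally show ?thesis .
  qed
  \<comment> \<open>One more than the upper bound q: M squares already contradict it as t tends to
    1.\<close>
  define M where "M = q + 1"
  have "real M * t ^ (M\<^sup>2) \<le> real q" if t: "0 < t" "t < 1" for t
  proof -
    have lim: "(\<lambda>N. real q + real q / real (Suc N) / (1 - t) + real N * t ^ N / (1 - t)) \<longlonglongrightarrow> real q + 0 / (1 - t) + 0 / (1 - t)"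
    proof (intro tendsto_intros)
      show "(\<lambda>N. real N * t ^ N) \<longlonglongrightarrow> 0" using powser_times_n_limit_0[of t] t by simp
      show "(\<lambda>N. real q / real (Suc N)) \<longlonglongrightarrow> 0" by (rule LIMSEQ_Suc[OF lim_const_over_n])
    qed (use t in auto)
    have "real M * t ^ (M\<^sup>2) \<le> real q + 0 / (1 - t) + 0 / (1 - t)"
      by (rule LIMSEQ_le_const[OF lim]) (use order_trans[OF lower[OF t] upper[OF t]] in blast)
    then show ?thesis by simp
  qed
  moreover have "((\<lambda>t::real. real M * t ^ (M\<^sup>2)) \<longlongrightarrow> real M * 1 ^ (M\<^sup>2)) (at_left 1)"
    by (intro tendsto_intros)
  moreover have "\<forall>\<^sub>F t in at_left (1::real). 0 < t \<and> t < 1"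
    by (auto simp: eventually_at_left_field intro!: exI[of _ 0])
  ultimately have "real M * 1 ^ (M\<^sup>2) \<le> real q"
    by (intro tendsto_upperbound[where F="at_left 1" and f="\<lambda>t::real. real M * t ^ (M\<^sup>2)"]) (auto elim: eventually_mono)
  then show False by (simp add: M_def)
qed

theorem GRH_Gfun_nonzero:
  assumes "GRH" "Re s > 1/2" shows "Gfun s \<noteq> 0"
proof -
  consider "Re s < 1" | "Re s = 1" | "Re s > 1" by linarith
  then show ?thesis
  proof cases
    case 1
    then have "s \<noteq> 1" by auto
    then show ?thesis using GRH_Hfun_nonzero[OF assms(1,2) 1] by (simp add: Gfun_eq)
  next
    case 2
    then have s: "s = Complex 1 (Im s)" by (simp add: complex_eq_iff)
    consider "principal q chi" "Im s = 0" | "\<not> principal q chi" "principal q chi2" "Im s = 0" | "Im s \<noteq> 0 \<or> \<not> principal q chi2" by blast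
    then show ?thesis
    proof cases
      case 1
      then have "s = 1" using s by (simp add: complex_eq_iff)
      then show ?thesis using Hfun_1_principal 1 by (simp add: Gfun_def)
    next
      case 2
      then have "s = 1" using s by (simp add: complex_eq_iff)
      then show ?thesis using nonvanishing_at_1_real 2 by simp
    next
      case 3
      then show ?thesis using nonvanishing_line_1[of "Im s"] s by simp
    qed
  next
    case 3
    then show ?thesis by (rule Gfun_nonzero_gt1)
  qed
qed

end

section \<open>Riesz means of the von Mangoldt function under GRH\<close>

definition zeta32 :: real where "zeta32 = (\<Sum>n. 1 / real (Suc n) powr (3/2))"

lemma zeta32_nonneg: "zeta32 \<ge> 0"
  unfolding zeta32_def by (intro suminf_nonneg dchar.summable_powr_Suc[OF dchar.dchar_chi0[of 1 "\<lambda>_. 1"]])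
    (auto simp: dchar_def dirichlet_character_def)

context dchar
begin

text \<open>Away from 1, division by \<open>s - 1\<close> costs at most a factor 2. Inside the disc
  of radius 1/2 around 1 the maximum modulus principle transfers the bound from the circle, where
  \<open>norm w + 1 \<le> 5/2\<close>; hence the second condition on X.\<close>

lemma norm_Gfun_le:
  assumes s: "Re s \<ge> 1/2" and X: "norm s + 1 \<le> X" "5/2 \<le> X"
  shows "norm (Gfun s) \<le> 2 * (1 + zeta32) * real q * X\<^sup>2"
proof -

  have H: "norm (Hfun w) \<le> (1 + zeta32) * real q * Y\<^sup>2" if "Re w \<ge> 1/2" "norm w + 1 \<le> Y" for w Y
  proof -
    have Y: "1 \<le> Y" using that norm_ge_zero[of w] by linarith
    have "norm (w - 1) \<le> Y" using that norm_triangle_ineq4[of w 1] by simp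
    then have "norm (w - 1) * norm w \<le> Y * Y" using that Y by (intro mult_mono) auto
    then have "norm (w - 1) * norm w * zeta32 \<le> Y\<^sup>2 * zeta32"
      using zeta32_nonneg by (intro mult_right_mono) (auto simp: power2_eq_square)
    moreover have "1 \<le> Y\<^sup>2" using Y by simp
    ultimately have "1 + norm (w - 1) * norm w * zeta32 \<le> (1 + zeta32) * Y\<^sup>2" by (simp add: algebra_simps)
    then have "real q * (1 + norm (w - 1) * norm w * zeta32) \<le> real q * ((1 + zeta32) * Y\<^sup>2)" by (intro mult_left_mono) auto
    moreover have "real q * ((1 + zeta32) * Y\<^sup>2) = (1 + zeta32) * real q * Y\<^sup>2" by (simp only: mult_ac)
    ultimately show ?thesis using Hfun_bound[OF that(1)] unfolding zeta32_def by linarith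
  qed
  let ?B = "(1 + zeta32) * real q * X\<^sup>2"
  have B0: "0 \<le> ?B" using zeta32_nonneg by simp
  show ?thesis
  proof (cases "principal q chi")
    case True
    then have "norm (Gfun s) \<le> ?B" using H[OF s X(1)] by (simp add: Gfun_def)
    then show ?thesis using B0 by linarith
  next
    case np: False
    have far: "norm (Gfun w) \<le> 2 * norm (Hfun w)" if "norm (w - 1) \<ge> 1/2" for w
    proof -
      have "w \<noteq> 1" using that by auto
      then have "norm (Gfun w) = norm (Hfun w) / norm (w - 1)" using np by (simp add: Gfun_eq norm_divide)
      also have "\<dots> \<le> norm (Hfun w) / (1/2)" using that by (intro divide_left_mono mult_pos_pos) auto
      finally show ?thesis by simp
    qed
    show ?thesis
    proof (cases "norm (s - 1) \<ge> 1/2")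
      case True
      then show ?thesis using far[OF True] H[OF s X(1)] by linarith
    next
      case False
      have "norm (Gfun s) \<le> 2 * ?B"
      proof (rule maximum_modulus_frontier[of Gfun "cball 1 (1/2)" "2 * ?B" s])
        show "Gfun holomorphic_on interior (cball 1 (1/2))" using Gfun_holo by (rule holomorphic_on_subset) auto
        show "continuous_on (closure (cball 1 (1/2))) Gfun"
          using holomorphic_on_imp_continuous_on[OF Gfun_holo] continuous_on_subset by blast
        show "s \<in> cball 1 (1/2)" using False by (simp add: dist_norm norm_minus_commute)
        fix w :: complex assume "w \<in> frontier (cball 1 (1/2))"
        then have w: "norm (w - 1) = 1/2" by (simp add: dist_norm norm_minus_commute)
        have "norm w \<le> 3/2" using norm_triangle_ineq[of "w - 1" 1] w by simp
        moreover have "Re w \<ge> 1/2" using abs_Re_le_cmod[of "w - 1"] w unfolding abs_le_iff minus_complex.sel one_complex.sel by linarith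
        ultimately have "norm (Hfun w) \<le> ?B" using H[of w X] X by simp
        then show "norm (Gfun w) \<le> 2 * ?B" using far[of w] w by simp
      qed auto
      then show ?thesis by (simp only: mult.assoc)
    qed
  qed
qed

lemma Gfun_ge: "Re s = 2 \<Longrightarrow> norm (Gfun s) \<ge> 1/4"
proof -
  assume s: "Re s = 2"
  have F: "1/4 \<le> norm (F s)" using F_ge[of s] s by simp
  have "1 \<le> norm (s - 1)" using abs_Re_le_cmod[of "s - 1"] s by simp
  then have "1 * (1/4) \<le> norm (s - 1) * norm (F s)" using F by (intro mult_mono) auto
  then show ?thesis using Gfun_eq_F[of s] s F by (simp add: norm_mult)
qed

text \<open>The disc of radius 3/2 around the point of real part 2 just touches the line of real
  part 1/2, so GRH makes \<open>Gfun\<close> free of zeros in it, and s lies in the concentric disc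
  of radius \<open>3/2 - \<delta>\<close>. The bound is \<open>12 / \<delta>\<^sup>2\<close> times
  the logarithm of the ratio of the maximum to the central value.\<close>

lemma log_deriv_Gfun_bound:
  assumes GRH: "GRH" and \<delta>: "0 < \<delta>" "\<delta> < 1" and s: "1/2 + \<delta> \<le> Re s" "Re s \<le> 2"
  shows "norm (deriv Gfun s / Gfun s) \<le> 12 / \<delta>\<^sup>2 * (12 + ln (16 * (1 + zeta32)) + ln (real q)) * (1 + \<bar>Im s\<bar>) powr (1/2)"
proof -
  define t where "t = Im s"
  define c where "c = Complex 2 t"
  define X where "X = \<bar>t\<bar> + 5"
  \<comment> \<open>The upper bound is 2P and the central value is at least 1/4, so any factor above
    8P serves; 16P makes the inequality strict.\<close>
  define B where "B = 16 * (1 + zeta32) * real q * X\<^sup>2"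
  have q1: "real q \<ge> 1" using q_pos by simp
  have z1: "1 + zeta32 \<ge> 1" using zeta32_nonneg by simp
  have X5: "X \<ge> 5" by (simp add: X_def)
  define P where "P = (1 + zeta32) * real q * X\<^sup>2"
  have P0: "0 < P" unfolding P_def using z1 q1 X5 by simp
  have BP: "B = 16 * P" by (simp add: B_def P_def)
  have ball: "Re w > 1/2 \<and> norm w + 1 \<le> X" if "w \<in> ball c (3/2)" for w
  proof -
    have d: "norm (c - w) < 3/2" using that by (simp add: dist_norm)
    then have "Re c - Re w < 3/2" using abs_Re_le_cmod[of "c - w"] by simp
    moreover have "norm c \<le> 2 + \<bar>t\<bar>" using cmod_le[of c] by (simp add: c_def)
    moreover have "norm w \<le> norm c + norm (c - w)" using norm_triangle_sub[of w c] by (simp add: norm_minus_commute)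
    ultimately show ?thesis using d by (simp add: X_def c_def)
  qed
  have "norm (deriv Gfun s / Gfun s) \<le> 8 * ln B * (3/2) / (3/2 - (3/2 - \<delta>))\<^sup>2"
  proof (rule holomorphic_log_deriv_bound[of _ c])
    show "Gfun holomorphic_on ball c (3/2)" using Gfun_holo by (rule holomorphic_on_subset) simp
    show "Gfun z \<noteq> 0" if "z \<in> ball c (3/2)" for z using GRH_Gfun_nonzero[OF GRH] ball[OF that] by blast
    show "norm (Gfun z) < B * norm (Gfun c)" if "z \<in> ball c (3/2)" for z
    proof -
      have "norm (Gfun z) \<le> 2 * (1 + zeta32) * real q * X\<^sup>2" using ball[OF that] X5 by (intro norm_Gfun_le) auto
      also have "\<dots> = 2 * P" by (simp only: P_def mult.assoc)
      also have "\<dots> < B * (1/4)" unfolding BP using P0 by simp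
      also have "\<dots> \<le> B * norm (Gfun c)" unfolding BP using P0 by (intro mult_left_mono Gfun_ge) (auto simp: c_def)
      finally show ?thesis .
    qed
    show "s \<in> cball c (3/2 - \<delta>)"
    proof -
      have "c - s = of_real (2 - Re s)" by (simp add: c_def t_def complex_eq_iff)
      then have "norm (c - s) = 2 - Re s" using s by (simp only: norm_of_real)
      then show ?thesis using s by (simp add: dist_norm)
    qed
  qed (use \<delta> s in auto)
  also have "\<dots> = 12 / \<delta>\<^sup>2 * ln B" by simp
  finally have 1: "norm (deriv Gfun s / Gfun s) \<le> 12 / \<delta>\<^sup>2 * ln B" .
  \<comment> \<open>The logarithmic growth is weakened to a square root, the form that the Perron
    estimate accepts.\<close>
  have 2: "ln B \<le> (12 + ln (16 * (1 + zeta32)) + ln (real q)) * (1 + \<bar>t\<bar>) powr (1/2)"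
  proof -
    define Y where "Y = (1 + \<bar>t\<bar>) powr (1/2)"
    have Y1: "Y \<ge> 1" unfolding Y_def by (intro ge_one_powr_ge_zero) auto
    have "ln (1 + \<bar>t\<bar>) \<le> (1 + \<bar>t\<bar>) powr (1/2) / (1/2)" by (rule ln_le_powr) auto
    then have l: "ln (1 + \<bar>t\<bar>) \<le> 2 * Y" by (simp add: Y_def)
    have "X \<le> 5 * (1 + \<bar>t\<bar>)" by (simp add: X_def)
    then have "ln X \<le> ln (5 * (1 + \<bar>t\<bar>))" using X5 by (subst ln_le_cancel_iff) auto
    also have "\<dots> = ln 5 + ln (1 + \<bar>t\<bar>)" by (subst ln_mult) auto
    also have "ln 5 \<le> (4::real)" using ln_le_minus_one[of "5::real"] by simp
    finally have lX: "ln X \<le> 4 + 2 * Y" using l by linarith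
    have "ln B = ln (16 * (1 + zeta32)) + ln (real q) + 2 * ln X"
      unfolding B_def using z1 q1 X5 by (simp add: ln_mult ln_realpow)
    also have "\<dots> \<le> ln (16 * (1 + zeta32)) * Y + ln (real q) * Y + 2 * (4 * Y + 2 * Y)"
    proof (intro add_mono)
      show "ln (16 * (1 + zeta32)) \<le> ln (16 * (1 + zeta32)) * Y" using mult_left_mono[OF Y1, of "ln (16 * (1 + zeta32))"] z1 by simp
      show "ln (real q) \<le> ln (real q) * Y" using mult_left_mono[OF Y1, of "ln (real q)"] q1 by simp
      show "2 * ln X \<le> 2 * (4 * Y + 2 * Y)" using lX Y1 by (simp add: algebra_simps)
    qed
    also have "\<dots> = (12 + ln (16 * (1 + zeta32)) + ln (real q)) * Y" by (simp add: algebra_simps)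
    finally show ?thesis by (simp add: Y_def)
  qed
  note 1
  also have "12 / \<delta>\<^sup>2 * ln B \<le> 12 / \<delta>\<^sup>2 * ((12 + ln (16 * (1 + zeta32)) + ln (real q)) * (1 + \<bar>t\<bar>) powr (1/2))"
    by (intro mult_left_mono 2) simp
  finally show ?thesis by (simp only: t_def mult.assoc)
qed

text \<open>The series D with its pole taken off is \<open>- deriv Gfun s / Gfun s\<close>,
  holomorphic right of 1/2 under GRH. Multiplying the Riesz mean on the line
  \<open>1/2 + \<delta>\<close> by y clears the denominator in the weights and raises the exponent
  to \<open>3/2 + \<delta>\<close>.\<close>

theorem GRH_psi1_bound:
  assumes GRH: "GRH" and \<delta>: "0 < \<delta>" "\<delta> < 1" and y: "y \<ge> 1" and N: "y \<le> real N"
  shows "norm ((\<Sum>n\<le>N. mangoldt n * chi n * of_real (max 0 (y - real n))) - rho * of_real ((y - 1)\<^sup>2 / 2))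
    \<le> 36 / \<delta>\<^sup>2 * (12 + ln (16 * (1 + zeta32)) + ln (real q)) * y powr (3/2 + \<delta>)"
proof -
  define M where "M = 12 / \<delta>\<^sup>2 * (12 + ln (16 * (1 + zeta32)) + ln (real q))"
  have M0: "M \<ge> 0" unfolding M_def using zeta32_nonneg q_pos by (intro mult_nonneg_nonneg add_nonneg_nonneg) auto
  let ?a = "\<lambda>n. mangoldt n * chi n"
  let ?f = "\<lambda>s. - deriv Gfun s / Gfun s"
  have hol: "?f holomorphic_on {s. Re s > 1/2}"
    using GRH_Gfun_nonzero[OF GRH]
    by (intro holomorphic_on_divide holomorphic_on_minus holomorphic_on_subset[OF holomorphic_deriv[OF Gfun_holo open_UNIV]] holomorphic_on_subset[OF Gfun_holo]) auto
  have "norm ((\<Sum>n<N. ?a (Suc n) * of_real (max 0 (1 - real (Suc n) / y))) - rho * of_real ((y - 1)\<^sup>2 / (2 * y))) \<le> 3 * M * y powr (1/2 + \<delta>)"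
  proof (rule riesz_mean_bound[OF y _ _ M0 hol])
    show "norm (?f s) \<le> M * (1 + \<bar>Im s\<bar>) powr (1/2)" if "1/2 + \<delta> \<le> Re s" "Re s \<le> 2" for s
      using log_deriv_Gfun_bound[OF GRH \<delta> that] unfolding M_def by simp
    show "summable (\<lambda>n. norm (?a (Suc n)) / (real (Suc n))\<^sup>2)"
      using chi_mangoldt_abs_conv unfolding dirichlet_abs_conv_def by (auto dest!: spec[of _ 2] simp del: of_nat_Suc)
    show "(\<lambda>n. ?a (Suc n) / of_nat (Suc n) powr s) sums (?f s + rho / (s - 1))" if "Re s = 2" for s
      using D_sums[of s] D_eq[of s] that by (simp add: algebra_simps)
  qed (use \<delta> N in auto)
  then have "y * norm ((\<Sum>n<N. ?a (Suc n) * of_real (max 0 (1 - real (Suc n) / y))) - rho * of_real ((y - 1)\<^sup>2 / (2 * y))) \<le> y * (3 * M * y powr (1/2 + \<delta>))"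
    using y by (intro mult_left_mono) auto
  also have "y * (3 * M * y powr (1/2 + \<delta>)) = 3 * M * y powr (3/2 + \<delta>)"
    using y powr_add[of y 1 "1/2 + \<delta>"] by (simp add: add.assoc[symmetric])
  also have "y * norm ((\<Sum>n<N. ?a (Suc n) * of_real (max 0 (1 - real (Suc n) / y))) - rho * of_real ((y - 1)\<^sup>2 / (2 * y))) =
     norm (of_real y * ((\<Sum>n<N. ?a (Suc n) * of_real (max 0 (1 - real (Suc n) / y))) - rho * of_real ((y - 1)\<^sup>2 / (2 * y))))"
    using y by (simp only: norm_mult norm_of_real abs_of_nonneg)
  also have "of_real y * ((\<Sum>n<N. ?a (Suc n) * of_real (max 0 (1 - real (Suc n) / y))) - rho * of_real ((y - 1)\<^sup>2 / (2 * y))) =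
     (\<Sum>n\<le>N. ?a n * of_real (max 0 (y - real n))) - rho * of_real ((y - 1)\<^sup>2 / 2)"
  proof -
    have m: "y * max 0 (1 - x / y) = max 0 (y - x)" for x using y by (simp add: max_def field_simps)
    have "of_real y * (\<Sum>n<N. ?a (Suc n) * of_real (max 0 (1 - real (Suc n) / y))) = (\<Sum>n<N. ?a (Suc n) * of_real (y * max 0 (1 - real (Suc n) / y)))"
      by (simp only: sum_distrib_left of_real_mult mult_ac)
    also have "\<dots> = (\<Sum>n\<le>N. ?a n * of_real (max 0 (y - real n)))"
      unfolding m lessThan_Suc_atMost[symmetric] by (subst sum.lessThan_Suc_shift) simp
    finally have 1: "of_real y * (\<Sum>n<N. ?a (Suc n) * of_real (max 0 (1 - real (Suc n) / y))) = (\<Sum>n\<le>N. ?a n * of_real (max 0 (y - real n)))" .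
    have "y * ((y - 1)\<^sup>2 / (2 * y)) = (y - 1)\<^sup>2 / 2" using y by simp
    then have 2: "of_real y * (rho * of_real ((y - 1)\<^sup>2 / (2 * y))) = rho * of_real ((y - 1)\<^sup>2 / 2)"
      by (metis (no_types, lifting) mult.left_commute of_real_mult)
    show ?thesis by (simp only: right_diff_distrib 1 2)
  qed
  finally show ?thesis by (simp add: M_def)
qed

end

section \<open>Characters to squarefree moduli\<close>

lemma sum_roots_of_unity:
  fixes i j n :: nat assumes "i < n" "j < n"
  shows "(\<Sum>k<n. cis (2 * pi * real (k * i) / real n) * cnj (cis (2 * pi * real (k * j) / real n))) = (if i = j then of_nat n else 0)"
proof -
  define x where "x = 2 * pi * (real i - real j) / real n"
  have n: "n > 0" using assms by simp
  have term_eq: "cis (2 * pi * real (k * i) / real n) * cnj (cis (2 * pi * real (k * j) / real n)) = cis x ^ k" for k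
  proof -
    have "cis (2 * pi * real (k * i) / real n) * cnj (cis (2 * pi * real (k * j) / real n)) = cis (2 * pi * real (k * i) / real n - 2 * pi * real (k * j) / real n)"
      by (simp only: cis_cnj cis_mult minus_real_def)
    also have "2 * pi * real (k * i) / real n - 2 * pi * real (k * j) / real n = real k * x"
      using n by (simp add: x_def field_simps)
    finally show ?thesis by (simp only: Complex.DeMoivre)
  qed
  show ?thesis
  proof (cases "i = j")
    case True
    then show ?thesis unfolding term_eq by (simp add: x_def)
  next
    case False
    have "cis x \<noteq> 1"
    proof
      assume "cis x = 1"
      then have "cos x = 1" by (simp add: complex_eq_iff)
      then obtain m :: int where m: "x = real_of_int m * (2 * pi)" by (auto simp: cos_one_2pi_int mult_ac)
      then have "2 * pi * ((real i - real j) / real n) = 2 * pi * real_of_int m" by (simp add: x_def)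
      then have "(real i - real j) / real n = real_of_int m" by (simp only: mult_cancel_left) simp
      then have e: "real i - real j = real_of_int m * real n" using n by (simp add: field_simps)
      have "\<bar>real i - real j\<bar> < real n" using assms by auto
      then have "\<bar>real_of_int m\<bar> * real n < 1 * real n" unfolding e by (simp add: abs_mult)
      then have "\<bar>real_of_int m\<bar> < 1" using n by (simp only: mult_less_cancel_right_pos of_nat_0_less_iff)
      then have "m = 0" by linarith
      then show False using e False by simp
    qed
    moreover have "cis x ^ n = 1"
    proof -
      have "cis x ^ n = cis (2 * pi * (real i - real j))" using n by (simp add: Complex.DeMoivre x_def)
      also have "\<dots> = 1" using cis_multiple_2pi[of "real i - real j"] by (simp add: mult_ac)
      finally show ?thesis .
    qed
    ultimately show ?thesis unfolding term_eq using False by (simp add: geometric_sum)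
  qed
qed

text \<open>The characters are indexed by natural numbers so that products over coprime moduli can be
  indexed by encoded pairs.\<close>
definition orthogonal_characters :: "nat \<Rightarrow> nat set \<Rightarrow> (nat \<Rightarrow> nat \<Rightarrow> complex) \<Rightarrow> bool" where
  "orthogonal_characters q I X \<longleftrightarrow> finite I \<and> (\<forall>i\<in>I. dirichlet_character q (X i)) \<and>
     (\<forall>a b. coprime a q \<longrightarrow> coprime b q \<longrightarrow>
        (\<Sum>i\<in>I. X i a * cnj (X i b)) = (if [a = b] (mod q) then of_nat (totient q) else 0))"

text \<open>The characters are the exponentials of the discrete logarithm to a primitive root.
  Orthogonality is all that is required of the family, not that it contains every character.\<close>

lemma orthogonal_characters_prime:
  assumes p: "prime p" shows "\<exists>I X. orthogonal_characters p I X"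
proof -
  have p1: "1 < p" using prime_gt_1_nat[OF p] .
  obtain g where g: "residue_primroot p g" using prime_primitive_root_exists[OF p1 p] by blast
  define n where "n = totient p"
  have n0: "n > 0" using p1 by (simp add: n_def)
  have bij: "bij_betw (\<lambda>i. g ^ i mod p) {..<n} (totatives p)"
    unfolding n_def by (rule residue_primroot_is_generator[OF p1 g])
  have gc: "coprime g p" using g by (simp add: residue_primroot_def coprime_commute)
  have ex: "\<exists>i<n. [g ^ i = a] (mod p)" if "coprime a p" for a
  proof -
    have "a mod p \<in> totatives p"
    proof -
      have "p \<noteq> 0" using p1 by simp
      then have "coprime (a mod p) p" using that by (simp add: coprime_mod_left_iff)
      moreover have "a mod p \<noteq> 0" using \<open>coprime (a mod p) p\<close> p1 by (intro notI) simp
      ultimately show ?thesis using p1 by (simp add: in_totatives_iff less_imp_le)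
    qed
    then obtain i where "i < n" "g ^ i mod p = a mod p"
      using bij unfolding bij_betw_def by (metis (no_types, lifting) imageE lessThan_iff)
    then show ?thesis by (auto simp: cong_def)
  qed
  define ind where "ind a = (SOME i. i < n \<and> [g ^ i = a] (mod p))" for a
  have ind: "ind a < n" "[g ^ ind a = a] (mod p)" if "coprime a p" for a
    using someI_ex[OF ex[OF that]] unfolding ind_def by auto
  have inj: "i = j" if "i < n" "j < n" "[g ^ i = g ^ j] (mod p)" for i j
    using bij that unfolding bij_betw_def inj_on_def cong_def by blast
  have ind_cong: "ind a = ind b \<longleftrightarrow> [a = b] (mod p)" if "coprime a p" "coprime b p" for a b
  proof
    assume "ind a = ind b"
    then show "[a = b] (mod p)" using ind(2)[OF that(1)] ind(2)[OF that(2)] by (metis cong_sym cong_trans)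
  next
    assume "[a = b] (mod p)"
    then have "[g ^ ind a = g ^ ind b] (mod p)" using ind(2)[OF that(1)] ind(2)[OF that(2)] by (metis cong_sym cong_trans)
    then show "ind a = ind b" using inj ind(1) that by blast
  qed
  have ind_mult: "ind (a * b) = (ind a + ind b) mod n" if ab: "coprime a p" "coprime b p" for a b
  proof -
    have c: "coprime (a * b) p" using ab by simp
    have e: "[g ^ n = 1] (mod p)" unfolding n_def by (rule euler_theorem[OF gc])
    define s where "s = ind a + ind b"
    have "g ^ s = (g ^ n) ^ (s div n) * g ^ (s mod n)"
      by (metis div_mult_mod_eq mult.commute power_add power_mult)
    moreover have "[(g ^ n) ^ (s div n) * g ^ (s mod n) = 1 ^ (s div n) * g ^ (s mod n)] (mod p)"
      by (intro cong_mult cong_pow e cong_refl)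
    ultimately have 1: "[g ^ s = g ^ (s mod n)] (mod p)" by simp
    have "[g ^ s = a * b] (mod p)" unfolding s_def power_add by (intro cong_mult ind ab)
    then have "[g ^ (s mod n) = g ^ ind (a * b)] (mod p)" using 1 ind(2)[OF c] by (metis cong_sym cong_trans)
    moreover have "s mod n < n" using n0 by simp
    ultimately show ?thesis using inj[OF _ ind(1)[OF c]] unfolding s_def by metis
  qed
  define X where "X k a = (if coprime a p then cis (2 * pi * real (k * ind a) / real n) else 0)" for k a
  have X: "dirichlet_character p (X k)" for k
    unfolding dirichlet_character_def
  proof (intro conjI allI)
    show "p > 0" using p1 by simp
    fix a b
    show "X k (a * b) = X k a * X k b"
    proof (cases "coprime a p \<and> coprime b p")
      case True
      then have ab: "coprime a p" "coprime b p" by auto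
      define s where "s = ind a + ind b"
      have "real (k * s) / real n = real (k * (s mod n)) / real n + real (k * (s div n))"
      proof -
        have "real s = real (s div n) * real n + real (s mod n)" by (metis div_mult_mod_eq of_nat_add of_nat_mult)
        then show ?thesis using n0 by (simp add: field_simps)
      qed
      then have "2 * pi * real (k * s) / real n = 2 * pi * real (k * (s mod n)) / real n + 2 * pi * real (k * (s div n))"
        by (simp only: times_divide_eq_right[symmetric] distrib_left)
      moreover have "cis (2 * pi * real (k * (s div n))) = 1"
        by (rule cis_multiple_2pi) (simp only: Ints_of_nat)
      ultimately have "cis (2 * pi * real (k * (s mod n)) / real n) = cis (2 * pi * real (k * s) / real n)"
        by (simp only: cis_mult[symmetric] mult_1_right)
      also have "2 * pi * real (k * s) / real n = 2 * pi * real (k * ind a) / real n + 2 * pi * real (k * ind b) / real n"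
        by (simp add: s_def distrib_left add_divide_distrib)
      finally show ?thesis using ab ind_mult[OF ab] by (simp add: X_def cis_mult s_def)
    qed (auto simp: X_def)
    have "coprime (a + p) p \<longleftrightarrow> coprime a p" by (metis coprime_mod_left_iff mod_add_self2 p1 not_less_zero)
    moreover have "coprime a p \<Longrightarrow> ind (a + p) = ind a" using calculation by (subst ind_cong) (auto simp: cong_def)
    ultimately show "X k (a + p) = X k a" by (simp add: X_def)
    show "X k a = 0 \<longleftrightarrow> \<not> coprime a p" by (simp add: X_def)
  qed
  have "(\<Sum>k<n. X k a * cnj (X k b)) = (if [a = b] (mod p) then of_nat n else 0)" if "coprime a p" "coprime b p" for a b
    using sum_roots_of_unity[OF ind(1)[OF that(1)] ind(1)[OF that(2)]] that by (simp add: X_def ind_cong)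
  then have "orthogonal_characters p {..<n} X" using X by (simp add: orthogonal_characters_def n_def)
  then show ?thesis by blast
qed

lemma orthogonal_characters_mult:
  assumes 1: "orthogonal_characters p I X" and 2: "orthogonal_characters m J Y" and c: "coprime p m" and pos: "p > 0" "m > 0"
  shows "\<exists>K Z. orthogonal_characters (p * m) K Z"
proof -
  define Z where "Z i n = X (fst (prod_decode i)) n * Y (snd (prod_decode i)) n" for i n
  define K where "K = prod_encode ` (I \<times> J)"
  have inj: "inj_on prod_encode (I \<times> J)" by (rule inj_prod_encode)
  have "dirichlet_character (p * m) (Z i)" if "i \<in> K" for i
  proof -
    obtain k j where kj: "k \<in> I" "j \<in> J" "prod_decode i = (k, j)" using \<open>i \<in> K\<close> by (auto simp: K_def)
    interpret x: dchar p "X k" using 1 kj by unfold_locales (auto simp: orthogonal_characters_def)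
    interpret y: dchar m "Y j" using 2 kj by unfold_locales (auto simp: orthogonal_characters_def)
    have Zi: "Z i n = X k n * Y j n" for n using kj by (simp add: Z_def)
    show ?thesis unfolding dirichlet_character_def Zi
      using pos x.chi_mult y.chi_mult x.chi_add_mult[of _ m] y.chi_add_mult[of _ p] x.chi_eq_0_iff y.chi_eq_0_iff
      by (auto simp: mult.commute[of p m] coprime_mult_right_iff)
  qed
  moreover have "(\<Sum>i\<in>K. Z i a * cnj (Z i b)) = (if [a = b] (mod p * m) then of_nat (totient (p * m)) else 0)"
    if "coprime a (p * m)" "coprime b (p * m)" for a b
  proof -
    have co: "coprime a p" "coprime b p" "coprime a m" "coprime b m" using that by auto
    have "(\<Sum>i\<in>K. Z i a * cnj (Z i b)) = (\<Sum>(k, j)\<in>I \<times> J. (X k a * cnj (X k b)) * (Y j a * cnj (Y j b)))"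
      unfolding K_def sum.reindex[OF inj] by (auto simp: Z_def o_def intro!: sum.cong)
    also have "\<dots> = (\<Sum>k\<in>I. X k a * cnj (X k b)) * (\<Sum>j\<in>J. Y j a * cnj (Y j b))"
      by (simp add: sum_product sum.cartesian_product)
    also have "\<dots> = (if [a = b] (mod p) then of_nat (totient p) else 0) * (if [a = b] (mod m) then of_nat (totient m) else 0)"
      using 1 2 co unfolding orthogonal_characters_def by simp
    also have "[a = b] (mod p * m) \<longleftrightarrow> [a = b] (mod p) \<and> [a = b] (mod m)"
      using c coprime_cong_mult_nat cong_modulus_mult_nat by (metis mult.commute)
    then have "(if [a = b] (mod p) then of_nat (totient p) else 0) * (if [a = b] (mod m) then of_nat (totient m) else 0) =
      (if [a = b] (mod p * m) then of_nat (totient (p * m)) else (0::complex))"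
      by (simp add: totient_mult_coprime[OF c])
    finally show ?thesis .
  qed
  moreover have "finite K" using 1 2 by (simp add: K_def orthogonal_characters_def)
  ultimately have "orthogonal_characters (p * m) K Z" unfolding orthogonal_characters_def by blast
  then show ?thesis by blast
qed

lemma squarefree_prime_times:
  fixes p q :: nat
  assumes "squarefree q" "prime p" "p dvd q"
  obtains m where "q = p * m" "coprime p m" "squarefree m" "m > 0"
proof -
  obtain m where m: "q = p * m" using assms by blast
  have q0: "q \<noteq> 0" using assms(1) by (metis not_squarefree_0)
  have "\<not> p dvd m"
  proof
    assume "p dvd m"
    then have "p\<^sup>2 dvd q" using m by (simp add: power2_eq_square)
    then show False using assms squarefree_def not_prime_unit by blast
  qed
  then have "coprime p m" using assms(2) by (simp add: prime_imp_coprime)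
  moreover have "squarefree m" using assms(1) m by (meson dvd_triv_right squarefree_mono)
  ultimately show ?thesis using that m q0 by auto
qed

lemma orthogonal_characters_exist: "squarefree q \<Longrightarrow> \<exists>I X. orthogonal_characters q I X"
proof (induction q rule: less_induct)
  case (less q)
  have q0: "q \<noteq> 0" using less.prems by (metis not_squarefree_0)
  show ?case
  proof (cases "q = 1")
    case True
    have "orthogonal_characters 1 {0} (\<lambda>_ _. 1)" by (simp add: orthogonal_characters_def dirichlet_character_def)
    then show ?thesis using True by blast
  next
    case False
    then obtain p where p: "prime p" "p dvd q" using prime_factor_nat by blast
    then obtain m where m: "q = p * m" "coprime p m" "squarefree m" "m > 0" using squarefree_prime_times[OF less.prems] by blast
    have "m < q" using m prime_gt_1_nat[OF p(1)] by simp
    then show ?thesis using less.IH[OF _ m(3)] orthogonal_characters_prime[OF p(1)] orthogonal_characters_mult[OF _ _ m(2) _ m(4)] prime_gt_0_nat[OF p(1)] m(1)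
      by blast
  qed
qed

lemma sum_totatives_eq:
  fixes f :: "nat \<Rightarrow> complex"
  assumes "\<And>n. \<not> coprime n q \<Longrightarrow> f n = 0"
  shows "(\<Sum>n<q. f (Suc n)) = (\<Sum>a\<in>totatives q. f a)"
proof -
  have "(\<Sum>n<q. f (Suc n)) = (\<Sum>n\<in>{1..q}. f n)"
    by (rule sum.reindex_bij_witness[of _ "\<lambda>n. n - 1" Suc]) auto
  also have "\<dots> = (\<Sum>a\<in>totatives q. f a)"
    by (rule sum.mono_neutral_right) (use assms in \<open>auto simp: in_totatives_iff\<close>)
  finally show ?thesis .
qed

lemma totative_representative:
  assumes "coprime m q" "q > 0"
  shows "\<exists>!a. a \<in> totatives q \<and> [m = a] (mod q)"
proof (cases "q = 1")
  case True
  then show ?thesis by (auto simp: in_totatives_iff)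
next
  case False
  then have q: "q > 1" using assms by simp
  have "coprime (m mod q) q" using assms by (simp add: coprime_mod_left_iff)
  moreover have "m mod q \<noteq> 0" using \<open>coprime (m mod q) q\<close> q by (intro notI) simp
  ultimately have "m mod q \<in> totatives q" using q by (simp add: in_totatives_iff less_imp_le)
  moreover have "a = m mod q" if "a \<in> totatives q" "[m = a] (mod q)" for a
    using totatives_less[OF that(1) q] that(2) by (simp add: cong_def)
  ultimately show ?thesis by (intro ex1I[of _ "m mod q"]) (auto simp: cong_def)
qed

text \<open>W is expanded in characters. The principal one yields the mean value; the others
  contribute B times the sum of the absolute values of the coefficients, which Cauchy-Schwarz and
  Parseval bound by the root of the square sum of W. A weight concentrated on few residues is thus
  cheaper than its supremum suggests.\<close>

theorem character_mean_square:
  fixes c W :: "nat \<Rightarrow> complex"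
  assumes sq: "squarefree q" and M: "finite M" and B: "B \<ge> 0"
    and bound: "\<And>chi. dirichlet_character q chi \<Longrightarrow> \<not> principal q chi \<Longrightarrow> norm (\<Sum>m\<in>M. c m * chi m) \<le> B"
    and W: "\<And>m n. [m = n] (mod q) \<Longrightarrow> W m = W n"
  shows "norm ((\<Sum>m | m \<in> M \<and> coprime m q. c m * W m) - (\<Sum>a\<in>totatives q. W a) / of_nat (totient q) * (\<Sum>m | m \<in> M \<and> coprime m q. c m))
    \<le> B * sqrt (\<Sum>a\<in>totatives q. (norm (W a))\<^sup>2)"
proof -
  obtain I X where oc: "orthogonal_characters q I X" using orthogonal_characters_exist[OF sq] by blast
  have q0: "q > 0" using sq by (metis not_squarefree_0 neq0_conv)
  let ?T = "totatives q" and ?\<phi> = "totient q"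
  have \<phi>0: "?\<phi> > 0" using q0 by simp
  have fin: "finite I" and dX: "\<And>i. i \<in> I \<Longrightarrow> dchar q (X i)"
    and orth: "\<And>a b. coprime a q \<Longrightarrow> coprime b q \<Longrightarrow> (\<Sum>i\<in>I. X i a * cnj (X i b)) = (if [a = b] (mod q) then of_nat ?\<phi> else 0)"
    using oc by (auto simp: orthogonal_characters_def dchar_def)
  have T: "coprime a q" if "a \<in> ?T" for a using that by (simp add: in_totatives_iff)
  define w where "w i = (\<Sum>a\<in>?T. W a * cnj (X i a))" for i
  define S where "S i = (\<Sum>m\<in>M. c m * X i m)" for i
  define S0 where "S0 = (\<Sum>m | m \<in> M \<and> coprime m q. c m)"
  define P where "P = {i \<in> I. principal q (X i)}"
  have X0: "X i m = 0" if "i \<in> I" "\<not> coprime m q" for i m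
    using dchar.chi_eq_0_iff[OF dX[OF that(1)]] that(2) by blast
  have select: "(\<Sum>a\<in>?T. (if [m = a] (mod q) then f a else 0)) = f a0"
    if "coprime m q" "a0 \<in> ?T" "[m = a0] (mod q)" for m a0 and f :: "nat \<Rightarrow> complex"
  proof -
    have "(\<Sum>a\<in>?T. (if [m = a] (mod q) then f a else 0)) = (\<Sum>a\<in>{a0}. (if [m = a] (mod q) then f a else 0))"
      by (rule sum.mono_neutral_right) (use totative_representative[OF that(1) q0] that in auto)
    then show ?thesis using that by simp
  qed
  have expand: "W m * of_nat ?\<phi> = (\<Sum>i\<in>I. w i * X i m)" if m: "coprime m q" for m
  proof -
    obtain a0 where a0: "a0 \<in> ?T" "[m = a0] (mod q)" using totative_representative[OF m q0] by blast
    have "(\<Sum>i\<in>I. w i * X i m) = (\<Sum>i\<in>I. \<Sum>a\<in>?T. W a * (X i m * cnj (X i a)))"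
      unfolding w_def sum_distrib_right by (intro sum.cong refl) (simp add: mult_ac)
    also have "\<dots> = (\<Sum>a\<in>?T. W a * (\<Sum>i\<in>I. X i m * cnj (X i a)))"
      by (subst sum.swap) (simp add: sum_distrib_left)
    also have "\<dots> = (\<Sum>a\<in>?T. if [m = a] (mod q) then W a * of_nat ?\<phi> else 0)"
      by (rule sum.cong) (use orth[OF m] T in auto)
    also have "\<dots> = W a0 * of_nat ?\<phi>" by (rule select[OF m a0])
    also have "W a0 = W m" using W[OF a0(2)] by simp
    finally show ?thesis by simp
  qed
  have main: "(\<Sum>m | m \<in> M \<and> coprime m q. c m * W m) * of_nat ?\<phi> = (\<Sum>i\<in>I. w i * S i)"
  proof -
    have "(\<Sum>m | m \<in> M \<and> coprime m q. c m * W m) * of_nat ?\<phi> = (\<Sum>m | m \<in> M \<and> coprime m q. \<Sum>i\<in>I. w i * (c m * X i m))"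
      unfolding sum_distrib_right
    proof (rule sum.cong[OF refl])
      fix m assume "m \<in> {m. m \<in> M \<and> coprime m q}"
      then have m: "coprime m q" by simp
      have "c m * W m * of_nat ?\<phi> = c m * (W m * of_nat ?\<phi>)" by simp
      also have "\<dots> = (\<Sum>i\<in>I. w i * (c m * X i m))" unfolding expand[OF m] by (simp add: sum_distrib_left mult_ac)
      finally show "c m * W m * of_nat ?\<phi> = (\<Sum>i\<in>I. w i * (c m * X i m))" .
    qed
    also have "\<dots> = (\<Sum>i\<in>I. \<Sum>m | m \<in> M \<and> coprime m q. w i * (c m * X i m))" by (rule sum.swap)
    also have "\<dots> = (\<Sum>i\<in>I. w i * S i)"
      unfolding S_def sum_distrib_left
      by (intro sum.cong refl sum.mono_neutral_left) (use M X0 in auto)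
    finally show ?thesis .
  qed
  have X1: "X i 1 = 1" if "i \<in> I" for i using dchar.chi_1[OF dX[OF that]] by simp
  have cardI: "card I = ?\<phi>"
  proof -
    have "of_nat (card I) = (\<Sum>i\<in>I. X i 1 * cnj (X i 1))" using X1 by simp
    also have "\<dots> = of_nat ?\<phi>" using orth[of 1 1] by simp
    finally show ?thesis by (simp only: of_nat_eq_iff)
  qed
  \<comment> \<open>Double counting: the sum of all \<open>X i a\<close> over i and a is the totient
    by orthogonality against 1, while each principal index contributes the totient and any other
    index 0.\<close>
  have cardP: "card P = 1"
  proof -
    have "(\<Sum>i\<in>I. \<Sum>a\<in>?T. X i a) = (\<Sum>a\<in>?T. \<Sum>i\<in>I. X i 1 * cnj (X i a))"
    proof -
      have "cnj (\<Sum>a\<in>?T. \<Sum>i\<in>I. X i 1 * cnj (X i a)) = (\<Sum>a\<in>?T. \<Sum>i\<in>I. X i a)" using X1 by simp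
      moreover have "(\<Sum>a\<in>?T. \<Sum>i\<in>I. X i 1 * cnj (X i a)) = (\<Sum>a\<in>?T. if [1 = a] (mod q) then of_nat ?\<phi> else 0)"
        by (rule sum.cong) (use orth[of 1] T in auto)
      then have "cnj (\<Sum>a\<in>?T. \<Sum>i\<in>I. X i 1 * cnj (X i a)) = (\<Sum>a\<in>?T. \<Sum>i\<in>I. X i 1 * cnj (X i a))"
        by (simp add: cnj_sum if_distrib[of cnj] cong: if_cong)
      ultimately show ?thesis by (subst sum.swap) simp
    qed
    also have "\<dots> = (\<Sum>a\<in>?T. if [1 = a] (mod q) then of_nat ?\<phi> else 0)"
      by (rule sum.cong) (use orth[of 1] T in auto)
    also have "\<dots> = of_nat ?\<phi>"
    proof -
      obtain a0 where "a0 \<in> ?T" "[1 = a0] (mod q)" using totative_representative[of 1 q] q0 by auto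
      then show ?thesis by (intro select) auto
    qed
    finally have 1: "(\<Sum>i\<in>I. \<Sum>a\<in>?T. X i a) = of_nat ?\<phi>" .
    have "(\<Sum>a\<in>?T. X i a) = (if i \<in> P then of_nat ?\<phi> else 0)" if i: "i \<in> I" for i
    proof (cases "principal q (X i)")
      case True
      then have "(\<Sum>a\<in>?T. X i a) = (\<Sum>a\<in>?T. 1)" by (intro sum.cong) (auto simp: principal_def T)
      then show ?thesis using True i by (simp add: P_def totient_def)
    next
      case False
      interpret x: dchar q "X i" by (rule dX[OF i])
      have "(\<Sum>a\<in>?T. X i a) = (\<Sum>n<q. X i (Suc n))"
        by (rule sum_totatives_eq[symmetric]) (rule X0[OF i])
      then show ?thesis using False x.sum_period x.sum_nonprincipal[OF False] by (simp add: P_def)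
    qed
    then have "(\<Sum>i\<in>I. \<Sum>a\<in>?T. X i a) = (\<Sum>i\<in>I. if i \<in> P then of_nat ?\<phi> else 0)" by simp
    also have "\<dots> = (\<Sum>i\<in>P. of_nat ?\<phi>)" by (rule sum.mono_neutral_cong_right) (use fin in \<open>auto simp: P_def\<close>)
    also have "\<dots> = of_nat (card P * ?\<phi>)" by simp
    finally have "of_nat (card P * ?\<phi>) = (of_nat ?\<phi> :: complex)" using 1 by simp
    then have "card P * ?\<phi> = ?\<phi>" by (simp only: of_nat_eq_iff)
    then show ?thesis using \<phi>0 by simp
  qed
  then obtain i0 where i0: "P = {i0}" using card_1_singletonE by blast
  have i0I: "i0 \<in> I" "principal q (X i0)" using i0 by (auto simp: P_def)
  have w0: "w i0 = (\<Sum>a\<in>?T. W a)" using i0I(2) T by (simp add: w_def principal_def)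
  have S00: "S i0 = S0"
    unfolding S_def S0_def using M X0[OF i0I(1)] i0I(2)
    by (intro sum.mono_neutral_cong_right) (auto simp: principal_def)
  have "(\<Sum>i\<in>I. w i * S i) = w i0 * S i0 + (\<Sum>i\<in>I - {i0}. w i * S i)" by (rule sum.remove[OF fin i0I(1)])
  then have diff: "((\<Sum>m | m \<in> M \<and> coprime m q. c m * W m) - (\<Sum>a\<in>?T. W a) / of_nat ?\<phi> * S0) * of_nat ?\<phi> = (\<Sum>i\<in>I - {i0}. w i * S i)"
    unfolding left_diff_distrib main w0 S00 using \<phi>0 by simp
  have "norm (\<Sum>i\<in>I - {i0}. w i * S i) \<le> (\<Sum>i\<in>I - {i0}. norm (w i) * B)"
  proof (rule sum_norm_le)
    fix i assume i: "i \<in> I - {i0}"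
    then have "\<not> principal q (X i)" using i0 by (auto simp: P_def)
    then have "norm (S i) \<le> B" unfolding S_def using dX[of i] i by (intro bound) (auto simp: dchar_def)
    then show "norm (w i * S i) \<le> norm (w i) * B" unfolding norm_mult by (intro mult_left_mono) auto
  qed
  also have "\<dots> \<le> (\<Sum>i\<in>I. norm (w i) * B)" by (rule sum_mono2) (use fin B in auto)
  also have "\<dots> = B * (\<Sum>i\<in>I. 1 * norm (w i))" by (simp add: sum_distrib_left mult.commute)
  also have "(\<Sum>i\<in>I. 1 * norm (w i)) \<le> sqrt (real ?\<phi>) * sqrt (real ?\<phi> * (\<Sum>a\<in>?T. (norm (W a))\<^sup>2))"
  proof -
    have cns: "(complex_of_real (norm z))\<^sup>2 = z * cnj z" for z
      by (simp only: of_real_power[symmetric] complex_norm_square)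
    \<comment> \<open>Parseval, obtained by applying \<open>expand\<close> at every
      totative.\<close>
    have sq: "(\<Sum>i\<in>I. (norm (w i))\<^sup>2) = real ?\<phi> * (\<Sum>a\<in>?T. (norm (W a))\<^sup>2)"
    proof -
      have "complex_of_real (\<Sum>i\<in>I. (norm (w i))\<^sup>2) = (\<Sum>i\<in>I. w i * cnj (w i))" by (simp only: of_real_sum of_real_power cns)
      also have "\<dots> = (\<Sum>i\<in>I. \<Sum>a\<in>?T. cnj (W a) * (w i * X i a))" by (simp add: w_def[of "_"] sum_distrib_left mult_ac cnj_sum)
      also have "\<dots> = (\<Sum>a\<in>?T. cnj (W a) * (\<Sum>i\<in>I. w i * X i a))" by (subst sum.swap) (simp add: sum_distrib_left)
      also have "\<dots> = (\<Sum>a\<in>?T. cnj (W a) * (W a * of_nat ?\<phi>))" by (rule sum.cong) (use expand T in auto)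
      also have "\<dots> = complex_of_real (real ?\<phi> * (\<Sum>a\<in>?T. (norm (W a))\<^sup>2))"
        unfolding of_real_mult of_real_sum of_real_power cns sum_distrib_left of_real_of_nat_eq
        by (intro sum.cong refl) (simp add: mult_ac)
      finally show ?thesis by (simp only: of_real_eq_iff)
    qed
    have "(\<Sum>i\<in>I. 1 * norm (w i))\<^sup>2 \<le> (\<Sum>i\<in>I. 1\<^sup>2) * (\<Sum>i\<in>I. (norm (w i))\<^sup>2)" by (rule Cauchy_Schwarz_ineq_sum)
    then have "(\<Sum>i\<in>I. 1 * norm (w i))\<^sup>2 \<le> real ?\<phi> * (real ?\<phi> * (\<Sum>a\<in>?T. (norm (W a))\<^sup>2))" using cardI sq by simp
    then have "(\<Sum>i\<in>I. 1 * norm (w i)) \<le> sqrt (real ?\<phi> * (real ?\<phi> * (\<Sum>a\<in>?T. (norm (W a))\<^sup>2)))" by (rule real_le_rsqrt)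
    then show ?thesis by (simp only: real_sqrt_mult)
  qed
  also have "sqrt (real ?\<phi>) * sqrt (real ?\<phi> * (\<Sum>a\<in>?T. (norm (W a))\<^sup>2)) = real ?\<phi> * sqrt (\<Sum>a\<in>?T. (norm (W a))\<^sup>2)"
    by (simp add: real_sqrt_mult)
  finally have "norm (\<Sum>i\<in>I - {i0}. w i * S i) \<le> B * (real ?\<phi> * sqrt (\<Sum>a\<in>?T. (norm (W a))\<^sup>2))" using B by (simp add: mult_left_mono)
  then have "norm ((\<Sum>m | m \<in> M \<and> coprime m q. c m * W m) - (\<Sum>a\<in>?T. W a) / of_nat ?\<phi> * S0) * real ?\<phi> \<le> (B * sqrt (\<Sum>a\<in>?T. (norm (W a))\<^sup>2)) * real ?\<phi>"
    unfolding diff[symmetric] norm_mult norm_of_nat by (simp only: mult_ac)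
  then show ?thesis unfolding S0_def using \<phi>0 by (simp only: mult_le_cancel_right_pos of_nat_0_less_iff)
qed

section \<open>Sums over squarefree moduli\<close>

lemma over_totient:
  assumes "r > 0"
  shows "real r / real (totient r) = (\<Prod>p\<in>prime_factors r. real p / real (p - 1))"
proof -
  have "real (totient r) = real r * (\<Prod>p\<in>prime_factors r. 1 - 1 / real p)"
    by (rule totient_formula2)
  moreover have "1 / (1 - 1 / real p) = real p / real (p - 1)" if "p \<in> prime_factors r" for p
  proof -
    have "p > 1" using that prime_gt_1_nat by auto
    then show ?thesis by (simp add: field_simps of_nat_diff)
  qed
  then have "(\<Prod>p\<in>prime_factors r. real p / real (p - 1)) = (\<Prod>p\<in>prime_factors r. 1 / (1 - 1 / real p))"
    by (intro prod.cong) simp_all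
  then have "(\<Prod>p\<in>prime_factors r. real p / real (p - 1)) = 1 / (\<Prod>p\<in>prime_factors r. 1 - 1 / real p)"
    by (simp add: prod_dividef)
  ultimately show ?thesis using assms by simp
qed

text \<open>A finite form of the Euler product: splitting off the full power of one prime maps F
  injectively into a product of an interval of exponents and a set supported on the remaining
  primes.\<close>

lemma smooth_sum_le:
  fixes Ps :: "nat set"
  assumes "finite Ps" "\<And>p. p \<in> Ps \<Longrightarrow> prime p" "finite F" "\<And>k. k \<in> F \<Longrightarrow> k > 0 \<and> prime_factors k \<subseteq> Ps"
  shows "(\<Sum>k\<in>F. 1 / real k) \<le> (\<Prod>p\<in>Ps. real p / real (p - 1))"
  using assms
proof (induction Ps arbitrary: F rule: finite_induct)
  case empty
  have "F \<subseteq> {1}"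
  proof
    fix k assume "k \<in> F"
    then have k: "k > 0" "prime_factors k = {}" using empty.prems by auto
    then have "k = 1" by (metis prime_factorization_empty_iff set_mset_eq_empty_iff not_gr_zero nat_dvd_1_iff_1)
    then show "k \<in> {1}" by simp
  qed
  then have "(\<Sum>k\<in>F. 1 / real k) \<le> (\<Sum>k\<in>{1::nat}. 1 / real k)" by (intro sum_mono2) auto
  then show ?case by simp
next
  case (insert p Ps)
  have p: "prime p" "p > 1" using insert.prems(1)[of p] prime_gt_1_nat by auto
  let ?g = "\<lambda>k. (multiplicity p k, k div p ^ multiplicity p k)"
  define F' where "F' = (\<lambda>k. k div p ^ multiplicity p k) ` F"
  define n where "n = Suc (Max (insert 0 (multiplicity p ` F)))"
  have dec: "k = p ^ multiplicity p k * (k div p ^ multiplicity p k)" for k by (simp add: multiplicity_dvd)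
  have mlt: "multiplicity p k < n" if "k \<in> F" for k
    unfolding n_def using that insert.prems(2) by (auto simp: less_Suc_eq_le)
  have inj: "inj_on ?g F"
  proof
    fix x y assume "?g x = ?g y"
    then show "x = y" using dec[of x] dec[of y] by (metis prod.inject)
  qed
  have "(\<Sum>k\<in>F. 1 / real k) = (\<Sum>k\<in>F. (\<lambda>(i, m). (1 / real p) ^ i * (1 / real m)) (?g k))"
  proof (rule sum.cong[OF refl])
    fix k
    have "real k = real p ^ multiplicity p k * real (k div p ^ multiplicity p k)" by (subst dec[of k]) simp
    then show "1 / real k = (\<lambda>(i, m). (1 / real p) ^ i * (1 / real m)) (?g k)" by (simp add: power_one_over)
  qed
  also have "\<dots> = (\<Sum>x\<in>?g ` F. (\<lambda>(i, m). (1 / real p) ^ i * (1 / real m)) x)" by (simp add: sum.reindex[OF inj] o_def)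
  also have "\<dots> \<le> (\<Sum>x\<in>{..<n} \<times> F'. (\<lambda>(i, m). (1 / real p) ^ i * (1 / real m)) x)"
    by (rule sum_mono2) (use insert.prems(2) mlt in \<open>auto simp: F'_def\<close>)
  also have "\<dots> = (\<Sum>i<n. (1 / real p) ^ i) * (\<Sum>m\<in>F'. 1 / real m)"
    by (simp add: sum_product sum.cartesian_product)
  also have "\<dots> \<le> (real p / real (p - 1)) * (\<Prod>p\<in>Ps. real p / real (p - 1))"
  proof (rule mult_mono)
    have "(\<Sum>i<n. (1 / real p) ^ i) \<le> (\<Sum>i. (1 / real p) ^ i)"
      using p by (intro sum_le_suminf summable_geometric) auto
    also have "\<dots> = 1 / (1 - 1 / real p)" using p by (intro suminf_geometric) auto
    also have "\<dots> = real p / real (p - 1)" using p by (simp add: field_simps of_nat_diff)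
    finally show "(\<Sum>i<n. (1 / real p) ^ i) \<le> real p / real (p - 1)" .
    show "(\<Sum>m\<in>F'. 1 / real m) \<le> (\<Prod>p\<in>Ps. real p / real (p - 1))"
    proof (rule insert.IH)
      show "finite F'" using insert.prems(2) by (simp add: F'_def)
      fix m assume "m \<in> F'"
      then obtain k where k: "k \<in> F" "m = k div p ^ multiplicity p k" by (auto simp: F'_def)
      have k0: "k > 0" "prime_factors k \<subseteq> insert p Ps" using insert.prems(3)[OF k(1)] by auto
      have "m \<noteq> 0" using dec[of k] k k0 by (intro notI) simp
      moreover have "\<not> p dvd m" unfolding k(2) using k0(1) p(1) by (intro multiplicity_decompose) (auto simp: prime_nat_iff)
      moreover have "m dvd k" using dec[of k] k(2) by (metis dvd_triv_right)
      then have "prime_factors m \<subseteq> prime_factors k" using k0(1) by (intro dvd_prime_factors) auto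
      ultimately show "m > 0 \<and> prime_factors m \<subseteq> Ps" using k0(2) by auto
    qed (use insert.prems in auto)
  qed (auto intro!: sum_nonneg prod_nonneg)
  finally show ?case using insert.hyps by simp
qed

definition rad :: "nat \<Rightarrow> nat" where "rad n = \<Prod>(prime_factors n)"

lemma rad_dvd: "n > 0 \<Longrightarrow> rad n dvd n"
  unfolding rad_def using prod_mset_subset_imp_dvd[of "mset_set (prime_factors n)" "prime_factorization n"]
  by (simp add: prod_mset_prime_factorization_nat mset_set_set_mset_msubset prod_unfold_prod_mset)

lemma prime_factors_rad: "n > 0 \<Longrightarrow> prime_factors (rad n) = prime_factors n"
proof -
  assume "n > 0"
  then have "rad n \<noteq> 0" using rad_dvd[of n] by (intro notI) simp
  moreover have "prime p \<Longrightarrow> p dvd rad n \<longleftrightarrow> p \<in> prime_factors n" for p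
  proof -
    assume p: "prime p"
    have "p dvd rad n \<longleftrightarrow> (\<exists>x\<in>prime_factors n. p dvd x)"
      unfolding rad_def using prime_dvd_prod_iff[of "prime_factors n" p "\<lambda>x. x"] p by simp
    also have "\<dots> \<longleftrightarrow> p \<in> prime_factors n"
    proof
      assume "\<exists>x\<in>prime_factors n. p dvd x"
      then obtain x where x: "x \<in> prime_factors n" "p dvd x" by blast
      then have "p = x" using primes_dvd_imp_eq[OF p _ x(2)] in_prime_factors_imp_prime[OF x(1)] by simp
      then show "p \<in> prime_factors n" using x by simp
    qed (use dvd_refl in blast)
    finally show ?thesis .
  qed
  ultimately show ?thesis by (auto simp: prime_factors_dvd[of "rad n"])
qed

lemma squarefree_rad: "squarefree (rad n)"
  unfolding rad_def
  by (rule squarefree_prod_coprime) (auto intro: primes_coprime squarefree_prime)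

lemma squarefree_part_le_rad: "n > 0 \<Longrightarrow> squarefree_part n \<le> rad n"
proof -
  assume n: "n > 0"
  have "squarefree_part n dvd rad n"
  proof (rule multiplicity_le_imp_dvd)
    fix p :: nat assume p: "prime p"
    show "multiplicity p (squarefree_part n) \<le> multiplicity p (rad n)"
    proof (cases "p dvd squarefree_part n")
      case True
      then have "p dvd n" by (metis squarefree_decompose dvd_mult2)
      then have "p \<in> prime_factors (rad n)" using n p by (simp add: prime_factors_rad prime_factors_dvd)
      then have "multiplicity p (rad n) \<ge> 1" by (simp add: prime_factors_multiplicity)
      moreover have "multiplicity p (squarefree_part n) \<le> Suc 0" using p by (intro prime_multiplicity_squarefree_part_le_Suc_0)
      ultimately show ?thesis by simp
    next
      case False
      then show ?thesis by (simp add: not_dvd_imp_multiplicity_0)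
    qed
  qed simp
  moreover have "rad n > 0" using rad_dvd[OF n] n dvd_pos_nat by blast
  ultimately show ?thesis by (rule dvd_imp_le)
qed

lemma harm_le: "n > 0 \<Longrightarrow> (\<Sum>k=1..n. 1 / real k) \<le> 1 + ln (real n)"
proof (induction n rule: nat_induct_non_zero)
  case (Suc n)
  have "1 / real (Suc n) \<le> ln (real (Suc n)) - ln (real n)"
  proof -
    have "ln (real n / real (Suc n)) \<le> real n / real (Suc n) - 1" using Suc by (intro ln_le_minus_one) auto
    also have "\<dots> = - 1 / real (Suc n)" by (simp add: field_simps)
    finally show ?thesis using Suc by (simp add: ln_div)
  qed
  then show ?case using Suc by simp
qed simp

lemma sum_inverse_squares_tail: "t > 0 \<Longrightarrow> (\<Sum>k=t+1..n. 1 / (real k)\<^sup>2) \<le> 1 / real t"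
proof -
  assume t: "t > 0"
  have "(\<Sum>k=t+1..n. 1 / (real k)\<^sup>2) \<le> 1 / real t - 1 / real n" if "n \<ge> t" for n
    using that
  proof (induction n rule: dec_induct)
    case (step n)
    have n: "n > 0" using step t by simp
    have "1 / (real (Suc n))\<^sup>2 \<le> 1 / (real n * real (Suc n))" unfolding power2_eq_square
      using n by (intro divide_left_mono mult_right_mono mult_pos_pos) auto
    also have "\<dots> = 1 / real n - 1 / real (Suc n)" using n by (simp add: field_simps)
    finally show ?case using step by simp
  qed simp
  then show ?thesis
  proof (cases "n \<ge> t")
    case True
    have "0 \<le> 1 / real n" by simp
    then show ?thesis using \<open>\<And>n. n \<ge> t \<Longrightarrow> _\<close>[OF True] by linarith
  qed simp
qed

lemma sum_inverse_ge_ln: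
  fixes a x :: nat assumes "0 < a" "a \<le> x"
  shows "ln (real (x + 1) / real (a + 1)) \<le> (\<Sum>n=a+1..x. 1 / real n)"
  using assms(2)
proof (induction x rule: dec_induct)
  case (step n)
  have "ln (real (Suc n + 1) / real (n + 1)) \<le> real (Suc n + 1) / real (n + 1) - 1" by (intro ln_le_minus_one) auto
  also have "\<dots> = 1 / real (Suc n)" by (simp add: field_simps)
  finally have "ln (real (Suc n + 1)) - ln (real (n + 1)) \<le> 1 / real (Suc n)" by (simp add: ln_div)
  moreover have "ln (real (n + 1) / real (a + 1)) = ln (real (n + 1)) - ln (real (a + 1))" "ln (real (Suc n + 1) / real (a + 1)) = ln (real (Suc n + 1)) - ln (real (a + 1))"
    by (simp_all add: ln_div)
  ultimately show ?case using step by simp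
qed simp

text \<open>Group the harmonic sum over \<open>n\<close> by the radical of \<open>n\<close>; the \<open>n\<close> whose radical is much smaller
  than \<open>n\<close> have a large square divisor.\<close>
lemma sum_inverse_totient_ge:
  fixes y x t :: nat
  assumes y: "y > 0" and t: "t > 0" and x: "y * t\<^sup>2 \<le> x"
  shows "ln (real x / (real y * (real t)\<^sup>2 + 1)) - (1 + ln (real x)) / real t \<le> (\<Sum>r | squarefree r \<and> y < r \<and> r \<le> x. 1 / real (totient r))"
proof -
  \<comment> \<open>For n beyond this threshold with square part at most t, the squarefree part, and
    with it the radical, exceeds y.\<close>
  define a where "a = y * t\<^sup>2"
  have a0: "a > 0" using y t by (simp add: a_def)
  have x0: "x > 0" using a0 x unfolding a_def by linarith
  define S where "S = {r. squarefree r \<and> y < r \<and> r \<le> x}"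
  have fS: "finite S" by (rule finite_subset[of _ "{..x}"]) (auto simp: S_def)
  define G where "G = {n \<in> {a+1..x}. square_part n \<le> t}"
  have good: "(\<Sum>n\<in>G. 1 / real n) \<le> (\<Sum>r\<in>S. 1 / real (totient r))"
  proof -
    have radS: "rad n \<in> S" if "n \<in> G" for n
    proof -
      have n: "n > 0" "a < n" "n \<le> x" "square_part n \<le> t" using that by (auto simp: G_def)
      have "y * t\<^sup>2 < squarefree_part n * (square_part n)\<^sup>2" using n(2) unfolding a_def by (subst (asm) squarefree_decompose[of n])
      also have "\<dots> \<le> rad n * t\<^sup>2" using squarefree_part_le_rad[OF n(1)] n(4) by (intro mult_mono power_mono) auto
      finally have "y < rad n" using t by simp
      moreover have "rad n \<le> n" using rad_dvd[OF n(1)] n(1) by (rule dvd_imp_le)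
      ultimately show ?thesis using n squarefree_rad by (simp add: S_def)
    qed
    have "(\<Sum>n\<in>G. 1 / real n) = (\<Sum>r\<in>S. \<Sum>n | n \<in> G \<and> rad n = r. 1 / real n)"
      using radS fS by (intro sum.group[symmetric]) (auto simp: G_def)
    also have "\<dots> \<le> (\<Sum>r\<in>S. 1 / real (totient r))"
    proof (rule sum_mono)
      fix r assume "r \<in> S"
      then have r: "r > 0" by (auto simp: S_def)
      \<comment> \<open>The n with radical r are r times numbers composed of primes of r, whose
        reciprocals sum to at most \<open>r / totient r\<close>; the factor r cancels.\<close>
      define K where "K = (\<lambda>n. n div r) ` {n. n \<in> G \<and> rad n = r}"
      have nk: "n = r * (n div r)" "n > 0" if "n \<in> G" "rad n = r" for n
        using that rad_dvd[of n] by (auto simp: G_def)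
      have inj: "inj_on (\<lambda>n. n div r) {n. n \<in> G \<and> rad n = r}"
        by (rule inj_onI) (metis (mono_tags, lifting) mem_Collect_eq nk(1))
      have "(\<Sum>n | n \<in> G \<and> rad n = r. 1 / real n) = (\<Sum>n | n \<in> G \<and> rad n = r. 1 / real r * (1 / real (n div r)))"
      proof (rule sum.cong[OF refl])
        fix n assume "n \<in> {n. n \<in> G \<and> rad n = r}"
        then have "n = r * (n div r)" using nk(1)[of n] by simp
        then have "real n = real r * real (n div r)" by (metis of_nat_mult)
        then show "1 / real n = 1 / real r * (1 / real (n div r))" by simp
      qed
      also have "\<dots> = 1 / real r * (\<Sum>k\<in>K. 1 / real k)"
        unfolding K_def sum.reindex[OF inj] by (simp add: sum_distrib_left)
      also have "\<dots> \<le> 1 / real r * (\<Prod>p\<in>prime_factors r. real p / real (p - 1))"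
      proof (intro mult_left_mono smooth_sum_le)
        show "finite K" by (simp add: K_def G_def)
        fix k assume "k \<in> K"
        then obtain n where n: "n \<in> G" "rad n = r" "k = n div r" by (auto simp: K_def)
        have "n = r * k" "n > 0" using nk[OF n(1,2)] n(3) by auto
        then have "k > 0" "k dvd n" by auto
        moreover have "prime_factors k \<subseteq> prime_factors n" using \<open>k dvd n\<close> \<open>n > 0\<close> by (intro dvd_prime_factors) auto
        ultimately show "k > 0 \<and> prime_factors k \<subseteq> prime_factors r" using prime_factors_rad[OF \<open>n > 0\<close>] n(2) by simp
      qed auto
      also have "\<dots> = 1 / real (totient r)" unfolding over_totient[OF r, symmetric] using r by simp
      finally show "(\<Sum>n | n \<in> G \<and> rad n = r. 1 / real n) \<le> 1 / real (totient r)" .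
    qed
    finally show ?thesis .
  qed
  have bad: "(\<Sum>n\<in>{a+1..x} - G. 1 / real n) \<le> (1 + ln (real x)) / real t"
  proof -
    \<comment> \<open>For the remaining n the square part exceeds t, so the sum is at most a tail of
      inverse squares times a harmonic sum.\<close>
    let ?g = "\<lambda>n::nat. (square_part n, squarefree_part n)"
    have dec: "n = snd (?g n) * (fst (?g n))\<^sup>2" for n by (simp add: squarefree_decompose[symmetric])
    have inj: "inj_on ?g A" for A by (rule inj_onI) (metis dec)
    have "(\<Sum>n\<in>{a+1..x} - G. 1 / real n) = (\<Sum>n\<in>{a+1..x} - G. (\<lambda>(u, s). 1 / (real u)\<^sup>2 * (1 / real s)) (?g n))"
    proof (rule sum.cong[OF refl])
      fix n :: nat
      have "real n = real (squarefree_part n) * (real (square_part n))\<^sup>2" using dec[of n] by (metis fst_conv of_nat_mult of_nat_power snd_conv)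
      then show "1 / real n = (\<lambda>(u, s). 1 / (real u)\<^sup>2 * (1 / real s)) (?g n)" by simp
    qed
    also have "\<dots> = (\<Sum>z\<in>?g ` ({a+1..x} - G). (\<lambda>(u, s). 1 / (real u)\<^sup>2 * (1 / real s)) z)" by (simp add: sum.reindex[OF inj] o_def)
    also have "\<dots> \<le> (\<Sum>z\<in>{t+1..x} \<times> {1..x}. (\<lambda>(u, s). 1 / (real u)\<^sup>2 * (1 / real s)) z)"
    proof (rule sum_mono2)
      show "?g ` ({a+1..x} - G) \<subseteq> {t+1..x} \<times> {1..x}"
      proof
        fix z assume "z \<in> ?g ` ({a+1..x} - G)"
        then obtain n where zn: "z = ?g n" "n \<in> {a+1..x} - G" by blast
        then have n: "z = ?g n" "a < n" "n \<le> x" "square_part n > t" by (auto simp: G_def)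
        have n0: "n > 0" using n by simp
        have s: "squarefree_part n > 0" by (metis neq0_conv squarefree_part_nonzero)
        have "squarefree_part n dvd n" by (metis dvd_triv_left squarefree_decompose)
        then have 1: "squarefree_part n \<le> n" using n0 by (rule dvd_imp_le)
        have "square_part n dvd n" by (metis dvd_mult dvd_power squarefree_decompose zero_less_numeral)
        then have 2: "square_part n \<le> n" using n0 by (rule dvd_imp_le)
        show "z \<in> {t+1..x} \<times> {1..x}" using n s 1 2 by auto
      qed
    qed auto
    also have "\<dots> = (\<Sum>u=t+1..x. 1 / (real u)\<^sup>2) * (\<Sum>s=1..x. 1 / real s)"
      by (simp add: sum_product sum.cartesian_product)
    also have "\<dots> \<le> (1 / real t) * (1 + ln (real x))"
      using x0 by (intro mult_mono sum_inverse_squares_tail[OF t] harm_le) (auto intro: sum_nonneg)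
    finally show ?thesis by simp
  qed
  have "ln (real x / (real y * (real t)\<^sup>2 + 1)) \<le> ln (real (x + 1) / real (a + 1))"
  proof -
    have "real (a + 1) = real y * (real t)\<^sup>2 + 1" by (simp add: a_def)
    moreover have "0 < real (a + 1)" by simp
    ultimately show ?thesis using x0 by (subst ln_le_cancel_iff) (auto intro!: divide_right_mono simp del: of_nat_add of_nat_Suc)
  qed
  also have "\<dots> \<le> (\<Sum>n=a+1..x. 1 / real n)" using a0 x by (intro sum_inverse_ge_ln) (auto simp: a_def)
  also have "\<dots> = (\<Sum>n\<in>{a+1..x} - G. 1 / real n) + (\<Sum>n\<in>G. 1 / real n)" by (rule sum.subset_diff) (auto simp: G_def)
  finally show ?thesis using good bad unfolding S_def by linarith
qed

lemma divide_le_divide_cross: "a * d \<le> c * b \<Longrightarrow> 0 < b \<Longrightarrow> 0 < d \<Longrightarrow> a / b \<le> c / d" for a b c d :: real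
  by (simp add: pos_divide_le_eq pos_le_divide_eq)

text \<open>The primes are replaced by the smallest admissible odd numbers: the largest of
  \<open>k + 1\<close> such numbers is at least \<open>2 * k + 3\<close>, so removing it costs at
  most \<open>(2 * k + 3) / (2 * k + 1)\<close>, and these factors telescope.\<close>

lemma odd_prod_le:
  fixes A :: "nat set"
  assumes "finite A" "\<And>p. p \<in> A \<Longrightarrow> odd p \<and> p \<ge> 3"
  shows "(\<Prod>p\<in>A. (real p / real (p - 1))\<^sup>2) \<le> 2 * real (card A) + 1"
  using assms
proof (induction "card A" arbitrary: A)
  case (Suc k)
  then have ne: "A \<noteq> {}" by auto
  define m where "m = Max A"
  have mA: "m \<in> A" unfolding m_def using Suc.prems(1) ne by (rule Max_in)
  have "A \<subseteq> (\<lambda>i. 2 * i + 1) ` {1..(m - 1) div 2}"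
  proof
    fix p assume p: "p \<in> A"
    then have "odd p" "p \<ge> 3" "p \<le> m" using Suc.prems unfolding m_def by auto
    then obtain i where "p = 2 * i + 1" by (elim oddE)
    moreover have "i \<in> {1..(m - 1) div 2}" using \<open>p \<ge> 3\<close> \<open>p \<le> m\<close> calculation by auto
    ultimately show "p \<in> (\<lambda>i. 2 * i + 1) ` {1..(m - 1) div 2}" by blast
  qed
  then have "card A \<le> card ((\<lambda>i::nat. 2 * i + 1) ` {1..(m - 1) div 2})" by (intro card_mono) auto
  also have "\<dots> \<le> (m - 1) div 2" using card_image_le[of "{1..(m-1) div 2}" "\<lambda>i::nat. 2 * i + 1"] by simp
  finally have "Suc k \<le> (m - 1) div 2" using Suc.hyps(2) by simp
  then have "2 * Suc k \<le> 2 * ((m - 1) div 2)" by (rule mult_le_mono2)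
  also have "\<dots> \<le> m - 1" by simp
  finally have m: "2 * Suc k + 1 \<le> m" by simp
  have "(\<Prod>p\<in>A. (real p / real (p - 1))\<^sup>2) = (real m / real (m - 1))\<^sup>2 * (\<Prod>p\<in>A - {m}. (real p / real (p - 1))\<^sup>2)"
    by (rule prod.remove[OF Suc.prems(1) mA])
  also have "\<dots> \<le> ((2 * real k + 3) / (2 * real k + 1)) * (2 * real k + 1)"
  proof (rule mult_mono)
    have sq: "((x + 1) / x)\<^sup>2 \<le> (u + 1) / (u - 1)" if u: "2 \<le> u" "u \<le> x" for u x :: real
    proof -
      have "(x + 1) / x \<le> (u + 1) / u" using u by (intro divide_le_divide_cross) (auto simp: algebra_simps)
      moreover have "0 \<le> (x + 1) / x" using u by simp
      ultimately have "((x + 1) / x)\<^sup>2 \<le> ((u + 1) / u)\<^sup>2" by (rule power_mono)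
      also have "\<dots> = (u + 1)\<^sup>2 / u\<^sup>2" by (rule power_divide)
      also have "\<dots> \<le> (u + 1) / (u - 1)"
      proof (rule divide_le_divide_cross)
        have "(u + 1) * (u - 1) \<le> u\<^sup>2" by (simp add: power2_eq_square algebra_simps)
        then have "(u + 1) * ((u + 1) * (u - 1)) \<le> (u + 1) * u\<^sup>2" using u by (intro mult_left_mono) auto
        then show "(u + 1)\<^sup>2 * (u - 1) \<le> (u + 1) * u\<^sup>2" by (simp only: power2_eq_square[of "u + 1"] mult.assoc)
      qed (use u in auto)
      finally show ?thesis .
    qed
    have b: "2 * real k + 2 \<le> real (m - 1)" and rm: "real m = real (m - 1) + 1" using m by auto
    have "2 \<le> 2 * real k + 2" by simp
    from sq[OF this b] have "(real m / real (m - 1))\<^sup>2 \<le> (2 * real k + 2 + 1) / (2 * real k + 2 - 1)" by (simp only: rm)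
    moreover have "(2 * real k + 2 + 1) / (2 * real k + 2 - 1) = (2 * real k + 3) / (2 * real k + 1)" by (simp add: add.commute)
    ultimately show "(real m / real (m - 1))\<^sup>2 \<le> (2 * real k + 3) / (2 * real k + 1)" by (simp only:)
    have "card (A - {m}) = k" using Suc.hyps(2) mA by simp
    then show "(\<Prod>p\<in>A - {m}. (real p / real (p - 1))\<^sup>2) \<le> 2 * real k + 1"
      using Suc.hyps(1)[of "A - {m}"] Suc.prems by simp
  qed (auto intro: prod_nonneg)
  also have "\<dots> = 2 * real (card A) + 1" using Suc.hyps(2)[symmetric] by (simp add: field_simps)
  finally show ?case .
qed simp

text \<open>The prime 2 contributes a factor 4 to the square. The number of odd prime factors is at
  most the logarithm to base 3 of r, which \<open>odd_prod_le\<close> turns into a bound linear in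
  \<open>ln r\<close>.\<close>

lemma over_totient_bound:
  assumes "r > 0" shows "(real r / real (totient r))\<^sup>2 \<le> 4 + 8 * ln (real r)"
proof -
  define A where "A = prime_factors r - {2}"
  have fA: "finite A" by (simp add: A_def)
  have A: "odd p \<and> p \<ge> 3" if "p \<in> A" for p
  proof -
    have p: "prime p" "p \<noteq> 2" using that by (auto simp: A_def)
    then have "p > 2" using prime_ge_2_nat[of p] by simp
    then show ?thesis using p prime_odd_nat[of p] by simp
  qed
  have "(3::nat) ^ card A = (\<Prod>p\<in>A. 3)" by simp
  also have "\<dots> \<le> \<Prod>A" using A by (intro prod_mono) auto
  also have "\<dots> \<le> rad r"
  proof -
    have "\<Prod>A dvd rad r" unfolding rad_def A_def by (intro prod_dvd_prod_subset) auto
    moreover have "rad r > 0" using rad_dvd[OF assms] assms dvd_pos_nat by blast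
    ultimately show ?thesis by (rule dvd_imp_le)
  qed
  also have "\<dots> \<le> r" using rad_dvd[OF assms] assms by (rule dvd_imp_le)
  finally have "(3::real) ^ card A \<le> real r" by (metis of_nat_le_iff of_nat_numeral of_nat_power)
  then have "ln ((3::real) ^ card A) \<le> ln (real r)" by (subst ln_le_cancel_iff) (use assms in auto)
  then have "real (card A) * ln 3 \<le> ln (real r)" by (simp add: ln_realpow)
  moreover have "real (card A) * 1 \<le> real (card A) * ln 3"
  proof (intro mult_left_mono)
    have "exp 1 \<le> (3::real)" by (rule exp_le)
    then have "ln (exp 1) \<le> ln (3::real)" by (subst ln_le_cancel_iff) auto
    then show "1 \<le> ln (3::real)" by simp
  qed simp
  ultimately have cA: "real (card A) \<le> ln (real r)" by linarith
  have "real r / real (totient r) = (\<Prod>p\<in>prime_factors r. real p / real (p - 1))" by (rule over_totient[OF assms])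
  also have "\<dots> \<le> 2 * (\<Prod>p\<in>A. real p / real (p - 1))"
  proof (cases "2 \<in> prime_factors r")
    case True
    then show ?thesis unfolding A_def by (subst prod.remove[of _ 2]) auto
  next
    case False
    then have "A = prime_factors r" by (simp add: A_def)
    then show ?thesis using prod_nonneg[of A "\<lambda>p. real p / real (p - 1)"] by simp
  qed
  finally have "(real r / real (totient r))\<^sup>2 \<le> (2 * (\<Prod>p\<in>A. real p / real (p - 1)))\<^sup>2" by (intro power_mono) auto
  also have "\<dots> = 4 * (\<Prod>p\<in>A. (real p / real (p - 1))\<^sup>2)" by (simp add: power_mult_distrib prod_power_distrib)
  also have "\<dots> \<le> 4 * (2 * real (card A) + 1)" by (intro mult_left_mono odd_prod_le fA A) auto
  also have "\<dots> \<le> 4 + 8 * ln (real r)" using cA by simp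
  finally show ?thesis .
qed

definition numdiv :: "nat \<Rightarrow> nat" where "numdiv n = card {d. d dvd n}"

lemma sum_numdiv_le:
  assumes "x > 0" shows "(\<Sum>n=1..x. real (numdiv n) / real n) \<le> (1 + ln (real x))\<^sup>2"
proof -
  have "(\<Sum>n=1..x. real (numdiv n) / real n) = (\<Sum>n=1..x. \<Sum>d | d dvd n. 1 / real n)"
    by (simp add: numdiv_def)
  also have "\<dots> = (\<Sum>(n, d)\<in>(SIGMA n:{1..x}. {d. d dvd n}). 1 / real n)"
    by (rule sum.Sigma) auto
  also have "\<dots> = (\<Sum>z\<in>(\<lambda>(n, d). (d, n div d)) ` (SIGMA n:{1..x}. {d. d dvd n}). 1 / real (fst z) * (1 / real (snd z)))"
  proof (subst sum.reindex)
    show "inj_on (\<lambda>(n, d). (d, n div d)) (SIGMA n:{1..x}. {d. d dvd n})"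
      by (auto simp: inj_on_def)
    show "(\<Sum>(n, d)\<in>(SIGMA n:{1..x}. {d. d dvd n}). 1 / real n) = sum ((\<lambda>z. 1 / real (fst z) * (1 / real (snd z))) \<circ> (\<lambda>(n, d). (d, n div d))) (SIGMA n:{1..x}. {d. d dvd n})"
      by (rule sum.cong) (auto simp: real_of_nat_div)
  qed
  also have "\<dots> \<le> (\<Sum>z\<in>{1..x} \<times> {1..x}. 1 / real (fst z) * (1 / real (snd z)))"
  proof (rule sum_mono2)
    show "(\<lambda>(n, d). (d, n div d)) ` (SIGMA n:{1..x}. {d. d dvd n}) \<subseteq> {1..x} \<times> {1..x}"
    proof
      fix z assume "z \<in> (\<lambda>(n, d). (d, n div d)) ` (SIGMA n:{1..x}. {d. d dvd n})"
      then obtain n d where nd: "z = (d, n div d)" "1 \<le> n" "n \<le> x" "d dvd n" by auto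
      have "d > 0" using nd by (metis dvd_pos_nat less_le_trans zero_less_one)
      moreover have "d \<le> n" using nd by (intro dvd_imp_le) auto
      moreover have "n div d \<le> n" by simp
      moreover have "n div d > 0" using \<open>d > 0\<close> \<open>d \<le> n\<close> by (simp add: div_greater_zero_iff)
      moreover have "n div d \<le> x" using \<open>n div d \<le> n\<close> nd by linarith
      ultimately show "z \<in> {1..x} \<times> {1..x}" using nd by auto
    qed
  qed auto
  also have "\<dots> = (\<Sum>d=1..x. 1 / real d) * (\<Sum>k=1..x. 1 / real k)"
    by (simp add: sum_product sum.cartesian_product case_prod_unfold)
  also have "\<dots> \<le> (1 + ln (real x)) * (1 + ln (real x))"
    using assms by (intro mult_mono harm_le) (auto intro: sum_nonneg)
  finally show ?thesis by (simp add: power2_eq_square)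
qed

section \<open>Exponential and Ramanujan sums\<close>

definition ee :: "real \<Rightarrow> complex" where "ee x = cis (2 * pi * x)"

lemma ee_add: "ee (x + y) = ee x * ee y"
  by (simp add: ee_def cis_mult distrib_left)

lemma ee_0 [simp]: "ee 0 = 1" by (simp add: ee_def)

lemma norm_ee [simp]: "norm (ee x) = 1" by (simp add: ee_def)

lemma ee_of_int [simp]: "ee (of_int n) = 1"
  unfolding ee_def by (rule cis_multiple_2pi) simp

lemma cnj_ee: "cnj (ee x) = ee (- x)" by (simp add: ee_def cis_cnj)

lemma ee_power: "ee x ^ n = ee (real n * x)"
  by (simp add: ee_def Complex.DeMoivre mult_ac)

lemma ee_add_of_int [simp]: "ee (x + of_int n) = ee x" by (simp add: ee_add)

lemma ee_eq_if_cong: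
  assumes "[a = b] (mod int q)" shows "ee (of_int a / real q) = ee (of_int b / real q)"
proof (cases "q = 0")
  case False
  have "int q dvd a - b" using assms by (simp add: cong_iff_dvd_diff)
  then obtain k where "a - b = int q * k" by blast
  then have "a = b + int q * k" by linarith
  then have "of_int a / real q = of_int b / real q + of_int k" using False by (simp add: field_simps)
  then show ?thesis by simp
qed simp

text \<open>The left side of the key estimate is \<open>2 * sin (pi * \<bar>x\<bar>)\<close>.
  Instead of concavity, the mean value theorem serves up to \<open>pi / 3\<close>, and beyond it the
  constant lower bound 1/2 for the sine.\<close>

lemma norm_one_minus_ee_ge:
  assumes "\<bar>x\<bar> \<le> 1/2" shows "2 * \<bar>x\<bar> \<le> norm (1 - ee x)"
proof -
  define z where "z = pi * \<bar>x\<bar>"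
  have z: "0 \<le> z" "z \<le> pi / 2" using assms by (auto simp: z_def)
  have "z / pi \<le> sin z"
  proof (cases "z \<le> pi / 3")
    case True
    show ?thesis
    proof (cases "z = 0")
      case False
      then have "0 < z" using z by simp
      then obtain \<xi> where \<xi>: "0 < \<xi>" "\<xi> < z" "sin z - sin 0 = (z - 0) * cos \<xi>"
        using MVT2[of 0 z sin cos] by (auto intro: DERIV_sin)
      have "cos (pi / 3) \<le> cos \<xi>" using \<xi> True by (intro cos_monotone_0_pi_le) auto
      then have "z * (1/2) \<le> z * cos \<xi>" using z by (intro mult_left_mono) (auto simp: cos_60)
      moreover have "z / pi \<le> z * (1/2)"
        using mult_left_mono[OF pi_ge_two \<open>0 \<le> z\<close>] by (simp add: field_simps)
      ultimately show ?thesis using \<xi>(3) by (simp only: sin_zero diff_0_right)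
    qed simp
  next
    case False
    have "sin (pi / 6) \<le> sin z" using z False by (intro sin_monotone_2pi_le) auto
    moreover have "z / pi \<le> 1/2" using z(2) pi_gt_zero by (subst pos_divide_le_eq) linarith+
    ultimately show ?thesis unfolding sin_30 by linarith
  qed
  then have a: "\<bar>x\<bar> \<le> sin z" by (simp add: z_def)
  have "(norm (1 - ee x))\<^sup>2 = (2 * sin z)\<^sup>2"
  proof -
    have "(norm (1 - ee x))\<^sup>2 = (1 - cos (2 * pi * x))\<^sup>2 + (sin (2 * pi * x))\<^sup>2"
      unfolding cmod_power2 ee_def by simp
    also have "\<dots> = 2 - 2 * cos (2 * pi * x)"
      using sin_cos_squared_add[of "2 * pi * x"] by (simp add: power2_eq_square algebra_simps)
    also have "cos (2 * pi * x) = cos (2 * z)"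
      using cos_minus[of "2 * pi * x"] by (cases "x \<ge> 0") (auto simp: z_def mult_ac)
    also have "2 - 2 * cos (2 * z) = (2 * sin z)\<^sup>2" by (simp add: cos_double_sin power2_eq_square)
    finally show ?thesis .
  qed
  then have "norm (1 - ee x) = \<bar>2 * sin z\<bar>" by (metis norm_ge_zero power2_eq_iff_nonneg abs_ge_zero power2_abs)
  then show ?thesis using a by linarith
qed

lemma norm_one_minus_ee_rational:
  assumes "\<not> int q dvd b" "q > 0" shows "2 / real q \<le> norm (1 - ee (of_int b / real q))"
proof -
  define k where "k = round (of_int b / real q)"
  define x where "x = of_int b / real q - of_int k"
  have x: "\<bar>x\<bar> \<le> 1/2" unfolding x_def k_def using of_int_round_abs_le[of "of_int b / real q"] by (simp add: abs_minus_commute)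
  have "x * real q = of_int (b - k * int q)" using assms by (simp add: x_def field_simps)
  moreover have "b - k * int q \<noteq> 0" using assms(1) by (metis dvd_triv_right eq_iff_diff_eq_0)
  then have "1 \<le> \<bar>b - k * int q\<bar>" by linarith
  then have "1 \<le> \<bar>real_of_int (b - k * int q)\<bar>" unfolding of_int_abs[symmetric] by (subst of_int_1_le_iff)
  ultimately have "1 \<le> \<bar>x\<bar> * real q" by (metis abs_mult abs_of_nat)
  then have "1 / real q \<le> \<bar>x\<bar>" using assms by (simp add: field_simps)
  moreover have "ee (of_int b / real q) = ee x" using ee_add_of_int[of x k] by (simp add: x_def)
  ultimately show ?thesis using norm_one_minus_ee_ge[OF x] by simp
qed

definition esum :: "nat \<Rightarrow> real \<Rightarrow> complex" where "esum H x = (\<Sum>j=1..H. ee (real j * x))"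

lemma esum_0 [simp]: "esum H 0 = of_nat H" by (simp add: esum_def)

lemma norm_esum_le: "norm (esum H x) \<le> real H"
  unfolding esum_def by (rule order_trans[OF norm_sum]) simp

lemma cnj_esum: "cnj (esum H x) = esum H (- x)" by (simp add: esum_def cnj_ee)

lemma esum_add_of_int: "esum H (x + of_int n) = esum H x"
proof -
  have "real j * (x + of_int n) = real j * x + of_int (int j * n)" for j by (simp add: distrib_left)
  then show ?thesis by (simp only: esum_def ee_add_of_int)
qed

lemma esum_minus_of_nat: "esum H (x - real n) = esum H x"
  using esum_add_of_int[of H x "- int n"] by simp

lemma norm_esum_le_inverse:
  assumes "x \<noteq> 0" "\<bar>x\<bar> \<le> 1/2" shows "norm (esum H x) \<le> 1 / \<bar>x\<bar>"
proof -
  have "(1 - ee x) * (\<Sum>j=1..H. ee (real j * x)) = ee x - ee (real (Suc H) * x)"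
  proof (induction H)
    case (Suc H)
    have e: "ee (real (Suc (Suc H)) * x) = ee (real (Suc H) * x) * ee x"
      unfolding ee_add[symmetric] by (simp add: algebra_simps)
    show ?case
      using Suc by (simp add: ring_distribs e del: of_nat_Suc)
  qed simp
  then have "norm (1 - ee x) * norm (esum H x) \<le> 2"
    unfolding esum_def norm_mult[symmetric] using norm_triangle_ineq4[of "ee x" "ee (real (Suc H) * x)"] by simp
  moreover have "2 * \<bar>x\<bar> * norm (esum H x) \<le> norm (1 - ee x) * norm (esum H x)"
    by (intro mult_right_mono norm_one_minus_ee_ge assms) simp
  ultimately have "\<bar>x\<bar> * norm (esum H x) \<le> 1" by simp
  then show ?thesis using assms by (simp add: field_simps)
qed

lemma sum_ee_period:
  assumes "q > 0"
  shows "(\<Sum>n<q. ee (real n * of_int b / real q)) = (if int q dvd b then of_nat q else 0)"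
proof -
  define z where "z = ee (of_int b / real q)"
  have t: "ee (real n * of_int b / real q) = z ^ n" for n by (simp add: z_def ee_power)
  have zq: "z ^ q = 1" using assms by (simp add: z_def ee_power)
  show ?thesis
  proof (cases "int q dvd b")
    case True
    then obtain k where "b = int q * k" by blast
    then have "z = 1" using assms by (simp add: z_def)
    then show ?thesis unfolding t using True by simp
  next
    case False
    have "2 / real q \<le> norm (1 - z)" unfolding z_def by (rule norm_one_minus_ee_rational[OF False assms])
    then have "z \<noteq> 1" using assms by auto
    then show ?thesis unfolding t using zq False by (simp add: geometric_sum)
  qed
qed

lemma parseval:
  assumes r: "r > 0" and A: "finite A" and inj: "\<And>a b. a \<in> A \<Longrightarrow> b \<in> A \<Longrightarrow> int r dvd a - b \<Longrightarrow> a = b"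
  shows "(\<Sum>n<r. (norm (\<Sum>a\<in>A. c a * ee (real n * of_int a / real r)))\<^sup>2) = real r * (\<Sum>a\<in>A. (norm (c a))\<^sup>2)"
proof -
  have cns: "(complex_of_real (norm z))\<^sup>2 = z * cnj z" for z
    by (simp only: of_real_power[symmetric] complex_norm_square)
  have tt: "ee (real n * of_int a / real r) * ee (- (real n * of_int b / real r)) = ee (real n * of_int (a - b) / real r)" for n a b
    unfolding ee_add[symmetric] by (simp add: diff_divide_distrib right_diff_distrib)
  have "complex_of_real (\<Sum>n<r. (norm (\<Sum>a\<in>A. c a * ee (real n * of_int a / real r)))\<^sup>2) =
    (\<Sum>n<r. \<Sum>a\<in>A. \<Sum>b\<in>A. (c a * cnj (c b)) * ee (real n * of_int (a - b) / real r))"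
    unfolding of_real_sum of_real_power cns cnj_sum sum_product complex_cnj_mult cnj_ee tt[symmetric]
    by (intro sum.cong refl) (simp add: mult_ac)
  also have "\<dots> = (\<Sum>a\<in>A. \<Sum>n<r. \<Sum>b\<in>A. (c a * cnj (c b)) * ee (real n * of_int (a - b) / real r))"
    by (rule sum.swap)
  also have "\<dots> = (\<Sum>a\<in>A. \<Sum>b\<in>A. (c a * cnj (c b)) * (\<Sum>n<r. ee (real n * of_int (a - b) / real r)))"
    by (intro sum.cong refl) (subst sum.swap, simp add: sum_distrib_left)
  also have "\<dots> = (\<Sum>a\<in>A. \<Sum>b\<in>A. if b = a then (c a * cnj (c a)) * of_nat r else 0)"
    unfolding sum_ee_period[OF r]
    by (intro sum.cong refl) (use inj in auto)
  also have "\<dots> = (\<Sum>a\<in>A. (c a * cnj (c a)) * of_nat r)" using A by simp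
  also have "\<dots> = complex_of_real (real r * (\<Sum>a\<in>A. (norm (c a))\<^sup>2))"
    unfolding of_real_mult of_real_sum of_real_power cns by (simp add: sum_distrib_left mult_ac)
  finally show ?thesis by (simp only: of_real_eq_iff)
qed

section \<open>Ramanujan sums to squarefree moduli\<close>

definition ramanujan_sum :: "nat \<Rightarrow> int \<Rightarrow> complex" where
  "ramanujan_sum q b = (\<Sum>a\<in>totatives q. ee (real a * of_int b / real q))"

lemma ramanujan_sum_prime:
  assumes "prime p" shows "ramanujan_sum p b = (if int p dvd b then of_nat (p - 1) else -1)"
proof -
  have p: "p > 1" using prime_gt_1_nat[OF assms] .
  have T: "totatives p = {..<p} - {0}"
  proof -
    have "totatives p = {0<..<p}" using totatives_prime[OF assms] .
    then show ?thesis by auto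
  qed
  have "(\<Sum>n<p. ee (real n * of_int b / real p)) = ee (real 0 * of_int b / real p) + ramanujan_sum p b"
    unfolding ramanujan_sum_def T using p by (intro sum.remove) auto
  then have "ramanujan_sum p b = (if int p dvd b then of_nat p else 0) - 1" using sum_ee_period[of p b] p by simp
  then show ?thesis using p by (simp add: of_nat_diff)
qed

text \<open>A Bezout relation splits \<open>b / (p * m)\<close> into
  \<open>s * b / p + t * b / m\<close>, and the Chinese remainder theorem separates the sum. The
  twists by s and t are harmless because they are coprime to the moduli and leave every gcd
  unchanged.\<close>

lemma ramanujan_sum_mult:
  assumes c: "coprime p m" and p: "p > 1" and m: "m > 1"
  obtains s t where "coprime s (int p)" "coprime t (int m)" "\<And>b. ramanujan_sum (p * m) b = ramanujan_sum p (s * b) * ramanujan_sum m (t * b)"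
proof -
  have "coprime (int m) (int p)" using c by (simp add: coprime_commute)
  then have g: "gcd (int m) (int p) = 1" by simp
  obtain s t where st: "s * int m + t * int p = 1" using bezout_int[of "int m" "int p"] unfolding g by blast
  have cs: "coprime s (int p)"
  proof (rule coprimeI)
    fix c assume "c dvd s" "c dvd int p"
    then have "c dvd s * int m + t * int p" by (intro dvd_add dvd_mult dvd_mult2)
    then show "is_unit c" unfolding st .
  qed
  have ct: "coprime t (int m)"
  proof (rule coprimeI)
    fix c assume "c dvd t" "c dvd int m"
    then have "c dvd s * int m + t * int p" by (simp add: dvd_add)
    then show "is_unit c" unfolding st .
  qed
  have "ramanujan_sum (p * m) b = ramanujan_sum p (s * b) * ramanujan_sum m (t * b)" for b
  proof -
    let ?g = "\<lambda>(x, y). ee (real x * of_int (s * b) / real p) * ee (real y * of_int (t * b) / real m)"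
    have "ramanujan_sum (p * m) b = (\<Sum>a\<in>totatives (p * m). ?g (a mod p, a mod m))"
      unfolding ramanujan_sum_def
    proof (rule sum.cong[OF refl])
      fix a
      have "real a * of_int b / real (p * m) = real a * of_int b * of_int (s * int m + t * int p) / real (p * m)" unfolding st by simp
      also have "\<dots> = of_int (int a * (s * b)) / real p + of_int (int a * (t * b)) / real m"
        using p m by (simp add: field_simps)
      finally have "ee (real a * of_int b / real (p * m)) = ee (of_int (int a * (s * b)) / real p) * ee (of_int (int a * (t * b)) / real m)"
        by (simp only: ee_add)
      also have "ee (of_int (int a * (s * b)) / real p) = ee (of_int (int (a mod p) * (s * b)) / real p)"
        by (intro ee_eq_if_cong cong_mult cong_refl) (simp add: cong_def zmod_int)
      also have "ee (of_int (int a * (t * b)) / real m) = ee (of_int (int (a mod m) * (t * b)) / real m)"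
        by (intro ee_eq_if_cong cong_mult cong_refl) (simp add: cong_def zmod_int)
      finally show "ee (real a * of_int b / real (p * m)) = ?g (a mod p, a mod m)" by (simp only: case_prod_conv of_int_mult of_int_of_nat_eq)
    qed
    also have "\<dots> = (\<Sum>z\<in>totatives p \<times> totatives m. ?g z)"
      using sum.reindex_bij_betw[OF bij_betw_totatives[OF p m c], of ?g] by simp
    also have "\<dots> = ramanujan_sum p (s * b) * ramanujan_sum m (t * b)"
      by (simp only: ramanujan_sum_def sum_product sum.cartesian_product)
    finally show ?thesis .
  qed
  then show ?thesis using that cs ct by blast
qed

lemma gcd_mult_coprime_int:
  fixes p m b :: int
  assumes "coprime p m" shows "gcd p b * gcd m b = gcd (p * m) b"
proof (rule zdvd_antisym_nonneg)
  have c: "coprime (gcd p b) (gcd m b)" by (rule coprime_divisors[of _ p _ m]) (use assms in auto)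
  show "gcd p b * gcd m b dvd gcd (p * m) b"
    by (intro gcd_greatest mult_dvd_mono gcd_dvd1 divides_mult[OF _ _ c] gcd_dvd2)
  obtain s t where st: "s * p + t * b = gcd p b" using bezout_int by blast
  obtain s' t' where st': "s' * m + t' * b = gcd m b" using bezout_int by blast
  have "(s * p + t * b) * (s' * m + t' * b) = s * s' * (p * m) + (s * p * t' + t * b * t' + t * s' * m) * b"
    by (simp add: algebra_simps)
  then show "gcd (p * m) b dvd gcd p b * gcd m b" unfolding st st' by simp
qed auto

lemma norm_ramanujan_sum: "squarefree q \<Longrightarrow> norm (ramanujan_sum q b) = real (totient (nat (gcd (int q) b)))"
proof (induction q arbitrary: b rule: less_induct)
  case (less q)
  have q0: "q \<noteq> 0" using less.prems by (metis not_squarefree_0)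
  show ?case
  proof (cases "q = 1")
    case True
    then show ?thesis by (simp add: ramanujan_sum_def)
  next
    case False
    then obtain p where p: "prime p" "p dvd q" using prime_factor_nat by blast
    have pr: "norm (ramanujan_sum p b) = real (totient (nat (gcd (int p) b)))" for b
    proof (cases "int p dvd b")
      case True
      then have "gcd (int p) b = int p" by (simp add: gcd_nat.absorb1 abs_of_nat gcd_proj1_if_dvd_int)
      then show ?thesis using True p(1) by (simp add: ramanujan_sum_prime totient_prime)
    next
      case False
      have "prime (int p)" using p(1) by simp
      then have "coprime (int p) b" using False by (rule prime_imp_coprime)
      then have "gcd (int p) b = 1" by simp
      then show ?thesis using False p(1) by (simp add: ramanujan_sum_prime)
    qed
    obtain m where m: "q = p * m" using p(2) by blast
    have m0: "m > 0" using m q0 by (cases m) auto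
    have "\<not> p dvd m"
    proof
      assume "p dvd m"
      then have "p\<^sup>2 dvd q" using m by (simp add: power2_eq_square)
      then show False using less.prems p squarefree_def not_prime_unit by blast
    qed
    then have c: "coprime p m" using p(1) by (simp add: prime_imp_coprime)
    show ?thesis
    proof (cases "m = 1")
      case True
      then show ?thesis using m pr by simp
    next
      case False
      then have m1: "m > 1" using m0 by simp
      have p1: "p > 1" using prime_gt_1_nat[OF p(1)] .
      obtain s t where st: "coprime s (int p)" "coprime t (int m)" "\<And>b. ramanujan_sum (p * m) b = ramanujan_sum p (s * b) * ramanujan_sum m (t * b)"
        using ramanujan_sum_mult[OF c p1 m1] by blast
      have sqm: "squarefree m" using less.prems m by (meson dvd_triv_right squarefree_mono)
      have "m < q" using m p1 m0 by simp
      have "norm (ramanujan_sum q b) = real (totient (nat (gcd (int p) (s * b)))) * real (totient (nat (gcd (int m) (t * b))))"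
        unfolding m st(3) norm_mult pr less.IH[OF \<open>m < q\<close> sqm] ..
      also have "gcd (int p) (s * b) = gcd (int p) b" using st(1) by (simp add: gcd_mult_left_left_cancel gcd_mult_right_left_cancel coprime_commute)
      also have "gcd (int m) (t * b) = gcd (int m) b" using st(2) by (simp add: gcd_mult_left_left_cancel gcd_mult_right_left_cancel coprime_commute)
      also have "real (totient (nat (gcd (int p) b))) * real (totient (nat (gcd (int m) b))) = real (totient (nat (gcd (int p) b) * nat (gcd (int m) b)))"
      proof -
        have "coprime (gcd (int p) b) (gcd (int m) b)"
          by (rule coprime_divisors[of _ "int p" _ "int m"]) (use c in auto)
        then have "coprime (nat (gcd (int p) b)) (nat (gcd (int m) b))"
          by (subst coprime_int_iff[symmetric]) simp
        then show ?thesis by (simp add: totient_mult_coprime)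
      qed
      also have "nat (gcd (int p) b) * nat (gcd (int m) b) = nat (gcd (int p) b * gcd (int m) b)" by (simp add: nat_mult_distrib)
      also have "gcd (int p) b * gcd (int m) b = gcd (int p * int m) b"
        using gcd_mult_coprime_int[of "int p" "int m" b] c by simp
      finally show ?thesis by (simp add: m)
    qed
  qed
qed

section \<open>Correlation with trigonometric polynomials\<close>

text \<open>
  A second difference of \<open>max 0 (y - n)\<close> at integers, so that it is controlled by Riesz means and
  its sum is exactly \<open>B\<^sup>2\<close>.
\<close>
definition hat :: "nat \<Rightarrow> nat \<Rightarrow> real \<Rightarrow> real" where
  "hat N B x = max 0 (real (N + 2 * B) - x) - 2 * max 0 (real (N + B) - x) + max 0 (real N - x)"

lemma hat_nonneg: "0 \<le> hat N B x" and hat_le: "hat N B x \<le> real B"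
  and hat_eq_0: "x \<le> real N \<or> real (N + 2 * B) \<le> x \<Longrightarrow> hat N B x = 0"
  by (auto simp: hat_def max_def)

lemma hat_diff: "\<bar>hat N B (x + 1) - hat N B x\<bar> \<le> 1"
  unfolding hat_def max_def by simp argo

text \<open>Three Riesz means with weights 1, -2, 1, whence the constant 4 times 36. Their main
  terms have second difference exactly \<open>(real B)\<^sup>2\<close>, and the conditions on B and
  j keep all three end points below \<open>3 * N\<close>.\<close>

lemma (in dchar) hat_psi_bound:
  assumes GRH: "GRH" and \<delta>: "0 < \<delta>" "\<delta> < 1" and N: "1 \<le> N" "2 * B \<le> N" and j: "j \<le> N"
  shows "norm ((\<Sum>m\<le>3 * N. mangoldt m * chi m * of_real (hat N B (real m - real j))) - rho * of_real ((real B)\<^sup>2))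
    \<le> 144 / \<delta>\<^sup>2 * (12 + ln (16 * (1 + zeta32)) + ln (real q)) * real (3 * N) powr (3/2 + \<delta>)"
proof -
  define S where "S k = (\<Sum>m\<le>3 * N. mangoldt m * chi m * of_real (max 0 (real (N + k + j) - real m)))" for k
  define T where "T k = (real (N + k + j) - 1)\<^sup>2 / 2" for k
  define X where "X = 36 / \<delta>\<^sup>2 * (12 + ln (16 * (1 + zeta32)) + ln (real q)) * real (3 * N) powr (3/2 + \<delta>)"
  have b: "norm (S k - rho * of_real (T k)) \<le> X" if "k \<le> N" for k
  proof -
    have "real (N + k + j) \<le> real (3 * N)" using that j by (subst of_nat_le_iff) linarith
    moreover have "real (N + k + j) \<ge> 1" using N by linarith
    ultimately have "norm (S k - rho * of_real (T k)) \<le> 36 / \<delta>\<^sup>2 * (12 + ln (16 * (1 + zeta32)) + ln (real q)) * real (N + k + j) powr (3/2 + \<delta>)"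
      unfolding S_def T_def by (intro GRH_psi1_bound[OF GRH \<delta>])
    also have "\<dots> \<le> X" unfolding X_def
      using zeta32_nonneg q_pos \<delta> \<open>real (N + k + j) \<le> real (3 * N)\<close> by (intro mult_left_mono powr_mono2 mult_nonneg_nonneg add_nonneg_nonneg) auto
    finally show ?thesis .
  qed
  have "hat N B (real m - real j) = max 0 (real (N + 2 * B + j) - real m) - 2 * max 0 (real (N + B + j) - real m) + max 0 (real (N + 0 + j) - real m)" for m
    unfolding hat_def by (simp add: algebra_simps)
  then have e1: "(\<Sum>m\<le>3 * N. mangoldt m * chi m * of_real (hat N B (real m - real j))) = S (2 * B) - 2 * S B + S 0"
    by (simp only: S_def sum_distrib_left sum_subtractf[symmetric] sum.distrib[symmetric]) (intro sum.cong refl, simp add: ring_distribs)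
  have e2: "(real B)\<^sup>2 = T (2 * B) - 2 * T B + T 0"
    unfolding T_def by (simp add: power2_eq_square field_simps)
  have e3: "S (2 * B) - 2 * S B + S 0 - rho * of_real ((real B)\<^sup>2)
    = (S (2 * B) - rho * of_real (T (2 * B))) - 2 * (S B - rho * of_real (T B)) + (S 0 - rho * of_real (T 0))"
    unfolding e2 by (simp add: ring_distribs)
  have "norm (S (2 * B) - 2 * S B + S 0 - rho * of_real ((real B)\<^sup>2)) \<le> X + 2 * X + X"
  proof -
    have tri: "norm (u - 2 * v + w) \<le> X + 2 * X + X" if "norm u \<le> X" "norm v \<le> X" "norm w \<le> X" for u v w :: complex
    proof -
      have "norm (u - 2 * v + w) \<le> norm u + norm (2 * v) + norm w" by norm
      then show ?thesis using that by (simp only: norm_mult norm_numeral)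
    qed
    show ?thesis unfolding e3 by (rule tri; rule b) (use N in auto)
  qed
  also have "X + 2 * X + X = 144 / \<delta>\<^sup>2 * (12 + ln (16 * (1 + zeta32)) + ln (real q)) * real (3 * N) powr (3/2 + \<delta>)"
    unfolding X_def by (simp add: ring_distribs)
  finally show ?thesis unfolding e1 .
qed

lemma card_prime_factors_le:
  assumes "q > 0" shows "real (card (prime_factors q)) \<le> 2 * ln (real q)"
proof -
  have "(2::nat) ^ card (prime_factors q) = (\<Prod>p\<in>prime_factors q. 2)" by simp
  also have "\<dots> \<le> (\<Prod>p\<in>prime_factors q. p ^ multiplicity p q)"
  proof (rule prod_mono)
    fix p assume p: "p \<in> prime_factors q"
    then have "prime p" "multiplicity p q > 0" by (auto simp: prime_factors_multiplicity)
    then have "p ^ 1 \<le> p ^ multiplicity p q" using prime_ge_1_nat[of p] by (intro power_increasing) auto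
    then show "0 \<le> (2::nat) \<and> 2 \<le> p ^ multiplicity p q" using prime_ge_2_nat[OF \<open>prime p\<close>] by simp
  qed
  also have "\<dots> = q" using assms prod_prime_factors[of q] by simp
  finally have "real (2 ^ card (prime_factors q)) \<le> real q" by (simp only: of_nat_le_iff)
  then have "ln (2 ^ card (prime_factors q)) \<le> ln (real q)" using assms by (subst ln_le_cancel_iff) auto
  then have "real (card (prime_factors q)) * ln 2 \<le> ln (real q)" by (simp add: ln_realpow)
  moreover have "real (card (prime_factors q)) * (1/2) \<le> real (card (prime_factors q)) * ln 2"
    using ln2_ge_two_thirds by (intro mult_left_mono) auto
  ultimately show ?thesis by linarith
qed

text \<open>Only powers of primes dividing q occur; the powers of one prime up to x contribute at
  most \<open>ln x\<close> altogether.\<close>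

lemma mangoldt_not_coprime_sum_le:
  assumes q: "q > 0" and x: "x > 0"
  shows "(\<Sum>m | m \<le> x \<and> \<not> coprime m q. mangoldt m) \<le> 2 * ln (real q) * ln (real x)"
proof -
  define k where "k p = nat \<lfloor>ln (real x) / ln (real p)\<rfloor>" for p
  have sub: "{m. m \<le> x \<and> \<not> coprime m q \<and> primepow m} \<subseteq> (\<lambda>(p, i). p ^ i) ` (SIGMA p:prime_factors q. {1..k p})"
  proof
    fix m assume "m \<in> {m. m \<le> x \<and> \<not> coprime m q \<and> primepow m}"
    then obtain p i where m: "m \<le> x" "\<not> coprime m q" "prime p" "i > 0" "m = p ^ i" by (auto simp: primepow_def)
    then have "\<not> coprime p q" using coprime_power_left_iff[of p i q] by simp
    then have "p dvd q" using m(3) prime_imp_coprime by blast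
    then have "p \<in> prime_factors q" using m q by (auto simp: prime_factors_dvd)
    moreover have "i \<in> {1..k p}"
    proof -
      have p1: "real p > 1" using prime_gt_1_nat[OF m(3)] by simp
      have "real (p ^ i) \<le> real x" using m by (simp only: of_nat_le_iff)
      then have "ln (real p ^ i) \<le> ln (real x)" using p1 x by (subst ln_le_cancel_iff) auto
      then have "real i * ln (real p) \<le> ln (real x)" using p1 by (simp add: ln_realpow)
      then have "real i \<le> ln (real x) / ln (real p)" using p1 by (simp add: field_simps)
      then have "int i \<le> \<lfloor>ln (real x) / ln (real p)\<rfloor>" by (simp add: le_floor_iff)
      then show ?thesis using m(4) unfolding k_def by auto
    qed
    ultimately show "m \<in> (\<lambda>(p, i). p ^ i) ` (SIGMA p:prime_factors q. {1..k p})" using m(5) by force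
  qed
  have "(\<Sum>m | m \<le> x \<and> \<not> coprime m q. mangoldt m :: real) = (\<Sum>m | m \<le> x \<and> \<not> coprime m q \<and> primepow m. mangoldt m)"
    by (rule sum.mono_neutral_right) (auto simp: mangoldt_def)
  also have "\<dots> \<le> (\<Sum>m\<in>(\<lambda>(p, i). p ^ i) ` (SIGMA p:prime_factors q. {1..k p}). mangoldt m)"
    by (rule sum_mono2[OF _ sub]) (auto simp: mangoldt_nonneg)
  also have "\<dots> \<le> (\<Sum>z\<in>(SIGMA p:prime_factors q. {1..k p}). (mangoldt \<circ> (\<lambda>(p, i). p ^ i)) z)"
    by (rule sum_image_le) (auto simp: mangoldt_nonneg)
  also have "\<dots> = (\<Sum>p\<in>prime_factors q. \<Sum>i\<in>{1..k p}. mangoldt (p ^ i))"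
    by (subst sum.Sigma) (auto intro!: sum.cong)
  also have "\<dots> \<le> (\<Sum>p\<in>prime_factors q. ln (real x))"
  proof (rule sum_mono)
    fix p assume "p \<in> prime_factors q"
    then have p: "prime p" by auto
    have p1: "real p > 1" using prime_gt_1_nat[OF p] by simp
    have "(\<Sum>i\<in>{1..k p}. mangoldt (p ^ i) :: real) = (\<Sum>i\<in>{1..k p}. ln (real p))" using p by (intro sum.cong) auto
    also have "\<dots> = real (k p) * ln (real p)" by simp
    also have "\<dots> \<le> (ln (real x) / ln (real p)) * ln (real p)"
      unfolding k_def using p1 x by (intro mult_right_mono) (auto intro: of_nat_floor)
    also have "\<dots> = ln (real x)" using p1 by simp
    finally show "(\<Sum>i\<in>{1..k p}. mangoldt (p ^ i) :: real) \<le> ln (real x)" .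
  qed
  also have "\<dots> = real (card (prime_factors q)) * ln (real x)" by simp
  also have "\<dots> \<le> 2 * ln (real q) * ln (real x)" using x by (intro mult_right_mono card_prime_factors_le q) auto
  finally show ?thesis .
qed

text \<open>The lcm is the product of \<open>r div gcd r s\<close> and s, and these are coprime
  because a common factor would divide r twice.\<close>

lemma squarefree_lcm:
  fixes r s :: nat
  assumes "squarefree r" "squarefree s" shows "squarefree (lcm r s)"
proof (cases "gcd r s = 0")
  case False
  define d where "d = gcd r s"
  have r: "r = d * (r div d)" and d0: "d > 0" using False by (auto simp: d_def)
  have c1: "coprime (r div d) (s div d)" unfolding d_def using False by (intro div_gcd_coprime) auto
  have c2: "coprime (r div d) d"
  proof (rule coprimeI)
    fix c assume "c dvd r div d" "c dvd d"
    then have "c * c dvd d * (r div d)" by (intro mult_dvd_mono)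
    then have "c\<^sup>2 dvd r" using r by (simp add: power2_eq_square)
    then show "is_unit c" using assms(1) unfolding squarefree_def by blast
  qed
  have s: "s = d * (s div d)" by (simp add: d_def)
  have "coprime (r div d) (d * (s div d))" using c1 c2 by simp
  then have "coprime (r div d) s" using s by simp
  moreover have "r div d dvd r" using r by (metis dvd_triv_right)
  then have "squarefree (r div d)" using assms(1) squarefree_mono by blast
  ultimately have "squarefree ((r div d) * s)" using assms(2) by (intro squarefree_mult_coprime)
  also have "(r div d) * s = lcm r s" unfolding d_def lcm_nat_def by (rule dvd_div_mult) simp
  finally show ?thesis .
qed (use assms in auto)

text \<open>The numerator of \<open>a/r - b/s\<close> over the denominator \<open>lcm r s\<close>.\<close>
definition cross :: "nat \<Rightarrow> int \<Rightarrow> nat \<Rightarrow> int \<Rightarrow> int" where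
  "cross r a s b = a * int (s div gcd r s) - b * int (r div gcd r s)"

lemma cross_div_lcm:
  assumes "r > 0" "s > 0"
  shows "of_int a / real r - of_int b / real s = of_int (cross r a s b) / real (lcm r s)"
proof -
  define d r' s' where "d = gcd r s" and "r' = r div d" and "s' = s div d"
  have rs: "r = d * r'" "s = d * s'" by (auto simp: d_def r'_def s'_def)
  have d0: "d > 0" using assms by (simp add: d_def)
  have "d * lcm r s = r * s" unfolding d_def by (rule prod_gcd_lcm_nat[symmetric])
  also have "\<dots> = d * (d * r' * s')" unfolding rs by (simp only: mult_ac)
  finally have l: "lcm r s = d * r' * s'" using d0 by simp
  have "r' \<noteq> 0" "s' \<noteq> 0" using assms unfolding rs by (rule_tac notI, simp)+
  then have p: "real d > 0" "real r' > 0" "real s' > 0" using d0 by auto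
  have "of_int a / (real d * real r') - of_int b / (real d * real s') = (of_int a * real s' - of_int b * real r') / (real d * real r' * real s')"
    using p by (simp add: field_simps)
  then show ?thesis unfolding cross_def d_def[symmetric] r'_def[symmetric] s'_def[symmetric] l unfolding rs
    by simp
qed

text \<open>By Parseval modulo r, \<open>mass_le\<close> says that the square sum over one full
  period of the part with denominator r is at most Q. This normalization is uniform in r and is the
  quantity that the character estimate consumes.\<close>

locale trig_polynomial =
  fixes S :: "nat set" and A :: "nat \<Rightarrow> int set" and c :: "nat \<Rightarrow> int \<Rightarrow> complex" and Q R :: real
  assumes finite_S: "finite S" and squarefree_S: "r \<in> S \<Longrightarrow> squarefree r" and S_le: "r \<in> S \<Longrightarrow> real r \<le> R"
    and finite_A: "r \<in> S \<Longrightarrow> finite (A r)" and coprime_A: "r \<in> S \<Longrightarrow> a \<in> A r \<Longrightarrow> coprime a (int r)"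
    and A_inj: "r \<in> S \<Longrightarrow> a \<in> A r \<Longrightarrow> b \<in> A r \<Longrightarrow> int r dvd a - b \<Longrightarrow> a = b"
    and mass_le: "r \<in> S \<Longrightarrow> real r * (\<Sum>a\<in>A r. (norm (c r a))\<^sup>2) \<le> Q"
    and Q_nonneg: "0 \<le> Q"
begin

definition part :: "nat \<Rightarrow> int \<Rightarrow> complex" where
  "part r n = (\<Sum>a\<in>A r. c r a * ee (of_int (n * a) / real r))"

definition total :: "int \<Rightarrow> complex" where "total n = (\<Sum>r\<in>S. part r n)"

lemma S_pos: "r \<in> S \<Longrightarrow> r > 0"
  using squarefree_S[of r] by (metis not_squarefree_0 neq0_conv)

lemma part_cong: "[m = n] (mod int r) \<Longrightarrow> part r m = part r n"
  unfolding part_def by (intro sum.cong refl arg_cong2[of _ _ _ _ "(*)"] ee_eq_if_cong cong_mult cong_refl)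

lemma part_mean_square:
  assumes r: "r \<in> S" shows "(\<Sum>n<r. (norm (part r (int n - j)))\<^sup>2) \<le> Q"
proof -
  have "part r (int n - j) = (\<Sum>a\<in>A r. (c r a * ee (of_int (- j * a) / real r)) * ee (real n * of_int a / real r))" for n
    unfolding part_def by (intro sum.cong refl) (simp add: mult.assoc ee_add[symmetric] left_diff_distrib diff_divide_distrib)
  then have "(\<Sum>n<r. (norm (part r (int n - j)))\<^sup>2) = real r * (\<Sum>a\<in>A r. (norm (c r a * ee (of_int (- j * a) / real r)))\<^sup>2)"
    using parseval[OF S_pos[OF r] finite_A[OF r] A_inj[OF r], of "\<lambda>a. c r a * ee (of_int (- j * a) / real r)"] by simp
  then show ?thesis using mass_le[OF r] by (simp add: norm_mult)
qed

lemma norm_part_le: assumes r: "r \<in> S" shows "norm (part r n) \<le> sqrt Q"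
proof -
  have "(norm (part r n))\<^sup>2 \<le> (\<Sum>k<r. (norm (part r (int k - (- n))))\<^sup>2)"
    using member_le_sum[of 0 "{..<r}" "\<lambda>k. (norm (part r (int k - (- n))))\<^sup>2"] S_pos[OF r] by simp
  also have "\<dots> \<le> Q" by (rule part_mean_square[OF r])
  finally show ?thesis by (rule real_le_rsqrt)
qed

text \<open>A residue modulo the lcm is determined by its residues modulo r and s, so the sum is
  dominated by the product of the two full-period square sums. The supremum bound for the product
  would lose a factor of the size of the modulus.\<close>

lemma product_mean_square:
  assumes r: "r \<in> S" and s: "s \<in> S"
  shows "(\<Sum>a\<in>totatives (lcm r s). (norm (part r (int a - j) * cnj (part s (int a - j))))\<^sup>2) \<le> Q\<^sup>2"
proof -
  let ?q = "lcm r s"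
  define f where "f r n = (norm (part r (int n - j)))\<^sup>2" for r and n :: nat
  have q0: "?q > 0" by (rule lcm_pos_nat[OF S_pos[OF r] S_pos[OF s]])
  have fm: "f r n = f r (n mod r)" for r n
    unfolding f_def by (rule arg_cong[where f="\<lambda>z. (norm z)\<^sup>2"], rule part_cong, rule cong_diff)
      (auto simp: cong_def zmod_int)
  have inj: "inj_on (\<lambda>a. (a mod r, a mod s)) (totatives ?q)"
  proof (rule inj_onI)
    fix a b assume a: "a \<in> totatives ?q" "b \<in> totatives ?q" "(a mod r, a mod s) = (b mod r, b mod s)"
    then have c: "[a = b] (mod ?q)" by (intro cong_cong_lcm_nat) (auto simp: cong_def)
    \<comment> \<open>Totatives are taken from 1 to the modulus rather than from 0, so the
      representative equal to the modulus is separated before uniqueness of residues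
      applies.\<close>
    show "a = b"
    proof (cases "a = ?q \<or> b = ?q")
      case True
      then have "a mod ?q = 0" "b mod ?q = 0" using c by (auto simp: cong_def)
      then have "?q dvd a" "?q dvd b" by (auto simp: mod_eq_0_iff_dvd)
      then have "?q \<le> a" "?q \<le> b" using a by (auto simp: in_totatives_iff intro: dvd_imp_le)
      then show ?thesis using a by (simp add: in_totatives_iff)
    next
      case False
      moreover have "a \<le> ?q" "b \<le> ?q" using a by (simp_all add: in_totatives_iff)
      ultimately have "a < ?q" "b < ?q" by (metis order_less_le)+
      then show ?thesis using c cong_less_modulus_unique_nat by blast
    qed
  qed
  have "(\<Sum>a\<in>totatives ?q. (norm (part r (int a - j) * cnj (part s (int a - j))))\<^sup>2) = (\<Sum>a\<in>totatives ?q. f r (a mod r) * f s (a mod s))"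
    unfolding norm_mult complex_mod_cnj power_mult_distrib f_def[symmetric] by (rule sum.cong[OF refl], rule arg_cong2[of _ _ _ _ "(*)", OF fm fm])
  also have "\<dots> = (\<Sum>z\<in>(\<lambda>a. (a mod r, a mod s)) ` totatives ?q. f r (fst z) * f s (snd z))"
    by (subst sum.reindex[OF inj]) simp
  also have "\<dots> \<le> (\<Sum>z\<in>{..<r} \<times> {..<s}. f r (fst z) * f s (snd z))"
    by (rule sum_mono2) (auto simp: S_pos r s f_def)
  also have "\<dots> = (\<Sum>n<r. f r n) * (\<Sum>n<s. f s n)"
    unfolding sum_product sum.cartesian_product by (simp add: case_prod_unfold)
  also have "\<dots> \<le> Q * Q" unfolding f_def by (intro mult_mono part_mean_square r s sum_nonneg Q_nonneg) auto
  finally show ?thesis by (simp only: power2_eq_square)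
qed

text \<open>The product of two parts has the frequencies \<open>a/r - b/s\<close> with denominator
  \<open>lcm r s\<close>; summing over totatives turns each of them into a Ramanujan sum. This is
  where the main term acquires its arithmetic.\<close>

lemma product_totatives:
  assumes r: "r \<in> S" and s: "s \<in> S"
  shows "(\<Sum>n\<in>totatives (lcm r s). part r (int n - j) * cnj (part s (int n - j)))
    = (\<Sum>a\<in>A r. \<Sum>b\<in>A s. c r a * cnj (c s b) * ramanujan_sum (lcm r s) (cross r a s b) * ee (- (of_int j * (of_int (cross r a s b) / real (lcm r s)))))"
proof -
  let ?q = "lcm r s"
  have t: "part r (int n - j) * cnj (part s (int n - j)) = (\<Sum>a\<in>A r. \<Sum>b\<in>A s. c r a * cnj (c s b) * ee (- (of_int j * (of_int (cross r a s b) / real ?q))) * ee (real n * of_int (cross r a s b) / real ?q))" for n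
  proof -
    have e: "ee (of_int ((int n - j) * a) / real r) * cnj (ee (of_int ((int n - j) * b) / real s))
       = ee (- (of_int j * (of_int (cross r a s b) / real ?q))) * ee (real n * of_int (cross r a s b) / real ?q)" for a b
    proof -
      have "of_int ((int n - j) * a) / real r - of_int ((int n - j) * b) / real s = (real n - of_int j) * (of_int a / real r - of_int b / real s)"
        by (simp add: algebra_simps)
      also have "\<dots> = (real n - of_int j) * (of_int (cross r a s b) / real ?q)" unfolding cross_div_lcm[OF S_pos[OF r] S_pos[OF s]] ..
      finally have "of_int ((int n - j) * a) / real r + - (of_int ((int n - j) * b) / real s) = - (of_int j * (of_int (cross r a s b) / real ?q)) + real n * of_int (cross r a s b) / real ?q"
        by (simp only: diff_conv_add_uminus[symmetric]) (simp add: left_diff_distrib diff_divide_distrib)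
      then show ?thesis unfolding cnj_ee ee_add[symmetric] by (simp only:)
    qed
    have "(c r a * ee (of_int ((int n - j) * a) / real r)) * cnj (c s b * ee (of_int ((int n - j) * b) / real s)) =
      c r a * cnj (c s b) * ee (- (of_int j * (of_int (cross r a s b) / real ?q))) * ee (real n * of_int (cross r a s b) / real ?q)" for a b
      using e[of a b] by (simp only: complex_cnj_mult mult_ac)
    then show ?thesis unfolding part_def cnj_sum sum_product by (simp only:)
  qed
  show ?thesis unfolding t ramanujan_sum_def sum_distrib_left sum_distrib_right
    by (subst sum.swap, rule sum.cong[OF refl], subst sum.swap, intro sum.cong refl) (simp add: mult_ac)
qed

lemma lcm_le: assumes "r \<in> S" "s \<in> S" shows "real (lcm r s) \<le> R\<^sup>2"
proof -
  have "lcm r s \<le> r * s" using S_pos assms by (intro dvd_imp_le lcm_least) auto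
  then have "real (lcm r s) \<le> real r * real s" by (simp only: of_nat_mult[symmetric] of_nat_le_iff)
  also have "\<dots> \<le> R * R" using S_le assms by (intro mult_mono) (auto intro: order_trans[OF of_nat_0_le_iff])
  finally show ?thesis by (simp only: power2_eq_square)
qed

definition err_bound :: "real \<Rightarrow> nat \<Rightarrow> real" where
  "err_bound \<delta> N = 144 / \<delta>\<^sup>2 * (12 + ln (16 * (1 + zeta32)) + ln (R\<^sup>2)) * real (3 * N) powr (3/2 + \<delta>)"

text \<open>Three replacements: the m not coprime to the modulus are dropped, the weight is replaced
  by its mean over totatives through the characters, and the remaining sum of von Mangoldt values by
  \<open>(real B)\<^sup>2\<close> through the principal character. The last two cost one character
  error each.\<close>

lemma pair_bound:
  assumes GRH: "GRH" and \<delta>: "0 < \<delta>" "\<delta> < 1" and N: "1 \<le> N" "2 * B \<le> N" and j: "j \<le> N"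
    and r: "r \<in> S" and s: "s \<in> S"
  shows "norm ((\<Sum>m\<le>3 * N. mangoldt m * of_real (hat N B (real m - real j)) * (part r (int m - int j) * cnj (part s (int m - int j))))
      - (\<Sum>n\<in>totatives (lcm r s). part r (int n - int j) * cnj (part s (int n - int j))) / of_nat (totient (lcm r s)) * of_real ((real B)\<^sup>2))
    \<le> Q * (2 * err_bound \<delta> N + real B * (2 * ln (R\<^sup>2) * ln (real (3 * N))))"
proof -
  define q where "q = lcm r s"
  define W where "W n = part r (int n - int j) * cnj (part s (int n - int j))" for n
  define f where "f m = (mangoldt m * of_real (hat N B (real m - real j)) :: complex)" for m
  define U where "U = (\<Sum>m | m \<in> {..3 * N} \<and> coprime m q. f m * W m)"
  define F where "F = (\<Sum>m | m \<in> {..3 * N} \<and> coprime m q. f m)"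
  define t where "t = (\<Sum>n\<in>totatives q. W n) / of_nat (totient q)"
  have q0: "q > 0" unfolding q_def by (rule lcm_pos_nat[OF S_pos[OF r] S_pos[OF s]])
  have sq: "squarefree q" unfolding q_def by (intro squarefree_lcm squarefree_S r s)
  have qR: "real q \<le> R\<^sup>2" unfolding q_def by (rule lcm_le[OF r s])
  have lnq: "0 \<le> ln (real q)" "ln (real q) \<le> ln (R\<^sup>2)" using q0 qR by (simp, subst ln_le_cancel_iff, auto)
  have ch: "norm ((\<Sum>m\<le>3 * N. f m * chi m) - dchar.rho q chi * of_real ((real B)\<^sup>2)) \<le> err_bound \<delta> N" if "dirichlet_character q chi" for chi
  proof -
    interpret dchar q chi using that by (simp add: dchar_def)
    have "(\<Sum>m\<le>3 * N. f m * chi m) = (\<Sum>m\<le>3 * N. mangoldt m * chi m * of_real (hat N B (real m - real j)))"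
      unfolding f_def by (intro sum.cong refl) (simp only: mult_ac)
    moreover have "144 / \<delta>\<^sup>2 * (12 + ln (16 * (1 + zeta32)) + ln (real q)) * real (3 * N) powr (3/2 + \<delta>) \<le> err_bound \<delta> N"
      unfolding err_bound_def using lnq by (intro mult_right_mono mult_left_mono) auto
    ultimately show ?thesis using hat_psi_bound[OF GRH \<delta> N j] by simp
  qed
  have e0: "0 \<le> err_bound \<delta> N" unfolding err_bound_def using lnq zeta32_nonneg by (intro mult_nonneg_nonneg add_nonneg_nonneg) auto
  have Wle: "norm (W n) \<le> Q" for n
  proof -
    have "norm (W n) \<le> sqrt Q * sqrt Q" unfolding W_def norm_mult complex_mod_cnj by (intro mult_mono norm_part_le r s) (use Q_nonneg in auto)
    then show ?thesis using Q_nonneg by simp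
  qed
  have Wcong: "W m = W n" if "[m = n] (mod q)" for m n
  proof -
    have "[int m = int n] (mod int q)" using that by (simp add: cong_int_iff)
    then have "[int m = int n] (mod int r)" "[int m = int n] (mod int s)"
      unfolding q_def by (auto elim!: cong_dvd_modulus)
    from this[THEN cong_diff[OF _ cong_refl], THEN part_cong] show ?thesis by (simp only: W_def)
  qed
  have 1: "norm ((\<Sum>m\<le>3 * N. f m * W m) - U) \<le> Q * (real B * (2 * ln (R\<^sup>2) * ln (real (3 * N))))"
  proof -
    have "(\<Sum>m\<le>3 * N. f m * W m) = U + (\<Sum>m | m \<in> {..3 * N} \<and> \<not> coprime m q. f m * W m)"
      unfolding U_def by (subst sum.union_disjoint[symmetric]) (auto intro: sum.cong)
    then have "norm ((\<Sum>m\<le>3 * N. f m * W m) - U) = norm (\<Sum>m | m \<in> {..3 * N} \<and> \<not> coprime m q. f m * W m)" by simp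
    also have "\<dots> \<le> (\<Sum>m | m \<in> {..3 * N} \<and> \<not> coprime m q. mangoldt m * (real B * Q))"
    proof (rule sum_norm_le)
      fix m
      have "norm (f m * W m) = mangoldt m * (hat N B (real m - real j) * norm (W m))"
        unfolding f_def using hat_nonneg by (simp add: norm_mult mult_ac)
      also have "\<dots> \<le> mangoldt m * (real B * Q)" by (intro mult_left_mono mult_mono hat_le Wle mangoldt_nonneg) auto
      finally show "norm (f m * W m) \<le> mangoldt m * (real B * Q)" .
    qed
    also have "\<dots> = (\<Sum>m | m \<le> 3 * N \<and> \<not> coprime m q. mangoldt m) * (real B * Q)" by (simp add: sum_distrib_right)
    also have "\<dots> \<le> (2 * ln (real q) * ln (real (3 * N))) * (real B * Q)"
      using Q_nonneg N by (intro mult_right_mono mangoldt_not_coprime_sum_le q0) auto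
    also have "\<dots> \<le> (2 * ln (R\<^sup>2) * ln (real (3 * N))) * (real B * Q)"
      using Q_nonneg lnq N by (intro mult_right_mono mult_left_mono) auto
    finally show ?thesis by (simp only: mult_ac)
  qed
  have 2: "norm (U - t * F) \<le> Q * err_bound \<delta> N"
  proof -
    have "norm (U - t * F) \<le> err_bound \<delta> N * sqrt (\<Sum>a\<in>totatives q. (norm (W a))\<^sup>2)"
      unfolding U_def t_def F_def
    proof (rule character_mean_square[OF sq _ e0 _ Wcong])
      fix chi assume chi: "dirichlet_character q chi" "\<not> principal q chi"
      then show "norm (\<Sum>m\<in>{..3 * N}. f m * chi m) \<le> err_bound \<delta> N"
        using ch[OF chi(1)] by (simp add: dchar.rho_def dchar_def)
    qed auto
    also have "\<dots> \<le> err_bound \<delta> N * Q"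
      using product_mean_square[OF r s, of "int j"] Q_nonneg unfolding W_def q_def by (intro mult_left_mono e0 real_le_lsqrt) auto
    finally show ?thesis by (simp only: mult_ac)
  qed
  have 3: "norm (t * F - t * of_real ((real B)\<^sup>2)) \<le> Q * err_bound \<delta> N"
  proof -
    define chi where "chi n = (if coprime n q then 1 else 0 :: complex)" for n
    have "coprime (n + q) q \<longleftrightarrow> coprime n q" for n by (metis coprime_iff_gcd_eq_1 gcd_add1)
    then have chi: "dirichlet_character q chi" using q0 unfolding dirichlet_character_def chi_def by auto
    have "principal q chi" by (simp add: principal_def chi_def)
    moreover have "(\<Sum>m\<le>3 * N. f m * chi m) = F"
      unfolding F_def chi_def by (rule sum.mono_neutral_cong_right) auto
    ultimately have F: "norm (F - of_real ((real B)\<^sup>2)) \<le> err_bound \<delta> N" using ch[OF chi] chi by (simp add: dchar.rho_def dchar_def)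
    have "norm (\<Sum>n\<in>totatives q. W n) \<le> (\<Sum>n\<in>totatives q. Q)" by (rule sum_norm_le[OF Wle])
    also have "\<dots> = Q * real (totient q)" by (simp add: totient_def)
    finally have "norm t \<le> Q" unfolding t_def using q0 by (simp add: norm_divide field_simps)
    then show ?thesis unfolding right_diff_distrib[symmetric] norm_mult using F by (intro mult_mono Q_nonneg) auto
  qed
  have "norm ((\<Sum>m\<le>3 * N. f m * W m) - t * of_real ((real B)\<^sup>2)) \<le>
    norm ((\<Sum>m\<le>3 * N. f m * W m) - U) + norm (U - t * F) + norm (t * F - t * of_real ((real B)\<^sup>2))" by norm
  also have "\<dots> \<le> Q * (real B * (2 * ln (R\<^sup>2) * ln (real (3 * N)))) + Q * err_bound \<delta> N + Q * err_bound \<delta> N"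
    by (intro add_mono 1 2 3)
  also have "\<dots> = Q * (2 * err_bound \<delta> N + real B * (2 * ln (R\<^sup>2) * ln (real (3 * N))))" by (simp add: algebra_simps)
  finally show ?thesis unfolding f_def W_def t_def q_def .
qed

lemma norm_total_square: "of_real ((norm (total n))\<^sup>2) = (\<Sum>r\<in>S. \<Sum>s\<in>S. part r n * cnj (part s n))"
  unfolding total_def by (simp only: complex_norm_square cnj_sum sum_product)

text \<open>The pair estimate is summed over all pairs of denominators and all shifts. The sum over
  j of the phases from \<open>product_totatives\<close> is what produces the conjugated
  \<open>esum\<close>.\<close>

lemma main_sum_bound:
  assumes GRH: "GRH" and \<delta>: "0 < \<delta>" "\<delta> < 1" and N: "1 \<le> N" "2 * B \<le> N" and H: "H \<le> N"
  shows "norm ((\<Sum>j=1..H. \<Sum>m\<le>3 * N. mangoldt m * of_real (hat N B (real m - real j)) * of_real ((norm (total (int m - int j)))\<^sup>2))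
      - of_real ((real B)\<^sup>2) * (\<Sum>r\<in>S. \<Sum>s\<in>S. \<Sum>a\<in>A r. \<Sum>b\<in>A s. c r a * cnj (c s b) *
          (ramanujan_sum (lcm r s) (cross r a s b) / of_nat (totient (lcm r s))) * cnj (esum H (of_int (cross r a s b) / real (lcm r s)))))
    \<le> real H * (real (card S))\<^sup>2 * (Q * (2 * err_bound \<delta> N + real B * (2 * ln (R\<^sup>2) * ln (real (3 * N)))))"
proof -
  define X where "X j r s = (\<Sum>m\<le>3 * N. mangoldt m * of_real (hat N B (real m - real j)) * (part r (int m - int j) * cnj (part s (int m - int j))))" for j r s
  define Y where "Y j r s = (\<Sum>n\<in>totatives (lcm r s). part r (int n - int j) * cnj (part s (int n - int j))) / of_nat (totient (lcm r s)) * of_real ((real B)\<^sup>2)" for j r s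
  have 1: "(\<Sum>m\<le>3 * N. mangoldt m * of_real (hat N B (real m - real j)) * of_real ((norm (total (int m - int j)))\<^sup>2)) = (\<Sum>r\<in>S. \<Sum>s\<in>S. X j r s)" for j
    unfolding norm_total_square X_def sum_distrib_left
    by (subst sum.swap, rule sum.cong[OF refl], subst sum.swap, rule refl)
  have 2: "of_real ((real B)\<^sup>2) * (\<Sum>a\<in>A r. \<Sum>b\<in>A s. c r a * cnj (c s b) *
          (ramanujan_sum (lcm r s) (cross r a s b) / of_nat (totient (lcm r s))) * cnj (esum H (of_int (cross r a s b) / real (lcm r s)))) = (\<Sum>j=1..H. Y j r s)"
    if rs: "r \<in> S" "s \<in> S" for r s
  proof -
    have e: "cnj (esum H x) = (\<Sum>j=1..H. ee (- (real j * x)))" for x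
      by (simp add: esum_def cnj_ee)
    show ?thesis unfolding Y_def product_totatives[OF rs] e sum_distrib_left sum_distrib_right sum_divide_distrib
      by (rule sym, subst sum.swap, rule sum.cong[OF refl], subst sum.swap, intro sum.cong refl) (simp add: mult_ac)
  qed
  have "(\<Sum>j=1..H. \<Sum>r\<in>S. \<Sum>s\<in>S. X j r s) - (\<Sum>r\<in>S. \<Sum>s\<in>S. \<Sum>j=1..H. Y j r s) = (\<Sum>j=1..H. \<Sum>r\<in>S. \<Sum>s\<in>S. X j r s - Y j r s)"
  proof -
    have "(\<Sum>r\<in>S. \<Sum>s\<in>S. \<Sum>j=1..H. Y j r s) = (\<Sum>j=1..H. \<Sum>r\<in>S. \<Sum>s\<in>S. Y j r s)"
      by (subst sum.swap[of _ S "{1..H}"], subst sum.swap[of _ S "{1..H}"], rule refl)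
    then show ?thesis by (simp only: sum_subtractf)
  qed
  also have "norm \<dots> \<le> (\<Sum>j=1..H. \<Sum>r\<in>S. \<Sum>s\<in>S. (Q * (2 * err_bound \<delta> N + real B * (2 * ln (R\<^sup>2) * ln (real (3 * N))))))"
    unfolding X_def Y_def by (intro sum_norm_le pair_bound GRH \<delta> N) (use H in auto)
  also have "\<dots> = real H * (real (card S))\<^sup>2 * (Q * (2 * err_bound \<delta> N + real B * (2 * ln (R\<^sup>2) * ln (real (3 * N)))))"
    by (simp add: power2_eq_square)
  finally have "norm ((\<Sum>j=1..H. \<Sum>r\<in>S. \<Sum>s\<in>S. X j r s) - (\<Sum>r\<in>S. \<Sum>s\<in>S. \<Sum>j=1..H. Y j r s)) \<le>
    real H * (real (card S))\<^sup>2 * (Q * (2 * err_bound \<delta> N + real B * (2 * ln (R\<^sup>2) * ln (real (3 * N)))))" .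
  moreover have "(\<Sum>r\<in>S. \<Sum>s\<in>S. \<Sum>j=1..H. Y j r s) = of_real ((real B)\<^sup>2) * (\<Sum>r\<in>S. \<Sum>s\<in>S. \<Sum>a\<in>A r. \<Sum>b\<in>A s. c r a * cnj (c s b) *
          (ramanujan_sum (lcm r s) (cross r a s b) / of_nat (totient (lcm r s))) * cnj (esum H (of_int (cross r a s b) / real (lcm r s))))"
    unfolding sum_distrib_left[of _ _ S] by (intro sum.cong refl 2[symmetric])
  ultimately show ?thesis unfolding 1 by (simp only:)
qed

end

section \<open>Mean square of the polynomial under the hat\<close>

lemma sum_max_linear:
  "y \<le> M \<Longrightarrow> (\<Sum>n\<le>M. max 0 (real y - real n)) = real y * (real y + 1) / 2"
proof (induction M arbitrary: y)
  case (Suc M)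
  show ?case
  proof (cases "y = Suc M")
    case True
    have "(\<Sum>n\<le>k. max 0 (real k + x - real n)) = (real k + 1) * (real k + 2 * x) / 2" if "x \<ge> 0" for k and x :: real
    proof -
      have "(\<Sum>n\<le>k. max 0 (real k + x - real n)) = (\<Sum>n\<le>k. real k + x - real n)"
        using that by (intro sum.cong refl) (auto simp: max_def)
      also have "\<dots> = (real k + 1) * (real k + x) - (\<Sum>n\<le>k. real n)" by (simp add: sum_subtractf algebra_simps)
      also have "(\<Sum>n\<le>k. real n) = real k * (real k + 1) / 2" by (induction k) (auto simp: field_simps)
      finally show ?thesis by (simp add: field_simps)
    qed
    from this[of 0 "Suc M"] show ?thesis using True by (simp add: field_simps)
  qed (use Suc in \<open>simp add: max_def\<close>)
qed simp

lemma sum_hat: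
  assumes "N + 2 * B \<le> M" shows "(\<Sum>n\<le>M. hat N B (real n)) = (real B)\<^sup>2"
proof -
  have "(\<Sum>n\<le>M. hat N B (real n)) = (\<Sum>n\<le>M. max 0 (real (N + 2 * B) - real n)) - 2 * (\<Sum>n\<le>M. max 0 (real (N + B) - real n)) + (\<Sum>n\<le>M. max 0 (real N - real n))"
    unfolding hat_def by (simp add: sum.distrib sum_subtractf sum_distrib_left)
  also have "\<dots> = (real B)\<^sup>2"
    using assms by (subst sum_max_linear, linarith)+ (simp add: power2_eq_square field_simps)
  finally show ?thesis .
qed

text \<open>One summation by parts: multiplied by \<open>1 - z\<close>, the sum involves only
  differences of the hat, which are at most 1 and live on 2B integers, while
  \<open>norm (1 - z)\<close> is at least \<open>2 / q\<close>.\<close>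

lemma norm_hat_ee_le:
  assumes q: "q > 0" "\<not> int q dvd b" and M: "N + 2 * B \<le> M"
  shows "norm (\<Sum>n\<le>M. of_real (hat N B (real n)) * ee (real n * of_int b / real q)) \<le> real B * real q"
proof -
  define z where "z = ee (of_int b / real q)"
  define v where "v n = hat N B (real n)" for n
  have zn: "ee (real n * of_int b / real q) = z ^ n" for n by (simp add: z_def ee_power)
  have nz: "norm (z ^ n) = 1" for n by (simp add: z_def norm_power)
  have v0: "v 0 = 0" "v M = 0" unfolding v_def using M by (auto intro!: hat_eq_0)
  have tel: "(1 - z) * (\<Sum>n\<le>k. of_real (v n) * z ^ n) = of_real (v 0) + (\<Sum>n<k. of_real (v (Suc n) - v n) * z ^ Suc n) - of_real (v k) * z ^ Suc k" for k
  proof (induction k)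
    case (Suc k)
    have "(1 - z) * (\<Sum>n\<le>Suc k. of_real (v n) * z ^ n) = (1 - z) * (\<Sum>n\<le>k. of_real (v n) * z ^ n) + (1 - z) * (of_real (v (Suc k)) * z ^ Suc k)"
      by (simp add: distrib_left)
    then show ?case unfolding Suc by (simp add: algebra_simps)
  qed (simp add: algebra_simps)
  have "norm ((1 - z) * (\<Sum>n\<le>M. of_real (v n) * z ^ n)) = norm (\<Sum>n<M. of_real (v (Suc n) - v n) * z ^ Suc n)"
    unfolding tel v0 by simp
  also have "\<dots> = norm (\<Sum>n\<in>{N..<N + 2 * B}. of_real (v (Suc n) - v n) * z ^ Suc n)"
  proof (rule arg_cong[where f = norm], rule sum.mono_neutral_right)
    show "\<forall>n\<in>{..<M} - {N..<N + 2 * B}. of_real (v (Suc n) - v n) * z ^ Suc n = 0"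
    proof
      fix n assume "n \<in> {..<M} - {N..<N + 2 * B}"
      then have "n < N \<or> N + 2 * B \<le> n" by auto
      then have "(Suc n \<le> N \<or> N + 2 * B \<le> Suc n) \<and> (n \<le> N \<or> N + 2 * B \<le> n)" by auto
      then have "v (Suc n) = 0 \<and> v n = 0" unfolding v_def by (intro conjI hat_eq_0) (simp_all only: of_nat_le_iff)
      then show "of_real (v (Suc n) - v n) * z ^ Suc n = 0" by simp
    qed
  qed (use M in auto)
  also have "\<dots> \<le> (\<Sum>n\<in>{N..<N + 2 * B}. 1)"
  proof (rule sum_norm_le)
    fix n
    have "norm (of_real (v (Suc n) - v n) * z ^ Suc n) = \<bar>hat N B (real n + 1) - hat N B (real n)\<bar>"
      unfolding norm_mult nz norm_of_real v_def by (simp add: add.commute)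
    then show "norm (of_real (v (Suc n) - v n) * z ^ Suc n) \<le> 1" using hat_diff[of N B "real n"] by linarith
  qed
  also have "\<dots> = 2 * real B" by simp
  finally have "norm (1 - z) * norm (\<Sum>n\<le>M. of_real (v n) * z ^ n) \<le> 2 * real B" by (simp only: norm_mult)
  moreover have "2 / real q * norm (\<Sum>n\<le>M. of_real (v n) * z ^ n) \<le> norm (1 - z) * norm (\<Sum>n\<le>M. of_real (v n) * z ^ n)"
    unfolding z_def by (intro mult_right_mono norm_one_minus_ee_rational q) auto
  ultimately have "2 / real q * norm (\<Sum>n\<le>M. of_real (v n) * z ^ n) \<le> 2 * real B" by linarith
  then show ?thesis unfolding zn v_def[symmetric] using q(1) by (simp add: field_simps)
qed

context trig_polynomial
begin

text \<open>Two reduced fractions \<open>a/r\<close> and \<open>b/s\<close> that agree modulo 1 have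
  equal denominators, and then \<open>A_inj\<close> identifies the numerators.\<close>

lemma cross_dvd:
  assumes r: "r \<in> S" and s: "s \<in> S" and a: "a \<in> A r" and b: "b \<in> A s" and d: "int (lcm r s) dvd cross r a s b"
  shows "r = s \<and> a = b"
proof -
  have p: "r > 0" "s > 0" using S_pos r s by auto
  obtain k where k: "cross r a s b = int (lcm r s) * k" using d by blast
  have l0: "lcm r s > 0" by (rule lcm_pos_nat[OF p])
  have "of_int a / real r - of_int b / real s = of_int k"
    unfolding cross_div_lcm[OF p] k using l0 p by simp
  then have "of_int a * real s - of_int b * real r = of_int k * real r * real s" using p by (simp add: field_simps)
  then have "real_of_int (a * int s - b * int r) = real_of_int (k * int r * int s)" by simp
  then have e: "a * int s - b * int r = k * int r * int s" by (simp only: of_int_eq_iff)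
  have "a * int s = int r * (k * int s + b)" using e by (simp add: algebra_simps)
  then have "int r dvd a * int s" by simp
  then have 1: "int r dvd int s" using coprime_A[OF r a] by (simp add: coprime_dvd_mult_right_iff coprime_commute)
  have "b * int r = int s * (a - k * int r)" using e by (simp add: algebra_simps)
  then have "int s dvd b * int r" by simp
  then have "int s dvd int r" using coprime_A[OF s b] by (simp add: coprime_dvd_mult_right_iff coprime_commute)
  then have rs: "r = s" using 1 by (simp add: dvd_antisym)
  have "(a - b) * int r = (k * int r) * int r" using e rs by (simp add: algebra_simps)
  then have "a - b = k * int r" using p by simp
  then have "int r dvd a - b" by simp
  then show ?thesis using A_inj[OF r a] b rs by auto
qed

lemma card_A_le: assumes r: "r \<in> S" shows "card (A r) \<le> r"
proof -
  have "inj_on (\<lambda>a. a mod int r) (A r)" by (rule inj_onI) (metis A_inj[OF r] mod_eq_dvd_iff)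
  then have "card (A r) \<le> card {0..<int r}" by (rule card_inj_on_le) (use S_pos[OF r] in auto)
  then show ?thesis by simp
qed

lemma sum_norm_coeff_le: assumes r: "r \<in> S" shows "(\<Sum>a\<in>A r. norm (c r a)) \<le> sqrt Q"
proof (rule real_le_rsqrt)
  have "(\<Sum>a\<in>A r. norm (c r a))\<^sup>2 \<le> (\<Sum>a\<in>A r. (1::real)\<^sup>2) * (\<Sum>a\<in>A r. (norm (c r a))\<^sup>2)"
    using Cauchy_Schwarz_ineq_sum[of "\<lambda>_. 1" "\<lambda>a. norm (c r a)" "A r"] by simp
  also have "\<dots> = real (card (A r)) * (\<Sum>a\<in>A r. (norm (c r a))\<^sup>2)" by simp
  also have "\<dots> \<le> real r * (\<Sum>a\<in>A r. (norm (c r a))\<^sup>2)" using card_A_le[OF r] by (intro mult_right_mono sum_nonneg) auto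
  also have "\<dots> \<le> Q" by (rule mass_le[OF r])
  finally show "(\<Sum>a\<in>A r. norm (c r a))\<^sup>2 \<le> Q" .
qed

text \<open>Equal frequencies give exactly \<open>(real B)\<^sup>2\<close>; distinct ones are not
  integers apart by \<open>cross_dvd\<close>, so their exponential sums are small. The coefficients
  of one denominator sum to at most the root of Q.\<close>

lemma hat_total_sum:
  assumes M: "N + 2 * B \<le> M"
  shows "\<bar>(\<Sum>n\<le>M. hat N B (real n) * (norm (total (int n)))\<^sup>2) - (real B)\<^sup>2 * (\<Sum>r\<in>S. \<Sum>a\<in>A r. (norm (c r a))\<^sup>2)\<bar>
    \<le> (real (card S))\<^sup>2 * (Q * (real B * R\<^sup>2))"
proof -
  define X where "X r s = (\<Sum>n\<le>M. of_real (hat N B (real n)) * (part r (int n) * cnj (part s (int n))))" for r s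
  define Y where "Y r s = (if r = s then of_real ((real B)\<^sup>2 * (\<Sum>a\<in>A r. (norm (c r a))\<^sup>2)) else (0 :: complex))" for r s
  have b: "norm (X r s - Y r s) \<le> Q * (real B * R\<^sup>2)" if r: "r \<in> S" and s: "s \<in> S" for r s
  proof -
    let ?q = "lcm r s"
    have q0: "?q > 0" by (rule lcm_pos_nat[OF S_pos[OF r] S_pos[OF s]])
    define Z where "Z a b = (\<Sum>n\<le>M. of_real (hat N B (real n)) * ee (real n * of_int (cross r a s b) / real ?q))" for a b
    define D where "D a b = (if r = s \<and> a = b then of_real ((real B)\<^sup>2) else (0 :: complex))" for a b :: int
    have pp: "part r (int n) * cnj (part s (int n)) = (\<Sum>a\<in>A r. \<Sum>b\<in>A s. c r a * cnj (c s b) * ee (real n * of_int (cross r a s b) / real ?q))" for n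
    proof -
      have "ee (of_int (int n * a) / real r) * cnj (ee (of_int (int n * b) / real s)) = ee (real n * of_int (cross r a s b) / real ?q)" for a b
      proof -
        have "of_int (int n * a) / real r + - (of_int (int n * b) / real s) = real n * (of_int a / real r - of_int b / real s)"
          by (simp add: algebra_simps)
        also have "\<dots> = real n * of_int (cross r a s b) / real ?q" unfolding cross_div_lcm[OF S_pos[OF r] S_pos[OF s]] by simp
        finally show ?thesis unfolding cnj_ee ee_add[symmetric] by (simp only:)
      qed
      then have "(c r a * ee (of_int (int n * a) / real r)) * cnj (c s b * ee (of_int (int n * b) / real s)) = c r a * cnj (c s b) * ee (real n * of_int (cross r a s b) / real ?q)" for a b
        by (metis (no_types, opaque_lifting) complex_cnj_mult mult.assoc mult.left_commute)
      then show ?thesis unfolding part_def cnj_sum sum_product by (simp only:)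
    qed
    have XZ: "X r s = (\<Sum>a\<in>A r. \<Sum>b\<in>A s. c r a * cnj (c s b) * Z a b)"
      unfolding X_def pp Z_def sum_distrib_left
      by (subst sum.swap, rule sum.cong[OF refl], subst sum.swap, intro sum.cong refl) (simp add: mult_ac)
    have YD: "Y r s = (\<Sum>a\<in>A r. \<Sum>b\<in>A s. c r a * cnj (c s b) * D a b)"
    proof (cases "r = s")
      case True
      have "(\<Sum>a\<in>A r. \<Sum>b\<in>A s. c r a * cnj (c s b) * D a b) = (\<Sum>a\<in>A r. \<Sum>b\<in>A r. if b = a then of_real ((real B)\<^sup>2) * (c r a * cnj (c r a)) else 0)"
        using True by (intro sum.cong refl) (auto simp: D_def)
      also have "\<dots> = (\<Sum>a\<in>A r. of_real ((real B)\<^sup>2) * (c r a * cnj (c r a)))" using finite_A[OF r] by simp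
      also have "\<dots> = Y r s" using True unfolding Y_def by (simp add: sum_distrib_left complex_norm_square[symmetric])
      finally show ?thesis ..
    qed (simp add: Y_def D_def)
    have ZD: "norm (Z a b - D a b) \<le> real B * R\<^sup>2" if ab: "a \<in> A r" "b \<in> A s" for a b
    proof (cases "r = s \<and> a = b")
      case True
      then have "cross r a s b = 0" by (simp add: cross_def)
      then have "Z a b = of_real (\<Sum>n\<le>M. hat N B (real n))" unfolding Z_def by simp
      then show ?thesis using True unfolding sum_hat[OF M] D_def by simp
    next
      case False
      then have "\<not> int ?q dvd cross r a s b" using cross_dvd[OF r s ab] by blast
      then have "norm (Z a b) \<le> real B * real ?q" unfolding Z_def by (rule norm_hat_ee_le[OF q0 _ M])
      also have "\<dots> \<le> real B * R\<^sup>2" by (intro mult_left_mono lcm_le r s) auto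
      finally show ?thesis using False by (auto simp: D_def)
    qed
    have "X r s - Y r s = (\<Sum>a\<in>A r. \<Sum>b\<in>A s. c r a * cnj (c s b) * (Z a b - D a b))"
      unfolding XZ YD by (simp only: sum_subtractf[symmetric] right_diff_distrib)
    also have "norm \<dots> \<le> (\<Sum>a\<in>A r. \<Sum>b\<in>A s. norm (c r a) * norm (c s b) * (real B * R\<^sup>2))"
      by (intro sum_norm_le) (auto simp: norm_mult intro!: mult_left_mono ZD)
    also have "\<dots> = (\<Sum>a\<in>A r. norm (c r a)) * (\<Sum>b\<in>A s. norm (c s b)) * (real B * R\<^sup>2)"
      unfolding sum_product by (simp only: sum_distrib_right)
    also have "\<dots> \<le> sqrt Q * sqrt Q * (real B * R\<^sup>2)"
      by (intro mult_right_mono mult_mono sum_norm_coeff_le r s sum_nonneg) (auto simp: Q_nonneg)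
    finally show ?thesis using Q_nonneg by simp
  qed
  have X: "(\<Sum>r\<in>S. \<Sum>s\<in>S. X r s) = of_real (\<Sum>n\<le>M. hat N B (real n) * (norm (total (int n)))\<^sup>2)"
    unfolding of_real_sum of_real_mult norm_total_square X_def sum_distrib_left
    by (rule sym, subst sum.swap, rule sum.cong[OF refl], subst sum.swap, rule refl)
  have Y: "(\<Sum>r\<in>S. \<Sum>s\<in>S. Y r s) = of_real ((real B)\<^sup>2 * (\<Sum>r\<in>S. \<Sum>a\<in>A r. (norm (c r a))\<^sup>2))"
  proof -
    have "(\<Sum>r\<in>S. \<Sum>s\<in>S. Y r s) = (\<Sum>r\<in>S. of_real ((real B)\<^sup>2 * (\<Sum>a\<in>A r. (norm (c r a))\<^sup>2)))"
      unfolding Y_def using finite_S by simp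
    then show ?thesis by (simp only: of_real_sum sum_distrib_left of_real_mult)
  qed
  have "norm ((\<Sum>r\<in>S. \<Sum>s\<in>S. X r s) - (\<Sum>r\<in>S. \<Sum>s\<in>S. Y r s)) = norm (\<Sum>r\<in>S. \<Sum>s\<in>S. X r s - Y r s)"
    by (simp only: sum_subtractf)
  also have "\<dots> \<le> (\<Sum>r\<in>S. \<Sum>s\<in>S. Q * (real B * R\<^sup>2))" by (intro sum_norm_le b)
  also have "\<dots> = (real (card S))\<^sup>2 * (Q * (real B * R\<^sup>2))" by (simp add: power2_eq_square)
  finally show ?thesis unfolding X Y by (simp only: of_real_diff[symmetric] norm_of_real)
qed

end

section \<open>The resonator\<close>

lemma cnj_ramanujan_sum: "cnj (ramanujan_sum q b) = ramanujan_sum q (- b)"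
  by (simp add: ramanujan_sum_def cnj_ee)

lemma ramanujan_sum_0: "ramanujan_sum q 0 = of_nat (totient q)"
  by (simp add: ramanujan_sum_def totient_def)

lemma card_abs_le:
  assumes "u \<ge> 0" shows "real (card {a :: int. a \<noteq> 0 \<and> \<bar>real_of_int a\<bar> \<le> u}) \<le> 2 * u"
proof -
  have "{a :: int. a \<noteq> 0 \<and> \<bar>real_of_int a\<bar> \<le> u} \<subseteq> {1..\<lfloor>u\<rfloor>} \<union> {- \<lfloor>u\<rfloor>..-1}"
  proof
    fix a :: int assume "a \<in> {a. a \<noteq> 0 \<and> \<bar>real_of_int a\<bar> \<le> u}"
    then have "a \<noteq> 0" "\<bar>a\<bar> \<le> \<lfloor>u\<rfloor>" by (auto simp: le_floor_iff)
    then show "a \<in> {1..\<lfloor>u\<rfloor>} \<union> {- \<lfloor>u\<rfloor>..-1}" by auto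
  qed
  then have "card {a :: int. a \<noteq> 0 \<and> \<bar>real_of_int a\<bar> \<le> u} \<le> card ({1..\<lfloor>u\<rfloor>} \<union> {- \<lfloor>u\<rfloor>..-1})" by (intro card_mono) auto
  also have "\<dots> \<le> card {1..\<lfloor>u\<rfloor>} + card {- \<lfloor>u\<rfloor>..-1}" by (rule card_Un_le)
  also have "\<dots> = 2 * nat \<lfloor>u\<rfloor>" by simp
  finally have "real (card {a :: int. a \<noteq> 0 \<and> \<bar>real_of_int a\<bar> \<le> u}) \<le> real (2 * nat \<lfloor>u\<rfloor>)" by (simp only: of_nat_le_iff)
  also have "\<dots> \<le> 2 * u" using assms by simp
  finally show ?thesis .
qed

text \<open>\<open>1 \<le> \<eta> * y\<close> ensures that the window of numerators has length at
  least 1 for every denominator beyond y, so that rounding it costs at most a factor 2.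
  \<open>\<eta> < 1 / 2\<close> keeps the fractions distinct modulo 1.\<close>

locale resonator =
  fixes H y x :: nat and \<eta> :: real
  assumes H_pos: "H > 0" and y_pos: "y > 0" and x_pos: "x > 0" and \<eta>_y: "1 \<le> \<eta> * real y" and \<eta>_less: "\<eta> < 1 / 2"
begin

definition S :: "nat set" where "S = {r. squarefree r \<and> y < r \<and> r \<le> x}"
definition A :: "nat \<Rightarrow> int set" where "A r = {a. coprime a (int r) \<and> \<bar>real_of_int a\<bar> \<le> \<eta> * real r}"
text \<open>As a is coprime to r, the Ramanujan sum equals the Moebius value of r, so this is the
  coefficient of the formal Ramanujan expansion summed over H shifts. It is left as a Ramanujan sum
  because the same sum and the conjugate \<open>esum\<close> come out of
  \<open>product_totatives\<close>, so that the mixed terms become squares.\<close>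

definition c0 :: "nat \<Rightarrow> int \<Rightarrow> complex" where
  "c0 r a = cnj (ramanujan_sum r a) / of_nat (totient r) * esum H (of_int a / real r)"
definition V :: real where "V = (\<Sum>r\<in>S. \<Sum>a\<in>A r. (norm (c0 r a))\<^sup>2)"
text \<open>Not the von Mangoldt function: a majorant of \<open>(n / totient n)\<^sup>2\<close> for
  n up to the square of x, the range of the lcm of two denominators.\<close>

definition \<Lambda> :: real where "\<Lambda> = 4 + 16 * ln (real x)"
text \<open>The last factor exceeds what the masses of the parts require; it is included so that Q
  also bounds V, the mass of the constant frequency.\<close>

definition Q :: real where "Q = 2 * \<eta> * (real H)\<^sup>2 * \<Lambda> * (1 + ln (real x))"

lemma \<eta>_pos: "\<eta> > 0"
proof (rule ccontr)
  assume "\<not> \<eta> > 0"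
  then have "\<eta> * real y \<le> 0" by (intro mult_nonpos_nonneg) auto
  then show False using \<eta>_y by linarith
qed

lemma \<Lambda>_ge: "\<Lambda> \<ge> 4" and ln_x_nonneg: "0 \<le> ln (real x)"
  using x_pos by (auto simp: \<Lambda>_def)

lemma S_gt_1: "r \<in> S \<Longrightarrow> r > 1" and S_squarefree: "r \<in> S \<Longrightarrow> squarefree r" and S_le_x: "r \<in> S \<Longrightarrow> r \<le> x"
  and S_gt_y: "r \<in> S \<Longrightarrow> y < r" and finite_S: "finite S"
  using y_pos by (auto simp: S_def intro: finite_subset[of _ "{..x}"])

lemma \<eta>_r: "r \<in> S \<Longrightarrow> 1 \<le> \<eta> * real r"
proof -
  assume "r \<in> S"
  then have "\<eta> * real y \<le> \<eta> * real r" using S_gt_y[of r] \<eta>_pos by (intro mult_left_mono) auto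
  then show ?thesis using \<eta>_y by linarith
qed

lemma over_totient_le:
  assumes "n > 0" "real n \<le> (real x)\<^sup>2" shows "1 / (real (totient n))\<^sup>2 \<le> \<Lambda> / (real n)\<^sup>2"
proof -
  have "ln (real n) \<le> ln ((real x)\<^sup>2)" using assms by (subst ln_le_cancel_iff) (auto intro: x_pos)
  then have "ln (real n) \<le> 2 * ln (real x)" using x_pos by (simp add: ln_realpow)
  then have "(real n / real (totient n))\<^sup>2 \<le> \<Lambda>" using over_totient_bound[OF assms(1)] unfolding \<Lambda>_def by linarith
  then show ?thesis using assms(1) by (simp add: power_divide field_simps)
qed

lemma S_le_square: "r \<in> S \<Longrightarrow> real r \<le> (real x)\<^sup>2"
proof -
  assume "r \<in> S"
  then have "real r \<le> real x" using S_le_x by simp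
  also have "\<dots> \<le> (real x)\<^sup>2" using x_pos by (intro self_le_power) auto
  finally show ?thesis .
qed

lemma A_bound:
  assumes "r \<in> S" shows "finite (A r)" "real (card (A r)) \<le> 2 * \<eta> * real r"
proof -
  have sub: "A r \<subseteq> {a :: int. a \<noteq> 0 \<and> \<bar>real_of_int a\<bar> \<le> \<eta> * real r}"
    using S_gt_1[OF assms] by (auto simp: A_def)
  have "{a :: int. a \<noteq> 0 \<and> \<bar>real_of_int a\<bar> \<le> \<eta> * real r} \<subseteq> {- \<lfloor>\<eta> * real r\<rfloor>..\<lfloor>\<eta> * real r\<rfloor>}"
    by (auto simp: le_floor_iff abs_le_iff) linarith
  then have fin: "finite {a :: int. a \<noteq> 0 \<and> \<bar>real_of_int a\<bar> \<le> \<eta> * real r}" by (rule finite_subset) simp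
  then show "finite (A r)" using sub by (rule finite_subset[rotated])
  have "card (A r) \<le> card {a :: int. a \<noteq> 0 \<and> \<bar>real_of_int a\<bar> \<le> \<eta> * real r}" by (rule card_mono[OF fin sub])
  then have "real (card (A r)) \<le> real (card {a :: int. a \<noteq> 0 \<and> \<bar>real_of_int a\<bar> \<le> \<eta> * real r})" by (simp only: of_nat_le_iff)
  also have "\<dots> \<le> 2 * (\<eta> * real r)" by (rule card_abs_le) (use \<eta>_pos in auto)
  finally show "real (card (A r)) \<le> 2 * \<eta> * real r" by simp
qed

lemma A_1: "A 1 = {0}"
proof -
  have "a = 0" if "\<bar>real_of_int a\<bar> \<le> \<eta>" for a :: int
  proof -
    have "\<bar>real_of_int a\<bar> < 1" using that \<eta>_less by linarith
    then show ?thesis by linarith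
  qed
  then show ?thesis using \<eta>_pos by (auto simp: A_def)
qed

lemma A_inj:
  assumes "r > 0" "a \<in> A r" "b \<in> A r" "int r dvd a - b" shows "a = b"
proof (rule ccontr)
  assume "a \<noteq> b"
  then have "int r \<le> \<bar>a - b\<bar>" using dvd_imp_le_int[OF _ assms(4)] by simp
  then have "real r \<le> \<bar>real_of_int a\<bar> + \<bar>real_of_int b\<bar>" by linarith
  also have "\<dots> \<le> 2 * (\<eta> * real r)" using assms by (auto simp: A_def)
  also have "\<dots> < real r" using \<eta>_less assms(1) by (simp add: mult.assoc[symmetric])
  finally show False by simp
qed

lemma norm_ramanujan_sum_A: "r \<in> S \<Longrightarrow> a \<in> A r \<Longrightarrow> norm (ramanujan_sum r a) = 1"
  using norm_ramanujan_sum[OF S_squarefree, of r a] by (auto simp: A_def coprime_commute)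

lemma norm_c0:
  assumes "r \<in> S" "a \<in> A r" shows "norm (c0 r a) = norm (esum H (of_int a / real r)) / real (totient r)"
  using norm_ramanujan_sum_A[OF assms] by (simp add: c0_def norm_mult norm_divide)

lemma mass_c0_le:
  assumes r: "r \<in> S" shows "real r * (\<Sum>a\<in>A r. (norm (c0 r a))\<^sup>2) \<le> 2 * \<eta> * (real H)\<^sup>2 * \<Lambda>"
proof -
  have r0: "real r > 0" using S_gt_1[OF r] by simp
  have "(\<Sum>a\<in>A r. (norm (c0 r a))\<^sup>2) \<le> (\<Sum>a\<in>A r. (real H)\<^sup>2 * (\<Lambda> / (real r)\<^sup>2))"
  proof (rule sum_mono)
    fix a assume a: "a \<in> A r"
    have "(norm (c0 r a))\<^sup>2 = (norm (esum H (of_int a / real r)))\<^sup>2 * (1 / (real (totient r))\<^sup>2)"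
      unfolding norm_c0[OF r a] by (simp add: power_divide)
    also have "\<dots> \<le> (real H)\<^sup>2 * (\<Lambda> / (real r)\<^sup>2)"
      using S_gt_1[OF r] by (intro mult_mono power_mono norm_esum_le over_totient_le S_le_square r) auto
    finally show "(norm (c0 r a))\<^sup>2 \<le> (real H)\<^sup>2 * (\<Lambda> / (real r)\<^sup>2)" .
  qed
  also have "\<dots> = real (card (A r)) * ((real H)\<^sup>2 * (\<Lambda> / (real r)\<^sup>2))" by simp
  also have "\<dots> \<le> (2 * \<eta> * real r) * ((real H)\<^sup>2 * (\<Lambda> / (real r)\<^sup>2))"
    using \<Lambda>_ge by (intro mult_right_mono A_bound r) auto
  finally have "real r * (\<Sum>a\<in>A r. (norm (c0 r a))\<^sup>2) \<le> real r * ((2 * \<eta> * real r) * ((real H)\<^sup>2 * (\<Lambda> / (real r)\<^sup>2)))"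
    by (intro mult_left_mono) auto
  also have "\<dots> = 2 * \<eta> * (real H)\<^sup>2 * \<Lambda>" using r0 by (simp add: power2_eq_square)
  finally show ?thesis .
qed

lemma sum_inverse_S_le: "(\<Sum>r\<in>S. 1 / real r) \<le> 1 + ln (real x)"
proof -
  have "(\<Sum>r\<in>S. 1 / real r) \<le> (\<Sum>r=1..x. 1 / real r)" by (rule sum_mono2) (auto simp: S_def)
  then show ?thesis using harm_le[OF x_pos] by linarith
qed

lemma V_nonneg: "0 \<le> V" unfolding V_def by (intro sum_nonneg) auto

lemma V_le: "V \<le> Q"
proof -
  have "V \<le> (\<Sum>r\<in>S. 2 * \<eta> * (real H)\<^sup>2 * \<Lambda> * (1 / real r))"
    unfolding V_def
  proof (rule sum_mono)
    fix r assume r: "r \<in> S"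
    then have "real r > 0" using S_gt_1[OF r] by simp
    then show "(\<Sum>a\<in>A r. (norm (c0 r a))\<^sup>2) \<le> 2 * \<eta> * (real H)\<^sup>2 * \<Lambda> * (1 / real r)"
      using mass_c0_le[OF r] by (simp add: field_simps)
  qed
  also have "\<dots> = 2 * \<eta> * (real H)\<^sup>2 * \<Lambda> * (\<Sum>r\<in>S. 1 / real r)" by (simp add: sum_distrib_left)
  also have "\<dots> \<le> Q" unfolding Q_def using \<Lambda>_ge \<eta>_pos by (intro mult_left_mono sum_inverse_S_le) auto
  finally show ?thesis .
qed

lemma mass_c0_le_Q: "r \<in> S \<Longrightarrow> real r * (\<Sum>a\<in>A r. (norm (c0 r a))\<^sup>2) \<le> Q"
proof -
  assume "r \<in> S"
  have "2 * \<eta> * (real H)\<^sup>2 * \<Lambda> * 1 \<le> Q" unfolding Q_def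
    using \<Lambda>_ge \<eta>_pos ln_x_nonneg by (intro mult_left_mono) auto
  then show ?thesis using mass_c0_le[OF \<open>r \<in> S\<close>] by linarith
qed

text \<open>The gcd is bounded by the sum of all common divisors, and at most \<open>H / d\<close>
  of the l are divisible by d.\<close>

lemma sum_gcd_le:
  assumes "r > 0" shows "(\<Sum>l=1..H. real (gcd r l)) \<le> real H * real (numdiv r)"
proof -
  have "(\<Sum>l=1..H. real (gcd r l)) \<le> (\<Sum>l=1..H. \<Sum>d | d dvd r. if d dvd l then real d else 0)"
  proof (rule sum_mono)
    fix l
    show "real (gcd r l) \<le> (\<Sum>d | d dvd r. if d dvd l then real d else 0)"
      using member_le_sum[of "gcd r l" "{d. d dvd r}" "\<lambda>d. if d dvd l then real d else 0"] assms by simp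
  qed
  also have "\<dots> = (\<Sum>d | d dvd r. real d * real (card {l \<in> {1..H}. d dvd l}))"
    by (subst sum.swap) (simp add: sum.If_cases Int_def mult_ac)
  also have "\<dots> \<le> (\<Sum>d | d dvd r. real H)"
  proof (rule sum_mono)
    fix d assume "d \<in> {d. d dvd r}"
    then have d: "d > 0" using assms by (auto intro: Nat.gr0I)
    have "{l \<in> {1..H}. d dvd l} \<subseteq> (\<lambda>k. d * k) ` {1..H div d}"
    proof
      fix l assume "l \<in> {l \<in> {1..H}. d dvd l}"
      then obtain k where k: "l = d * k" "1 \<le> l" "l \<le> H" by auto
      then have "1 \<le> k" by (cases k) auto
      moreover have "k \<le> H div d" using k d by (metis div_le_mono nonzero_mult_div_cancel_left less_irrefl)
      ultimately show "l \<in> (\<lambda>k. d * k) ` {1..H div d}" using k by auto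
    qed
    then have "card {l \<in> {1..H}. d dvd l} \<le> card {1..H div d}" by (rule surj_card_le[rotated]) simp
    then have "d * card {l \<in> {1..H}. d dvd l} \<le> d * (H div d)" by simp
    also have "\<dots> \<le> H" by simp
    finally show "real d * real (card {l \<in> {1..H}. d dvd l}) \<le> real H" by (simp only: of_nat_mult[symmetric] of_nat_le_iff)
  qed
  also have "\<dots> = real H * real (numdiv r)" by (simp add: numdiv_def)
  finally show ?thesis .
qed

text \<open>Opening the square leaves Ramanujan sums at the differences of two shifts. The H equal
  pairs give the totient each; the others are bounded by gcds, which sum to H times a divisor count
  for each shift.\<close>

lemma sum_esum_totatives_ge:
  assumes r: "r \<in> S"
  shows "(\<Sum>a\<in>totatives r. (norm (esum H (real a / real r)))\<^sup>2) \<ge> real H * real (totient r) - 2 * (real H)\<^sup>2 * real (numdiv r)"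
proof -
  have r0: "r > 0" using S_gt_1[OF r] by simp
  have sq: "complex_of_real ((norm (esum H (real a / real r)))\<^sup>2) = (\<Sum>j=1..H. \<Sum>k=1..H. ee (real a * of_int (int j - int k) / real r))" for a
  proof -
    have "ee (real j * (real a / real r)) * cnj (ee (real k * (real a / real r))) = ee (real a * of_int (int j - int k) / real r)" for j k
      unfolding cnj_ee ee_add[symmetric] by (simp add: right_diff_distrib diff_divide_distrib mult_ac)
    then show ?thesis unfolding complex_norm_square esum_def cnj_sum sum_product by (simp only:)
  qed
  have "complex_of_real (\<Sum>a\<in>totatives r. (norm (esum H (real a / real r)))\<^sup>2) = (\<Sum>j=1..H. \<Sum>k=1..H. ramanujan_sum r (int j - int k))"
    unfolding of_real_sum sq ramanujan_sum_def
    by (subst sum.swap, rule sum.cong[OF refl], subst sum.swap, rule refl)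
  also have "\<dots> = (\<Sum>j=1..H. ramanujan_sum r 0 + (\<Sum>k\<in>{1..H} - {j}. ramanujan_sum r (int j - int k)))"
  proof (rule sum.cong[OF refl])
    fix j assume "j \<in> {1..H}"
    then show "(\<Sum>k=1..H. ramanujan_sum r (int j - int k)) = ramanujan_sum r 0 + (\<Sum>k\<in>{1..H} - {j}. ramanujan_sum r (int j - int k))"
      using sum.remove[of "{1..H}" j "\<lambda>k. ramanujan_sum r (int j - int k)"] by simp
  qed
  also have "\<dots> = of_real (real H * real (totient r)) + (\<Sum>j=1..H. \<Sum>k\<in>{1..H} - {j}. ramanujan_sum r (int j - int k))"
    by (simp add: ramanujan_sum_0 sum.distrib)
  finally have e: "complex_of_real ((\<Sum>a\<in>totatives r. (norm (esum H (real a / real r)))\<^sup>2) - real H * real (totient r)) = (\<Sum>j=1..H. \<Sum>k\<in>{1..H} - {j}. ramanujan_sum r (int j - int k))"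
    by (simp only: of_real_diff) simp
  have "norm (\<Sum>j=1..H. \<Sum>k\<in>{1..H} - {j}. ramanujan_sum r (int j - int k)) \<le> (\<Sum>j=1..H. 2 * (real H * real (numdiv r)))"
  proof (rule sum_norm_le)
    fix j assume j: "j \<in> {1..H}"
    have g: "norm (ramanujan_sum r b) \<le> real (gcd r (nat \<bar>b\<bar>))" for b
    proof -
      have "nat (gcd (int r) b) = gcd r (nat \<bar>b\<bar>)" unfolding gcd_int_def by (simp only: abs_of_nat nat_int)
      then show ?thesis unfolding norm_ramanujan_sum[OF S_squarefree[OF r]] by (simp only: of_nat_le_iff totient_le)
    qed
    have U: "{1..H} - {j} = {1..<j} \<union> {j<..H}" using j by auto
    have "norm (\<Sum>k\<in>{1..H} - {j}. ramanujan_sum r (int j - int k)) \<le> (\<Sum>k\<in>{1..H} - {j}. real (gcd r (nat \<bar>int j - int k\<bar>)))"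
      by (rule sum_norm_le[OF g])
    also have "\<dots> = (\<Sum>k\<in>{1..<j}. real (gcd r (nat \<bar>int j - int k\<bar>))) + (\<Sum>k\<in>{j<..H}. real (gcd r (nat \<bar>int j - int k\<bar>)))"
      unfolding U by (rule sum.union_disjoint) auto
    finally have n: "norm (\<Sum>k\<in>{1..H} - {j}. ramanujan_sum r (int j - int k)) \<le> (\<Sum>k\<in>{1..<j}. real (gcd r (nat \<bar>int j - int k\<bar>))) + (\<Sum>k\<in>{j<..H}. real (gcd r (nat \<bar>int j - int k\<bar>)))" .
    have lo: "(\<Sum>k\<in>{1..<j}. real (gcd r (nat \<bar>int j - int k\<bar>))) \<le> (\<Sum>l=1..H. real (gcd r l))"
    proof -
      have "(\<Sum>k\<in>{1..<j}. real (gcd r (nat \<bar>int j - int k\<bar>))) = (\<Sum>l\<in>{1..<j}. real (gcd r l))"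
      proof (rule sum.reindex_bij_witness[of _ "\<lambda>l. j - l" "\<lambda>k. j - k"])
        fix k assume "k \<in> {1..<j}"
        then have "nat \<bar>int j - int k\<bar> = j - k" by auto
        then show "real (gcd r (j - k)) = real (gcd r (nat \<bar>int j - int k\<bar>))" by (simp only:)
      qed auto
      also have "\<dots> \<le> (\<Sum>l=1..H. real (gcd r l))" by (rule sum_mono2) (use j in auto)
      finally show ?thesis .
    qed
    have hi: "(\<Sum>k\<in>{j<..H}. real (gcd r (nat \<bar>int j - int k\<bar>))) \<le> (\<Sum>l=1..H. real (gcd r l))"
    proof -
      have "(\<Sum>k\<in>{j<..H}. real (gcd r (nat \<bar>int j - int k\<bar>))) = (\<Sum>l\<in>{1..H - j}. real (gcd r l))"
      proof (rule sum.reindex_bij_witness[of _ "\<lambda>l. j + l" "\<lambda>k. k - j"])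
        fix k assume "k \<in> {j<..H}"
        then have "nat \<bar>int j - int k\<bar> = k - j" by auto
        then show "real (gcd r (k - j)) = real (gcd r (nat \<bar>int j - int k\<bar>))" by (simp only:)
      qed auto
      also have "\<dots> \<le> (\<Sum>l=1..H. real (gcd r l))" by (rule sum_mono2) auto
      finally show ?thesis .
    qed
    show "norm (\<Sum>k\<in>{1..H} - {j}. ramanujan_sum r (int j - int k)) \<le> 2 * (real H * real (numdiv r))"
      using n lo hi sum_gcd_le[OF r0] by linarith
  qed
  then have "norm (complex_of_real ((\<Sum>a\<in>totatives r. (norm (esum H (real a / real r)))\<^sup>2) - real H * real (totient r))) \<le> 2 * (real H)\<^sup>2 * real (numdiv r)"
    unfolding e by (simp add: power2_eq_square)
  then show ?thesis unfolding norm_of_real by linarith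
qed

text \<open>Numerators outside the window are discarded. There the exponential sum is at most the
  inverse distance of \<open>a / r\<close> to the nearest integer, so the loss is a tail of inverse
  squares of order \<open>r / \<eta>\<close>, independent of H.\<close>

lemma sum_esum_A_ge:
  assumes r: "r \<in> S"
  shows "(\<Sum>a\<in>A r. (norm (esum H (of_int a / real r)))\<^sup>2) \<ge> real H * real (totient r) - 2 * (real H)\<^sup>2 * real (numdiv r) - 4 * real r / \<eta>"
proof -
  define g where "g a = (norm (esum H (of_int a / real r)))\<^sup>2" for a :: int
  define t where "t = nat \<lfloor>\<eta> * real r\<rfloor>"
  have r1: "r > 1" by (rule S_gt_1[OF r])
  have u1: "1 \<le> \<eta> * real r" by (rule \<eta>_r[OF r])
  then have t1: "t \<ge> 1" unfolding t_def by linarith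
  have tle: "real t \<le> \<eta> * real r" "\<eta> * real r < real t + 1" unfolding t_def using u1 by linarith+
  \<comment> \<open>T1 holds the nonnegative numerators of the window, T2 the negative ones shifted
    by r, and T3 the discarded residues.\<close>
  define T1 T2 T3 where "T1 = {a \<in> totatives r. a \<le> t}" and "T2 = {a \<in> totatives r. r - a \<le> t}"
    and "T3 = {a \<in> totatives r. t < a \<and> t < r - a}"
  have tr: "2 * t < r"
  proof -
    have "2 * (\<eta> * real r) < real r" using \<eta>_less r1 by (simp add: mult.assoc[symmetric])
    then have "real (2 * t) < real r" using tle by simp
    then show ?thesis by (simp only: of_nat_less_iff)
  qed
  have tot: "a \<in> totatives r \<longleftrightarrow> 0 < a \<and> a < r \<and> coprime a r" for a
  proof -
    have "a \<noteq> r" if "coprime a r" using that r1 by auto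
    then have "coprime a r \<Longrightarrow> a \<le> r \<longleftrightarrow> a < r" by linarith
    then show ?thesis by (auto simp: in_totatives_iff)
  qed
  have fin: "finite T1" "finite T2" "finite T3" by (auto simp: T1_def T2_def T3_def)
  have split: "(\<Sum>a\<in>totatives r. g (int a)) = (\<Sum>a\<in>T1. g (int a)) + (\<Sum>a\<in>T2. g (int a)) + (\<Sum>a\<in>T3. g (int a))"
  proof -
    have U: "totatives r = (T1 \<union> T2) \<union> T3"
    proof (intro equalityI subsetI)
      fix a assume "a \<in> totatives r"
      then show "a \<in> (T1 \<union> T2) \<union> T3" unfolding T1_def T2_def T3_def by (cases "a \<le> t"; cases "r - a \<le> t") simp_all
    qed (auto simp: T1_def T2_def T3_def)
    have d: "T1 \<inter> T2 = {}" "(T1 \<union> T2) \<inter> T3 = {}" using tr by (auto simp: T1_def T2_def T3_def)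
    show ?thesis unfolding U by (simp only: sum.union_disjoint[OF _ _ d(2)] sum.union_disjoint[OF _ _ d(1)] fin finite_UnI)
  qed
  have main: "(\<Sum>a\<in>T1. g (int a)) + (\<Sum>a\<in>T2. g (int a)) \<le> (\<Sum>a\<in>A r. g a)"
  proof -
    have g2: "g (int a) = g (int a - int r)" for a
    proof -
      have "of_int (int a - int r) / real r = of_int (int a) / real r - real 1" using r1 by (simp add: field_simps)
      then show ?thesis unfolding g_def by (simp only: esum_minus_of_nat)
    qed
    have "(\<Sum>a\<in>T1. g (int a)) + (\<Sum>a\<in>T2. g (int a)) = (\<Sum>a\<in>int ` T1. g a) + (\<Sum>a\<in>(\<lambda>a. int a - int r) ` T2. g a)"
      by (subst (1 2) sum.reindex) (auto simp: inj_on_def g2[symmetric])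
    also have "\<dots> = (\<Sum>a\<in>int ` T1 \<union> (\<lambda>a. int a - int r) ` T2. g a)"
      by (rule sum.union_disjoint[symmetric]) (use fin in \<open>auto simp: T1_def T2_def tot\<close>)
    also have "\<dots> \<le> (\<Sum>a\<in>A r. g a)"
    proof (rule sum_mono2[OF A_bound(1)[OF r]])
      show "int ` T1 \<union> (\<lambda>a. int a - int r) ` T2 \<subseteq> A r"
      proof
        fix b assume "b \<in> int ` T1 \<union> (\<lambda>a. int a - int r) ` T2"
        then consider a where "b = int a" "a \<in> T1" | a where "b = int a - int r" "a \<in> T2" by blast
        then show "b \<in> A r"
        proof cases
          case 1
          then have "real a \<le> \<eta> * real r" using tle by (simp add: T1_def)
          then show ?thesis using 1 by (simp add: A_def T1_def tot)
        next
          case 2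
          then have a: "a < r" "r - a \<le> t" "coprime a r" by (auto simp: T2_def tot)
          then have "real r - real a \<le> real t" by linarith
          then have "\<bar>real_of_int b\<bar> \<le> \<eta> * real r" using tle a 2 by simp
          moreover have "coprime (int a) (int r)" using a by simp
          then have "coprime b (int r)" unfolding 2(1) by (metis coprime_iff_gcd_eq_1 gcd_diff1)
          ultimately show ?thesis by (simp add: A_def)
        qed
      qed
    qed (auto simp: g_def)
    finally show ?thesis .
  qed
  have tail: "(\<Sum>a\<in>T3. g (int a)) \<le> 4 * real r / \<eta>"
  proof -
    have "(\<Sum>a\<in>T3. g (int a)) \<le> (\<Sum>a\<in>T3. (real r)\<^sup>2 * (1 / (real a)\<^sup>2) + (real r)\<^sup>2 * (1 / (real (r - a))\<^sup>2))"
    proof (rule sum_mono)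
      fix a assume a: "a \<in> T3"
      then have ar: "0 < a" "a < r" by (auto simp: T3_def tot)
      show "g (int a) \<le> (real r)\<^sup>2 * (1 / (real a)\<^sup>2) + (real r)\<^sup>2 * (1 / (real (r - a))\<^sup>2)"
      proof (cases "2 * a \<le> r")
        case True
        have "real (2 * a) \<le> real r" using True by (simp only: of_nat_le_iff)
        then have "norm (esum H (real a / real r)) \<le> 1 / \<bar>real a / real r\<bar>" using ar by (intro norm_esum_le_inverse) (auto simp: field_simps)
        then have "g (int a) \<le> (1 / \<bar>real a / real r\<bar>)\<^sup>2" unfolding g_def by (intro power_mono) auto
        also have "\<dots> = (real r)\<^sup>2 * (1 / (real a)\<^sup>2)" by (simp add: power_divide)
        finally show ?thesis by (rule order_trans) simp
      next
        case False
        have e: "real a / real r = - (real (r - a) / real r) + of_int 1" using ar by (simp add: of_nat_diff field_simps)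
        have "real r \<le> real (2 * a)" using False by (simp only: of_nat_le_iff)
        then have "norm (esum H (- (real (r - a) / real r))) \<le> 1 / \<bar>- (real (r - a) / real r)\<bar>" using ar by (intro norm_esum_le_inverse) (auto simp: field_simps of_nat_diff)
        then have "norm (esum H (real a / real r)) \<le> 1 / \<bar>real (r - a) / real r\<bar>" unfolding e esum_add_of_int by simp
        then have "g (int a) \<le> (1 / \<bar>real (r - a) / real r\<bar>)\<^sup>2" unfolding g_def by (intro power_mono) auto
        also have "\<dots> = (real r)\<^sup>2 * (1 / (real (r - a))\<^sup>2)" by (simp add: power_divide)
        finally show ?thesis by (rule order_trans) simp
      qed
    qed
    also have "\<dots> = (real r)\<^sup>2 * (\<Sum>a\<in>T3. 1 / (real a)\<^sup>2) + (real r)\<^sup>2 * (\<Sum>a\<in>T3. 1 / (real (r - a))\<^sup>2)"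
      by (simp only: sum.distrib sum_distrib_left)
    also have "(\<Sum>a\<in>T3. 1 / (real (r - a))\<^sup>2) = (\<Sum>a\<in>(\<lambda>a. r - a) ` T3. 1 / (real a)\<^sup>2)"
      by (subst sum.reindex) (auto simp: inj_on_def T3_def tot)
    also have "(real r)\<^sup>2 * (\<Sum>a\<in>T3. 1 / (real a)\<^sup>2) + (real r)\<^sup>2 * (\<Sum>a\<in>(\<lambda>a. r - a) ` T3. 1 / (real a)\<^sup>2) \<le> (real r)\<^sup>2 * (1 / real t) + (real r)\<^sup>2 * (1 / real t)"
    proof -
      have X: "(\<Sum>a\<in>X. 1 / (real a)\<^sup>2) \<le> 1 / real t" if "X \<subseteq> {t+1..r}" for X
      proof -
        have "(\<Sum>a\<in>X. 1 / (real a)\<^sup>2) \<le> (\<Sum>a=t+1..r. 1 / (real a)\<^sup>2)" by (rule sum_mono2) (use that in auto)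
        then show ?thesis using sum_inverse_squares_tail[of t r] t1 by linarith
      qed
      have "T3 \<subseteq> {t+1..r}" "(\<lambda>a. r - a) ` T3 \<subseteq> {t+1..r}" by (auto simp: T3_def tot)
      then show ?thesis by (intro add_mono mult_left_mono X) auto
    qed
    also have "\<dots> = 2 * (real r)\<^sup>2 * (1 / real t)" by simp
    also have "\<dots> \<le> 2 * (real r)\<^sup>2 * (2 / (\<eta> * real r))"
    proof (intro mult_left_mono)
      have "\<eta> * real r \<le> 2 * real t" using tle t1 by linarith
      then show "1 / real t \<le> 2 / (\<eta> * real r)" using t1 u1 by (simp add: field_simps)
    qed auto
    also have "\<dots> = 4 * real r / \<eta>" using r1 \<eta>_pos by (simp add: power2_eq_square)
    finally show ?thesis .
  qed
  have "(\<Sum>a\<in>totatives r. g (int a)) \<ge> real H * real (totient r) - 2 * (real H)\<^sup>2 * real (numdiv r)"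
    using sum_esum_totatives_ge[OF r] by (simp add: g_def)
  then show ?thesis using split main tail unfolding g_def by linarith
qed

lemma sum_numdiv_S_le: "(\<Sum>r\<in>S. real (numdiv r) / real r) \<le> (1 + ln (real x))\<^sup>2"
proof -
  have "(\<Sum>r\<in>S. real (numdiv r) / real r) \<le> (\<Sum>r=1..x. real (numdiv r) / real r)" by (rule sum_mono2) (auto simp: S_def)
  then show ?thesis using sum_numdiv_le[OF x_pos] by linarith
qed

text \<open>The denominators are large, \<open>r > y\<close>, which tames the gcd error of order
  H^2; the window error of order \<open>1 / \<eta>\<close> pays only a harmonic sum.\<close>

lemma V_ge:
  "V \<ge> real H * (\<Sum>r\<in>S. 1 / real (totient r)) - \<Lambda> * (2 * (real H)\<^sup>2 / real y * (1 + ln (real x))\<^sup>2 + 4 / \<eta> * (1 + ln (real x)))"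
proof -
  have "real H * (1 / real (totient r)) - \<Lambda> * (2 * (real H)\<^sup>2 / real y * (real (numdiv r) / real r) + 4 / \<eta> * (1 / real r)) \<le> (\<Sum>a\<in>A r. (norm (c0 r a))\<^sup>2)"
    if r: "r \<in> S" for r
  proof -
    have r0: "real r > 0" and p0: "real (totient r) > 0" using S_gt_1[OF r] by auto
    let ?E = "2 * (real H)\<^sup>2 * real (numdiv r) + 4 * real r / \<eta>"
    have E0: "0 \<le> ?E" using \<eta>_pos by simp
    have "(\<Sum>a\<in>A r. (norm (c0 r a))\<^sup>2) = (1 / (real (totient r))\<^sup>2) * (\<Sum>a\<in>A r. (norm (esum H (of_int a / real r)))\<^sup>2)"
      unfolding sum_distrib_left by (intro sum.cong refl) (simp add: norm_c0[OF r] power_divide)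
    also have "\<dots> \<ge> (1 / (real (totient r))\<^sup>2) * (real H * real (totient r) - ?E)"
      using sum_esum_A_ge[OF r] by (intro mult_left_mono) auto
    moreover have "(1 / (real (totient r))\<^sup>2) * (real H * real (totient r) - ?E) = real H * (1 / real (totient r)) - (1 / (real (totient r))\<^sup>2) * ?E"
      using p0 by (simp add: right_diff_distrib power2_eq_square)
    moreover have "(1 / (real (totient r))\<^sup>2) * ?E \<le> \<Lambda> * (2 * (real H)\<^sup>2 / real y * (real (numdiv r) / real r) + 4 / \<eta> * (1 / real r))"
    proof -
      have "(1 / (real (totient r))\<^sup>2) * ?E \<le> (\<Lambda> / (real r)\<^sup>2) * ?E"
        using S_gt_1[OF r] by (intro mult_right_mono over_totient_le S_le_square r E0) auto
      also have "\<dots> = \<Lambda> * (2 * (real H)\<^sup>2 * (real (numdiv r) / real r) * (1 / real r) + 4 / \<eta> * (1 / real r))"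
        using r0 \<eta>_pos by (simp add: power2_eq_square field_simps)
      also have "\<dots> \<le> \<Lambda> * (2 * (real H)\<^sup>2 * (real (numdiv r) / real r) * (1 / real y) + 4 / \<eta> * (1 / real r))"
        using \<Lambda>_ge S_gt_y[OF r] y_pos by (intro mult_left_mono add_right_mono divide_left_mono) auto
      finally show ?thesis by (simp add: field_simps)
    qed
    ultimately show ?thesis by linarith
  qed
  then have "(\<Sum>r\<in>S. real H * (1 / real (totient r)) - \<Lambda> * (2 * (real H)\<^sup>2 / real y * (real (numdiv r) / real r) + 4 / \<eta> * (1 / real r))) \<le> V"
    unfolding V_def by (rule sum_mono)
  moreover have "(\<Sum>r\<in>S. real H * (1 / real (totient r)) - \<Lambda> * (2 * (real H)\<^sup>2 / real y * (real (numdiv r) / real r) + 4 / \<eta> * (1 / real r)))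
    = real H * (\<Sum>r\<in>S. 1 / real (totient r)) - \<Lambda> * (2 * (real H)\<^sup>2 / real y * (\<Sum>r\<in>S. real (numdiv r) / real r) + 4 / \<eta> * (\<Sum>r\<in>S. 1 / real r))"
    by (simp add: sum_subtractf sum.distrib sum_distrib_left distrib_left)
  moreover have "\<Lambda> * (2 * (real H)\<^sup>2 / real y * (\<Sum>r\<in>S. real (numdiv r) / real r) + 4 / \<eta> * (\<Sum>r\<in>S. 1 / real r)) \<le>
    \<Lambda> * (2 * (real H)\<^sup>2 / real y * (1 + ln (real x))\<^sup>2 + 4 / \<eta> * (1 + ln (real x)))"
    using \<Lambda>_ge \<eta>_pos by (intro mult_left_mono add_mono sum_numdiv_S_le sum_inverse_S_le) auto
  ultimately show ?thesis by linarith
qed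

section \<open>Evaluation of the main term\<close>

definition c :: "real \<Rightarrow> nat \<Rightarrow> int \<Rightarrow> complex" where
  "c C r a = (if r = 1 then of_real C else c0 r a)"

text \<open>The constant C is the frequency 0 with denominator 1. Its mass is V by assumption, and
  \<open>V_le\<close> fits it under the common bound Q.\<close>

lemma trig_polynomial_c:
  assumes "C\<^sup>2 = V" shows "trig_polynomial (insert 1 S) A (c C) Q (real x)"
proof
  have S1: "r \<noteq> 1" if "r \<in> S" for r using S_gt_1[OF that] by simp
  show "finite (insert 1 S)" using finite_S by simp
  show "0 \<le> Q" using V_nonneg V_le by linarith
  fix r assume r: "r \<in> insert 1 S"
  show "squarefree r" using r S_squarefree by auto
  show "real r \<le> real x" using r S_le_x x_pos by auto
  show "finite (A r)" using r A_1 A_bound(1) by auto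
  show "real r * (\<Sum>a\<in>A r. (norm (c C r a))\<^sup>2) \<le> Q"
  proof (cases "r = 1")
    case True
    then show ?thesis using A_1 assms V_le by (simp add: c_def)
  qed (use r mass_c0_le_Q in \<open>auto simp: c_def\<close>)
  fix a assume a: "a \<in> A r"
  then show "coprime a (int r)" by (simp add: A_def)
  fix b assume "b \<in> A r" "int r dvd a - b"
  then show "a = b" using A_inj[OF _ a] r S_gt_1 by (cases "r = 1") (auto simp: A_1)
qed

definition cross_term :: "real \<Rightarrow> nat \<Rightarrow> nat \<Rightarrow> int \<Rightarrow> int \<Rightarrow> complex" where
  "cross_term C r s a b = c C r a * cnj (c C s b) * (ramanujan_sum (lcm r s) (cross r a s b) / of_nat (totient (lcm r s)))
    * cnj (esum H (of_int (cross r a s b) / real (lcm r s)))"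

text \<open>What is left of the pairs of distinct frequencies after the trivial bounds for the
  coefficients and for \<open>esum\<close>: the gcd is the size of the Ramanujan sum, the
  denominators come from the three totients.\<close>

definition off_diagonal :: real where
  "off_diagonal = (\<Sum>r\<in>S. \<Sum>s\<in>S. \<Sum>a\<in>A r. \<Sum>b\<in>A s.
     if r = s \<and> a = b then 0 else real_of_int (gcd (int (lcm r s)) (cross r a s b)) / (real r * real s * real (lcm r s)))"

lemma norm_c0_le:
  assumes "r \<in> S" "a \<in> A r" shows "norm (c0 r a) \<le> real H * (sqrt \<Lambda> / real r)"
proof -
  have "norm (c0 r a) = norm (esum H (of_int a / real r)) * (1 / real (totient r))" unfolding norm_c0[OF assms] by simp
  also have "\<dots> \<le> real H * (sqrt \<Lambda> / real r)"
  proof (intro mult_mono norm_esum_le)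
    have "sqrt (1 / (real (totient r))\<^sup>2) \<le> sqrt (\<Lambda> / (real r)\<^sup>2)"
      using S_gt_1[OF assms(1)] by (intro real_sqrt_le_mono over_totient_le S_le_square assms) auto
    then show "1 / real (totient r) \<le> sqrt \<Lambda> / real r" by (simp add: real_sqrt_divide)
  qed auto
  finally show ?thesis .
qed

lemma cross_term_off:
  assumes r: "r \<in> S" and s: "s \<in> S" and a: "a \<in> A r" and b: "b \<in> A s"
  shows "norm (cross_term C r s a b) \<le> real H ^ 3 * (\<Lambda> * sqrt \<Lambda>) * (real_of_int (gcd (int (lcm r s)) (cross r a s b)) / (real r * real s * real (lcm r s)))"
proof -
  let ?q = "lcm r s" and ?x = "cross r a s b"
  have q0: "?q > 0" by (rule lcm_pos_nat) (use S_gt_1[OF r] S_gt_1[OF s] in auto)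
  have sq: "squarefree ?q" by (intro squarefree_lcm S_squarefree r s)
  have "?q \<le> r * s" using S_gt_1[OF r] S_gt_1[OF s] by (intro dvd_imp_le lcm_least) auto
  then have "real ?q \<le> real r * real s" by (simp only: of_nat_mult[symmetric] of_nat_le_iff)
  also have "\<dots> \<le> real x * real x" using S_le_x r s by (intro mult_mono) auto
  finally have qx: "real ?q \<le> (real x)\<^sup>2" by (simp only: power2_eq_square)
  have 1: "norm (ramanujan_sum ?q ?x / of_nat (totient ?q)) \<le> real_of_int (gcd (int ?q) ?x) * (sqrt \<Lambda> / real ?q)"
  proof -
    have "norm (ramanujan_sum ?q ?x / of_nat (totient ?q)) = real (totient (nat (gcd (int ?q) ?x))) * (1 / real (totient ?q))"
      unfolding norm_divide norm_ramanujan_sum[OF sq] by simp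
    also have "\<dots> \<le> real_of_int (gcd (int ?q) ?x) * (sqrt \<Lambda> / real ?q)"
    proof (intro mult_mono)
      have "real (totient (nat (gcd (int ?q) ?x))) \<le> real (nat (gcd (int ?q) ?x))" by (simp only: of_nat_le_iff totient_le)
      also have "\<dots> = real_of_int (gcd (int ?q) ?x)" by (rule of_nat_nat) simp
      finally show "real (totient (nat (gcd (int ?q) ?x))) \<le> real_of_int (gcd (int ?q) ?x)" .
      have "sqrt (1 / (real (totient ?q))\<^sup>2) \<le> sqrt (\<Lambda> / (real ?q)\<^sup>2)"
        by (intro real_sqrt_le_mono over_totient_le q0 qx)
      then show "1 / real (totient ?q) \<le> sqrt \<Lambda> / real ?q" by (simp add: real_sqrt_divide)
    qed auto
    finally show ?thesis .
  qed
  have "norm (cross_term C r s a b) = norm (c0 r a) * norm (c0 s b) * norm (ramanujan_sum ?q ?x / of_nat (totient ?q)) * norm (esum H (of_int ?x / real ?q))"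
    using S_gt_1[OF r] S_gt_1[OF s] unfolding cross_term_def c_def norm_mult complex_mod_cnj by simp
  also have "\<dots> \<le> (real H * (sqrt \<Lambda> / real r)) * (real H * (sqrt \<Lambda> / real s)) * (real_of_int (gcd (int ?q) ?x) * (sqrt \<Lambda> / real ?q)) * real H"
    using \<Lambda>_ge by (intro mult_mono norm_c0_le 1 norm_esum_le r s a b mult_nonneg_nonneg) auto
  also have "\<dots> = real H ^ 3 * ((sqrt \<Lambda> * sqrt \<Lambda>) * sqrt \<Lambda>) * (real_of_int (gcd (int ?q) ?x) / (real r * real s * real ?q))"
    by (simp add: power3_eq_cube)
  also have "sqrt \<Lambda> * sqrt \<Lambda> = \<Lambda>" using \<Lambda>_ge by simp
  finally show ?thesis .
qed

text \<open>The pair of constants gives \<open>H * C\<^sup>2\<close> and equal frequencies give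
  \<open>H * V\<close>, both merely H times the mean weight. Each of the two mixed families gives
  \<open>C * V\<close>, by the choice of the coefficients; this is the resonance.\<close>

lemma main_term_bound:
  assumes C: "C\<^sup>2 = V"
  shows "norm ((\<Sum>r\<in>insert 1 S. \<Sum>s\<in>insert 1 S. \<Sum>a\<in>A r. \<Sum>b\<in>A s. cross_term C r s a b) - of_real (real H * (C\<^sup>2 + V) + 2 * C * V))
    \<le> real H ^ 3 * (\<Lambda> * sqrt \<Lambda>) * off_diagonal"
proof -
  define f where "f r s = (\<Sum>a\<in>A r. \<Sum>b\<in>A s. cross_term C r s a b)" for r s
  have S1: "r \<noteq> 1" if "r \<in> S" for r using S_gt_1[OF that] by simp
  then have nS: "1 \<notin> S" by blast
  have f11: "f 1 1 = of_real (real H * C\<^sup>2)"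
    unfolding f_def A_1 by (simp add: cross_term_def cross_def c_def ramanujan_sum_0 power2_eq_square)
  have sq: "of_real ((norm z)\<^sup>2) = z * cnj z" for z by (rule complex_norm_square)
  have fr1: "f r 1 = of_real (C * (\<Sum>a\<in>A r. (norm (c0 r a))\<^sup>2))" if r: "r \<in> S" for r
  proof -
    have "cross_term C r 1 a 0 = of_real (C * (norm (c0 r a))\<^sup>2)" for a
    proof -
      have "cross_term C r 1 a 0 = c0 r a * of_real C * (ramanujan_sum r a / of_nat (totient r)) * cnj (esum H (of_int a / real r))"
        using S1[OF r] by (simp add: cross_term_def cross_def c_def)
      also have "\<dots> = of_real C * (c0 r a * cnj (c0 r a))" by (simp add: c0_def)
      finally show ?thesis by (simp only: sq of_real_mult)
    qed
    then show ?thesis unfolding f_def A_1 by (simp add: sum_distrib_left)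
  qed
  have f1s: "f 1 s = of_real (C * (\<Sum>a\<in>A s. (norm (c0 s a))\<^sup>2))" if s: "s \<in> S" for s
  proof -
    have "cross_term C 1 s 0 b = of_real (C * (norm (c0 s b))\<^sup>2)" for b
    proof -
      have "cross_term C 1 s 0 b = of_real C * cnj (c0 s b) * (ramanujan_sum s (- b) / of_nat (totient s)) * cnj (esum H (of_int (- b) / real s))"
        using S1[OF s] by (simp add: cross_term_def cross_def c_def)
      also have "\<dots> = of_real C * (cnj (c0 s b) * c0 s b)" by (simp add: c0_def cnj_ramanujan_sum cnj_esum)
      also have "\<dots> = of_real (C * (norm (c0 s b))\<^sup>2)" by (simp only: sq of_real_mult mult.commute[of "cnj _"])
      finally show ?thesis .
    qed
    then show ?thesis unfolding f_def A_1 by (simp add: sum_distrib_left)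
  qed
  define d where "d r s = (if r = s then of_real (real H * (\<Sum>a\<in>A r. (norm (c0 r a))\<^sup>2)) else (0 :: complex))" for r s
  have fd: "norm (f r s - d r s) \<le> (\<Sum>a\<in>A r. \<Sum>b\<in>A s. if r = s \<and> a = b then 0 else real H ^ 3 * (\<Lambda> * sqrt \<Lambda>) * (real_of_int (gcd (int (lcm r s)) (cross r a s b)) / (real r * real s * real (lcm r s))))"
    if r: "r \<in> S" and s: "s \<in> S" for r s
  proof -
    have d: "d r s = (\<Sum>a\<in>A r. \<Sum>b\<in>A s. if r = s \<and> a = b then of_real (real H * (norm (c0 r a))\<^sup>2) else 0)"
    proof (cases "r = s")
      case True
      have "(\<Sum>a\<in>A r. \<Sum>b\<in>A s. if r = s \<and> a = b then complex_of_real (real H * (norm (c0 r a))\<^sup>2) else 0) = (\<Sum>a\<in>A r. of_real (real H * (norm (c0 r a))\<^sup>2))"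
        using True A_bound(1)[OF s] by (intro sum.cong refl) simp
      then show ?thesis using True by (simp add: d_def sum_distrib_left)
    qed (simp add: d_def)
    show ?thesis unfolding f_def d sum_subtractf[symmetric]
    proof (intro sum_norm_le)
      fix a b assume ab: "a \<in> A r" "b \<in> A s"
      show "norm (cross_term C r s a b - (if r = s \<and> a = b then of_real (real H * (norm (c0 r a))\<^sup>2) else 0)) \<le>
        (if r = s \<and> a = b then 0 else real H ^ 3 * (\<Lambda> * sqrt \<Lambda>) * (real_of_int (gcd (int (lcm r s)) (cross r a s b)) / (real r * real s * real (lcm r s))))"
      proof (cases "r = s \<and> a = b")
        case True
        then have "cross_term C r s a b = c0 r a * cnj (c0 r a) * of_nat H"
          using S_gt_1[OF r] by (simp add: cross_term_def cross_def c_def ramanujan_sum_0)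
        also have "\<dots> = of_real (real H * (norm (c0 r a))\<^sup>2)" by (simp only: sq of_real_mult of_real_of_nat_eq mult.commute)
        finally show ?thesis using True by (simp only: if_P diff_self norm_zero)
      next
        case False
        then show ?thesis using cross_term_off[OF r s ab] by (simp only: if_False diff_zero)
      qed
    qed
  qed
  have tot: "(\<Sum>r\<in>insert 1 S. \<Sum>s\<in>insert 1 S. f r s) = f 1 1 + (\<Sum>s\<in>S. f 1 s) + (\<Sum>r\<in>S. f r 1) + (\<Sum>r\<in>S. \<Sum>s\<in>S. f r s)"
    using nS finite_S by (simp add: sum.distrib)
  have dS: "(\<Sum>r\<in>S. \<Sum>s\<in>S. d r s) = of_real (real H * V)"
    unfolding d_def V_def using finite_S by (simp add: sum_distrib_left)
  have CV: "of_real (C * V) = (\<Sum>r\<in>S. complex_of_real (C * (\<Sum>a\<in>A r. (norm (c0 r a))\<^sup>2)))"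
    unfolding V_def by (simp only: sum_distrib_left of_real_sum)
  have s1: "(\<Sum>s\<in>S. f 1 s) = of_real (C * V)" "(\<Sum>r\<in>S. f r 1) = of_real (C * V)"
    unfolding CV by (intro sum.cong refl f1s fr1; assumption)+
  have "(\<Sum>r\<in>insert 1 S. \<Sum>s\<in>insert 1 S. f r s) - of_real (real H * (C\<^sup>2 + V) + 2 * C * V) = (\<Sum>r\<in>S. \<Sum>s\<in>S. f r s) - (\<Sum>r\<in>S. \<Sum>s\<in>S. d r s)"
  proof -
    have "(of_real (real H * C\<^sup>2) + of_real (C * V) + of_real (C * V) + X) - of_real (real H * (C\<^sup>2 + V) + 2 * C * V) = X - of_real (real H * V)" for X :: complex
      by (simp add: algebra_simps)
    then show ?thesis unfolding tot dS f11 s1 .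
  qed
  then have E: "(\<Sum>r\<in>insert 1 S. \<Sum>s\<in>insert 1 S. f r s) - of_real (real H * (C\<^sup>2 + V) + 2 * C * V) = (\<Sum>r\<in>S. \<Sum>s\<in>S. f r s - d r s)"
    by (simp only: sum_subtractf)
  have "norm ((\<Sum>r\<in>insert 1 S. \<Sum>s\<in>insert 1 S. f r s) - of_real (real H * (C\<^sup>2 + V) + 2 * C * V)) \<le> (\<Sum>r\<in>S. \<Sum>s\<in>S. \<Sum>a\<in>A r. \<Sum>b\<in>A s. if r = s \<and> a = b then 0 else real H ^ 3 * (\<Lambda> * sqrt \<Lambda>) * (real_of_int (gcd (int (lcm r s)) (cross r a s b)) / (real r * real s * real (lcm r s))))"
    unfolding E by (intro sum_norm_le fd)
  also have "\<dots> = real H ^ 3 * (\<Lambda> * sqrt \<Lambda>) * off_diagonal"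
    unfolding off_diagonal_def sum_distrib_left by (intro sum.cong refl) simp
  finally show ?thesis unfolding f_def .
qed

end

section \<open>Pairs of distinct frequencies\<close>

lemma card_residue_le:
  assumes u: "u \<ge> 0" and m: "m > 0" and F: "\<And>a. a \<in> F \<Longrightarrow> \<bar>real_of_int a\<bar> \<le> u"
    and cong: "\<And>a b. a \<in> F \<Longrightarrow> b \<in> F \<Longrightarrow> int m dvd a - b"
  shows "finite F" "real (card F) \<le> 1 + 2 * u / real m"
proof -
  have "finite F \<and> real (card F) \<le> 1 + 2 * u / real m"
  proof (cases "F = {}")
    case True
    then show ?thesis using u by simp
  next
    case False
    then obtain a0 where a0: "a0 \<in> F" by blast
    define p r where "p = \<lceil>(- u - of_int a0) / real m\<rceil>" and "r = \<lfloor>(u - of_int a0) / real m\<rfloor>"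
    have sub: "F \<subseteq> (\<lambda>k. a0 + int m * k) ` {p..r}"
    proof
      fix a assume a: "a \<in> F"
      obtain k where "a - a0 = int m * k" using cong[OF a a0] by blast
      then have k: "a = a0 + int m * k" by linarith
      have "- u \<le> of_int a0 + real m * of_int k" "of_int a0 + real m * of_int k \<le> u" using F[OF a] k by (auto simp: abs_le_iff)
      then have "(- u - of_int a0) / real m \<le> of_int k" "of_int k \<le> (u - of_int a0) / real m"
        using m by (auto simp: field_simps)
      then have "k \<in> {p..r}" by (auto simp: p_def r_def ceiling_le_iff le_floor_iff)
      then show "a \<in> (\<lambda>k. a0 + int m * k) ` {p..r}" using k by blast
    qed
    have fin: "finite F" by (rule finite_subset[OF sub]) simp
    have "card F \<le> card {p..r}" by (rule surj_card_le[OF _ sub]) simp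
    then have "card F \<le> nat (r - p + 1)" by simp
    moreover have "card F > 0" using fin False by (simp add: card_gt_0_iff)
    ultimately have "int (card F) \<le> r - p + 1" by linarith
    then have "real (card F) \<le> of_int (r - p + 1)" by linarith
    also have "\<dots> \<le> (u - of_int a0) / real m - (- u - of_int a0) / real m + 1"
      unfolding p_def r_def by linarith
    also have "\<dots> = 1 + 2 * u / real m" by (simp add: diff_divide_distrib add_divide_distrib)
    finally show ?thesis using fin by blast
  qed
  then show "finite F" "real (card F) \<le> 1 + 2 * u / real m" by auto
qed

lemma card_le_sum_fibres:
  assumes "finite X" "\<And>x. x \<in> X \<Longrightarrow> finite (F x) \<and> real (card (F x)) \<le> K" and "inj_on f P" "f ` P \<subseteq> Sigma X F"
  shows "finite P" "real (card P) \<le> real (card X) * K"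
proof -
  have fin: "finite (Sigma X F)" using assms by auto
  then show "finite P" using assms(3,4) by (meson finite_subset finite_imageD)
  have "card P \<le> card (Sigma X F)" by (rule card_inj_on_le[OF assms(3,4) fin])
  also have "\<dots> = (\<Sum>x\<in>X. card (F x))" using assms by (simp add: card_SigmaI)
  finally have "real (card P) \<le> real (\<Sum>x\<in>X. card (F x))" by (simp only: of_nat_le_iff)
  also have "\<dots> = (\<Sum>x\<in>X. real (card (F x)))" by simp
  also have "\<dots> \<le> (\<Sum>x\<in>X. K)" using assms by (intro sum_mono) auto
  finally show "real (card P) \<le> real (card X) * K" by simp
qed

text \<open>With \<open>r = d * k\<close> and \<open>s = d * l\<close> for the gcd d, the sum is
  dominated by a product of a divisor sum and two harmonic sums.\<close>

lemma sum_gcd_pairs_le: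
  fixes x :: nat assumes x: "x > 0"
  shows "(\<Sum>r\<in>{1..x}. \<Sum>s\<in>{1..x}. real (numdiv (gcd r s)) * real (gcd r s) / (real r * real s)) \<le> (1 + ln (real x)) ^ 4"
proof -
  let ?I = "{1..x}"
  define h where "h = (\<lambda>(d, k, l). (real (numdiv d) / real d) * ((1 / real k) * (1 / real l)))"
  define \<phi> where "\<phi> = (\<lambda>(r, s). (gcd r s, r div gcd r s, s div gcd r s :: nat))"
  have inj: "inj_on \<phi> (?I \<times> ?I)"
  proof (rule inj_onI, clarify)
    fix r s r' s' assume "\<phi> (r, s) = \<phi> (r', s')"
    then have e: "gcd r s = gcd r' s'" "r div gcd r s = r' div gcd r' s'" "s div gcd r s = s' div gcd r' s'" by (auto simp: \<phi>_def)
    have "r = gcd r s * (r div gcd r s)" "s = gcd r s * (s div gcd r s)" "r' = gcd r' s' * (r' div gcd r' s')" "s' = gcd r' s' * (s' div gcd r' s')" by simp_all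
    then show "r = r' \<and> s = s'" using e by metis
  qed
  have img: "\<phi> ` (?I \<times> ?I) \<subseteq> ?I \<times> ?I \<times> ?I"
  proof
    fix z assume "z \<in> \<phi> ` (?I \<times> ?I)"
    then obtain r s where z: "z = \<phi> (r, s)" "1 \<le> r" "r \<le> x" "1 \<le> s" "s \<le> x" by auto
    have "gcd r s \<le> r" using z by (intro gcd_le1_nat) auto
    moreover have "gcd r s > 0" using z by simp
    moreover have "r div gcd r s \<le> r" "s div gcd r s \<le> s" by (rule div_le_dividend)+
    moreover have "r div gcd r s > 0" "s div gcd r s > 0" using z by (auto simp: div_greater_zero_iff gcd_le1_nat gcd_le2_nat)
    ultimately have "gcd r s \<in> ?I" "r div gcd r s \<in> ?I" "s div gcd r s \<in> ?I" using z unfolding atLeastAtMost_iff by linarith+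
    then show "z \<in> ?I \<times> ?I \<times> ?I" unfolding z(1) \<phi>_def by (simp only: case_prod_conv mem_Sigma_iff)
  qed
  have hterm: "real (numdiv (gcd r s)) * real (gcd r s) / (real r * real s) = h (\<phi> (r, s))" if "r \<in> ?I" "s \<in> ?I" for r s
  proof -
    have 1: "real r = real (gcd r s) * real (r div gcd r s)" "real s = real (gcd r s) * real (s div gcd r s)"
      by (simp_all only: of_nat_mult[symmetric] of_nat_eq_iff dvd_mult_div_cancel gcd_dvd1 gcd_dvd2)
    have 2: "real (gcd r s) > 0" using that by simp
    have "n * g / (g * k * (g * l)) = (n / g) * ((1 / k) * (1 / l))" if "g > 0" for n g k l :: real
      using that by simp
    from this[OF 2] show ?thesis unfolding h_def \<phi>_def using 1 by simp
  qed
  have "(\<Sum>r\<in>?I. \<Sum>s\<in>?I. real (numdiv (gcd r s)) * real (gcd r s) / (real r * real s)) = (\<Sum>r\<in>?I. \<Sum>s\<in>?I. h (\<phi> (r, s)))"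
    by (intro sum.cong refl hterm)
  also have "\<dots> = (\<Sum>z\<in>?I \<times> ?I. h (\<phi> z))" by (simp add: sum.cartesian_product)
  also have "\<dots> = (\<Sum>z\<in>\<phi> ` (?I \<times> ?I). h z)" by (subst sum.reindex[OF inj]) (simp only: o_def)
  also have "\<dots> \<le> (\<Sum>z\<in>?I \<times> ?I \<times> ?I. h z)" by (rule sum_mono2[OF _ img]) (auto simp: h_def)
  also have "\<dots> = (\<Sum>d\<in>?I. \<Sum>k\<in>?I. \<Sum>l\<in>?I. (real (numdiv d) / real d) * ((1 / real k) * (1 / real l)))"
    by (simp add: sum.cartesian_product h_def case_prod_unfold)
  also have "\<dots> = (\<Sum>d\<in>?I. real (numdiv d) / real d) * ((\<Sum>k\<in>?I. 1 / real k) * (\<Sum>l\<in>?I. 1 / real l))"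
    unfolding sum_product[of "\<lambda>k. 1 / real k"] sum_distrib_right by (simp only: sum_distrib_left)
  also have "\<dots> \<le> (1 + ln (real x))\<^sup>2 * ((1 + ln (real x)) * (1 + ln (real x)))"
    using x by (intro mult_mono sum_numdiv_le harm_le sum_nonneg mult_nonneg_nonneg) auto
  also have "\<dots> = (1 + ln (real x)) ^ 4" by (simp add: power2_eq_square power4_eq_xxxx)
  finally show ?thesis .
qed

context resonator
begin

text \<open>
  If \<open>d = gcd r s\<close> is at least \<open>\<surd>y\<close>, choose the value of \<open>cross\<close> first, which fixes \<open>a\<close> modulo \<open>r/d\<close>;
  otherwise choose \<open>a\<close> first, which fixes \<open>b\<close> modulo \<open>e\<close>.
\<close>
lemma count_cross_le:
  assumes r: "r \<in> S" and s: "s \<in> S" and e: "e dvd gcd r s"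
  defines "P \<equiv> {(a, b). a \<in> A r \<and> b \<in> A s \<and> \<not> (r = s \<and> a = b) \<and> int e dvd cross r a s b}"
  shows "finite P" and "real e * real (card P) \<le> real (lcm r s) * real (gcd r s) * (4 * \<eta> / sqrt (real y) + 8 * \<eta>\<^sup>2)"
proof -
  interpret trig_polynomial "insert 1 S" A "c (sqrt V)" Q "real x"
    by (rule trig_polynomial_c) (simp add: V_nonneg)
  have r1: "r > 1" and s1: "s > 1" using S_gt_1 r s by auto
  define d r' s' q where "d = gcd r s" and "r' = r div d" and "s' = s div d" and "q = lcm r s"
  have rs: "r = d * r'" "s = d * s'" by (auto simp: d_def r'_def s'_def)
  have d0: "d > 0" using r1 by (simp add: d_def)
  have r0: "r' > 0" "s' > 0" using r1 s1 rs by (auto intro!: Nat.gr0I)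
  have q0: "q > 0" unfolding q_def using r1 s1 by (intro lcm_pos_nat) auto
  have qd: "real q * real d = real r * real s"
    unfolding q_def d_def of_nat_mult[symmetric] prod_gcd_lcm_nat[of r s] by (simp only: mult.commute)
  have cop: "coprime r' s'" unfolding r'_def s'_def d_def using r1 by (intro div_gcd_coprime) simp
  have cr: "cross r a s b = a * int s' - b * int r'" for a b by (simp add: cross_def r'_def s'_def d_def)
  have e0: "e > 0" using e d0 d_def by (auto intro!: Nat.gr0I)
  have ed: "e dvd d" using e d_def by simp
  have nz: "cross r a s b \<noteq> 0" if "(a, b) \<in> P" for a b
  proof
    assume "cross r a s b = 0"
    then have "r = s \<and> a = b" using that r s by (intro cross_dvd) (auto simp: P_def)
    then show False using that by (auto simp: P_def)
  qed
  have absx: "\<bar>real_of_int (cross r a s b)\<bar> \<le> 2 * \<eta> * real q" if "(a, b) \<in> P" for a b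
  proof -
    have "\<bar>real_of_int a / real r\<bar> \<le> \<eta>" "\<bar>real_of_int b / real s\<bar> \<le> \<eta>" using that r1 s1 by (auto simp: P_def A_def field_simps)
    then have "\<bar>real_of_int (cross r a s b) / real q\<bar> \<le> 2 * \<eta>"
      unfolding q_def using cross_div_lcm[of r s a b] r1 s1 by linarith
    then show ?thesis using q0 by (simp add: field_simps)
  qed
  have u: "0 \<le> \<eta> * real r" "0 \<le> \<eta> * real s" using \<eta>_pos by auto

  define F1 where "F1 z = {a \<in> A r. int r' dvd a * int s' - z}" for z
  \<comment> \<open>The possible values of \<open>cross\<close>: nonzero multiples of e of absolute
    value at most \<open>2 * \<eta> * q\<close>, because both fractions are at most \<eta> in
    absolute value.\<close>
  define X where "X = (\<lambda>k. int e * k) ` {k :: int. k \<noteq> 0 \<and> \<bar>real_of_int k\<bar> \<le> 2 * \<eta> * real q / real e}"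
  have F1: "finite (F1 z) \<and> real (card (F1 z)) \<le> 1 + 2 * \<eta> * real d" for z
  proof -
    have dv: "int r' dvd a - b" if "a \<in> F1 z" "b \<in> F1 z" for a b
    proof -
      have "int r' dvd a * int s' - z" "int r' dvd b * int s' - z" using that unfolding F1_def by blast+
      then have "int r' dvd (a * int s' - z) - (b * int s' - z)" by (rule dvd_diff)
      then have "int r' dvd (a - b) * int s'" by (simp add: algebra_simps)
      then show ?thesis using cop by (simp add: coprime_dvd_mult_left_iff)
    qed
    have "\<bar>real_of_int a\<bar> \<le> \<eta> * real r" if "a \<in> F1 z" for a using that by (simp add: F1_def A_def)
    from card_residue_le[OF u(1) r0(1) this dv] have "finite (F1 z)" "real (card (F1 z)) \<le> 1 + 2 * (\<eta> * real r) / real r'" by auto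
    moreover have "2 * (\<eta> * real r) / real r' = 2 * \<eta> * real d" using r0 rs(1) by simp
    ultimately show ?thesis by simp
  qed
  have kfin: "finite {k :: int. k \<noteq> 0 \<and> \<bar>real_of_int k\<bar> \<le> w}" for w
  proof (rule finite_subset)
    show "{k :: int. k \<noteq> 0 \<and> \<bar>real_of_int k\<bar> \<le> w} \<subseteq> {- \<lfloor>w\<rfloor>..\<lfloor>w\<rfloor>}" by (auto simp: le_floor_iff abs_le_iff) linarith
  qed simp
  have X: "finite X" unfolding X_def by (intro finite_imageI kfin)
  have cX: "real (card X) \<le> 4 * \<eta> * real q / real e"
  proof -
    have "real (card X) \<le> real (card {k :: int. k \<noteq> 0 \<and> \<bar>real_of_int k\<bar> \<le> 2 * \<eta> * real q / real e})"
      unfolding X_def of_nat_le_iff by (rule card_image_le[OF kfin])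
    also have "\<dots> \<le> 2 * (2 * \<eta> * real q / real e)" using \<eta>_pos by (intro card_abs_le) auto
    finally show ?thesis by simp
  qed
  have sub1: "(\<lambda>(a, b). (cross r a s b, a)) ` P \<subseteq> Sigma X F1"
  proof clarify
    fix a b assume ab: "(a, b) \<in> P"
    then have "int e dvd cross r a s b" by (simp add: P_def)
    then obtain k where k: "cross r a s b = int e * k" by blast
    have "\<bar>real e * of_int k\<bar> \<le> 2 * \<eta> * real q" using absx[OF ab] k by simp
    then have "\<bar>real_of_int k\<bar> \<le> 2 * \<eta> * real q / real e" using e0 by (simp add: abs_mult field_simps)
    moreover have "k \<noteq> 0" using nz[OF ab] k by auto
    ultimately have "cross r a s b \<in> X" unfolding X_def k by blast
    moreover have "a \<in> F1 (cross r a s b)" using ab by (simp add: F1_def cr P_def)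
    ultimately show "cross r a s b \<in> X \<and> a \<in> F1 (cross r a s b)" by blast
  qed
  have inj1: "inj_on (\<lambda>(a, b). (cross r a s b, a)) P"
    by (rule inj_onI) (use r0 in \<open>auto simp: cr\<close>)
  show "finite P" by (rule card_le_sum_fibres(1)[OF X F1 inj1 sub1])
  have c1: "real e * real (card P) \<le> 4 * \<eta> * real q * (1 + 2 * \<eta> * real d)"
  proof -
    have "real (card P) \<le> real (card X) * (1 + 2 * \<eta> * real d)" by (rule card_le_sum_fibres(2)[OF X F1 inj1 sub1])
    also have "\<dots> \<le> (4 * \<eta> * real q / real e) * (1 + 2 * \<eta> * real d)" using \<eta>_pos by (intro mult_right_mono cX) auto
    finally have "real e * real (card P) \<le> real e * ((4 * \<eta> * real q / real e) * (1 + 2 * \<eta> * real d))" by (intro mult_left_mono) auto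
    then show ?thesis using e0 by simp
  qed

  define F2 where "F2 a = {b \<in> A s. int e dvd a * int s' - b * int r'}" for a
  have F2: "finite (F2 z) \<and> real (card (F2 z)) \<le> 1 + 2 * (\<eta> * real s) / real e" for z
  proof -
    \<comment> \<open>As r is squarefree, its divisor d is coprime to \<open>r div d\<close>, so
      \<open>r'\<close> can be cancelled modulo e.\<close>
    have ce: "coprime e r'"
    proof (rule coprimeI)
      fix w assume w: "w dvd e" "w dvd r'"
      then have "w * w dvd d * r'" using ed by (intro mult_dvd_mono) (auto intro: dvd_trans)
      then have "w\<^sup>2 dvd r" using rs by (simp add: power2_eq_square)
      then show "is_unit w" using S_squarefree[OF r] unfolding squarefree_def by blast
    qed
    have dv: "int e dvd a - b" if "a \<in> F2 z" "b \<in> F2 z" for a b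
    proof -
      have "int e dvd z * int s' - b * int r'" "int e dvd z * int s' - a * int r'" using that unfolding F2_def by blast+
      then have "int e dvd (z * int s' - b * int r') - (z * int s' - a * int r')" by (rule dvd_diff)
      then have "int e dvd (a - b) * int r'" by (simp add: algebra_simps)
      then show ?thesis using ce by (simp add: coprime_dvd_mult_left_iff)
    qed
    have "\<bar>real_of_int a\<bar> \<le> \<eta> * real s" if "a \<in> F2 z" for a using that by (simp add: F2_def A_def)
    from card_residue_le[OF u(2) e0 this dv] show ?thesis by auto
  qed
  have c2: "real e * real (card P) \<le> 2 * \<eta> * real r * (real e + 2 * \<eta> * real s)"
  proof -
    have "real (card P) \<le> real (card (A r)) * (1 + 2 * (\<eta> * real s) / real e)"
      by (rule card_le_sum_fibres(2)[OF A_bound(1)[OF r] F2, of "\<lambda>z. z"]) (auto simp: P_def F2_def cr)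
    also have "\<dots> \<le> (2 * \<eta> * real r) * (1 + 2 * (\<eta> * real s) / real e)" using u by (intro mult_right_mono A_bound(2) r) auto
    finally have "real e * real (card P) \<le> real e * ((2 * \<eta> * real r) * (1 + 2 * (\<eta> * real s) / real e))" by (intro mult_left_mono) auto
    also have "\<dots> = 2 * \<eta> * real r * (real e + 2 * \<eta> * real s)" using e0 by (simp add: field_simps)
    finally show ?thesis .
  qed
  have sy: "sqrt (real y) > 0" "sqrt (real y) * sqrt (real y) = real y" using y_pos by auto
  have "real e * real (card P) \<le> real q * real d * (4 * \<eta> / sqrt (real y) + 8 * \<eta>\<^sup>2)"
  \<comment> \<open>For large d the term without d in the first count is absorbed by
    \<open>d / sqrt y \<ge> 1\<close>. For small d the summand e in the second count is below
    \<open>sqrt y\<close>, hence at most \<open>s / sqrt y\<close>.\<close>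
  proof (cases "real d \<ge> sqrt (real y)")
    case True
    then have "1 \<le> real d / sqrt (real y)" using sy by simp
    then have "4 * \<eta> * real q * 1 \<le> 4 * \<eta> * real q * (real d / sqrt (real y))" using \<eta>_pos by (intro mult_left_mono) auto
    then show ?thesis using c1 by (simp add: power2_eq_square algebra_simps)
  next
    case False
    have "real e \<le> real d" using dvd_imp_le[OF ed d0] by simp
    also have "\<dots> \<le> sqrt (real y)" using False by simp
    also have "\<dots> = real y / sqrt (real y)" using sy by (simp add: field_simps)
    also have "\<dots> \<le> real s / sqrt (real y)" using S_gt_y[OF s] sy by (intro divide_right_mono) auto
    finally have "2 * \<eta> * real r * (real e + 2 * \<eta> * real s) \<le> 2 * \<eta> * real r * (real s / sqrt (real y) + 2 * \<eta> * real s)"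
      using \<eta>_pos by (intro mult_left_mono) auto
    also have "\<dots> = (real r * real s) * (2 * \<eta> / sqrt (real y) + 4 * \<eta>\<^sup>2)" by (simp add: power2_eq_square algebra_simps)
    also have "\<dots> \<le> (real r * real s) * (4 * \<eta> / sqrt (real y) + 8 * \<eta>\<^sup>2)"
      using \<eta>_pos sy by (intro mult_left_mono add_mono divide_right_mono) auto
    finally show ?thesis using c2 unfolding qd by linarith
  qed
  then show "real e * real (card P) \<le> real (lcm r s) * real (gcd r s) * (4 * \<eta> / sqrt (real y) + 8 * \<eta>\<^sup>2)"
    by (simp only: q_def d_def)
qed

text \<open>A common factor of \<open>cross\<close> and \<open>r div d\<close> would divide
  \<open>a * s'\<close>, although a and \<open>s'\<close> are coprime to \<open>r div d\<close>;
  likewise for \<open>s div d\<close>. Thus only the factor d of the lcm can meet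
  \<open>cross\<close>.\<close>

lemma gcd_lcm_cross_dvd:
  assumes r: "r \<in> S" and s: "s \<in> S" and a: "a \<in> A r" and b: "b \<in> A s"
  shows "gcd (int (lcm r s)) (cross r a s b) dvd int (gcd r s)"
proof -
  have r1: "r > 1" and s1: "s > 1" using S_gt_1 r s by auto
  define d r' s' g where "d = gcd r s" and "r' = r div d" and "s' = s div d" and "g = gcd (int (lcm r s)) (cross r a s b)"
  have rs: "r = d * r'" "s = d * s'" by (auto simp: d_def r'_def s'_def)
  have d0: "d > 0" using r1 by (simp add: d_def)
  have cop: "coprime r' s'" unfolding r'_def s'_def d_def using r1 by (intro div_gcd_coprime) simp
  have cr: "cross r a s b = a * int s' - b * int r'" by (simp add: cross_def r'_def s'_def d_def)
  have "d * lcm r s = r * s" unfolding d_def by (rule prod_gcd_lcm_nat[symmetric])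
  also have "\<dots> = d * (d * (r' * s'))" unfolding rs by (simp only: mult_ac)
  finally have l: "lcm r s = d * (r' * s')" using d0 by simp
  have gx: "g dvd a * int s' - b * int r'" unfolding g_def cr by simp
  have ca: "coprime a (int r')" "coprime b (int s')" using a b rs by (auto simp: A_def)
  have cg1: "coprime g (int r')"
  proof (rule coprimeI)
    fix w assume w: "w dvd g" "w dvd int r'"
    have "w dvd a * int s' - b * int r'" "w dvd b * int r'" using w gx by (auto intro: dvd_trans)
    then have "w dvd (a * int s' - b * int r') + b * int r'" by (rule dvd_add)
    then have "w dvd a * int s'" by simp
    moreover have "coprime w (int s')" using w(2) cop by (meson coprime_divisors coprime_int_iff dvd_refl)
    ultimately have "w dvd a" by (simp add: coprime_dvd_mult_left_iff)
    then show "is_unit w" using w(2) ca(1) by (meson coprime_common_divisor)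
  qed
  have cg2: "coprime g (int s')"
  proof (rule coprimeI)
    fix w assume w: "w dvd g" "w dvd int s'"
    have "w dvd a * int s'" "w dvd a * int s' - b * int r'" using w gx by (auto intro: dvd_trans)
    then have "w dvd a * int s' - (a * int s' - b * int r')" by (rule dvd_diff)
    then have "w dvd b * int r'" by simp
    moreover have "coprime w (int r')" using w(2) cop by (meson coprime_divisors coprime_int_iff dvd_refl coprime_commute)
    ultimately have "w dvd b" by (simp add: coprime_dvd_mult_left_iff)
    then show "is_unit w" using w(2) ca(2) by (meson coprime_common_divisor)
  qed
  have "g dvd int (lcm r s)" unfolding g_def by simp
  then have "g dvd int d * (int r' * int s')" unfolding l by simp
  then have "g dvd int d" using cg1 cg2 by (simp add: coprime_dvd_mult_left_iff)
  then show ?thesis unfolding g_def d_def .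
qed

text \<open>The gcd is one of the divisors e of \<open>gcd r s\<close> that divide
  \<open>cross\<close>, so it is at most their sum; exchanging summations leaves e times the count
  of \<open>count_cross_le\<close>, a bound free of e that the number of divisors
  multiplies.\<close>

lemma off_diagonal_le: "off_diagonal \<le> (1 + ln (real x)) ^ 4 * (4 * \<eta> / sqrt (real y) + 8 * \<eta>\<^sup>2)"
proof -
  define \<kappa> where "\<kappa> = 4 * \<eta> / sqrt (real y) + 8 * \<eta>\<^sup>2"
  have \<kappa>0: "\<kappa> \<ge> 0" using \<eta>_pos by (simp add: \<kappa>_def)
  have pair: "(\<Sum>a\<in>A r. \<Sum>b\<in>A s. if r = s \<and> a = b then 0 else real_of_int (gcd (int (lcm r s)) (cross r a s b)) / (real r * real s * real (lcm r s)))
     \<le> \<kappa> * (real (numdiv (gcd r s)) * real (gcd r s) / (real r * real s))" if r: "r \<in> S" and s: "s \<in> S" for r s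
  proof -
    define d q where "d = gcd r s" and "q = lcm r s"
    have d0: "d > 0" using S_gt_1[OF r] by (simp add: d_def)
    have q0: "q > 0" unfolding q_def using S_gt_1[OF r] S_gt_1[OF s] by (intro lcm_pos_nat) auto
    define P where "P e = {(a, b). a \<in> A r \<and> b \<in> A s \<and> \<not> (r = s \<and> a = b) \<and> int e dvd cross r a s b}" for e
    have fin: "finite (A r \<times> A s)" by (intro finite_SigmaI A_bound r s)
    have "(\<Sum>a\<in>A r. \<Sum>b\<in>A s. if r = s \<and> a = b then 0 else real_of_int (gcd (int q) (cross r a s b)))
      \<le> (\<Sum>a\<in>A r. \<Sum>b\<in>A s. \<Sum>e | e dvd d. if \<not> (r = s \<and> a = b) \<and> int e dvd cross r a s b then real e else 0)"
    proof (intro sum_mono)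
      fix a b assume ab: "a \<in> A r" "b \<in> A s"
      show "(if r = s \<and> a = b then 0 else real_of_int (gcd (int q) (cross r a s b))) \<le> (\<Sum>e | e dvd d. if \<not> (r = s \<and> a = b) \<and> int e dvd cross r a s b then real e else 0)"
      proof (cases "r = s \<and> a = b")
        case True
        then show ?thesis by simp
      next
        case False
        define e where "e = nat (gcd (int q) (cross r a s b))"
        have ie: "int e = gcd (int q) (cross r a s b)" by (simp add: e_def)
        have "int e dvd int d" unfolding ie q_def d_def by (rule gcd_lcm_cross_dvd[OF r s ab])
        then have ed: "e \<in> {e. e dvd d}" by simp
        have ex: "int e dvd cross r a s b" unfolding ie by simp
        have "real_of_int (gcd (int q) (cross r a s b)) = (if \<not> (r = s \<and> a = b) \<and> int e dvd cross r a s b then real e else 0)"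
          using False ex by (simp add: ie[symmetric])
        also have "\<dots> \<le> (\<Sum>e | e dvd d. if \<not> (r = s \<and> a = b) \<and> int e dvd cross r a s b then real e else 0)"
          using d0 by (intro member_le_sum[OF ed]) auto
        finally show ?thesis using False by auto
      qed
    qed
    also have "\<dots> = (\<Sum>z\<in>A r \<times> A s. \<Sum>e | e dvd d. if \<not> (r = s \<and> fst z = snd z) \<and> int e dvd cross r (fst z) s (snd z) then real e else 0)"
      by (subst sum.cartesian_product) (simp only: case_prod_unfold)
    also have "\<dots> = (\<Sum>e | e dvd d. \<Sum>z\<in>A r \<times> A s. if \<not> (r = s \<and> fst z = snd z) \<and> int e dvd cross r (fst z) s (snd z) then real e else 0)"
      by (rule sum.swap)
    also have "\<dots> = (\<Sum>e | e dvd d. \<Sum>z\<in>P e. real e)"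
    proof (rule sum.cong[OF refl])
      fix e
      have "P e = (A r \<times> A s) \<inter> {z. \<not> (r = s \<and> fst z = snd z) \<and> int e dvd cross r (fst z) s (snd z)}" by (auto simp: P_def)
      then show "(\<Sum>z\<in>A r \<times> A s. if \<not> (r = s \<and> fst z = snd z) \<and> int e dvd cross r (fst z) s (snd z) then real e else 0) = (\<Sum>z\<in>P e. real e)"
        using sum.inter_restrict[OF fin, of "\<lambda>_. real e" "{z. \<not> (r = s \<and> fst z = snd z) \<and> int e dvd cross r (fst z) s (snd z)}"] by simp
    qed
    also have "\<dots> = (\<Sum>e | e dvd d. real e * real (card (P e)))" by (simp add: mult.commute)
    also have "\<dots> \<le> (\<Sum>e | e dvd d. real q * real d * \<kappa>)"
      unfolding P_def q_def d_def \<kappa>_def by (intro sum_mono count_cross_le(2) r s) auto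
    also have "\<dots> = real q * (\<kappa> * (real (numdiv d) * real d))" by (simp add: numdiv_def)
    finally have *: "(\<Sum>a\<in>A r. \<Sum>b\<in>A s. if r = s \<and> a = b then 0 else real_of_int (gcd (int q) (cross r a s b))) \<le> real q * (\<kappa> * (real (numdiv d) * real d))" .
    have "(\<Sum>a\<in>A r. \<Sum>b\<in>A s. if r = s \<and> a = b then 0 else real_of_int (gcd (int q) (cross r a s b)) / (real r * real s * real q))
      = (1 / (real r * real s * real q)) * (\<Sum>a\<in>A r. \<Sum>b\<in>A s. if r = s \<and> a = b then 0 else real_of_int (gcd (int q) (cross r a s b)))"
      unfolding sum_distrib_left by (intro sum.cong refl) simp
    also have "\<dots> \<le> (1 / (real r * real s * real q)) * (real q * (\<kappa> * (real (numdiv d) * real d)))"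
      by (intro mult_left_mono *) auto
    also have "\<dots> = \<kappa> * (real (numdiv d) * real d / (real r * real s))" using q0 by simp
    finally show ?thesis unfolding q_def d_def .
  qed
  have SI: "S \<subseteq> {1..x}" by (auto simp: S_def)
  have "off_diagonal \<le> (\<Sum>r\<in>S. \<Sum>s\<in>S. \<kappa> * (real (numdiv (gcd r s)) * real (gcd r s) / (real r * real s)))"
    unfolding off_diagonal_def by (intro sum_mono pair)
  also have "\<dots> \<le> (\<Sum>r\<in>{1..x}. \<Sum>s\<in>{1..x}. \<kappa> * (real (numdiv (gcd r s)) * real (gcd r s) / (real r * real s)))"
  proof -
    have "(\<Sum>r\<in>S. \<Sum>s\<in>S. \<kappa> * (real (numdiv (gcd r s)) * real (gcd r s) / (real r * real s))) \<le> (\<Sum>r\<in>S. \<Sum>s\<in>{1..x}. \<kappa> * (real (numdiv (gcd r s)) * real (gcd r s) / (real r * real s)))"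
      by (intro sum_mono sum_mono2 SI) (use \<kappa>0 in auto)
    also have "\<dots> \<le> (\<Sum>r\<in>{1..x}. \<Sum>s\<in>{1..x}. \<kappa> * (real (numdiv (gcd r s)) * real (gcd r s) / (real r * real s)))"
      by (intro sum_mono2 SI sum_nonneg) (use \<kappa>0 in auto)
    finally show ?thesis .
  qed
  also have "\<dots> = \<kappa> * (\<Sum>r\<in>{1..x}. \<Sum>s\<in>{1..x}. real (numdiv (gcd r s)) * real (gcd r s) / (real r * real s))"
    by (simp only: sum_distrib_left)
  also have "\<dots> \<le> \<kappa> * (1 + ln (real x)) ^ 4" by (intro mult_left_mono sum_gcd_pairs_le x_pos \<kappa>0)
  finally show ?thesis by (simp add: \<kappa>_def mult.commute)
qed

end

section \<open>The resonance argument\<close>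

lemma chebyshev_psi_of_nat: "chebyshev_psi (real n) = (\<Sum>k=1..n. mangoldt k)"
  unfolding chebyshev_psi_def by (rule sum.cong) auto

text \<open>Between integers \<psi> is constant, so only the integer part of h matters at an integer
  n.\<close>

lemma chebyshev_psi_add:
  assumes "real H \<le> h" "h < real H + 1"
  shows "chebyshev_psi (real n + h) - chebyshev_psi (real n) = (\<Sum>j=1..H. mangoldt (n + j))"
proof -
  have "{k. 0 < k \<and> real k \<le> real n + h} = {1..n + H}"
  proof (intro equalityI subsetI)
    fix k assume "k \<in> {k. 0 < k \<and> real k \<le> real n + h}"
    then have "0 < k" "real k < real (n + H + 1)" using assms by auto
    then have "k < n + H + 1" by (simp only: of_nat_less_iff)
    then show "k \<in> {1..n + H}" using \<open>0 < k\<close> by auto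
  next
    fix k assume k: "k \<in> {1..n + H}"
    then have "real k \<le> real (n + H)" by (simp only: of_nat_le_iff atLeastAtMost_iff)
    then show "k \<in> {k. 0 < k \<and> real k \<le> real n + h}" using k assms by auto
  qed
  then have "chebyshev_psi (real n + h) = (\<Sum>k=1..n + H. mangoldt k)" by (simp add: chebyshev_psi_def)
  also have "\<dots> = (\<Sum>k=1..n. mangoldt k) + (\<Sum>k=n + 1..n + H. mangoldt k)"
    by (subst sum.union_disjoint[symmetric]) (auto intro: sum.cong)
  also have "(\<Sum>k=n + 1..n + H. mangoldt k :: real) = (\<Sum>j=1..H. mangoldt (n + j))"
    by (rule sum.reindex_bij_witness[of _ "\<lambda>j. n + j" "\<lambda>k. k - n"]) auto
  finally show ?thesis unfolding chebyshev_psi_of_nat by simp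
qed

text \<open>The hat is supported strictly between N and \<open>N + 2 * B\<close>, so after the shift
  by j the variable runs exactly through the interval in which the theorem seeks its
  integers.\<close>

lemma sum_hat_shift:
  fixes f :: "nat \<Rightarrow> real" and g :: "int \<Rightarrow> real"
  assumes "2 * B \<le> N" "j \<le> N"
  shows "(\<Sum>m\<le>3 * N. f m * hat N B (real m - real j) * g (int m - int j)) = (\<Sum>n=N + 1..2 * N. hat N B (real n) * g (int n) * f (n + j))"
proof -
  have "(\<Sum>m\<le>3 * N. f m * hat N B (real m - real j) * g (int m - int j)) = (\<Sum>m\<in>{N + 1 + j..2 * N + j}. f m * hat N B (real m - real j) * g (int m - int j))"
  proof (rule sum.mono_neutral_right)
    show "\<forall>m\<in>{..3 * N} - {N + 1 + j..2 * N + j}. f m * hat N B (real m - real j) * g (int m - int j) = 0"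
    proof
      fix m assume "m \<in> {..3 * N} - {N + 1 + j..2 * N + j}"
      then have "m \<le> N + j \<or> N + 2 * B + j \<le> m" using assms by auto
      then have "real m \<le> real (N + j) \<or> real (N + 2 * B + j) \<le> real m" by (simp only: of_nat_le_iff)
      then have "real m - real j \<le> real N \<or> real (N + 2 * B) \<le> real m - real j" by auto
      then show "f m * hat N B (real m - real j) * g (int m - int j) = 0" using hat_eq_0 by simp
    qed
  qed (use assms in auto)
  also have "\<dots> = (\<Sum>n=N + 1..2 * N. hat N B (real n) * g (int n) * f (n + j))"
    by (rule sum.reindex_bij_witness[of _ "\<lambda>n. n + j" "\<lambda>m. m - j"]) (auto simp: of_nat_diff)
  finally show ?thesis .
qed

context resonator
begin

text \<open>If s times the deviation were at most a throughout, so would be its mean against the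
  nonnegative weight. With \<open>C = s * sqrt V\<close> that mean is \<open>sqrt V\<close> up to
  the errors listed, whichever sign s is.\<close>

lemma resonance:
  assumes GRH: "GRH" and \<delta>: "0 < \<delta>" "\<delta> < 1" and N: "1 \<le> N" "2 * B \<le> N" and HN: "H \<le> N"
    and h: "real H \<le> h" "h < real H + 1" and s: "s = 1 \<or> s = -1" and a: "0 \<le> a"
    and X: "\<And>n. n \<in> {N + 1..2 * N} \<Longrightarrow> s * (chebyshev_psi (real n + h) - chebyshev_psi (real n) - h) \<le> a"
  shows "2 * (real B)\<^sup>2 * (V * sqrt V) \<le> 2 * (real B)\<^sup>2 * V * (a + 1)
    + (real B)\<^sup>2 * (real H ^ 3 * (\<Lambda> * sqrt \<Lambda>) * ((1 + ln (real x)) ^ 4 * (4 * \<eta> / sqrt (real y) + 8 * \<eta>\<^sup>2)))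
    + real H * (real x)\<^sup>2 * (Q * (2 * trig_polynomial.err_bound (real x) \<delta> N + real B * (2 * ln ((real x)\<^sup>2) * ln (real (3 * N)))))
    + (h + a) * ((real x)\<^sup>2 * (Q * (real B * (real x)\<^sup>2)))"
proof -
  define C where "C = s * sqrt V"
  have C2: "C\<^sup>2 = V" using s V_nonneg by (auto simp: C_def power_mult_distrib)
  interpret trig_polynomial "insert 1 S" A "c C" Q "real x" by (rule trig_polynomial_c[OF C2])
  define w where "w n = (norm (total n))\<^sup>2" for n
  define W0 where "W0 = (\<Sum>n=N + 1..2 * N. hat N B (real n) * w (int n))"
  define G where "G = (\<Sum>n=N + 1..2 * N. hat N B (real n) * w (int n) * (\<Sum>j=1..H. mangoldt (n + j)))"
  define M where "M = (\<Sum>r\<in>insert 1 S. \<Sum>s\<in>insert 1 S. \<Sum>a\<in>A r. \<Sum>b\<in>A s. cross_term C r s a b)"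
  define D where "D = real H ^ 3 * (\<Lambda> * sqrt \<Lambda>) * ((1 + ln (real x)) ^ 4 * (4 * \<eta> / sqrt (real y) + 8 * \<eta>\<^sup>2))"
  define E where "E = Q * (2 * err_bound \<delta> N + real B * (2 * ln ((real x)\<^sup>2) * ln (real (3 * N))))"
  define E2 where "E2 = (real x)\<^sup>2 * (Q * (real B * (real x)\<^sup>2))"
  have sabs: "\<bar>s\<bar> = 1" "s * s = 1" using s by auto
  have crd: "(real (card (insert 1 S)))\<^sup>2 \<le> (real x)\<^sup>2"
  proof -
    have "insert 1 S \<subseteq> {1..x}" using x_pos by (auto simp: S_def)
    then have "card (insert 1 S) \<le> card {1..x}" by (intro card_mono) auto
    then show ?thesis by (intro power_mono) auto
  qed
  have lnx: "0 \<le> ln ((real x)\<^sup>2)" using x_pos by simp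
  have E0: "0 \<le> E" unfolding E_def err_bound_def using Q_nonneg lnx zeta32_nonneg N
    by (intro mult_nonneg_nonneg add_nonneg_nonneg) auto

  have M: "norm (M - of_real (2 * real H * V + 2 * C * V)) \<le> D"
  proof -
    have "norm (M - of_real (real H * (C\<^sup>2 + V) + 2 * C * V)) \<le> real H ^ 3 * (\<Lambda> * sqrt \<Lambda>) * off_diagonal"
      unfolding M_def by (rule main_term_bound[OF C2])
    also have "\<dots> \<le> D" unfolding D_def using \<Lambda>_ge by (intro mult_left_mono off_diagonal_le) auto
    also have "real H * (C\<^sup>2 + V) + 2 * C * V = 2 * real H * V + 2 * C * V" unfolding C2 by simp
    finally show ?thesis .
  qed
  have GM: "norm (of_real G - of_real ((real B)\<^sup>2) * M) \<le> real H * (real x)\<^sup>2 * E"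
  proof -
    have "(\<Sum>j=1..H. \<Sum>m\<le>3 * N. mangoldt m * hat N B (real m - real j) * w (int m - int j)) = (\<Sum>j=1..H. \<Sum>n=N + 1..2 * N. hat N B (real n) * w (int n) * mangoldt (n + j))"
      using HN by (intro sum.cong refl sum_hat_shift N(2)) auto
    also have "\<dots> = G" unfolding G_def sum_distrib_left by (rule sum.swap)
    finally have G: "G = (\<Sum>j=1..H. \<Sum>m\<le>3 * N. mangoldt m * hat N B (real m - real j) * w (int m - int j))" ..
    have Gc: "of_real G = (\<Sum>j=1..H. \<Sum>m\<le>3 * N. mangoldt m * of_real (hat N B (real m - real j)) * complex_of_real ((norm (total (int m - int j)))\<^sup>2))"
      unfolding G w_def by (simp only: of_real_sum of_real_mult of_real_mangoldt)
    have "norm (of_real G - of_real ((real B)\<^sup>2) * M) \<le> real H * (real (card (insert 1 S)))\<^sup>2 * E"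
      unfolding Gc M_def cross_term_def E_def by (rule main_sum_bound[OF GRH \<delta> N HN])
    also have "\<dots> \<le> real H * (real x)\<^sup>2 * E" using crd E0 by (intro mult_right_mono mult_left_mono) auto
    finally show ?thesis .
  qed
  have G: "\<bar>G - (real B)\<^sup>2 * (2 * real H * V + 2 * C * V)\<bar> \<le> real H * (real x)\<^sup>2 * E + (real B)\<^sup>2 * D"
  proof -
    have "of_real (G - (real B)\<^sup>2 * (2 * real H * V + 2 * C * V)) = (of_real G - of_real ((real B)\<^sup>2) * M) + of_real ((real B)\<^sup>2) * (M - of_real (2 * real H * V + 2 * C * V))"
      by (simp only: of_real_diff of_real_mult right_diff_distrib) simp
    then have "norm (complex_of_real (G - (real B)\<^sup>2 * (2 * real H * V + 2 * C * V))) \<le> norm (of_real G - of_real ((real B)\<^sup>2) * M) + norm (of_real ((real B)\<^sup>2) * (M - of_real (2 * real H * V + 2 * C * V)))"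
      by (simp only: norm_triangle_ineq)
    also have "norm (of_real ((real B)\<^sup>2) * (M - of_real (2 * real H * V + 2 * C * V))) \<le> (real B)\<^sup>2 * D"
      unfolding norm_mult by (intro mult_mono M) (auto simp: norm_power)
    finally show ?thesis using GM by (simp only: norm_of_real) linarith
  qed
  have W0: "\<bar>W0 - (real B)\<^sup>2 * (2 * V)\<bar> \<le> E2"
  proof -
    have e1: "(\<Sum>n\<le>3 * N. hat N B (real n) * (norm (total (int n)))\<^sup>2) = W0"
      using sum_hat_shift[OF N(2), of 0 "\<lambda>_. 1" w] by (simp add: W0_def w_def)
    have nS: "1 \<notin> S" using S_gt_1 by blast
    have "(\<Sum>r\<in>S. \<Sum>a\<in>A r. (norm (c C r a))\<^sup>2) = V"
      unfolding V_def by (intro sum.cong refl) (use nS in \<open>auto simp: c_def\<close>)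
    then have e2: "(\<Sum>r\<in>insert 1 S. \<Sum>a\<in>A r. (norm (c C r a))\<^sup>2) = 2 * V"
      using nS finite_S A_1 C2 by (simp add: c_def)
    have "\<bar>W0 - (real B)\<^sup>2 * (2 * V)\<bar> \<le> (real (card (insert 1 S)))\<^sup>2 * (Q * (real B * (real x)\<^sup>2))"
      using hat_total_sum[of N B "3 * N"] N unfolding e1 e2 by simp
    also have "\<dots> \<le> E2" unfolding E2_def using crd Q_nonneg by (intro mult_right_mono) auto
    finally show ?thesis .
  qed
  have main: "s * (G - h * W0) \<le> a * W0"
  proof -
    have "s * (G - h * W0) = (\<Sum>n=N + 1..2 * N. hat N B (real n) * w (int n) * (s * ((\<Sum>j=1..H. mangoldt (n + j)) - h)))"
      unfolding G_def W0_def by (simp add: sum_distrib_left right_diff_distrib sum_subtractf mult_ac)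
    also have "\<dots> \<le> (\<Sum>n=N + 1..2 * N. hat N B (real n) * w (int n) * a)"
    proof (rule sum_mono)
      fix n assume "n \<in> {N + 1..2 * N}"
      then have "s * ((\<Sum>j=1..H. mangoldt (n + j)) - h) \<le> a" using X[of n] unfolding chebyshev_psi_add[OF h] by simp
      then show "hat N B (real n) * w (int n) * (s * ((\<Sum>j=1..H. mangoldt (n + j)) - h)) \<le> hat N B (real n) * w (int n) * a"
        by (intro mult_left_mono) (auto simp: w_def hat_nonneg)
    qed
    also have "\<dots> = a * W0" by (simp add: W0_def sum_distrib_left mult_ac)
    finally show ?thesis .
  qed
  have h0: "0 \<le> h" using h by linarith
  have 1: "s * ((real B)\<^sup>2 * (2 * real H * V + 2 * C * V)) - (real H * (real x)\<^sup>2 * E + (real B)\<^sup>2 * D) \<le> s * G"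
    using G s by (auto simp: abs_le_iff)
  have 2: "s * (h * W0) \<le> s * (h * ((real B)\<^sup>2 * (2 * V))) + h * E2"
  proof -
    have "s * (h * W0) - s * (h * ((real B)\<^sup>2 * (2 * V))) = (s * h) * (W0 - (real B)\<^sup>2 * (2 * V))" by (simp add: algebra_simps)
    also have "\<dots> \<le> \<bar>(s * h) * (W0 - (real B)\<^sup>2 * (2 * V))\<bar>" by (rule abs_ge_self)
    also have "\<dots> \<le> h * E2" unfolding abs_mult using sabs h0 W0 by (simp add: mult_left_mono)
    finally show ?thesis by linarith
  qed
  have 3: "a * W0 \<le> a * ((real B)\<^sup>2 * (2 * V) + E2)" using W0 a by (intro mult_left_mono) linarith+
  have 4: "s * ((real B)\<^sup>2 * (2 * real H * V + 2 * C * V)) = 2 * (real B)\<^sup>2 * V * (s * real H) + 2 * (real B)\<^sup>2 * (V * sqrt V)"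
  proof -
    have "s * ((real B)\<^sup>2 * (2 * real H * V + 2 * C * V)) = 2 * (real B)\<^sup>2 * V * (s * real H) + (s * s) * (2 * (real B)\<^sup>2 * (V * sqrt V))"
      unfolding C_def by (simp add: algebra_simps)
    then show ?thesis unfolding sabs by simp
  qed
  \<comment> \<open>The main term knows only the integer H; the fractional part of h accounts for
    the 1 in \<open>a + 1\<close>.\<close>
  have 5: "2 * (real B)\<^sup>2 * V * (s * (h - real H)) \<le> 2 * (real B)\<^sup>2 * V * 1"
    using V_nonneg s h by (intro mult_left_mono) auto
  have "2 * (real B)\<^sup>2 * (V * sqrt V) \<le> 2 * (real B)\<^sup>2 * V * (a + 1) + (real B)\<^sup>2 * D + real H * (real x)\<^sup>2 * E + (h + a) * E2"
    using 1 2 3 5 main unfolding 4 by (simp add: algebra_simps)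
  then show ?thesis unfolding D_def E_def E2_def .
qed

end

section \<open>Choice of the parameters\<close>

locale large =
  fixes N H :: nat and \<delta> l :: real
  assumes l_eq: "l = ln (real N)" and N_gt_1: "1 < N" and \<delta>: "0 < \<delta>" "\<delta> \<le> 1 / 100"
    and H_ge: "l powr (139/10) \<le> real H" and H_le: "real H \<le> real N powr (1/7)"
    and l_ge: "l \<ge> 100"
    and l1: "2 * l powr (6/5) < l powr (139/10)"
    and l2: "(l ^ 20 + 1) * (l + 1)\<^sup>2 + 1 \<le> l ^ 23"
    and l3: "23 * ln l + 13 + 20 * l powr (4/5) \<le> \<delta> * l"
    and l4: "120 * l ^ 5 * l powr (6/5) / l ^ 10 \<le> \<delta> * l"
    and l5: "240 * l ^ 5 * (l powr (6/5))\<^sup>2 \<le> \<delta> * (l powr (139/20) * l)"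
    and N1: "2 * (real N powr (1/7) * ((l ^ 20 + 1) * (l + 1)\<^sup>2)) \<le> real N powr (3/14 - \<delta>)"
    and N2: "10 * l powr (6/5) * l\<^sup>2 * real N powr (1/2 - 2 * \<delta>) *
      (2 * (144 / \<delta>\<^sup>2 * (12 + ln (16 * (1 + zeta32)) + l) * (3 * real N) powr (3/2 + \<delta>)) + real N * (2 * l * (2 * l))) \<le> \<delta> * (real N / 3)\<^sup>2"
    and N3: "40 * l powr (6/5) * l\<^sup>2 * real N powr (1 - 4 * \<delta>) * real N \<le> \<delta> * (real N / 3)\<^sup>2"
begin

text \<open>The exponent has to exceed 1, because the discarded frequencies cost
  \<open>l\<^sup>2 / K\<close> against a main term of order l. With 6/5 the off-diagonal estimate
  asks for H beyond \<open>l powr (64/5)\<close>; the bound \<open>l powr (139/10)\<close> lies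
  above that and below the 14th power, which leaves room for the implied constant and for rounding
  h.\<close>

definition K :: real where "K = l powr (6/5)"
text \<open>A generous power: it makes the gcd error in V and the off-diagonal term with
  \<open>sqrt y\<close> negligible, while it costs only a multiple of \<open>ln l\<close> in the
  logarithm of \<open>x / y\<close>.\<close>

definition L :: nat where "L = nat \<lceil>l ^ 20\<rceil>"
definition y :: nat where "y = H * L"
definition \<eta> :: real where "\<eta> = K / real H"
text \<open>The exponent 1/4 is where the character errors reach the main term; the factor
  \<open>N powr (- \<delta>)\<close> makes them smaller by a power of N, at the price of
  \<open>\<delta> * l\<close> in the logarithm.\<close>

definition X :: real where "X = (real N / real H) powr (1/4) * real N powr (- \<delta>)"
definition x :: nat where "x = nat \<lfloor>X\<rfloor>"

lemma K_ge: "1 \<le> K"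
  unfolding K_def using l_ge by (intro ge_one_powr_ge_zero) auto

lemma L_bounds: "l ^ 20 \<le> real L" "real L \<le> l ^ 20 + 1"
proof -
  have "0 \<le> l ^ 20" using l_ge by simp
  then show "l ^ 20 \<le> real L" "real L \<le> l ^ 20 + 1" unfolding L_def by linarith+
qed

lemma l20: "1 \<le> l ^ 20"
  using l_ge by (intro one_le_power) auto

lemma H_pos: "0 < H"
proof -
  have "0 < l powr (139/10)" using l_ge by simp
  then have "0 < real H" using H_ge by linarith
  then show ?thesis by simp
qed

lemma N_pos: "real N > 0" using N_gt_1 by simp

lemma X_power: "X\<^sup>2 = sqrt (real N) / sqrt (real H) * real N powr (- 2 * \<delta>)" "X ^ 4 = real N / real H * real N powr (- 4 * \<delta>)"
proof -
  have p: "0 < real N / real H" using N_pos H_pos by simp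
  have e: "((real N / real H) powr (1/4)) ^ k = (real N / real H) powr (real k / 4)" "(real N powr (- \<delta>)) ^ k = real N powr (- (real k * \<delta>))" for k
  proof -
    have "(q powr b) ^ k = q powr (b * real k)" if "q > 0" for q b :: real using that by (simp add: powr_power mult.commute)
    from this[OF p] this[OF N_pos] show "((real N / real H) powr (1/4)) ^ k = (real N / real H) powr (real k / 4)" "(real N powr (- \<delta>)) ^ k = real N powr (- (real k * \<delta>))"
      by (simp_all add: mult.commute del: powr_divide)
  qed
  have "X\<^sup>2 = (real N / real H) powr (1/2) * real N powr (- 2 * \<delta>)"
    unfolding X_def power_mult_distrib e by simp
  then show "X\<^sup>2 = sqrt (real N) / sqrt (real H) * real N powr (- 2 * \<delta>)" using p by (simp add: powr_half_sqrt real_sqrt_divide)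
  show "X ^ 4 = real N / real H * real N powr (- 4 * \<delta>)"
    unfolding X_def power_mult_distrib e using p by simp
qed

text \<open>The exponent 3/14 is (1 - 1/7)/4. It exceeds the exponent 1/7 of H, so the range between
  y and x is long.\<close>

lemma X_ge: "real N powr (3/14 - \<delta>) \<le> X"
proof -
  have "real N powr (6/7) = real N / real N powr (1/7)"
    using N_pos powr_diff[of "real N" 1 "1/7"] by simp
  also have "\<dots> \<le> real N / real H" using H_le H_pos N_pos by (intro divide_left_mono) auto
  finally have "(real N powr (6/7)) powr (1/4) \<le> (real N / real H) powr (1/4)" by (intro powr_mono2) auto
  then have "real N powr (3/14) \<le> (real N / real H) powr (1/4)" by (simp add: powr_powr)
  then have "real N powr (3/14) * real N powr (- \<delta>) \<le> X" unfolding X_def by (intro mult_right_mono) auto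
  then show ?thesis by (simp add: powr_add[symmetric])
qed

lemma y_t_le: "real y * (real (nat \<lceil>l\<rceil>))\<^sup>2 * 2 \<le> X" "1 \<le> real y"
proof -
  have "real (nat \<lceil>l\<rceil>) \<le> l + 1" using l_ge by linarith
  then have t: "(real (nat \<lceil>l\<rceil>))\<^sup>2 \<le> (l + 1)\<^sup>2" by (intro power_mono) auto
  have "real y \<le> real N powr (1/7) * (l ^ 20 + 1)" unfolding y_def of_nat_mult by (intro mult_mono H_le L_bounds) auto
  then have "real y * (real (nat \<lceil>l\<rceil>))\<^sup>2 \<le> real N powr (1/7) * (l ^ 20 + 1) * (l + 1)\<^sup>2" using t l20 by (intro mult_mono) auto
  then show "real y * (real (nat \<lceil>l\<rceil>))\<^sup>2 * 2 \<le> X" using N1 X_ge by (simp only: mult.assoc mult.commute[of _ 2])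
  have "real H * 1 \<le> real H * real L" using L_bounds(1) l20 by (intro mult_left_mono) auto
  moreover have "1 \<le> real H" using H_pos by simp
  ultimately show "1 \<le> real y" unfolding y_def of_nat_mult by linarith
qed

lemma x_bounds: "X / 2 \<le> real x" "real x \<le> X" "real x \<ge> 1" "y * (nat \<lceil>l\<rceil>)\<^sup>2 \<le> x"
proof -
  have "1 * 1 \<le> real y * (real (nat \<lceil>l\<rceil>))\<^sup>2" using y_t_le(2) l_ge by (intro mult_mono) (auto simp: one_le_power)
  then have X2: "X \<ge> 2" using y_t_le(1) by linarith
  show "X / 2 \<le> real x" "real x \<le> X" "real x \<ge> 1" unfolding x_def using X2 by linarith+
  have "real (y * (nat \<lceil>l\<rceil>)\<^sup>2) \<le> X / 2" using y_t_le(1) by simp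
  also have "\<dots> \<le> real x" by fact
  finally show "y * (nat \<lceil>l\<rceil>)\<^sup>2 \<le> x" by (simp only: of_nat_le_iff)
qed

lemma ln_X: "ln X = (l - ln (real H)) / 4 - \<delta> * l"
  unfolding X_def using N_pos H_pos by (simp add: ln_mult ln_powr ln_div l_eq)

lemma ln_x_le: "ln (real x) \<le> l / 4" "0 \<le> ln (real x)"
proof -
  have "ln (real x) \<le> ln X" using x_bounds by (subst ln_le_cancel_iff) auto
  moreover have "0 \<le> ln (real H)" using H_pos by simp
  moreover have "0 \<le> \<delta> * l" using \<delta> l_ge by simp
  ultimately show "ln (real x) \<le> l / 4" unfolding ln_X by argo
qed (use x_bounds in simp)

sublocale resonator H y x \<eta>
proof
  show "0 < H" by (rule H_pos)
  show "0 < y" using y_t_le(2) by simp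
  show "0 < x" using x_bounds(3) by simp
  have "1 * 1 \<le> K * real L" using K_ge L_bounds(1) l20 by (intro mult_mono) auto
  then show "1 \<le> \<eta> * real y" unfolding \<eta>_def y_def using H_pos by simp
  have "2 * K < real H" using l1 H_ge unfolding K_def by linarith
  then show "\<eta> < 1 / 2" unfolding \<eta>_def using H_pos by (simp add: field_simps)
qed

lemma \<Lambda>_le: "\<Lambda> \<le> 5 * l" and u_le: "1 + ln (real x) \<le> l"
  unfolding \<Lambda>_def using ln_x_le l_ge by linarith+

lemma sqrt_H: "sqrt (real H) \<ge> 1" "real H = sqrt (real H) * sqrt (real H)" "l powr (139/20) \<le> sqrt (real H)"
proof -
  show "sqrt (real H) \<ge> 1" using H_pos by simp
  show "real H = sqrt (real H) * sqrt (real H)" by simp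
  have "(l powr (139/20))\<^sup>2 \<le> real H" using H_ge l_ge by (simp add: powr_power)
  then show "l powr (139/20) \<le> sqrt (real H)" by (rule real_le_rsqrt)
qed

text \<open>Up to lower order the logarithm of \<open>x / y\<close> is
  \<open>(l - ln H) / 4 - ln H\<close>, which explains the 5. One \<open>\<delta> * l\<close> of the
  loss comes from X, the other covers the logarithms of the powers of l, the rounding and the two
  error terms of \<open>V_ge\<close>.\<close>

lemma V_lower:
  assumes a: "real H \<le> real N powr a"
  shows "real H * l * ((1 - 5 * a) / 4 - 2 * \<delta>) \<le> V"
proof -
  \<comment> \<open>With t of the size of l, the square-divisor error \<open>(1 + ln x) / t\<close>
    is at most 1.\<close>
  define t where "t = nat \<lceil>l\<rceil>"
  define u where "u = 1 + ln (real x)"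
  have t: "l \<le> real t" "real t \<le> l + 1" "t > 0" unfolding t_def using l_ge by linarith+
  have lnH: "ln (real H) \<le> a * l"
  proof -
    have "ln (real H) \<le> ln (real N powr a)" using a H_pos N_pos by (subst ln_le_cancel_iff) auto
    then show ?thesis using N_pos by (simp add: ln_powr l_eq)
  qed
  have u: "1 \<le> u" "u \<le> l" unfolding u_def using ln_x_le u_le by linarith+
  have "ln (real x / (real y * (real t)\<^sup>2 + 1)) - (1 + ln (real x)) / real t \<le> (\<Sum>r\<in>S. 1 / real (totient r))"
    unfolding S_def using x_bounds(4) t y_pos by (intro sum_inverse_totient_ge) (auto simp: t_def)
  moreover have "(1 + ln (real x)) / real t \<le> 1" using u t l_ge unfolding u_def by simp
  moreover have "ln (real x / (real y * (real t)\<^sup>2 + 1)) = ln (real x) - ln (real y * (real t)\<^sup>2 + 1)"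
  proof (rule ln_divide_pos)
    show "0 < real y * (real t)\<^sup>2 + 1" by (intro add_nonneg_pos) auto
  qed (use x_bounds(3) in simp)
  moreover have "ln (real x) \<ge> ln X - 1"
  proof -
    have "ln (X / 2) \<le> ln (real x)" using x_bounds by (subst ln_le_cancel_iff) auto
    moreover have "ln (X / 2) = ln X - ln 2" using x_bounds by (intro ln_divide_pos) auto
    ultimately show ?thesis using ln2_le_25_over_36 by linarith
  qed
  moreover have "ln (real y * (real t)\<^sup>2 + 1) \<le> ln (real H) + 23 * ln l"
  proof -
    have "(real t)\<^sup>2 \<le> (l + 1)\<^sup>2" using t by (intro power_mono) auto
    then have "real L * (real t)\<^sup>2 \<le> (l ^ 20 + 1) * (l + 1)\<^sup>2" using L_bounds l20 by (intro mult_mono) auto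
    then have "real L * (real t)\<^sup>2 + 1 \<le> l ^ 23" using l2 by linarith
    then have "real H * (real L * (real t)\<^sup>2 + 1) \<le> real H * l ^ 23" by (intro mult_left_mono) auto
    moreover have "1 \<le> real H" using H_pos by simp
    ultimately have "real y * (real t)\<^sup>2 + 1 \<le> real H * l ^ 23" unfolding y_def by (simp add: algebra_simps)
    then have "ln (real y * (real t)\<^sup>2 + 1) \<le> ln (real H * l ^ 23)" using H_pos l_ge by (subst ln_le_cancel_iff) (auto intro: add_nonneg_pos)
    also have "\<dots> = ln (real H) + 23 * ln l" using H_pos l_ge by (simp add: ln_mult ln_realpow)
    finally show ?thesis .
  qed
  ultimately have S: "(l - 5 * ln (real H)) / 4 - \<delta> * l - 2 - 23 * ln l \<le> (\<Sum>r\<in>S. 1 / real (totient r))"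
    unfolding ln_X by argo
  have "\<Lambda> * (2 * (real H)\<^sup>2 / real y * u\<^sup>2 + 4 / \<eta> * u) \<le> real H * (10 + 20 * l powr (4/5))"
  proof -
    have "2 * (real H)\<^sup>2 / real y * u\<^sup>2 \<le> 2 * (real H / l ^ 20) * l\<^sup>2"
    proof (intro mult_mono)
      have "2 * (real H)\<^sup>2 / real y = 2 * (real H / real L)" unfolding y_def using H_pos by (simp add: power2_eq_square)
      also have "\<dots> \<le> 2 * (real H / l ^ 20)" using L_bounds l20 by (intro mult_left_mono divide_left_mono mult_pos_pos) auto
      finally show "2 * (real H)\<^sup>2 / real y \<le> 2 * (real H / l ^ 20)" .
    qed (use u l_ge in \<open>auto intro: power_mono\<close>)
    moreover have "4 / \<eta> * u \<le> 4 * (real H / K) * l" unfolding \<eta>_def using u H_pos K_ge by (simp add: field_simps)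
    ultimately have "\<Lambda> * (2 * (real H)\<^sup>2 / real y * u\<^sup>2 + 4 / \<eta> * u) \<le> (5 * l) * (2 * (real H / l ^ 20) * l\<^sup>2 + 4 * (real H / K) * l)"
      using u \<eta>_pos l_ge by (intro mult_mono[OF \<Lambda>_le] add_mono add_nonneg_nonneg) auto
    also have "\<dots> = real H * (10 * (l ^ 3 / l ^ 20) + 20 * (l\<^sup>2 / K))" by (simp add: power2_eq_square power3_eq_cube algebra_simps)
    also have "\<dots> \<le> real H * (10 + 20 * l powr (4/5))"
    proof (intro mult_left_mono)
      have "l ^ 3 \<le> l ^ 20" using l_ge by (intro power_increasing) auto
      then have "l ^ 3 / l ^ 20 \<le> 1" using l20 by (subst divide_le_eq_1_pos) auto
      moreover have "l\<^sup>2 / K = l powr (4/5)" unfolding K_def using l_ge powr_diff[of l 2 "6/5"] by (simp add: powr_numeral)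
      ultimately show "10 * (l ^ 3 / l ^ 20) + 20 * (l\<^sup>2 / K) \<le> 10 + 20 * l powr (4/5)" by linarith
    qed auto
    finally show ?thesis .
  qed
  then have "V \<ge> real H * (\<Sum>r\<in>S. 1 / real (totient r)) - real H * (10 + 20 * l powr (4/5))"
    using V_ge unfolding u_def by linarith
  moreover have "real H * ((l - 5 * ln (real H)) / 4 - \<delta> * l - 2 - 23 * ln l) \<le> real H * (\<Sum>r\<in>S. 1 / real (totient r))"
    by (intro mult_left_mono S) auto
  moreover have "real H * (l * ((1 - 5 * a) / 4 - 2 * \<delta>)) \<le> real H * (((l - 5 * ln (real H)) / 4 - \<delta> * l - 2 - 23 * ln l) - (10 + 20 * l powr (4/5)))"
  proof (intro mult_left_mono)
    have "l * ((1 - 5 * a) / 4 - 2 * \<delta>) = (l - 5 * (a * l)) / 4 - 2 * (\<delta> * l)" by (simp add: field_simps)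
    then show "l * ((1 - 5 * a) / 4 - 2 * \<delta>) \<le> ((l - 5 * ln (real H)) / 4 - \<delta> * l - 2 - 23 * ln l) - (10 + 20 * l powr (4/5))"
      using l3 lnH by argo
  qed simp
  ultimately show ?thesis by (simp only: right_diff_distrib mult.assoc)
qed

lemma Q_le: "Q \<le> 10 * K * real H * l\<^sup>2"
proof -
  have "Q = (2 * \<eta> * (real H)\<^sup>2) * (\<Lambda> * (1 + ln (real x)))" by (simp add: Q_def)
  also have "\<dots> \<le> (2 * \<eta> * (real H)\<^sup>2) * ((5 * l) * l)"
    using \<Lambda>_le u_le \<eta>_pos ln_x_nonneg l_ge by (intro mult_left_mono mult_mono) auto
  also have "\<dots> = 10 * K * real H * l\<^sup>2" unfolding \<eta>_def using H_pos by (simp add: power2_eq_square)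
  finally show ?thesis .
qed

lemma Q_nonneg: "0 \<le> Q" using V_nonneg V_le by linarith

text \<open>Both parts are compared with \<open>H powr (3/2)\<close>. The part with
  \<open>sqrt y\<close> already contains that power of H and is saved by
  \<open>sqrt L \<ge> l ^ 10\<close>; the part with \<open>\<eta>\<^sup>2\<close> lacks a factor
  \<open>sqrt H\<close>, and here the lower bound for H is spent.\<close>

lemma off_diagonal_small:
  "real H ^ 3 * (\<Lambda> * sqrt \<Lambda>) * ((1 + ln (real x)) ^ 4 * (4 * \<eta> / sqrt (real y) + 8 * \<eta>\<^sup>2)) \<le> \<delta> * (real H * sqrt (real H) * (l * sqrt l))"
proof -
  define r where "r = sqrt (real H)"
  have r: "r \<ge> 1" "real H = r * r" "l powr (139/20) \<le> r" unfolding r_def using sqrt_H by auto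
  have sl: "sqrt l \<ge> 0" using l_ge by simp
  have ll: "\<Lambda> * sqrt \<Lambda> \<le> (5 * l) * (3 * sqrt l)"
  proof (intro mult_mono \<Lambda>_le)
    have "sqrt \<Lambda> \<le> sqrt (9 * l)" using \<Lambda>_le l_ge by (intro real_sqrt_le_mono) linarith
    then show "sqrt \<Lambda> \<le> 3 * sqrt l" by (simp add: real_sqrt_mult)
  qed (use \<Lambda>_ge l_ge in auto)
  have sy: "r * l ^ 10 \<le> sqrt (real y)"
  proof (rule real_le_rsqrt)
    have "(r * l ^ 10)\<^sup>2 = real H * l ^ 20" using r(2) by (simp add: power_mult_distrib power_mult[symmetric] power2_eq_square[of r])
    also have "\<dots> \<le> real y" unfolding y_def of_nat_mult by (intro mult_left_mono L_bounds) auto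
    finally show "(r * l ^ 10)\<^sup>2 \<le> real y" .
  qed
  have l10: "0 < l ^ 10" using l_ge by simp
  have e: "4 * \<eta> / sqrt (real y) + 8 * \<eta>\<^sup>2 \<le> 4 * (K / (r * r)) / (r * l ^ 10) + 8 * (K / (r * r))\<^sup>2"
    unfolding \<eta>_def r(2)[symmetric] using sy r(1) l10 K_ge y_pos by (intro add_mono divide_left_mono order_refl mult_pos_pos) auto
  have "real H ^ 3 * (\<Lambda> * sqrt \<Lambda>) * ((1 + ln (real x)) ^ 4 * (4 * \<eta> / sqrt (real y) + 8 * \<eta>\<^sup>2))
    \<le> real H ^ 3 * ((5 * l) * (3 * sqrt l)) * (l ^ 4 * (4 * (K / (r * r)) / (r * l ^ 10) + 8 * (K / (r * r))\<^sup>2))"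
    using ln_x_nonneg \<Lambda>_ge \<eta>_pos l_ge by (intro mult_mono[OF mult_left_mono[OF ll] mult_mono[OF power_mono[OF u_le] e]]) auto
  also have "\<dots> = (r * r * r * sqrt l) * (60 * l ^ 5 * K / l ^ 10) + (r * r * sqrt l) * (120 * l ^ 5 * K\<^sup>2)"
  proof -
    have id: "(r * r) ^ 3 * ((5 * l) * (3 * s)) * (l ^ 4 * (4 * (K / (r * r)) / (r * m) + 8 * (K / (r * r))\<^sup>2)) = (r * r * r * s) * (60 * (l * l ^ 4) * K / m) + (r * r * s) * (120 * (l * l ^ 4) * K\<^sup>2)"
      if "m > 0" for s m :: real
      using r(1) that by (simp add: power2_eq_square power3_eq_cube field_simps)
    have "l * l ^ 4 = l ^ 5" by (simp add: power_Suc[symmetric])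
    then show ?thesis unfolding r(2) using id[OF l10, of "sqrt l"] by simp
  qed
  also have "\<dots> \<le> (r * r * r * sqrt l) * (\<delta> * l / 2) + (r * r * sqrt l) * (\<delta> * l / 2 * r)"
  proof (intro add_mono mult_left_mono)
    show "60 * l ^ 5 * K / l ^ 10 \<le> \<delta> * l / 2" using l4 unfolding K_def by argo
    have "240 * l ^ 5 * K\<^sup>2 \<le> \<delta> * (l powr (139/20) * l)" using l5 unfolding K_def .
    also have "\<dots> \<le> \<delta> * (r * l)" using r \<delta> l_ge by (intro mult_left_mono mult_right_mono) auto
    finally show "120 * l ^ 5 * K\<^sup>2 \<le> \<delta> * l / 2 * r" by (simp add: algebra_simps)
  qed (use r sl in auto)
  also have "\<dots> = \<delta> * (real H * r * (l * sqrt l))" unfolding r(2) by (simp add: field_simps)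
  finally show ?thesis unfolding r_def .
qed

lemma B_square: "(real N / 3)\<^sup>2 \<le> (real (N div 2))\<^sup>2"
proof -
  have "N \<le> 3 * (N div 2)" using N_gt_1 by linarith
  then have "real N \<le> real (3 * (N div 2))" by (simp only: of_nat_le_iff)
  then show ?thesis by (intro power_mono) auto
qed

text \<open>The square of x supplies \<open>N powr (1/2 - 2 * \<delta>)\<close> and the character
  error \<open>N powr (3/2 + \<delta>)\<close>, together a saving of \<open>N powr \<delta>\<close>
  over \<open>N\<^sup>2\<close>. The root of H in the denominator of \<open>x\<^sup>2\<close> leaves
  just \<open>H powr (3/2)\<close>.\<close>

lemma character_error_small:
  "real H * (real x)\<^sup>2 * (Q * (2 * trig_polynomial.err_bound (real x) \<delta> N + real (N div 2) * (2 * ln ((real x)\<^sup>2) * ln (real (3 * N)))))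
    \<le> (real (N div 2))\<^sup>2 * (\<delta> * (real H * sqrt (real H)))"
proof -
  interpret trig_polynomial "insert 1 S" A "c (sqrt V)" Q "real x"
    by (rule trig_polynomial_c) (simp add: V_nonneg)
  define r where "r = sqrt (real H)"
  have r: "r \<ge> 1" "real H = r * r" unfolding r_def using sqrt_H by auto
  define W where "W = 2 * (144 / \<delta>\<^sup>2 * (12 + ln (16 * (1 + zeta32)) + l) * (3 * real N) powr (3/2 + \<delta>)) + real N * (2 * l * (2 * l))"
  have z: "0 \<le> ln (16 * (1 + zeta32))" using zeta32_nonneg by simp
  have lx: "ln ((real x)\<^sup>2) = 2 * ln (real x)" using x_bounds(3) by (simp add: ln_realpow)
  have lx': "0 \<le> ln ((real x)\<^sup>2)" "ln ((real x)\<^sup>2) \<le> l" unfolding lx using ln_x_le l_ge by linarith+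
  have "ln (real (3 * N)) = ln 3 + l" using N_pos by (simp add: l_eq ln_mult)
  moreover have "ln 3 \<le> (2 :: real)" using ln_le_minus_one[of "3 :: real"] by simp
  ultimately have l3N: "0 \<le> ln (real (3 * N))" "ln (real (3 * N)) \<le> 2 * l" using l_ge by (auto simp: ln_ge_zero)
  have W: "2 * err_bound \<delta> N + real (N div 2) * (2 * ln ((real x)\<^sup>2) * ln (real (3 * N))) \<le> W"
    unfolding W_def err_bound_def
  proof (intro add_mono mult_left_mono mult_mono)
    show "real (3 * N) powr (3 / 2 + \<delta>) \<le> (3 * real N) powr (3 / 2 + \<delta>)" by simp
    show "real (N div 2) \<le> real N" by simp
  qed (use lx' l3N z l_ge zeta32_nonneg in auto)
  have W0: "0 \<le> W" unfolding W_def using z l_ge by (intro add_nonneg_nonneg mult_nonneg_nonneg) auto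
  have x2: "(real x)\<^sup>2 \<le> sqrt (real N) / r * real N powr (- 2 * \<delta>)"
    using x_bounds unfolding r_def X_power(1)[symmetric] by (intro power_mono) auto
  have "real H * (real x)\<^sup>2 * (Q * (2 * err_bound \<delta> N + real (N div 2) * (2 * ln ((real x)\<^sup>2) * ln (real (3 * N)))))
    \<le> real H * (sqrt (real N) / r * real N powr (- 2 * \<delta>)) * ((10 * K * real H * l\<^sup>2) * W)"
  proof (intro mult_mono x2 Q_le W order_refl)
    show "0 \<le> Q * (2 * err_bound \<delta> N + real (N div 2) * (2 * ln ((real x)\<^sup>2) * ln (real (3 * N))))"
      unfolding err_bound_def using z lx' l3N by (intro mult_nonneg_nonneg add_nonneg_nonneg Q_nonneg) auto
    show "0 \<le> 2 * err_bound \<delta> N + real (N div 2) * (2 * ln ((real x)\<^sup>2) * ln (real (3 * N)))"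
      unfolding err_bound_def using z lx' l3N by (intro mult_nonneg_nonneg add_nonneg_nonneg) auto
  qed (use K_ge r in auto)
  also have "\<dots> = (real H * r) * (10 * K * l\<^sup>2 * (sqrt (real N) * real N powr (- 2 * \<delta>)) * W)"
  proof -
    have id: "(r * r) * (p / r * m) * ((10 * K * (r * r) * l\<^sup>2) * W) = ((r * r) * r) * (10 * K * l\<^sup>2 * (p * m) * W)" for p m
      using r(1) by (simp add: field_simps)
    show ?thesis unfolding r(2) by (rule id)
  qed
  also have "sqrt (real N) * real N powr (- 2 * \<delta>) = real N powr (1/2 - 2 * \<delta>)"
    using N_pos by (simp add: powr_half_sqrt[symmetric] powr_add[symmetric])
  also have "(real H * r) * (10 * K * l\<^sup>2 * real N powr (1/2 - 2 * \<delta>) * W) \<le> (real H * r) * (\<delta> * (real N / 3)\<^sup>2)"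
    using N2 r unfolding W_def K_def by (intro mult_left_mono) auto
  also have "\<dots> \<le> (real H * r) * (\<delta> * (real (N div 2))\<^sup>2)" using r \<delta> by (intro mult_left_mono B_square) auto
  finally show ?thesis unfolding r_def by (simp only: mult_ac)
qed

text \<open>Here the fourth power of x meets one factor N from the hat, and the saving is
  \<open>N powr (4 * \<delta>)\<close>.\<close>

lemma diagonal_error_small:
  assumes w: "w \<le> 4 * real H"
  shows "w * ((real x)\<^sup>2 * (Q * (real (N div 2) * (real x)\<^sup>2))) \<le> (real (N div 2))\<^sup>2 * (\<delta> * (real H * sqrt (real H)))"
proof -
  have x4: "real x ^ 4 \<le> real N / real H * real N powr (- 4 * \<delta>)"
    using x_bounds unfolding X_power(2)[symmetric] by (intro power_mono) auto
  have N4: "real N * real N powr (- 4 * \<delta>) = real N powr (1 - 4 * \<delta>)" using N_pos powr_add[of "real N" 1 "- 4 * \<delta>"] by simp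
  have "w * ((real x)\<^sup>2 * (Q * (real (N div 2) * (real x)\<^sup>2))) = w * (Q * real (N div 2) * real x ^ 4)"
    by (simp add: power2_eq_square power4_eq_xxxx)
  also have "\<dots> \<le> (4 * real H) * ((10 * K * real H * l\<^sup>2) * real N * (real N / real H * real N powr (- 4 * \<delta>)))"
    using w K_ge by (intro mult_mono x4 Q_le Q_nonneg mult_nonneg_nonneg) (auto simp: Q_nonneg)
  also have "\<dots> = real H * (40 * K * l\<^sup>2 * (real N * real N powr (- 4 * \<delta>)) * real N)"
    using H_pos by (simp add: field_simps)
  also have "\<dots> \<le> real H * (\<delta> * (real N / 3)\<^sup>2)" unfolding N4 using N3 unfolding K_def by (intro mult_left_mono) auto
  also have "\<dots> \<le> (real H * sqrt (real H)) * (\<delta> * (real (N div 2))\<^sup>2)"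
    using \<delta> sqrt_H(1) by (intro mult_mono B_square) auto
  finally show ?thesis by (simp only: mult_ac)
qed

text \<open>After division by \<open>2 * V\<close> the resonance inequality bounds
  \<open>sqrt V\<close> by a plus small errors, whereas \<open>V_lower\<close> makes it larger by
  nearly e times T, where T is \<open>sqrt (H * l)\<close>.\<close>

lemma contradiction:
  assumes GRH: "GRH" and h: "real H \<le> h" "h < real H + 1" "h \<le> real N powr (1/7)" and h\<alpha>: "h = real N powr \<alpha>"
    and s: "s = 1 \<or> s = -1" and e: "0 < e" "e \<le> 1/10" "\<delta> = e\<^sup>2 / 200"
    and l6: "1 + sqrt l < e / 2 * (l * sqrt l)"
    and X: "\<And>n. n \<in> {N + 1..2 * N} \<Longrightarrow> s * (chebyshev_psi (real n + h) - chebyshev_psi (real n) - h) \<le> (sqrt (1 - 5 * \<alpha>) / 2 - e) * sqrt (h * l)"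
  shows False
proof -
  define B where "B = N div 2"
  define a where "a = (sqrt (1 - 5 * \<alpha>) / 2 - e) * sqrt (h * l)"
  define r where "r = sqrt (real H)"
  define T where "T = r * sqrt l"
  have r: "r \<ge> 1" "real H = r * r" "l powr (139/20) \<le> r" unfolding r_def using sqrt_H by auto
  have sl: "sqrt l \<ge> 1" "sqrt l * sqrt l = l" using l_ge by auto
  have T: "T * T = real H * l" "T \<ge> 1" unfolding T_def r(2)
    using r(1) sl mult_mono[of 1 r 1 "sqrt l"] by (auto simp: mult_ac)
  have H1: "1 \<le> real H" using H_pos by simp
  have \<alpha>: "0 \<le> \<alpha>" "\<alpha> \<le> 1/7"
  proof -
    have "real N powr 0 \<le> real N powr \<alpha>" using h(1) h\<alpha> H1 N_pos by simp
    then show "0 \<le> \<alpha>" using N_gt_1 by (subst (asm) powr_le_cancel_iff) auto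
    show "\<alpha> \<le> 1/7" using h(3) N_gt_1 unfolding h\<alpha> by (subst (asm) powr_le_cancel_iff) auto
  qed
  have s5: "1/2 \<le> sqrt (1 - 5 * \<alpha>)"
  proof (rule real_le_rsqrt)
    show "(1/2)\<^sup>2 \<le> 1 - 5 * \<alpha>" using \<alpha>(2) by (simp add: power2_eq_square)
  qed
  moreover have "sqrt (1 - 5 * \<alpha>) \<le> 1" using \<alpha> by simp
  ultimately have sm: "0 \<le> sqrt (1 - 5 * \<alpha>) / 2 - e" "sqrt (1 - 5 * \<alpha>) / 2 - e \<le> 1" using e by linarith+
  have lH: "l \<le> real H"
  proof -
    have "l powr 1 \<le> l powr (139/10)" using l_ge by (intro powr_mono) auto
    then show ?thesis using H_ge l_ge by simp
  qed
  have a0: "0 \<le> a" unfolding a_def using h H1 l_ge by (intro mult_nonneg_nonneg sm) auto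
  have aH: "a \<le> 2 * real H"
  proof -
    have "a \<le> 1 * sqrt (h * l)" unfolding a_def using h H1 l_ge by (intro mult_right_mono sm) auto
    also have "h * l \<le> (2 * real H) * (2 * real H)" using h H1 lH l_ge by (intro mult_mono) auto
    then have "1 * sqrt (h * l) \<le> sqrt ((2 * real H) * (2 * real H))" by simp
    also have "\<dots> = 2 * real H" by (simp only: real_sqrt_abs2)
    finally show ?thesis .
  qed
  have HN: "H \<le> N"
  proof -
    have "real N powr (1/7) \<le> real N powr 1" using N_gt_1 by (intro powr_mono) auto
    then have "real H \<le> real N" using H_le N_pos by simp
    then show ?thesis by simp
  qed
  have B0: "0 < (real B)\<^sup>2" using B_square N_pos unfolding B_def by (auto intro: order.strict_trans2[of _ "(real N / 3)\<^sup>2"])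
  have HN\<alpha>: "real H \<le> real N powr \<alpha>" using h h\<alpha> by simp
  have Vl: "real H * l * ((1 - 5 * \<alpha>) / 4 - 2 * \<delta>) \<le> V" by (rule V_lower[OF HN\<alpha>])
  have d: "\<delta> \<le> e / 2000"
  proof -
    have "e * e \<le> e * (1/10)" using e by (intro mult_left_mono) auto
    then show ?thesis unfolding e(3) power2_eq_square by simp
  qed
  \<comment> \<open>At \<open>\<alpha> \<le> 1/7\<close> the factor
    \<open>(1 - 5 * \<alpha>) / 4\<close> is at least 1/14, and half of it survives the subtraction.
    The resulting \<open>T * T \<le> 28 * V\<close> lets the errors, of order T^3, be divided by
    V.\<close>
  have "real H * l * (1/28) \<le> real H * l * ((1 - 5 * \<alpha>) / 4 - 2 * \<delta>)"
  proof (intro mult_left_mono)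
    show "1/28 \<le> (1 - 5 * \<alpha>) / 4 - 2 * \<delta>" using d e(2) \<alpha>(2) by argo
  qed (use l_ge in auto)
  then have V28: "T * T \<le> 28 * V" using Vl T(1) by linarith
  then have V0: "0 < V" using T(2) mult_mono[of 1 T 1 T] by linarith
  have "2 * (real B)\<^sup>2 * (V * sqrt V) \<le> 2 * (real B)\<^sup>2 * V * (a + 1)
    + (real B)\<^sup>2 * (\<delta> * (real H * r * (l * sqrt l))) + (real B)\<^sup>2 * (\<delta> * (real H * r)) + (real B)\<^sup>2 * (\<delta> * (real H * r))"
  proof (rule order_trans[OF resonance[OF GRH \<delta>(1) _ _ _ HN h(1,2) s a0]])
    show "s * (chebyshev_psi (real n + h) - chebyshev_psi (real n) - h) \<le> a" if "n \<in> {N + 1..2 * N}" for n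
      using X[OF that] by (simp only: a_def)
    show "2 * B \<le> N" by (simp add: B_def)
    show "2 * (real B)\<^sup>2 * V * (a + 1)
    + (real B)\<^sup>2 * (real H ^ 3 * (\<Lambda> * sqrt \<Lambda>) * ((1 + ln (real x)) ^ 4 * (4 * \<eta> / sqrt (real y) + 8 * \<eta>\<^sup>2)))
    + real H * (real x)\<^sup>2 * (Q * (2 * trig_polynomial.err_bound (real x) \<delta> N + real B * (2 * ln ((real x)\<^sup>2) * ln (real (3 * N)))))
    + (h + a) * ((real x)\<^sup>2 * (Q * (real B * (real x)\<^sup>2))) \<le> 2 * (real B)\<^sup>2 * V * (a + 1)
    + (real B)\<^sup>2 * (\<delta> * (real H * r * (l * sqrt l))) + (real B)\<^sup>2 * (\<delta> * (real H * r)) + (real B)\<^sup>2 * (\<delta> * (real H * r))"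
      unfolding B_def r_def
      by (intro add_mono order_refl character_error_small diagonal_error_small mult_left_mono off_diagonal_small)
        (use h aH H1 in auto)
  qed (use \<delta> N_gt_1 in auto)
  also have "\<dots> = (real B)\<^sup>2 * (2 * V * (a + 1) + \<delta> * (real H * r * (l * sqrt l)) + 2 * (\<delta> * (real H * r)))"
    by (simp add: algebra_simps)
  finally have "(real B)\<^sup>2 * (2 * (V * sqrt V)) \<le> (real B)\<^sup>2 * (2 * V * (a + 1) + \<delta> * (real H * r * (l * sqrt l)) + 2 * (\<delta> * (real H * r)))"
    by (simp only: mult_ac)
  then have "2 * (V * sqrt V) \<le> 2 * V * (a + 1) + \<delta> * (real H * r * (l * sqrt l)) + 2 * (\<delta> * (real H * r))"
    using B0 by (simp only: mult_le_cancel_left_pos)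
  also have "\<dots> \<le> 2 * V * (a + 1) + 3 * \<delta> * (T * T * T)"
  proof -
    have "1 * 1 \<le> l * sqrt l" using sl l_ge by (intro mult_mono) auto
    then have "\<delta> * (real H * r * 1) \<le> \<delta> * (real H * r * (l * sqrt l))" using \<delta> r by (intro mult_left_mono) auto
    moreover have "\<delta> * (T * T * T) = \<delta> * (real H * r * (l * sqrt l))" unfolding T(1) by (simp add: T_def)
    moreover have "3 * \<delta> * (T * T * T) = 3 * (\<delta> * (T * T * T))" by simp
    ultimately show ?thesis by linarith
  qed
  \<comment> \<open>Division by \<open>2 * V\<close> leaves 3 * 28 / 2 = 42.\<close>
  also have "3 * \<delta> * (T * T * T) \<le> 3 * \<delta> * (28 * V * T)"
    using \<delta> T(2) V28 by (intro mult_left_mono mult_right_mono) auto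
  finally have "(2 * V) * sqrt V \<le> (2 * V) * (a + 1 + 42 * \<delta> * T)" by (simp add: algebra_simps)
  then have sV: "sqrt V \<le> a + 1 + 42 * \<delta> * T" using V0 mult_le_cancel_left_pos[of "2 * V"] by simp
  have sV2: "T * (sqrt (1 - 5 * \<alpha>) / 2 - e / 10) \<le> sqrt V"
  proof -
    have v: "0 \<le> (1 - 5 * \<alpha>) / 4 - 2 * \<delta>" using d e(2) \<alpha>(2) by argo
    have "sqrt (((1 - 5 * \<alpha>) / 4 - 2 * \<delta>) + 2 * \<delta>) \<le> sqrt ((1 - 5 * \<alpha>) / 4 - 2 * \<delta>) + sqrt (2 * \<delta>)"
      using v \<delta> by (intro sqrt_add_le_add_sqrt) auto
    moreover have "sqrt (((1 - 5 * \<alpha>) / 4 - 2 * \<delta>) + 2 * \<delta>) = sqrt (1 - 5 * \<alpha>) / 2" by (simp add: real_sqrt_divide)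
    \<comment> \<open>This fixes \<delta> as \<open>e\<^sup>2 / 200\<close>: the loss of 2\<delta>
      under the root costs only e/10 outside it.\<close>
    moreover have "sqrt (2 * \<delta>) = e / 10"
      unfolding e(3) using e(1) by (intro real_sqrt_unique) (auto simp: power2_eq_square)
    ultimately have "sqrt (1 - 5 * \<alpha>) / 2 - e / 10 \<le> sqrt ((1 - 5 * \<alpha>) / 4 - 2 * \<delta>)" by linarith
    then have "T * (sqrt (1 - 5 * \<alpha>) / 2 - e / 10) \<le> T * sqrt ((1 - 5 * \<alpha>) / 4 - 2 * \<delta>)" using T(2) by (intro mult_left_mono) auto
    also have "\<dots> = sqrt (real H * l * ((1 - 5 * \<alpha>) / 4 - 2 * \<delta>))" unfolding T_def r_def by (simp add: real_sqrt_mult)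
    also have "\<dots> \<le> sqrt V" using Vl by simp
    finally show ?thesis .
  qed
  have aT: "a \<le> (sqrt (1 - 5 * \<alpha>) / 2 - e) * T + sqrt l"
  proof -
    have "h * l \<le> (real H + 1) * l" using h l_ge by (intro mult_right_mono) auto
    then have "sqrt (h * l) \<le> sqrt (real H * l + l)" by (simp add: distrib_right)
    also have "\<dots> \<le> sqrt (real H * l) + sqrt l" using l_ge by (intro sqrt_add_le_add_sqrt) auto
    also have "sqrt (real H * l) = T" unfolding T_def r_def by (simp add: real_sqrt_mult)
    finally have "a \<le> (sqrt (1 - 5 * \<alpha>) / 2 - e) * (T + sqrt l)" unfolding a_def by (intro mult_left_mono sm)
    moreover have "(sqrt (1 - 5 * \<alpha>) / 2 - e) * sqrt l \<le> 1 * sqrt l" using sl by (intro mult_right_mono sm) auto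
    ultimately show ?thesis by (simp add: distrib_left)
  qed
  have lT: "l * sqrt l \<le> T"
  proof -
    have "l powr 1 \<le> l powr (139/20)" using l_ge by (intro powr_mono) auto
    then have "l \<le> r" using r(3) l_ge by simp
    then show ?thesis unfolding T_def using sl by (intro mult_right_mono) auto
  qed
  have "e / 2 * (l * sqrt l) \<le> e / 2 * T" using lT e by (intro mult_left_mono) auto
  then have 1: "1 + sqrt l < e / 2 * T" using l6 by linarith
  have "42 * \<delta> * T \<le> 42 * (e / 2000) * T" using d T(2) by (intro mult_right_mono mult_left_mono) auto
  then have "T * (sqrt (1 - 5 * \<alpha>) / 2 - e / 10) \<le> (sqrt (1 - 5 * \<alpha>) / 2 - e) * T + sqrt l + 1 + 42 * (e / 2000) * T"
    using sV sV2 aT by linarith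
  \<comment> \<open>Of the margin e, the parts 1/10 and 42/2000 are spent and 879/1000 remains, more
    than the half that already exceeds \<open>1 + sqrt l\<close>.\<close>
  then have "(e * T) * (879/1000) \<le> 1 + sqrt l" by (simp add: algebra_simps)
  moreover have "0 \<le> e * T" using e T(2) by simp
  moreover have "e / 2 * T = e * T * (1/2)" by simp
  ultimately show False using 1 by linarith
qed

end

section \<open>Asymptotic comparisons and conclusion\<close>

lemma eventually_large:
  fixes \<epsilon> c C e \<delta> :: real
  assumes "\<epsilon> > 0" "c > 0" "C > 0" "0 < e" "0 < \<delta>" "\<delta> \<le> 1/100"
  shows "\<forall>\<^sub>F N :: nat in at_top. ln (real N) powr (139/10) + 1 \<le> c * ln (real N) ^ 14"
    and "\<forall>\<^sub>F N :: nat in at_top. C * real N powr (1/7 - \<epsilon>) \<le> real N powr (1/7)"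
    and "\<forall>\<^sub>F N :: nat in at_top. ln (real N) \<ge> 100"
    and "\<forall>\<^sub>F N :: nat in at_top. 2 * ln (real N) powr (6/5) < ln (real N) powr (139/10)"
    and "\<forall>\<^sub>F N :: nat in at_top. (ln (real N) ^ 20 + 1) * (ln (real N) + 1)\<^sup>2 + 1 \<le> ln (real N) ^ 23"
    and "\<forall>\<^sub>F N :: nat in at_top. 23 * ln (ln (real N)) + 13 + 20 * ln (real N) powr (4/5) \<le> \<delta> * ln (real N)"
    and "\<forall>\<^sub>F N :: nat in at_top. 120 * ln (real N) ^ 5 * ln (real N) powr (6/5) / ln (real N) ^ 10 \<le> \<delta> * ln (real N)"
    and "\<forall>\<^sub>F N :: nat in at_top. 240 * ln (real N) ^ 5 * (ln (real N) powr (6/5))\<^sup>2 \<le> \<delta> * (ln (real N) powr (139/20) * ln (real N))"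
    and "\<forall>\<^sub>F N :: nat in at_top. 1 + sqrt (ln (real N)) < e / 2 * (ln (real N) * sqrt (ln (real N)))"
  using assms by real_asymp+

text \<open>The powers of N on the left fall short of those on the right by
  \<open>N powr (1/14 - \<delta>)\<close>, \<open>N powr (4 * \<delta>)\<close> and
  \<open>N powr \<delta>\<close>, which outweighs all logarithms. The free k stands for the constant
  with \<open>zeta32\<close>.\<close>

lemma eventually_large_powers:
  fixes \<delta> k :: real
  assumes "0 < \<delta>" "\<delta> \<le> 1/100"
  shows "\<forall>\<^sub>F N :: nat in at_top. 2 * (real N powr (1/7) * ((ln (real N) ^ 20 + 1) * (ln (real N) + 1)\<^sup>2)) \<le> real N powr (3/14 - \<delta>)"
    and "\<forall>\<^sub>F N :: nat in at_top. 40 * ln (real N) powr (6/5) * (ln (real N))\<^sup>2 * real N powr (1 - 4 * \<delta>) * real N \<le> \<delta> * (real N / 3)\<^sup>2"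
    and "\<forall>\<^sub>F N :: nat in at_top. 10 * ln (real N) powr (6/5) * (ln (real N))\<^sup>2 * real N powr (1/2 - 2 * \<delta>) *
      (2 * (144 / \<delta>\<^sup>2 * (12 + k + ln (real N)) * (3 * real N) powr (3/2 + \<delta>)) + real N * (2 * ln (real N) * (2 * ln (real N)))) \<le> \<delta> * (real N / 3)\<^sup>2"
  using assms by real_asymp+

theorem theorem3:
  fixes \<epsilon> \<eta> c C :: real
  assumes "GRH"
    and "\<epsilon> > 0" and "\<eta> > 0"
    and "c > 0" and "C > 0"
  shows "\<forall>\<^sub>F N :: nat in at_top. \<forall>h \<alpha> :: real.
    c * ln (real N) ^ 14 \<le> h \<and> h \<le> C * real N powr (1 / 7 - \<epsilon>) \<and> h = real N powr \<alpha> \<longrightarrow>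
      (\<exists>n\<^sub>1 \<in> {N + 1..2 * N}.
         chebyshev_psi (real n\<^sub>1 + h) - chebyshev_psi (real n\<^sub>1) - h
           > (sqrt (1 - 5 * \<alpha>) / 2 - \<eta>) * (h * ln (real N)) powr (1 / 2)) \<and>
      (\<exists>n\<^sub>2 \<in> {N + 1..2 * N}.
         chebyshev_psi (real n\<^sub>2 + h) - chebyshev_psi (real n\<^sub>2) - h
           < - ((sqrt (1 - 5 * \<alpha>) / 2 - \<eta>) * (h * ln (real N)) powr (1 / 2)))"
proof -
  \<comment> \<open>A smaller e only strengthens the claim. The cap 1/10 keeps
    \<open>sqrt (1 - 5 * \<alpha>) / 2 - e\<close> positive, since the root is at least 1/2.\<close>
  define e where "e = min \<eta> (1/10)"
  define \<delta> where "\<delta> = e\<^sup>2 / 200"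
  have e: "0 < e" "e \<le> 1/10" "e \<le> \<eta>" using assms(3) by (auto simp: e_def)
  have \<delta>: "0 < \<delta>" using e(1) by (simp add: \<delta>_def)
  have "e\<^sup>2 \<le> (1/10)\<^sup>2" using e by (intro power_mono) auto
  then have \<delta>1: "\<delta> \<le> 1/100" by (simp add: \<delta>_def power2_eq_square)
  note ev = eventually_large[OF assms(2,4,5) e(1) \<delta> \<delta>1] eventually_large_powers(1,2)[OF \<delta> \<delta>1]
    eventually_large_powers(3)[OF \<delta> \<delta>1, of "ln (16 * (1 + zeta32))"] eventually_gt_at_top[of 1]
  from ev show ?thesis
  proof eventually_elim
    case (elim N)
    show ?case
    proof (intro allI impI)
      fix h \<alpha> :: real
      assume *: "c * ln (real N) ^ 14 \<le> h \<and> h \<le> C * real N powr (1 / 7 - \<epsilon>) \<and> h = real N powr \<alpha>"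
      \<comment> \<open>The integer part loses less than 1, which the \<open>+ 1\<close> in the
        first asymptotic comparison has set aside.\<close>
      define H where "H = nat \<lfloor>h\<rfloor>"
      have "0 \<le> ln (real N) powr (139/10)" by simp
      then have h1: "ln (real N) powr (139/10) + 1 \<le> h" "h \<ge> 1" using * elim(1) by linarith+
      have H: "real H \<le> h" "h < real H + 1" unfolding H_def using h1(2) by linarith+
      have h17: "h \<le> real N powr (1/7)" using * elim(2) by linarith
      have "real H \<le> real N powr (1/7)" "ln (real N) powr (139/10) \<le> real H" using H h1 h17 by linarith+
      then interpret large N H \<delta> "ln (real N)"
        using elim \<delta> \<delta>1 by unfold_locales (auto simp: add.assoc)
      have sq: "(h * ln (real N)) powr (1/2) = sqrt (h * ln (real N))"
        using h1 elim(3) by (intro powr_half_sqrt) auto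
      have "\<exists>n\<in>{N + 1..2 * N}. s * (chebyshev_psi (real n + h) - chebyshev_psi (real n) - h) > (sqrt (1 - 5 * \<alpha>) / 2 - e) * sqrt (h * ln (real N))"
        if s: "s = 1 \<or> s = -1" for s
      proof (rule ccontr)
        assume "\<not> ?thesis"
        then have "s * (chebyshev_psi (real n + h) - chebyshev_psi (real n) - h) \<le> (sqrt (1 - 5 * \<alpha>) / 2 - e) * sqrt (h * ln (real N))"
          if "n \<in> {N + 1..2 * N}" for n using that by (meson not_le)
        then show False using contradiction[OF assms(1) H h17 _ s e(1,2) \<delta>_def elim(9)] * by blast
      qed
      from this[of 1] this[of "-1"] obtain m n where m: "m \<in> {N + 1..2 * N}" "(sqrt (1 - 5 * \<alpha>) / 2 - e) * sqrt (h * ln (real N)) < chebyshev_psi (real m + h) - chebyshev_psi (real m) - h"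
        and n: "n \<in> {N + 1..2 * N}" "(sqrt (1 - 5 * \<alpha>) / 2 - e) * sqrt (h * ln (real N)) < - (chebyshev_psi (real n + h) - chebyshev_psi (real n) - h)"
        by auto
      have le: "(sqrt (1 - 5 * \<alpha>) / 2 - \<eta>) * sqrt (h * ln (real N)) \<le> (sqrt (1 - 5 * \<alpha>) / 2 - e) * sqrt (h * ln (real N))"
        using e(3) h1 elim(3) by (intro mult_right_mono) auto
      show "(\<exists>n\<^sub>1 \<in> {N + 1..2 * N}.
         chebyshev_psi (real n\<^sub>1 + h) - chebyshev_psi (real n\<^sub>1) - h
           > (sqrt (1 - 5 * \<alpha>) / 2 - \<eta>) * (h * ln (real N)) powr (1 / 2)) \<and>
      (\<exists>n\<^sub>2 \<in> {N + 1..2 * N}.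
         chebyshev_psi (real n\<^sub>2 + h) - chebyshev_psi (real n\<^sub>2) - h
           < - ((sqrt (1 - 5 * \<alpha>) / 2 - \<eta>) * (h * ln (real N)) powr (1 / 2)))"
        unfolding sq
      proof (intro conjI bexI)
        show "chebyshev_psi (real m + h) - chebyshev_psi (real m) - h > (sqrt (1 - 5 * \<alpha>) / 2 - \<eta>) * sqrt (h * ln (real N))"
          using m(2) le by linarith
        show "chebyshev_psi (real n + h) - chebyshev_psi (real n) - h < - ((sqrt (1 - 5 * \<alpha>) / 2 - \<eta>) * sqrt (h * ln (real N)))"
          using n(2) le by linarith
      qed (fact m(1) n(1))+
    qed
  qed
qed

end
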